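(* The distinguished super vertex operator algebra $V^{s\natural}$ is isomorphic to $\mathcal H_{X,\text{NS-NS}}$ as a module for the Virasoro algebra, when the latter is equipped with the diagonal Virasoro element $\omega^{\mathcal D}$. Similarly, $V^{s\natural}_{\mathrm{tw}}$ is isomorphic as a Virasoro module to $\mathcal H_{X,\text{R-R}}$.
   Context: **Clifford modules.** For an even-dimensional complex vector space $\mathfrak b$ with non-degenerate symmetric bilinear form, and symbols $u(r)$ ($u\in\mathfrak b$, $r\in\frac12\mathbb Z$), let $A(\mathfrak b)=\bigwedge(\bigoplus_{n\ge1}\mathfrak b(-n+\frac12))\mathbf v$, where for $r\in\mathbb Z+\frac12$, $u(r)$ acts by left multiplication for $r<0$, $u(r)\mathbf v=0$ for $r>0$, and $u(r)w(s)+w(s)u(r)=-2\delta_{r+s,0}\langle u,w\rangle$. It is a super vertex operator algebra with $Y(u(-\frac12)\mathbf v,z)=\sum_nu(n+\frac12)z^{-n-1}$ and Virasoro element $\omega=-\frac14\sum_ie_i(-\frac32)e_i(-\frac12)\mathbf v$ ($e_i$ an orthonormal basis), central charge $\frac12\dim\mathfrak b$. For a polarization $\mathfrak b=\mathfrak b^-\oplus\mathfrak b^+$ (isotropic subspaces), $A(\mathfrak b)_{\mathrm{tw}}=\bigwedge(\mathfrak b^-(0)\oplus\bigoplus_{n\ge1}\mathfrak b(-n))\mathbf v_{\mathrm{tw}}$, with $u(r)$, $r\in\mathbb Z$, acting by left multiplication for $r<0$ or $r=0,u\in\mathfrak b^-$, killing $\mathbf v_{\mathrm{tw}}$ for $r>0$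 or $r=0,u\in\mathfrak b^+$, same anticommutation relations; it is a canonically-twisted $A(\mathfrak b)$-module with $Y_{\mathrm{tw}}(u(-\frac12)\mathbf v,z^{1/2})=\sum_nu(n)z^{-n-1/2}$. $A(\mathfrak b)^j$ and $A(\mathfrak b)^j_{\mathrm{tw}}$ ($j=0,1$) denote the subspaces of even/odd exterior degree (relative to $\mathbf v$, $\mathbf v_{\mathrm{tw}}$ respectively). **$V^{s\natural}$.** For $\mathfrak a$ of dimension 24, $V^{s\natural}=A(\mathfrak a)^0\oplus A(\mathfrak a)^1_{\mathrm{tw}}$ (a super vertex operator algebra of central charge 12) and $V^{s\natural}_{\mathrm{tw}}=A(\mathfrak a)^1\oplus A(\mathfrak a)^0_{\mathrm{tw}}$ (a canonically-twisted $V^{s\natural}$-module), with Virasoro action given by $\omega$. **The sigma model.** Let $\Gamma\subset V=\mathbb C^2\simeq\mathbb R^4$ be the $D_4$ lattice $\{\sum n_ie_i:n_i\in\mathbb Z,\sum n_i\equiv0\bmod2\}$, where $e_1=(1,0),e_2=(\sqrt{-1},0),e_3=(0,1),e_4=(0,\sqrt{-1})$ are orthonormal; $\Gamma^*=\bigcup_{i\in\{0,1,\omega,\bar\omega\}}(\Gamma+\gamma_i)$, with the index set having the Klein four-group structure of $\Gamma^*/\Gamma$ (identity $0$, $1+\omega=\bar\omega$). Let $T=\mathbb C^2/\Gamma$ and let $X$ be the Kummer K3 surface, the minimal resolution of $T/\langle\kappa\rangle$, $\kappa(x)=-x$. Write $V_{\Gamma+\gamma_i}$ for the irreducible modules of the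 lattice vertex operator algebra $V_\Gamma$. The torus model is $$\mathcal H_{T,\text{NS-NS}}=\bigoplus_iA(\Gamma\otimes\mathbb C)^{\mathcal L}\otimes V^{\mathcal L}_{\Gamma+\gamma_i}\otimes A(\Gamma\otimes\mathbb C)^{\mathcal R}\otimes V^{\mathcal R}_{\Gamma+\gamma_i},$$ and $\mathcal H_{T,\text{R-R}}$ is given by the same formula with $A(\Gamma\otimes\mathbb C)_{\mathrm{tw}}$ in place of $A(\Gamma\otimes\mathbb C)$ (superscripts $\mathcal L,\mathcal R$ label left and right movers). The diagonal Virasoro element is $\omega^{\mathcal D}=\omega^{\mathcal L}\otimes1+1\otimes\omega^{\mathcal R}$ with $\omega^{\mathcal L}$ the Virasoro element of $A(\Gamma\otimes\mathbb C)^{\mathcal L}\otimes V_\Gamma^{\mathcal L}$, and similarly $\omega^{\mathcal R}$; central charge 12. Let $\mathfrak e$ be an 8-dimensional complex space with non-degenerate symmetric form and $U_0=A(\mathfrak e)^0$, $U_1=A(\mathfrak e)^1$, $U_\omega=A(\mathfrak e)^0_{\mathrm{tw}}$, $U_{\bar\omega}=A(\mathfrak e)^1_{\mathrm{tw}}$. By the boson-fermion correspondence $U_0\simeq V_\Gamma$ and (after labelling) $U_i\simeq V_{\Gamma+\gamma_i}$; also $U_0\oplus U_1\simeq A(\Gamma\otimes\mathbb C)^{\otimes2}$ and $U_\omega\oplus U_{\bar\omega}\simeq A(\Gamma\otimes\mathbb C)_{\mathrm{tw}}^{\otimes2}$. Hence $\mathcal H_{T,\text{NS-NS}}\simeq\bigoplus_i(U_0\oplus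 U_1)\otimes U_i\otimes U_i$ and $\mathcal H_{T,\text{R-R}}\simeq\bigoplus_i(U_\omega\oplus U_{\bar\omega})\otimes U_i\otimes U_i$, with $\omega^{\mathcal D}$ corresponding to the Virasoro element of $U_0\otimes U_0\otimes U_0$. $\mathcal H_X$ is the $\mathbb Z/2$-orbifold of $\mathcal H_T$ by the lift $\hat\kappa$ of $\kappa$, acting on $\mathcal H_T$ as $\theta\otimes1\otimes\theta$, where $\theta$ is $+1$ on $U_0,U_\omega$ and $-1$ on $U_1,U_{\bar\omega}$. The $\hat\kappa$-twisted sectors are $\bigoplus_i(U_\omega\oplus U_{\bar\omega})\otimes U_i\otimes U_{i+\omega}$ (NS-NS) and $\bigoplus_i(U_0\oplus U_1)\otimes U_i\otimes U_{i+\omega}$ (R-R), with $\hat\kappa$ acting as $\theta\otimes\theta\otimes1$. $\mathcal H_{X,\text{NS-NS}}$ and $\mathcal H_{X,\text{R-R}}$ are the direct sums of the $\hat\kappa$-fixed points in untwisted and twisted sectors; with $U_{ijk}=U_i\otimes U_j\otimes U_k$, $$\mathcal H_{X,\text{NS-NS}}\simeq U_{000}\oplus U_{0\omega\omega}\oplus U_{111}\oplus U_{1\bar\omega\bar\omega}\oplus U_{\omega0\omega}\oplus U_{\omega\omega0}\oplus U_{\bar\omega1\bar\omega}\oplus U_{\bar\omega\bar\omega1},$$ $$\mathcal H_{X,\text{R-R}}\simeq U_{\omega00}\oplus U_{\omega\omega\omega}\oplus U_{\bar\omega11}\oplus U_{\bar\omega\bar\omega\bar\omega}\oplus U_{00\omega}\oplus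 U_{0\omega0}\oplus U_{11\bar\omega}\oplus U_{1\bar\omega1},$$ with Virasoro action (also on the R-R sector) that of the Virasoro element of $U_0\otimes U_0\otimes U_0$. *)

theory Defs
  imports "HOL-Analysis.Analysis" "HOL-Library.Function_Algebras" "HOL-Library.Multiset"
begin

section \<open>Virasoro modules\<close>

text \<open>Every module below is a subspace of a space of functions \<open>'x \<Rightarrow> complex\<close>: the finitely
  supported functions are the free vector space on the set of basis labels \<open>'x\<close>.  Addition is
  pointwise (\<^theory>\<open>HOL-Library.Function_Algebras\<close>).  Only the values of the operators on the
  subspace matter.\<close>

type_synonym 'x fn = "'x \<Rightarrow> complex"

definition scal :: "complex \<Rightarrow> 'x fn \<Rightarrow> 'x fn" where
  "scal c f = (\<lambda>x. c * f x)"

global_interpretation fn: vector_space "scal :: complex \<Rightarrow> 'x fn \<Rightarrow> 'x fn"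
  by unfold_locales (auto simp: scal_def fun_eq_iff algebra_simps)

definition unit_fn :: "'x \<Rightarrow> 'x fn" where
  "unit_fn x = (\<lambda>y. if y = x then 1 else 0)"

text \<open>A subspace, the Virasoro operators $L(n)$, and the action of the central element.\<close>

record 'x vir =
  carr :: "'x fn set"
  vir_L :: "int \<Rightarrow> 'x fn \<Rightarrow> 'x fn"
  central :: "'x fn \<Rightarrow> 'x fn"

definition linear_between :: "'x fn set \<Rightarrow> 'y fn set \<Rightarrow> ('x fn \<Rightarrow> 'y fn) \<Rightarrow> bool" where
  "linear_between V W T \<longleftrightarrow> T ` V \<subseteq> W \<and>
     (\<forall>f\<in>V. \<forall>g\<in>V. T (f + g) = T f + T g) \<and> (\<forall>c. \<forall>f\<in>V. T (scal c f) = scal c (T f))"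

definition virasoro_module :: "'x vir \<Rightarrow> bool" where
  "virasoro_module M \<longleftrightarrow>
     fn.subspace (carr M) \<and>
     (\<forall>n. linear_between (carr M) (carr M) (vir_L M n)) \<and>
     linear_between (carr M) (carr M) (central M) \<and>
     (\<forall>n. \<forall>f\<in>carr M. vir_L M n (central M f) = central M (vir_L M n f)) \<and>
     (\<forall>m n. \<forall>f\<in>carr M.
        vir_L M m (vir_L M n f) - vir_L M n (vir_L M m f) =
          scal (of_int (m - n)) (vir_L M (m + n) f)
          + (if m + n = 0 then scal (of_int (m ^ 3 - m) / 12) (central M f) else 0))"

definition virasoro_isomorphic :: "'x vir \<Rightarrow> 'y vir \<Rightarrow> bool" where
  "virasoro_isomorphic M N \<longleftrightarrow> virasoro_module M \<and> virasoro_module N \<and>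
     (\<exists>T. linear_between (carr M) (carr N) T \<and> bij_betw T (carr M) (carr N) \<and>
        (\<forall>f\<in>carr M. T (central M f) = central N (T f) \<and> (\<forall>n. T (vir_L M n f) = vir_L N n (T f))))"

definition dsum2 :: "'x vir \<Rightarrow> 'y vir \<Rightarrow> ('x + 'y) vir" where
  "dsum2 M N =
    \<lparr> carr = {f. f \<circ> Inl \<in> carr M \<and> f \<circ> Inr \<in> carr N},
      vir_L = (\<lambda>n f. case_sum (vir_L M n (f \<circ> Inl)) (vir_L N n (f \<circ> Inr))),
      central = (\<lambda>f. case_sum (central M (f \<circ> Inl)) (central N (f \<circ> Inr))) \<rparr>"

text \<open>Direct sum over a finite index set \<open>I\<close>.\<close>

definition dsum :: "'i set \<Rightarrow> ('i \<Rightarrow> 'x vir) \<Rightarrow> ('i \<times> 'x) vir" where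
  "dsum I M =
    \<lparr> carr = {f. (\<forall>i\<in>I. (\<lambda>x. f (i, x)) \<in> carr (M i)) \<and> (\<forall>i. i \<notin> I \<longrightarrow> (\<forall>x. f (i, x) = 0))},
      vir_L = (\<lambda>n f (i, x). if i \<in> I then vir_L (M i) n (\<lambda>y. f (i, y)) x else 0),
      central = (\<lambda>f (i, x). if i \<in> I then central (M i) (\<lambda>y. f (i, y)) x else 0) \<rparr>"

text \<open>$T \otimes 1$ and $1 \otimes T$, and the tensor product with $L(n)\otimes 1 + 1 \otimes L(n)$.\<close>

definition op_left :: "('x fn \<Rightarrow> 'x fn) \<Rightarrow> ('x \<times> 'y) fn \<Rightarrow> ('x \<times> 'y) fn" where
  "op_left T f = (\<lambda>(x, y). T (\<lambda>x'. f (x', y)) x)"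

definition op_right :: "('y fn \<Rightarrow> 'y fn) \<Rightarrow> ('x \<times> 'y) fn \<Rightarrow> ('x \<times> 'y) fn" where
  "op_right T f = (\<lambda>(x, y). T (\<lambda>y'. f (x, y')) y)"

definition tensor :: "'x vir \<Rightarrow> 'y vir \<Rightarrow> ('x \<times> 'y) vir" where
  "tensor M N =
    \<lparr> carr = fn.span {(\<lambda>(x, y). f x * g y) | f g. f \<in> carr M \<and> g \<in> carr N},
      vir_L = (\<lambda>n f. op_left (vir_L M n) f + op_right (vir_L N n) f),
      central = (\<lambda>f. op_left (central M) f + op_right (central N) f) \<rparr>"

definition fixed_points :: "('x fn \<Rightarrow> 'x fn) \<Rightarrow> 'x vir \<Rightarrow> 'x vir" where
  "fixed_points K M = M \<lparr> carr := {f \<in> carr M. K f = f} \<rparr>"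

text \<open>Sum of a family of vectors of which all but finitely many vanish.\<close>

definition fsum :: "(int \<Rightarrow> 'x fn) \<Rightarrow> 'x fn" where
  "fsum t = (\<Sum>k | t k \<noteq> 0. t k)"


section \<open>Clifford modules\<close>

text \<open>A complex space of dimension \<open>CARD('n)\<close> with a symmetric bilinear form, an orthonormal basis
  (used only to write the Virasoro element), and a polarization.\<close>

type_synonym 'n cvec = "(complex, 'n) vec"

record 'n polarized_space =
  form :: "'n cvec \<Rightarrow> 'n cvec \<Rightarrow> complex"
  onb :: "'n \<Rightarrow> 'n cvec"
  minus_part :: "'n cvec set"
  plus_part :: "'n cvec set"

definition polarized_space :: "'n::finite polarized_space \<Rightarrow> bool" where
  "polarized_space b \<longleftrightarrow>
     (\<forall>u. Vector_Spaces.linear (*s) (*) (form b u)) \<and>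
     (\<forall>u w. form b u w = form b w u) \<and>
     (\<forall>u. (\<forall>w. form b u w = 0) \<longrightarrow> u = 0) \<and>
     (\<forall>i j. form b (onb b i) (onb b j) = (if i = j then 1 else 0)) \<and>
     vec.subspace (minus_part b) \<and> vec.subspace (plus_part b) \<and>
     (\<forall>u\<in>minus_part b. \<forall>w\<in>minus_part b. form b u w = 0) \<and>
     (\<forall>u\<in>plus_part b. \<forall>w\<in>plus_part b. form b u w = 0) \<and>
     (\<forall>u. \<exists>!p. p \<in> minus_part b \<and> u - p \<in> plus_part b)"

definition minus_proj :: "'n::finite polarized_space \<Rightarrow> 'n cvec \<Rightarrow> 'n cvec" where
  "minus_proj b u = (THE p. p \<in> minus_part b \<and> u - p \<in> plus_part b)"

text \<open>The symbol $u(r)$, $r \in \frac12\mathbb Z$, is represented by \<open>(u, k)\<close> with $k = 2r$.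
  All the exterior algebras live in $\bigwedge(\bigoplus_{k \le 0}\mathfrak b(k/2))$.  With \<open>b i\<close> the
  coordinate basis of $\mathfrak b$, its basis is labelled by the finite sets of pairs \<open>(i, k)\<close>: the
  label \<open>S\<close> stands for the product of the $b_i(k/2)$, $(i, k) \in S$, in increasing order (by mode,
  then by index), and the empty set for the vacuum.\<close>

type_synonym 'n modes = "('n \<times> int) set"

definition koszul_sign :: "'n::linorder \<times> int \<Rightarrow> 'n modes \<Rightarrow> complex" where
  "koszul_sign s S =
     (- 1) ^ card {t \<in> S. snd t < snd s \<or> (snd t = snd s \<and> fst t < fst s)}"

text \<open>Left multiplication by a basis element, and the antiderivation dual to it.\<close>

definition wedge_basis :: "'n::linorder \<times> int \<Rightarrow> 'n modes fn \<Rightarrow> 'n modes fn" where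
  "wedge_basis s f = (\<lambda>S. if s \<in> S then koszul_sign s S * f (S - {s}) else 0)"

definition contract_basis :: "'n::linorder \<times> int \<Rightarrow> 'n modes fn \<Rightarrow> 'n modes fn" where
  "contract_basis s f = (\<lambda>S. if s \<in> S then 0 else koszul_sign s S * f (insert s S))"

definition wedge :: "'n::{finite,linorder} cvec \<Rightarrow> int \<Rightarrow> 'n modes fn \<Rightarrow> 'n modes fn" where
  "wedge u k f = (\<Sum>i\<in>UNIV. scal (u $ i) (wedge_basis (i, k) f))"

text \<open>For $r = k/2 \ge 0$: the antiderivation killing the vacuum and sending $w(-r)$ to
  $-2\langle u, w\rangle$.\<close>

definition contract ::
  "'n::{finite,linorder} polarized_space \<Rightarrow> 'n cvec \<Rightarrow> int \<Rightarrow> 'n modes fn \<Rightarrow> 'n modes fn" where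
  "contract b u k f =
     (\<Sum>i\<in>UNIV. scal (- 2 * form b u (axis i 1)) (contract_basis (i, - k) f))"

definition cliff ::
  "'n::{finite,linorder} polarized_space \<Rightarrow> 'n cvec \<Rightarrow> int \<Rightarrow> 'n modes fn \<Rightarrow> 'n modes fn" where
  "cliff b u k f =
     (if k < 0 then wedge u k f
      else if k > 0 then contract b u k f
      else wedge (minus_proj b u) 0 f + contract b (u - minus_proj b u) 0 f)"

text \<open>$A(\mathfrak b)$ for \<open>tw = False\<close> and $A(\mathfrak b)_{\mathrm{tw}}$ for \<open>tw = True\<close>: the
  subalgebra generated by the creating $u(r)$, applied to the vacuum.\<close>

definition creating :: "'n::finite polarized_space \<Rightarrow> bool \<Rightarrow> ('n cvec \<times> int) set" where
  "creating b tw =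
     (if tw then {(u, k). even k \<and> (k < 0 \<or> (k = 0 \<and> u \<in> minus_part b))}
      else {(u, k). odd k \<and> k < 0})"

definition cliff_space :: "'n::{finite,linorder} polarized_space \<Rightarrow> bool \<Rightarrow> 'n modes fn set" where
  "cliff_space b tw =
     fn.span {foldr (\<lambda>(u, k). wedge u k) us (unit_fn {}) | us. set us \<subseteq> creating b tw}"

text \<open>$:\!u(k/2)\,w(l/2)\!:$, antisymmetrized when $u(k/2)$ is a zero mode.\<close>

definition normal_ordered ::
  "'n::{finite,linorder} polarized_space \<Rightarrow> 'n cvec \<Rightarrow> int \<Rightarrow> 'n cvec \<Rightarrow> int
    \<Rightarrow> 'n modes fn \<Rightarrow> 'n modes fn" where
  "normal_ordered b u k w l f =
     (if k < 0 then cliff b u k (cliff b w l f)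
      else if k > 0 then - cliff b w l (cliff b u k f)
      else scal (1 / 2) (cliff b u k (cliff b w l f) - cliff b w l (cliff b u k f)))"

text \<open>With $u(z) = \sum_r u(r) z^{-r-1/2}$ one has
  $Y(u(-\frac32)w(-\frac12)\mathbf v, z) = \mathopen:\partial u(z)\, w(z)\mathclose:
   = \sum_{r,s} (-r-\frac12) \mathopen:u(r)w(s)\mathclose:\, z^{-r-s-2}$, so that
  $Y(\omega, z) = \sum_n L(n) z^{-n-2}$ for $\omega = -\frac14\sum_i e_i(-\frac32)e_i(-\frac12)\mathbf v$
  has $L(n) = -\frac14\sum_i\sum_r(-r-\frac12)\mathopen:e_i(r)e_i(n-r)\mathclose:$.  On the twisted
  module the sum is over integral $r$, and the twisted vertex operator of $\omega$ is this normally
  ordered expression plus $\frac{1}{16}\dim\mathfrak b\, z^{-2}$, whence $L(0)$ is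
  $\frac1{16}\dim\mathfrak b$ on $\mathbf v_{\mathrm{tw}}$.\<close>

definition cliff_L ::
  "'n::{finite,linorder} polarized_space \<Rightarrow> bool \<Rightarrow> int \<Rightarrow> 'n modes fn \<Rightarrow> 'n modes fn" where
  "cliff_L b tw n f =
     scal (- 1 / 4) (\<Sum>i\<in>UNIV. fsum (\<lambda>k.
        if even k = tw
        then scal (- of_int k / 2 - 1 / 2) (normal_ordered b (onb b i) k (onb b i) (2 * n - k) f)
        else 0))
     + (if tw \<and> n = 0 then scal (of_nat CARD('n) / 16) f else 0)"

definition clifford :: "'n::{finite,linorder} polarized_space \<Rightarrow> bool \<Rightarrow> 'n modes vir" where
  "clifford b tw =
    \<lparr> carr = cliff_space b tw, vir_L = cliff_L b tw, central = scal (of_nat CARD('n) / 2) \<rparr>"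

abbreviation A_untw :: "'n::{finite,linorder} polarized_space \<Rightarrow> 'n modes vir" where
  "A_untw b \<equiv> clifford b False"

abbreviation A_tw :: "'n::{finite,linorder} polarized_space \<Rightarrow> 'n modes vir" where
  "A_tw b \<equiv> clifford b True"

text \<open>The subspace of exterior degree congruent to \<open>j\<close> modulo 2.\<close>

definition parity_part :: "nat \<Rightarrow> 'n modes vir \<Rightarrow> 'n modes vir" where
  "parity_part j M = M \<lparr> carr := {f \<in> carr M. \<forall>S. f S \<noteq> 0 \<longrightarrow> card S mod 2 = j} \<rparr>"

definition Vsnat :: "'n::{finite,linorder} polarized_space \<Rightarrow> ('n modes + 'n modes) vir" where
  "Vsnat a = dsum2 (parity_part 0 (A_untw a)) (parity_part 1 (A_tw a))"

definition Vsnat_tw :: "'n::{finite,linorder} polarized_space \<Rightarrow> ('n modes + 'n modes) vir" where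
  "Vsnat_tw a = dsum2 (parity_part 1 (A_untw a)) (parity_part 0 (A_tw a))"


section \<open>Lattice modules\<close>

text \<open>For a coset \<open>K\<close> in $\mathbb R^n$ of an even lattice of full rank, the Virasoro module
  $V_K = S(\bigoplus_{m \ge 1}\mathfrak h(-m)) \otimes \mathbb C[K]$ of central charge $n$.  With $h_i$
  the standard orthonormal basis of $\mathfrak h = \mathbb C^n$, the label \<open>(P, v)\<close> stands for
  $\prod_{(i,m) \in P} h_i(-m) \otimes e^v$.  The cocycle of the lattice vertex algebra does not enter
  into the action of $\omega = \frac12\sum_i h_i(-1)^2\mathbf 1$.\<close>

type_synonym 'n lattice_label = "('n \<times> nat) multiset \<times> (real ^ 'n)"

definition heis :: "'n::finite \<Rightarrow> int \<Rightarrow> 'n lattice_label fn \<Rightarrow> 'n lattice_label fn" where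
  "heis i k f = (\<lambda>(P, v).
     if k < 0 then (if (i, nat (- k)) \<in># P then f (P - {#(i, nat (- k))#}, v) else 0)
     else if k > 0 then
       of_int k * of_nat (count P (i, nat k) + 1) * f (add_mset (i, nat k) P, v)
     else of_real (v $ i) * f (P, v))"

definition lattice_L :: "int \<Rightarrow> 'n::finite lattice_label fn \<Rightarrow> 'n lattice_label fn" where
  "lattice_L n f =
     scal (1 / 2) (\<Sum>i\<in>UNIV. fsum (\<lambda>k.
       if k \<le> n - k then heis i k (heis i (n - k) f) else heis i (n - k) (heis i k f)))"

definition lattice_module :: "(real ^ 'n::finite) set \<Rightarrow> 'n lattice_label vir" where
  "lattice_module K =
    \<lparr> carr = {f. finite {x. f x \<noteq> 0} \<and>
                  (\<forall>P v. f (P, v) \<noteq> 0 \<longrightarrow> v \<in> K \<and> (\<forall>(i, m) \<in># P. m \<ge> 1))},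
      vir_L = lattice_L,
      central = scal (of_nat CARD('n)) \<rparr>"

text \<open>$\mathbb R^4 = \mathbb C^2$ through the orthonormal basis
  $(1,0), (\sqrt{-1},0), (0,1), (0,\sqrt{-1})$.\<close>

definition D4 :: "(real ^ 4) set" where
  "D4 = {x. \<exists>n :: 4 \<Rightarrow> int. (\<forall>i. x $ i = of_int (n i)) \<and> even (\<Sum>i\<in>UNIV. n i)}"

definition dual_lattice :: "(real ^ 'n::finite) set \<Rightarrow> (real ^ 'n) set" where
  "dual_lattice \<Lambda> = {y. \<forall>x\<in>\<Lambda>. x \<bullet> y \<in> \<int>}"

definition coset :: "(real ^ 'n::finite) set \<Rightarrow> real ^ 'n \<Rightarrow> (real ^ 'n) set" where
  "coset \<Lambda> v = (\<lambda>x. x + v) ` \<Lambda>"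


section \<open>The sigma model\<close>

text \<open>The Klein four-group $\{0, 1, \omega, \bar\omega\}$.\<close>

datatype klein = K0 | K1 | Kw | Kwbar

fun kadd :: "klein \<Rightarrow> klein \<Rightarrow> klein" where
  "kadd K0 j = j"
| "kadd i K0 = i"
| "kadd K1 K1 = K0"
| "kadd K1 Kw = Kwbar"
| "kadd K1 Kwbar = Kw"
| "kadd Kw K1 = Kwbar"
| "kadd Kw Kw = K0"
| "kadd Kw Kwbar = K1"
| "kadd Kwbar K1 = Kw"
| "kadd Kwbar Kw = K1"
| "kadd Kwbar Kwbar = K0"

text \<open>The representatives $\gamma_i$, compatible with the group structure (so \<open>\<gamma> K0 \<in> D4\<close>).\<close>

definition D4_labelling :: "(klein \<Rightarrow> real ^ 4) \<Rightarrow> bool" where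
  "D4_labelling \<gamma> \<longleftrightarrow>
     dual_lattice D4 = (\<Union>i. coset D4 (\<gamma> i)) \<and>
     (\<forall>i j. \<gamma> i + \<gamma> j - \<gamma> (kadd i j) \<in> D4)"

text \<open>$U_i$; the involution $\theta$ is the scalar \<open>theta i\<close> on $U_i$.\<close>

primrec U_mod :: "'n::{finite,linorder} polarized_space \<Rightarrow> klein \<Rightarrow> 'n modes vir" where
  "U_mod e K0 = parity_part 0 (A_untw e)"
| "U_mod e K1 = parity_part 1 (A_untw e)"
| "U_mod e Kw = parity_part 0 (A_tw e)"
| "U_mod e Kwbar = parity_part 1 (A_tw e)"

primrec theta :: "klein \<Rightarrow> complex" where
  "theta K0 = 1"
| "theta K1 = - 1"
| "theta Kw = 1"
| "theta Kwbar = - 1"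

text \<open>$\mathcal H_T$: NS-NS for \<open>rr = False\<close>, R-R for \<open>rr = True\<close>.  The Virasoro action of the outer
  tensor product is that of $\omega^{\mathcal D} = \omega^{\mathcal L}\otimes 1
  + 1\otimes\omega^{\mathcal R}$.\<close>

type_synonym chiral_label = "4 modes \<times> 4 lattice_label"

definition torus ::
  "4 polarized_space \<Rightarrow> (klein \<Rightarrow> real ^ 4) \<Rightarrow> bool \<Rightarrow> (klein \<times> chiral_label \<times> chiral_label) vir" where
  "torus g \<gamma> rr =
     dsum UNIV (\<lambda>i.
       tensor (tensor (clifford g rr) (lattice_module (coset D4 (\<gamma> i))))
              (tensor (clifford g rr) (lattice_module (coset D4 (\<gamma> i)))))"

text \<open>$\hat\kappa = \theta\otimes 1\otimes\theta$ on $\mathcal H_T$.  The first factor is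
  $A(\Gamma\otimes\mathbb C)^{\otimes 2} \simeq U_0 \oplus U_1$
  (resp. $A(\Gamma\otimes\mathbb C)_{\mathrm{tw}}^{\otimes 2} \simeq U_\omega \oplus U_{\bar\omega}$), formed
  by the left and right fermions, on which $\theta$ is the parity of the total exterior degree; the
  second and third are $V^{\mathcal L}_{\Gamma+\gamma_i}$ and
  $V^{\mathcal R}_{\Gamma+\gamma_i} \simeq U_i$, and $\theta$ is a scalar on the latter.\<close>

definition kappa_torus ::
  "(klein \<times> chiral_label \<times> chiral_label) fn \<Rightarrow> (klein \<times> chiral_label \<times> chiral_label) fn" where
  "kappa_torus f = (\<lambda>(i, (S, p), (S', p')).
     (- 1) ^ (card S + card S') * theta i * f (i, (S, p), (S', p')))"

text \<open>The \<open>\<kappa>\<close>-twisted sectors $\bigoplus_i (U_\omega \oplus U_{\bar\omega})\otimes U_i\otimes U_{i+\omega}$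
  (NS-NS) and $\bigoplus_i (U_0 \oplus U_1)\otimes U_i\otimes U_{i+\omega}$ (R-R), where $\hat\kappa$ is
  $\theta\otimes\theta\otimes 1$.\<close>

type_synonym 'n twisted_label = "klein \<times> (klein \<times> 'n modes) \<times> ('n modes \<times> 'n modes)"

definition twisted_sector ::
  "'n::{finite,linorder} polarized_space \<Rightarrow> bool \<Rightarrow> 'n twisted_label vir" where
  "twisted_sector e rr =
     dsum UNIV (\<lambda>i.
       tensor (dsum (if rr then {K0, K1} else {Kw, Kwbar}) (U_mod e))
              (tensor (U_mod e i) (U_mod e (kadd i Kw))))"

definition kappa_twisted :: "'n twisted_label fn \<Rightarrow> 'n twisted_label fn" where
  "kappa_twisted f = (\<lambda>(i, (j, S), (S', S'')). theta j * theta i * f (i, (j, S), (S', S'')))"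

text \<open>$\mathcal H_X$: NS-NS for \<open>rr = False\<close>, R-R for \<open>rr = True\<close>.\<close>

definition K3_model ::
  "4 polarized_space \<Rightarrow> (klein \<Rightarrow> real ^ 4) \<Rightarrow> 'n::{finite,linorder} polarized_space \<Rightarrow> bool
    \<Rightarrow> (klein \<times> chiral_label \<times> chiral_label + 'n twisted_label) vir" where
  "K3_model g \<gamma> e rr =
     dsum2 (fixed_points kappa_torus (torus g \<gamma> rr))
           (fixed_points kappa_twisted (twisted_sector e rr))"

end

theory Submission
  imports Defs "HOL-Computational_Algebra.Formal_Power_Series"
begin

text \<open>Each of the four modules is unitary: it has a positive definite Hermitian form for which $L(n)$ and
  $L(-n)$ are adjoint, and $L(0)$ is diagonalizable with finite-dimensional eigenspaces.  A unitary
  Virasoro module with a given central charge is determined by its graded dimension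
  (\<open>unitary_models_isomorphic\<close>), since it is a direct sum of irreducible highest weight modules whose
  highest weights can be read off weight by weight.  As all four modules have central charge 12, the
  theorem becomes an identity of two pairs of power series.

  Unitarity is obtained from explicit coordinates.  A polarization identifies the Clifford modules with
  the Fock space of charged fermions (\<open>clifford_model\<close>), in which the monomials are orthonormal.  The
  monomials of a lattice module are orthogonal (\<open>lattice_model\<close>).  The Virasoro relations of both come
  from one principle: the Virasoro field shifts the modes of the generating fields in the expected way,
  so that the failure of the relations is a scalar, which is computed on the vacuum
  (\<open>primary_fields\<close>).  Direct sums, tensor products and the fixed points of involutions stay in the
  class, and this covers all the orbifold sectors.

  For the graded dimensions, let $u_0$ and $u_1$ be those of the even and the odd part of the
  untwisted Clifford module of rank 8.  The Jacobi triple product, proved as a bijection between finite sets of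
  fermionic modes and pairs of a charge and a partition (\<open>fermion_boson_bijection\<close>), carries
  fermions of even and odd parity to cosets of the $D_4$ lattice in its dual.  The three nontrivial
  cosets are permuted by isometries fixing $D_4$ (triality), so that $U_1$, $U_\omega$ and
  $U_{\bar\omega}$ all have graded dimension $u_1$, and so have the three nontrivial lattice modules.
  Splitting the 12 pairs of fermions of the moonshine module into three groups of four turns its
  graded dimension into $u_0^3 + 3u_0u_1^2 + 4u_1^3$, and that of the twisted module into
  $3u_0^2u_1 + 5u_1^3$.  The untwisted and twisted sectors of the sigma model give
  $(u_0^3 + u_0u_1^2 + 2u_1^3) + (2u_0u_1^2 + 2u_1^3)$ and
  $(u_0^2u_1 + 3u_1^3) + (2u_0^2u_1 + 2u_1^3)$.\<close>

section \<open>Linear algebra on finitely supported functions\<close>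

lemma sum_fun_apply: "(\<Sum>a\<in>A. f a) x = (\<Sum>a\<in>A. f a x)" for f :: "'a \<Rightarrow> 'x \<Rightarrow> 'b::comm_monoid_add"
  by (induction A rule: infinite_finite_induct) auto

lemma scal_apply: "scal c f x = c * f x"
  by (simp add: scal_def)

text \<open>The pointwise rules leave the simplifier, which would otherwise rewrite eta-expanded sums of
  vectors under the abstraction.\<close>

lemmas fn_apply = plus_fun_apply minus_apply uminus_apply zero_fun_apply scal_apply sum_fun_apply

declare plus_fun_apply [simp del] minus_apply [simp del] uminus_apply [simp del]

definition fsupp :: "'x set \<Rightarrow> 'x fn set" where
  "fsupp X = {f. finite {x. f x \<noteq> 0} \<and> {x. f x \<noteq> 0} \<subseteq> X}"

lemma fsuppD: "f \<in> fsupp X \<Longrightarrow> finite {x. f x \<noteq> 0}" "f \<in> fsupp X \<Longrightarrow> f x \<noteq> 0 \<Longrightarrow> x \<in> X"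
  by (auto simp: fsupp_def)

lemma fsupp_outside: "f \<in> fsupp X \<Longrightarrow> x \<notin> X \<Longrightarrow> f x = 0"
  by (auto simp: fsupp_def)

lemma fsuppI: "finite A \<Longrightarrow> (\<And>x. x \<notin> A \<Longrightarrow> f x = 0) \<Longrightarrow> (\<And>x. x \<notin> X \<Longrightarrow> f x = 0) \<Longrightarrow> f \<in> fsupp X"
  unfolding fsupp_def by (auto intro: finite_subset[of _ A])

lemma subspace_fsupp: "fn.subspace (fsupp X)"
proof (rule fn.subspaceI)
  show "0 \<in> fsupp X" by (simp add: fsupp_def)
next
  fix f g assume "f \<in> fsupp X" "g \<in> fsupp X"
  then show "f + g \<in> fsupp X"
    by (intro fsuppI[of "{x. f x \<noteq> 0} \<union> {x. g x \<noteq> 0}"]) (auto simp: fn_apply fsupp_outside dest: fsuppD(1))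
next
  fix c f assume "f \<in> fsupp X"
  then show "scal c f \<in> fsupp X"
    by (intro fsuppI[of "{x. f x \<noteq> 0}"]) (auto simp: fn_apply fsupp_outside dest: fsuppD(1))
qed

lemma unit_fn_fsupp: "x \<in> X \<Longrightarrow> unit_fn x \<in> fsupp X"
  by (intro fsuppI[of "{x}"]) (auto simp: unit_fn_def)

lemma fn_expand:
  assumes "finite A" "\<And>x. x \<notin> A \<Longrightarrow> f x = 0"
  shows "f = (\<Sum>x\<in>A. scal (f x) (unit_fn x))"
proof
  fix y
  have "(\<Sum>x\<in>A. scal (f x) (unit_fn x)) y = (\<Sum>x\<in>A. if x = y then f y else 0)"
    unfolding sum_fun_apply by (rule sum.cong) (auto simp: unit_fn_def scal_apply)
  also have "\<dots> = f y" using assms by (cases "y \<in> A") auto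
  finally show "f y = (\<Sum>x\<in>A. scal (f x) (unit_fn x)) y" ..
qed

lemma fsupp_eq_span: "fsupp X = fn.span (unit_fn ` X)"
proof
  show "fn.span (unit_fn ` X) \<subseteq> fsupp X"
    by (intro fn.span_minimal subspace_fsupp) (auto intro: unit_fn_fsupp)
  show "fsupp X \<subseteq> fn.span (unit_fn ` X)"
  proof
    fix f assume f: "f \<in> fsupp X"
    have "f = (\<Sum>x\<in>{x. f x \<noteq> 0}. scal (f x) (unit_fn x))"
      by (rule fn_expand) (use f in \<open>auto simp: fsupp_def\<close>)
    also have "\<dots> \<in> fn.span (unit_fn ` X)"
      by (intro fn.span_sum fn.span_scale fn.span_base) (use f in \<open>auto simp: fsupp_def\<close>)
    finally show "f \<in> fn.span (unit_fn ` X)" .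
  qed
qed

lemma linear_betweenD:
  assumes "linear_between V W T"
  shows "f \<in> V \<Longrightarrow> T f \<in> W" "f \<in> V \<Longrightarrow> g \<in> V \<Longrightarrow> T (f + g) = T f + T g"
    "f \<in> V \<Longrightarrow> T (scal c f) = scal c (T f)"
  using assms by (auto simp: linear_between_def)

lemma linear_betweenI:
  assumes "\<And>f. f \<in> V \<Longrightarrow> T f \<in> W" "\<And>f g. f \<in> V \<Longrightarrow> g \<in> V \<Longrightarrow> T (f + g) = T f + T g"
    "\<And>c f. f \<in> V \<Longrightarrow> T (scal c f) = scal c (T f)"
  shows "linear_between V W T"
  using assms by (auto simp: linear_between_def)

lemma scal_0 [simp]: "scal 0 f = 0" and scal_zero [simp]: "scal c 0 = 0"
  and scal_1 [simp]: "scal 1 f = f" and scal_scal: "scal a (scal b f) = scal (a * b) f"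
  by (auto simp: scal_def fun_eq_iff)

lemma scal_add: "scal c (f + g) = scal c f + scal c g"
  and scal_diff: "scal c (f - g) = scal c f - scal c g"
  and scal_minus: "scal c (- f) = - scal c f"
  and scal_add_left: "scal (a + b) f = scal a f + scal b f"
  and scal_minus_left: "scal (- a) f = - scal a f"
  by (auto simp: fun_eq_iff fn_apply algebra_simps)

lemma scal_sum: "scal c (\<Sum>a\<in>A. f a) = (\<Sum>a\<in>A. scal c (f a))"
  by (rule ext) (simp add: fn_apply sum_distrib_left)

lemma linear_between_0:
  assumes "linear_between V W T" "fn.subspace V" shows "T 0 = 0"
  using linear_betweenD(3)[OF assms(1), of 0 0] fn.subspace_0[OF assms(2)] by simp

lemma linear_between_diff:
  assumes "linear_between V W T" "fn.subspace V" "f \<in> V" "g \<in> V" shows "T (f - g) = T f - T g"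
proof -
  have "T (f + scal (-1) g) = T f + T (scal (-1) g)"
    by (rule linear_betweenD(2)[OF assms(1,3) fn.subspace_scale[OF assms(2,4)]])
  also have "T (scal (-1) g) = scal (-1) (T g)"
    by (rule linear_betweenD(3)[OF assms(1,4)])
  finally show ?thesis by simp
qed

lemma linear_between_sum:
  assumes "linear_between V W T" "fn.subspace V" "\<And>a. a \<in> A \<Longrightarrow> f a \<in> V"
  shows "T (\<Sum>a\<in>A. f a) = (\<Sum>a\<in>A. T (f a))"
  using assms(3)
proof (induction A rule: infinite_finite_induct)
  case (insert a A)
  then have "sum f A \<in> V" by (intro fn.subspace_sum[OF assms(2)]) simp
  with insert show ?case
    by (simp add: linear_betweenD(2)[OF assms(1)])
qed (simp_all add: linear_between_0[OF assms(1,2)])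

lemma linear_between_comp:
  "linear_between U V S \<Longrightarrow> linear_between V W T \<Longrightarrow> linear_between U W (\<lambda>f. T (S f))"
  by (rule linear_betweenI) (simp_all add: linear_betweenD)

lemma linear_between_add:
  "fn.subspace W \<Longrightarrow> linear_between V W S \<Longrightarrow> linear_between V W T \<Longrightarrow> linear_between V W (\<lambda>f. S f + T f)"
  by (rule linear_betweenI) (simp_all add: linear_betweenD[of V W S] linear_betweenD[of V W T] fn.subspace_add scal_add)

lemma linear_between_scal:
  "fn.subspace W \<Longrightarrow> linear_between V W S \<Longrightarrow> linear_between V W (\<lambda>f. scal c (S f))"
  by (rule linear_betweenI)
    (simp_all add: linear_betweenD[of V W S] fn.subspace_scale scal_add scal_scal mult.commute)

lemma linear_between_sub:
  "fn.subspace W \<Longrightarrow> linear_between V W S \<Longrightarrow> linear_between V W T \<Longrightarrow> linear_between V W (\<lambda>f. S f - T f)"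
  by (rule linear_betweenI) (simp_all add: linear_betweenD[of V W S] linear_betweenD[of V W T] fn.subspace_diff scal_diff)

lemma linear_fsupp_eqI:
  assumes "linear_between (fsupp X) V S" "linear_between (fsupp X) W T"
    and "\<And>x. x \<in> X \<Longrightarrow> S (unit_fn x) = T (unit_fn x)" and f: "f \<in> fsupp X"
  shows "S f = T f"
proof -
  let ?A = "{x. f x \<noteq> 0}"
  have exp: "f = (\<Sum>x\<in>?A. scal (f x) (unit_fn x))"
    by (rule fn_expand) (use f in \<open>auto simp: fsupp_def\<close>)
  have in_X: "x \<in> X" if "x \<in> ?A" for x using that f by (auto simp: fsupp_def)
  have mem: "scal (f x) (unit_fn x) \<in> fsupp X" if "x \<in> ?A" for x
    using in_X[OF that] by (intro fn.subspace_scale subspace_fsupp unit_fn_fsupp)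
  have "S f = (\<Sum>x\<in>?A. S (scal (f x) (unit_fn x)))"
    by (subst exp) (rule linear_between_sum[OF assms(1) subspace_fsupp mem])
  also have "\<dots> = (\<Sum>x\<in>?A. T (scal (f x) (unit_fn x)))"
    by (rule sum.cong) (use in_X assms in \<open>auto simp: linear_betweenD(3)[OF assms(1)]
        linear_betweenD(3)[OF assms(2)] unit_fn_fsupp\<close>)
  also have "\<dots> = T f"
    by (subst (2) exp) (rule linear_between_sum[OF assms(2) subspace_fsupp mem, symmetric])
  finally show ?thesis .
qed

lemma linear_between_span_eqI:
  assumes "linear_between (fn.span B) V S" "linear_between (fn.span B) W T"
    and "\<And>x. x \<in> B \<Longrightarrow> S x = T x" and f: "f \<in> fn.span B"
  shows "S f = T f"
proof -
  have "fn.subspace {f \<in> fn.span B. S f = T f}"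
    using linear_between_0[OF assms(1)] linear_between_0[OF assms(2)]
    by (intro fn.subspaceI) (auto simp: linear_betweenD[OF assms(1)] linear_betweenD[OF assms(2)]
      fn.span_zero fn.span_add fn.span_scale)
  then have "fn.span B \<subseteq> {f \<in> fn.span B. S f = T f}"
    by (rule fn.span_minimal[rotated]) (use assms(3) fn.span_base in auto)
  with f show ?thesis by auto
qed

section \<open>Tensor products of spaces of functions\<close>

definition prod_fn :: "'x fn \<Rightarrow> 'y fn \<Rightarrow> ('x \<times> 'y) fn" where
  "prod_fn f g = (\<lambda>(x, y). f x * g y)"

text \<open>\<open>op_left\<close> and \<open>op_right\<close> for maps between different spaces.\<close>

definition map_left :: "('x fn \<Rightarrow> 'z fn) \<Rightarrow> ('x \<times> 'y) fn \<Rightarrow> ('z \<times> 'y) fn" where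
  "map_left T f = (\<lambda>(x, y). T (\<lambda>x'. f (x', y)) x)"

definition map_right :: "('y fn \<Rightarrow> 'z fn) \<Rightarrow> ('x \<times> 'y) fn \<Rightarrow> ('x \<times> 'z) fn" where
  "map_right T f = (\<lambda>(x, y). T (\<lambda>y'. f (x, y')) y)"

definition tens :: "'x fn set \<Rightarrow> 'y fn set \<Rightarrow> ('x \<times> 'y) fn set" where
  "tens V W = fn.span {prod_fn f g | f g. f \<in> V \<and> g \<in> W}"

lemma subspace_tens: "fn.subspace (tens V W)"
  by (simp add: tens_def)

lemma prod_fn_tens: "f \<in> V \<Longrightarrow> g \<in> W \<Longrightarrow> prod_fn f g \<in> tens V W"
  unfolding tens_def by (rule fn.span_base) auto

lemma tens_induct:
  assumes "F \<in> tens V W" "fn.subspace P" "\<And>f g. f \<in> V \<Longrightarrow> g \<in> W \<Longrightarrow> prod_fn f g \<in> P"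
  shows "F \<in> P"
  using fn.span_minimal[of "{prod_fn f g | f g. f \<in> V \<and> g \<in> W}" P] assms unfolding tens_def by blast

lemma tens_slice_left: 
  assumes "fn.subspace V" "F \<in> tens V W" shows "(\<lambda>x. F (x, y)) \<in> V"
proof -
  have "F \<in> {F. (\<lambda>x. F (x, y)) \<in> V}"
  proof (rule tens_induct[OF assms(2)])
    show "fn.subspace {F. (\<lambda>x. F (x, y)) \<in> V}"
    proof (rule fn.subspaceI)
      show "0 \<in> {F. (\<lambda>x. F (x, y)) \<in> V}" using fn.subspace_0[OF assms(1)] by (simp add: zero_fun_def)
    next
      fix F G assume "F \<in> {F. (\<lambda>x. F (x, y)) \<in> V}" "G \<in> {F. (\<lambda>x. F (x, y)) \<in> V}"
      then show "F + G \<in> {F. (\<lambda>x. F (x, y)) \<in> V}"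
        using fn.subspace_add[OF assms(1), of "\<lambda>x. F (x, y)" "\<lambda>x. G (x, y)"] by (simp add: plus_fun_def)
    next
      fix c F assume "F \<in> {F. (\<lambda>x. F (x, y)) \<in> V}"
      then show "scal c F \<in> {F. (\<lambda>x. F (x, y)) \<in> V}"
        using fn.subspace_scale[OF assms(1), of "\<lambda>x. F (x, y)" c] by (simp add: scal_def)
    qed
  next
    fix f g assume "f \<in> V" "g \<in> W"
    then have "scal (g y) f \<in> V" using assms(1) by (simp add: fn.subspace_scale)
    then show "prod_fn f g \<in> {F. (\<lambda>x. F (x, y)) \<in> V}" by (simp add: prod_fn_def scal_def mult.commute)
  qed
  then show ?thesis by simp
qed

lemma tens_slice_right: 
  assumes "fn.subspace W" "F \<in> tens V W" shows "(\<lambda>y. F (x, y)) \<in> W"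
proof -
  have "F \<in> {F. (\<lambda>y. F (x, y)) \<in> W}"
  proof (rule tens_induct[OF assms(2)])
    show "fn.subspace {F. (\<lambda>y. F (x, y)) \<in> W}"
    proof (rule fn.subspaceI)
      show "0 \<in> {F. (\<lambda>y. F (x, y)) \<in> W}" using fn.subspace_0[OF assms(1)] by (simp add: zero_fun_def)
    next
      fix F G assume "F \<in> {F. (\<lambda>y. F (x, y)) \<in> W}" "G \<in> {F. (\<lambda>y. F (x, y)) \<in> W}"
      then show "F + G \<in> {F. (\<lambda>y. F (x, y)) \<in> W}"
        using fn.subspace_add[OF assms(1), of "\<lambda>y. F (x, y)" "\<lambda>y. G (x, y)"] by (simp add: plus_fun_def)
    next
      fix c F assume "F \<in> {F. (\<lambda>y. F (x, y)) \<in> W}"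
      then show "scal c F \<in> {F. (\<lambda>y. F (x, y)) \<in> W}"
        using fn.subspace_scale[OF assms(1), of "\<lambda>y. F (x, y)" c] by (simp add: scal_def)
    qed
  next
    fix f g assume "f \<in> V" "g \<in> W"
    then have "scal (f x) g \<in> W" using assms(1) by (simp add: fn.subspace_scale)
    then show "prod_fn f g \<in> {F. (\<lambda>y. F (x, y)) \<in> W}" by (simp add: prod_fn_def scal_def)
  qed
  then show ?thesis by simp
qed

lemma map_left_prod:
  assumes "linear_between V V' A" "f \<in> V"
  shows "map_left A (prod_fn f g) = prod_fn (A f) g"
proof -
  have "A (\<lambda>x'. f x' * g y) x = A f x * g y" for x y
    using arg_cong[OF linear_betweenD(3)[OF assms(1,2), of "g y"], of "\<lambda>h. h x"]
    by (simp add: scal_def mult.commute)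
  then show ?thesis by (auto simp: map_left_def prod_fn_def fun_eq_iff)
qed

lemma map_right_prod:
  assumes "linear_between W W' A" "g \<in> W"
  shows "map_right A (prod_fn f g) = prod_fn f (A g)"
proof -
  have "A (\<lambda>y'. f x * g y') y = f x * A g y" for x y
    using arg_cong[OF linear_betweenD(3)[OF assms(1,2), of "f x"], of "\<lambda>h. h y"]
    by (simp add: scal_def)
  then show ?thesis by (auto simp: map_right_def prod_fn_def fun_eq_iff)
qed

lemma map_left_zero: "A 0 = 0 \<Longrightarrow> map_left A 0 = 0"
  by (auto simp: map_left_def fun_eq_iff zero_fun_def)

lemma map_right_zero: "A 0 = 0 \<Longrightarrow> map_right A 0 = 0"
  by (auto simp: map_right_def fun_eq_iff zero_fun_def)

lemma map_left_linear:
  assumes A: "linear_between V V' A" and V: "fn.subspace V"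
  shows "linear_between (tens V W) (tens V' W) (map_left A)"
proof -
  have add: "map_left A (F + G) = map_left A F + map_left A G" if "F \<in> tens V W" "G \<in> tens V W" for F G
  proof -
    have "A (\<lambda>x'. (F + G) (x', y)) = A (\<lambda>x'. F (x', y)) + A (\<lambda>x'. G (x', y))" for y
      using linear_betweenD(2)[OF A tens_slice_left[OF V that(1)] tens_slice_left[OF V that(2)], of y y]
      by (simp add: plus_fun_def)
    then show ?thesis by (auto simp: map_left_def fun_eq_iff fn_apply)
  qed
  have scale: "map_left A (scal c F) = scal c (map_left A F)" if "F \<in> tens V W" for c F
  proof -
    have "A (\<lambda>x'. c * F (x', y)) = scal c (A (\<lambda>x'. F (x', y)))" for y
      using linear_betweenD(3)[OF A tens_slice_left[OF V that], of c y]
      by (simp add: scal_def)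
    then show ?thesis by (auto simp: map_left_def fun_eq_iff fn_apply)
  qed
  have "F \<in> {F \<in> tens V W. map_left A F \<in> tens V' W}" if "F \<in> tens V W" for F
  proof (rule tens_induct[OF that])
    have "map_left A 0 \<in> tens V' W"
      using linear_between_0[OF A V] by (simp add: map_left_zero fn.subspace_0[OF subspace_tens])
    then show "fn.subspace {F \<in> tens V W. map_left A F \<in> tens V' W}"
      by (intro fn.subspaceI)
        (simp_all add: add scale fn.subspace_0[OF subspace_tens] fn.subspace_add[OF subspace_tens] fn.subspace_scale[OF subspace_tens])
  next
    fix f g assume "f \<in> V" "g \<in> W"
    then show "prod_fn f g \<in> {F \<in> tens V W. map_left A F \<in> tens V' W}"
      by (auto simp: map_left_prod[OF A] intro!: prod_fn_tens linear_betweenD(1)[OF A])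
  qed
  then show ?thesis by (intro linear_betweenI add scale) auto
qed

lemma map_right_linear:
  assumes A: "linear_between W W' A" and W: "fn.subspace W"
  shows "linear_between (tens V W) (tens V W') (map_right A)"
proof -
  have add: "map_right A (F + G) = map_right A F + map_right A G" if "F \<in> tens V W" "G \<in> tens V W" for F G
  proof -
    have "A (\<lambda>y'. (F + G) (x, y')) = A (\<lambda>y'. F (x, y')) + A (\<lambda>y'. G (x, y'))" for x
      using linear_betweenD(2)[OF A tens_slice_right[OF W that(1)] tens_slice_right[OF W that(2)], of x x]
      by (simp add: plus_fun_def)
    then show ?thesis by (auto simp: map_right_def fun_eq_iff fn_apply)
  qed
  have scale: "map_right A (scal c F) = scal c (map_right A F)" if "F \<in> tens V W" for c F
  proof -
    have "A (\<lambda>y'. c * F (x, y')) = scal c (A (\<lambda>y'. F (x, y')))" for x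
      using linear_betweenD(3)[OF A tens_slice_right[OF W that], of c x]
      by (simp add: scal_def)
    then show ?thesis by (auto simp: map_right_def fun_eq_iff fn_apply)
  qed
  have "F \<in> {F \<in> tens V W. map_right A F \<in> tens V W'}" if "F \<in> tens V W" for F
  proof (rule tens_induct[OF that])
    have "map_right A 0 \<in> tens V W'"
      using linear_between_0[OF A W] by (simp add: map_right_zero fn.subspace_0[OF subspace_tens])
    then show "fn.subspace {F \<in> tens V W. map_right A F \<in> tens V W'}"
      by (intro fn.subspaceI)
        (simp_all add: add scale fn.subspace_0[OF subspace_tens] fn.subspace_add[OF subspace_tens] fn.subspace_scale[OF subspace_tens])
  next
    fix f g assume "f \<in> V" "g \<in> W"
    then show "prod_fn f g \<in> {F \<in> tens V W. map_right A F \<in> tens V W'}"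
      by (auto simp: map_right_prod[OF A] intro!: prod_fn_tens linear_betweenD(1)[OF A])
  qed
  then show ?thesis by (intro linear_betweenI add scale) auto
qed

lemma map_left_right_commute:
  assumes A: "linear_between V V' A" and V: "fn.subspace V" and B: "linear_between W W' B" and W: "fn.subspace W"
    and F: "F \<in> tens V W"
  shows "map_left A (map_right B F) = map_right B (map_left A F)"
proof -
  have l: "linear_between (tens V W) (tens V' W') (\<lambda>F. map_left A (map_right B F))"
    by (rule linear_between_comp[OF map_right_linear[OF B W] map_left_linear[OF A V]])
  have r: "linear_between (tens V W) (tens V' W') (\<lambda>F. map_right B (map_left A F))"
    by (rule linear_between_comp[OF map_left_linear[OF A V] map_right_linear[OF B W]])
  show ?thesis
  proof (rule linear_between_span_eqI[OF l[unfolded tens_def[of V W]] r[unfolded tens_def[of V W]]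
        _ F[unfolded tens_def]])
    fix G assume "G \<in> {prod_fn f g | f g. f \<in> V \<and> g \<in> W}"
    then obtain f g where G: "G = prod_fn f g" and f: "f \<in> V" "A f \<in> V'" and g: "g \<in> W" "B g \<in> W'"
      using linear_betweenD(1)[OF A] linear_betweenD(1)[OF B] by blast
    show "map_left A (map_right B G) = map_right B (map_left A G)"
      by (simp add: G map_left_prod[OF A f(1)] map_right_prod[OF B g(1)])
  qed
qed

text \<open>The tensor product of two free vector spaces is free on the pairs of labels, so that tensor products
  of modules in coordinates are again in coordinates.\<close>

lemma tens_fsupp: "tens (fsupp X) (fsupp Y) = fsupp (X \<times> Y)"
proof
  have "prod_fn f g \<in> fsupp (X \<times> Y)" if "f \<in> fsupp X" "g \<in> fsupp Y" for f g
    using that by (intro fsuppI[of "{x. f x \<noteq> 0} \<times> {y. g y \<noteq> 0}"]) (auto simp: fsupp_def prod_fn_def)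
  then show "tens (fsupp X) (fsupp Y) \<subseteq> fsupp (X \<times> Y)"
    unfolding tens_def by (intro fn.span_minimal subspace_fsupp) auto
  have "unit_fn (x, y) = prod_fn (unit_fn x) (unit_fn y)" for x :: 'a and y :: 'b
    by (auto simp: unit_fn_def prod_fn_def fun_eq_iff)
  then have "unit_fn ` (X \<times> Y) \<subseteq> tens (fsupp X) (fsupp Y)"
    by (auto intro!: prod_fn_tens unit_fn_fsupp)
  then show "fsupp (X \<times> Y) \<subseteq> tens (fsupp X) (fsupp Y)"
    unfolding fsupp_eq_span[of "X \<times> Y"] by (intro fn.span_minimal subspace_tens)
qed

section \<open>Constructions of Virasoro modules\<close>

lemma virasoro_moduleD:
  assumes "virasoro_module M"
  shows "fn.subspace (carr M)" "linear_between (carr M) (carr M) (vir_L M n)"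
    "linear_between (carr M) (carr M) (central M)"
    "f \<in> carr M \<Longrightarrow> vir_L M n (central M f) = central M (vir_L M n f)"
    "f \<in> carr M \<Longrightarrow> vir_L M m (vir_L M n f) - vir_L M n (vir_L M m f) =
          scal (of_int (m - n)) (vir_L M (m + n) f)
          + (if m + n = 0 then scal (of_int (m ^ 3 - m) / 12) (central M f) else 0)"
  using assms unfolding virasoro_module_def by auto

lemma tensor_simps:
  "carr (tensor M N) = tens (carr M) (carr N)"
  "vir_L (tensor M N) n = (\<lambda>F. map_left (vir_L M n) F + map_right (vir_L N n) F)"
  "central (tensor M N) = (\<lambda>F. map_left (central M) F + map_right (central N) F)"
  by (simp_all add: tensor_def tens_def prod_fn_def op_left_def op_right_def map_left_def map_right_def)

text \<open>The operators of the two factors commute, since they act on different variables.\<close>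

lemma virasoro_module_tensor:
  assumes M: "virasoro_module M" and N: "virasoro_module N"
  shows "virasoro_module (tensor M N)"
proof -
  note VM = virasoro_moduleD[OF M] and VN = virasoro_moduleD[OF N]
  let ?T = "tens (carr M) (carr N)"
  note l = map_left_linear[OF VM(2) VM(1), where W = "carr N"]
    and r = map_right_linear[OF VN(2) VN(1), where V = "carr M"]
    and lc = map_left_linear[OF VM(3) VM(1), where W = "carr N"]
    and rc = map_right_linear[OF VN(3) VN(1), where V = "carr M"]
  have lin: "linear_between ?T ?T (vir_L (tensor M N) n)" for n
    unfolding tensor_simps by (intro linear_between_add subspace_tens l r)
  have linc: "linear_between ?T ?T (central (tensor M N))"
    unfolding tensor_simps by (intro linear_between_add subspace_tens lc rc)
  have comm: "vir_L (tensor M N) n (central (tensor M N) F) = central (tensor M N) (vir_L (tensor M N) n F)"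
    if F: "F \<in> ?T" for n F
  proof -
    have 1: "map_left (vir_L M n) (map_left (central M) F) = map_left (central M) (map_left (vir_L M n) F)"
      using VM(4)[OF tens_slice_left[OF VM(1) F]] by (auto simp: map_left_def fun_eq_iff)
    have 2: "map_right (vir_L N n) (map_right (central N) F) = map_right (central N) (map_right (vir_L N n) F)"
      using VN(4)[OF tens_slice_right[OF VN(1) F]] by (auto simp: map_right_def fun_eq_iff)
    show ?thesis
      unfolding tensor_simps
      by (simp add: linear_betweenD[OF l] linear_betweenD[OF r] linear_betweenD[OF lc] linear_betweenD[OF rc]
          F 1 2 map_left_right_commute[OF VM(2) VM(1) VN(3) VN(1) F]
          map_left_right_commute[OF VM(3) VM(1) VN(2) VN(1) F] algebra_simps)
  qed
  have rel: "vir_L (tensor M N) m (vir_L (tensor M N) n F) - vir_L (tensor M N) n (vir_L (tensor M N) m F) =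
      scal (of_int (m - n)) (vir_L (tensor M N) (m + n) F)
      + (if m + n = 0 then scal (of_int (m ^ 3 - m) / 12) (central (tensor M N) F) else 0)"
    if F: "F \<in> ?T" for m n F
  proof -
    have 1: "map_left (vir_L M m) (map_left (vir_L M n) F) - map_left (vir_L M n) (map_left (vir_L M m) F)
        = scal (of_int (m - n)) (map_left (vir_L M (m + n)) F)
          + (if m + n = 0 then scal (of_int (m ^ 3 - m) / 12) (map_left (central M) F) else 0)"
      (is "?l = ?r")
    proof
      fix z :: "'a \<times> 'b" obtain x y where z: "z = (x, y)" by (cases z)
      show "?l z = ?r z"
        using fun_cong[OF VM(5)[OF tens_slice_left[OF VM(1) F], of m n y], of x]
        by (auto simp: map_left_def z fn_apply)
    qed
    have 2: "map_right (vir_L N m) (map_right (vir_L N n) F) - map_right (vir_L N n) (map_right (vir_L N m) F)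
        = scal (of_int (m - n)) (map_right (vir_L N (m + n)) F)
          + (if m + n = 0 then scal (of_int (m ^ 3 - m) / 12) (map_right (central N) F) else 0)"
      (is "?l = ?r")
    proof
      fix z :: "'a \<times> 'b" obtain x y where z: "z = (x, y)" by (cases z)
      show "?l z = ?r z"
        using fun_cong[OF VN(5)[OF tens_slice_right[OF VN(1) F], of m n x], of y]
        by (auto simp: map_right_def z fn_apply)
    qed
    have e: "vir_L (tensor M N) m (vir_L (tensor M N) n F) - vir_L (tensor M N) n (vir_L (tensor M N) m F) =
       (map_left (vir_L M m) (map_left (vir_L M n) F) - map_left (vir_L M n) (map_left (vir_L M m) F))
       + (map_right (vir_L N m) (map_right (vir_L N n) F) - map_right (vir_L N n) (map_right (vir_L N m) F))"
      unfolding tensor_simps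
      by (simp add: linear_betweenD[OF l] linear_betweenD[OF r] F
          map_left_right_commute[OF VM(2) VM(1) VN(2) VN(1) F])
    show ?thesis unfolding e 1 2 by (simp add: tensor_simps scal_add)
  qed
  show ?thesis
    unfolding virasoro_module_def using lin linc comm rel
    by (auto simp: tensor_simps subspace_tens)
qed

text \<open>Explicit coordinate modules are compared with the given ones through this transport of structure.\<close>

lemma virasoro_module_transport:
  assumes N: "virasoro_module N" and R: "linear_between (carr N) (carr M) R" and b: "bij_betw R (carr N) (carr M)"
    and c: "\<And>f. f \<in> carr N \<Longrightarrow> R (central N f) = central M (R f)"
    and L: "\<And>f n. f \<in> carr N \<Longrightarrow> R (vir_L N n f) = vir_L M n (R f)"
  shows "virasoro_module M"
proof -
  note VN = virasoro_moduleD[OF N]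
  have im: "carr M = R ` carr N" using b by (simp add: bij_betw_def)
  have memL: "vir_L N n f \<in> carr N" and memc: "central N f \<in> carr N" if "f \<in> carr N" for n f
    using that VN linear_betweenD(1) by blast+
  have sc: "scal a f \<in> carr N" if "f \<in> carr N" for a f using fn.subspace_scale[OF VN(1) that] .
  have ad: "f + g \<in> carr N" if "f \<in> carr N" "g \<in> carr N" for f g using fn.subspace_add[OF VN(1) that] .
  have sub: "fn.subspace (carr M)"
  proof (rule fn.subspaceI)
    show "0 \<in> carr M"
      unfolding im using linear_between_0[OF R VN(1)] imageI[OF fn.subspace_0[OF VN(1)], of R] by simp
  next
    fix f g assume "f \<in> carr M" "g \<in> carr M"
    then show "f + g \<in> carr M"
      unfolding im by (auto simp: ad simp flip: linear_betweenD(2)[OF R] intro!: imageI)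
  next
    fix a f assume "f \<in> carr M"
    then show "scal a f \<in> carr M"
      unfolding im by (auto simp: sc simp flip: linear_betweenD(3)[OF R] intro!: imageI)
  qed
  have op: "linear_between (carr M) (carr M) B"
    if A: "linear_between (carr N) (carr N) A" and int: "\<And>f. f \<in> carr N \<Longrightarrow> R (A f) = B (R f)" for A B
  proof -
    have "B (R f) \<in> R ` carr N" if "f \<in> carr N" for f
      by (simp add: linear_betweenD(1)[OF A that] flip: int[OF that])
    moreover have "B (R f + R g) = B (R f) + B (R g)" if "f \<in> carr N" "g \<in> carr N" for f g
    proof -
      have "B (R f + R g) = R (A (f + g))" using int[OF ad[OF that]] linear_betweenD(2)[OF R that] by simp
      also have "\<dots> = R (A f) + R (A g)"
        using that by (simp add: linear_betweenD(1,2)[OF A] linear_betweenD(2)[OF R])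
      finally show ?thesis using int that by simp
    qed
    moreover have "B (scal a (R f)) = scal a (B (R f))" if "f \<in> carr N" for f a
    proof -
      have "B (scal a (R f)) = R (A (scal a f))" using int[OF sc[OF that]] linear_betweenD(3)[OF R that] by simp
      also have "\<dots> = scal a (R (A f))"
        using that by (simp add: linear_betweenD(1,3)[OF A] linear_betweenD(3)[OF R])
      finally show ?thesis using int that by simp
    qed
    ultimately show ?thesis by (intro linear_betweenI) (auto simp: im)
  qed
  have rel: "vir_L M m (vir_L M n (R f)) - vir_L M n (vir_L M m (R f)) =
          scal (of_int (m - n)) (vir_L M (m + n) (R f))
          + (if m + n = 0 then scal (of_int (m ^ 3 - m) / 12) (central M (R f)) else 0)"
    if f: "f \<in> carr N" for m n f
  proof -
    have "vir_L M m (vir_L M n (R f)) - vir_L M n (vir_L M m (R f))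
      = R (vir_L N m (vir_L N n f) - vir_L N n (vir_L N m f))"
      using f by (simp add: linear_between_diff[OF R VN(1)] L memL)
    also have "\<dots> = R (scal (of_int (m - n)) (vir_L N (m + n) f)
          + (if m + n = 0 then scal (of_int (m ^ 3 - m) / 12) (central N f) else 0))"
      using VN(5)[OF f] by simp
    also have "\<dots> = scal (of_int (m - n)) (vir_L M (m + n) (R f))
          + (if m + n = 0 then scal (of_int (m ^ 3 - m) / 12) (central M (R f)) else 0)"
      using f by (auto simp: linear_betweenD(2,3)[OF R] L memL memc c sc)
    finally show ?thesis .
  qed
  show ?thesis
    unfolding virasoro_module_def
  proof (intro conjI allI ballI)
    fix n show "linear_between (carr M) (carr M) (vir_L M n)" by (rule op[OF VN(2) L])
  next
    show "linear_between (carr M) (carr M) (central M)" by (rule op[OF VN(3) c])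
  next
    fix n f assume "f \<in> carr M"
    then obtain f' where f': "f = R f'" "f' \<in> carr N" by (auto simp: im)
    have "vir_L M n (central M f) = R (vir_L N n (central N f'))" using f' by (simp add: L c memc)
    also have "\<dots> = central M (vir_L M n f)" using f' by (simp add: VN(4) L c memL)
    finally show "vir_L M n (central M f) = central M (vir_L M n f)" .
  next
    fix m n f assume "f \<in> carr M"
    then obtain f' where f': "f = R f'" "f' \<in> carr N" by (auto simp: im)
    show "vir_L M m (vir_L M n f) - vir_L M n (vir_L M m f) =
          scal (of_int (m - n)) (vir_L M (m + n) f)
          + (if m + n = 0 then scal (of_int (m ^ 3 - m) / 12) (central M f) else 0)"
      unfolding f'(1) by (rule rel[OF f'(2)])
  qed (rule sub)
qed

section \<open>Unitary Virasoro modules\<close>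

text \<open>The Hermitian form for which the labels are an orthonormal basis.  Only one argument need have finite
  support for the sum to be finite.\<close>

definition ip :: "'x fn \<Rightarrow> 'x fn \<Rightarrow> complex" where
  "ip f g = (\<Sum>x | f x \<noteq> 0 \<and> g x \<noteq> 0. cnj (f x) * g x)"

text \<open>The diagonal operator with eigenvalues \<open>s\<close>.\<close>

definition smul :: "'x fn \<Rightarrow> 'x fn \<Rightarrow> 'x fn" where
  "smul s f = (\<lambda>x. s x * f x)"

lemma ip_eq:
  assumes "finite A" "\<And>x. x \<notin> A \<Longrightarrow> f x = 0 \<or> g x = 0"
  shows "ip f g = (\<Sum>x\<in>A. cnj (f x) * g x)"
  unfolding ip_def by (rule sum.mono_neutral_left) (use assms in auto)

lemma ip_left:
  assumes "finite {x. f x \<noteq> 0}" shows "ip f g = (\<Sum>x | f x \<noteq> 0. cnj (f x) * g x)"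
  by (rule ip_eq) (use assms in auto)

lemma ip_right:
  assumes "finite {x. g x \<noteq> 0}" shows "ip f g = (\<Sum>x | g x \<noteq> 0. cnj (f x) * g x)"
  by (rule ip_eq) (use assms in auto)

lemma ip_cnj: "cnj (ip f g) = ip g f"
  unfolding ip_def by (auto intro!: sum.cong simp: mult.commute)

lemma ip_add_right: "f \<in> fsupp X \<Longrightarrow> ip f (g + h) = ip f g + ip f h"
  by (simp add: ip_left fsuppD(1) fn_apply sum.distrib algebra_simps)

lemma ip_diff_right: "f \<in> fsupp X \<Longrightarrow> ip f (g - h) = ip f g - ip f h"
  by (simp add: ip_left fsuppD(1) fn_apply sum_subtractf algebra_simps)

lemma ip_scal_right: "f \<in> fsupp X \<Longrightarrow> ip f (scal a g) = a * ip f g"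
  by (simp add: ip_left fsuppD(1) fn_apply sum_distrib_left mult_ac)

lemma ip_add_left: "h \<in> fsupp X \<Longrightarrow> ip (f + g) h = ip f h + ip g h"
  by (simp add: ip_right fsuppD(1) fn_apply sum.distrib algebra_simps)

lemma ip_diff_left: "h \<in> fsupp X \<Longrightarrow> ip (f - g) h = ip f h - ip g h"
  by (simp add: ip_right fsuppD(1) fn_apply sum_subtractf algebra_simps)

lemma ip_scal_left: "h \<in> fsupp X \<Longrightarrow> ip (scal a g) h = cnj a * ip g h"
  by (simp add: ip_right fsuppD(1) fn_apply sum_distrib_left mult_ac)

lemma ip_self_eq_0: 
  assumes "f \<in> fsupp X" "ip f f = 0" shows "f = 0"
proof -
  have fin: "finite {x. f x \<noteq> 0}" using assms by (simp add: fsuppD)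
  have "ip f f = of_real (\<Sum>x | f x \<noteq> 0. (cmod (f x))\<^sup>2)"
    unfolding ip_left[OF fin] of_real_sum
    by (rule sum.cong) (auto simp: complex_norm_square[symmetric] mult.commute)
  with assms(2) have "(\<Sum>x | f x \<noteq> 0. (cmod (f x))\<^sup>2) = 0" by (simp only: of_real_eq_0_iff)
  then have "\<forall>x\<in>{x. f x \<noteq> 0}. (cmod (f x))\<^sup>2 = 0"
    by (subst (asm) sum_nonneg_eq_0_iff[OF fin]) auto
  then show ?thesis by (auto simp: fun_eq_iff)
qed

lemma smul_fsupp: "f \<in> fsupp X \<Longrightarrow> smul s f \<in> fsupp X"
  by (rule fsuppI[of "{x. f x \<noteq> 0}"]) (auto simp: smul_def fsupp_outside dest: fsuppD(1))

lemma smul_linear: "linear_between (fsupp X) (fsupp X) (smul s)"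
proof (rule linear_betweenI)
  show "smul s f \<in> fsupp X" if "f \<in> fsupp X" for f using that by (rule smul_fsupp)
qed (auto simp: smul_def fun_eq_iff fn_apply algebra_simps)

text \<open>The coordinate form of a unitary module: an orthonormal basis of eigenvectors of $L(0)$,
  labelled by \<open>X\<close>, with four times the eigenvalue recorded by \<open>d\<close>, in which $L(n)$ and $L(-n)$ are
  adjoint.  (All conformal weights below are multiples of $1/4$.)  The sign function \<open>s\<close> is a
  grading respected by the action.\<close>

definition unitary_vir :: "'x vir \<Rightarrow> 'x set \<Rightarrow> ('x \<Rightarrow> nat) \<Rightarrow> complex \<Rightarrow> 'x fn \<Rightarrow> bool" where
  "unitary_vir N X d c s \<longleftrightarrow>
     carr N = fsupp X \<and> virasoro_module N \<and>
     (\<forall>f\<in>fsupp X. central N f = scal c f \<and> vir_L N 0 f = (\<lambda>x. of_nat (d x) / 4 * f x)) \<and>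
     (\<forall>n. \<forall>f\<in>fsupp X. \<forall>g\<in>fsupp X. ip (vir_L N n f) g = ip f (vir_L N (- n) g)) \<and>
     (\<forall>n. \<forall>f\<in>fsupp X. vir_L N n (smul s f) = smul s (vir_L N n f)) \<and>
     (\<forall>x\<in>X. s x = 1 \<or> s x = - 1)"

lemma unitary_virD:
  assumes "unitary_vir N X d c s"
  shows "carr N = fsupp X" "virasoro_module N" "f \<in> fsupp X \<Longrightarrow> central N f = scal c f"
    "f \<in> fsupp X \<Longrightarrow> vir_L N 0 f = (\<lambda>x. of_nat (d x) / 4 * f x)"
    "f \<in> fsupp X \<Longrightarrow> g \<in> fsupp X \<Longrightarrow> ip (vir_L N n f) g = ip f (vir_L N (- n) g)"
    "f \<in> fsupp X \<Longrightarrow> vir_L N n (smul s f) = smul s (vir_L N n f)"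
    "x \<in> X \<Longrightarrow> s x = 1 \<or> s x = - 1"
  using assms by (auto simp: unitary_vir_def)

lemma unitary_vir_L:
  assumes "unitary_vir N X d c s"
  shows "linear_between (fsupp X) (fsupp X) (vir_L N n)"
  using virasoro_moduleD(2)[OF unitary_virD(2)[OF assms], of n] unitary_virD(1)[OF assms] by simp

text \<open>A product of orthonormal bases is an orthonormal basis, and the adjoint of $L(n)\otimes 1 + 1\otimes L(n)$ is
  formed factor by factor.\<close>

lemma unitary_vir_tensor:
  assumes N: "unitary_vir N X d c s" and N': "unitary_vir N' Y d' c' s'"
  shows "unitary_vir (tensor N N') (X \<times> Y) (\<lambda>(x, y). d x + d' y) (c + c') (\<lambda>(x, y). s x * s' y)"
proof -
  note D = unitary_virD[OF N] and D' = unitary_virD[OF N']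
  note L = unitary_vir_L[OF N] and L' = unitary_vir_L[OF N']
  note S = subspace_fsupp[of X] and S' = subspace_fsupp[of Y]
  have sl: "(\<lambda>x. F (x, y)) \<in> fsupp X" and sr: "(\<lambda>y. F (x, y)) \<in> fsupp Y"
    if "F \<in> fsupp (X \<times> Y)" for F :: "('a \<times> 'b) fn" and x y
    using tens_slice_left[OF S, of F "fsupp Y"] tens_slice_right[OF S', of F "fsupp X"] that
    by (simp_all add: tens_fsupp)
  have adj_left: "ip (map_left (vir_L N n) F) G = ip F (map_left (vir_L N (- n)) G)"
    if F: "F \<in> fsupp (X \<times> Y)" and G: "G \<in> fsupp (X \<times> Y)" for F G n
  proof -
    define P where "P = {p. F p \<noteq> 0} \<union> {p. G p \<noteq> 0}"
    define A B where "A = fst ` P" and "B = snd ` P"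
    have fin: "finite A" "finite B" using F G by (auto simp: A_def B_def P_def dest: fsuppD(1))
    have out: "F (x, y) = 0" "G (x, y) = 0" if "x \<notin> A \<or> y \<notin> B" for x y
      using that by (force simp: A_def B_def P_def)+
    have "ip (map_left (vir_L N n) F) G = (\<Sum>p\<in>A \<times> B. cnj (map_left (vir_L N n) F p) * G p)"
      using fin out by (intro ip_eq) auto
    also have "\<dots> = (\<Sum>y\<in>B. ip (vir_L N n (\<lambda>x. F (x, y))) (\<lambda>x. G (x, y)))"
      unfolding sum.cartesian_product' using fin out
      by (subst sum.swap) (auto intro!: sum.cong ip_eq[symmetric] simp: map_left_def)
    also have "\<dots> = (\<Sum>y\<in>B. ip (\<lambda>x. F (x, y)) (vir_L N (- n) (\<lambda>x. G (x, y))))"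
      using D(5)[OF sl[OF F] sl[OF G]] by simp
    also have "\<dots> = (\<Sum>p\<in>A \<times> B. cnj (F p) * map_left (vir_L N (- n)) G p)"
      unfolding sum.cartesian_product' using fin out
      by (subst sum.swap) (auto intro!: sum.cong ip_eq simp: map_left_def)
    also have "\<dots> = ip F (map_left (vir_L N (- n)) G)"
      using fin out by (intro ip_eq[symmetric]) auto
    finally show ?thesis .
  qed
  have adj_right: "ip (map_right (vir_L N' n) F) G = ip F (map_right (vir_L N' (- n)) G)"
    if F: "F \<in> fsupp (X \<times> Y)" and G: "G \<in> fsupp (X \<times> Y)" for F G n
  proof -
    define P where "P = {p. F p \<noteq> 0} \<union> {p. G p \<noteq> 0}"
    define A B where "A = fst ` P" and "B = snd ` P"
    have fin: "finite A" "finite B" using F G by (auto simp: A_def B_def P_def dest: fsuppD(1))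
    have out: "F (x, y) = 0" "G (x, y) = 0" if "x \<notin> A \<or> y \<notin> B" for x y
      using that by (force simp: A_def B_def P_def)+
    have "ip (map_right (vir_L N' n) F) G = (\<Sum>p\<in>A \<times> B. cnj (map_right (vir_L N' n) F p) * G p)"
      using fin out by (intro ip_eq) auto
    also have "\<dots> = (\<Sum>x\<in>A. ip (vir_L N' n (\<lambda>y. F (x, y))) (\<lambda>y. G (x, y)))"
      unfolding sum.cartesian_product' using fin out
      by (auto intro!: sum.cong ip_eq[symmetric] simp: map_right_def)
    also have "\<dots> = (\<Sum>x\<in>A. ip (\<lambda>y. F (x, y)) (vir_L N' (- n) (\<lambda>y. G (x, y))))"
      using D'(5)[OF sr[OF F] sr[OF G]] by simp
    also have "\<dots> = (\<Sum>p\<in>A \<times> B. cnj (F p) * map_right (vir_L N' (- n)) G p)"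
      unfolding sum.cartesian_product' using fin out
      by (auto intro!: sum.cong ip_eq simp: map_right_def)
    also have "\<dots> = ip F (map_right (vir_L N' (- n)) G)"
      using fin out by (intro ip_eq[symmetric]) auto
    finally show ?thesis .
  qed
  have mem: "map_left (vir_L N n) F \<in> fsupp (X \<times> Y)" "map_right (vir_L N' n) F \<in> fsupp (X \<times> Y)"
    if "F \<in> fsupp (X \<times> Y)" for F n
    using linear_betweenD(1)[OF map_left_linear[OF L S, where W = "fsupp Y"], of F n]
      linear_betweenD(1)[OF map_right_linear[OF L' S', where V = "fsupp X"], of F n] that
    by (simp_all add: tens_fsupp)
  have smul_eq: "smul (\<lambda>(x, y). s x * s' y) F = map_left (smul s) (map_right (smul s') F)" for F
    by (auto simp: smul_def map_left_def map_right_def fun_eq_iff)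
  have gr: "vir_L (tensor N N') n (smul (\<lambda>(x, y). s x * s' y) F) = smul (\<lambda>(x, y). s x * s' y) (vir_L (tensor N N') n F)"
    if F: "F \<in> fsupp (X \<times> Y)" for n F
  proof -
    let ?G = "map_right (smul s') F"
    have G: "?G \<in> tens (fsupp X) (fsupp Y)"
      using linear_betweenD(1)[OF map_right_linear[OF smul_linear S', where V = "fsupp X"], of F] F
      by (simp add: tens_fsupp)
    have F': "F \<in> tens (fsupp X) (fsupp Y)" using F by (simp add: tens_fsupp)
    have 1: "map_left (vir_L N n) (map_left (smul s) ?G) = map_left (smul s) (map_left (vir_L N n) ?G)"
      using D(6)[OF tens_slice_left[OF S G]] by (auto simp: map_left_def fun_eq_iff)
    have 2: "map_right (vir_L N' n) (map_left (smul s) ?G) = map_left (smul s) (map_right (vir_L N' n) ?G)"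
      by (rule map_left_right_commute[OF smul_linear S L' S' G, symmetric])
    have 3: "map_right (vir_L N' n) ?G = map_right (smul s') (map_right (vir_L N' n) F)"
      using D'(6)[OF tens_slice_right[OF S' F']] by (auto simp: map_right_def fun_eq_iff)
    have 4: "map_left (vir_L N n) ?G = map_right (smul s') (map_left (vir_L N n) F)"
      by (rule map_left_right_commute[OF L S smul_linear S' F'])
    show ?thesis
      unfolding smul_eq tensor_simps 1 2 3 4 by (auto simp: map_left_def map_right_def smul_def fun_eq_iff fn_apply algebra_simps)
  qed
  show ?thesis
    unfolding unitary_vir_def
  proof (intro conjI ballI allI)
    show "carr (tensor N N') = fsupp (X \<times> Y)" by (simp add: tensor_simps D(1) D'(1) tens_fsupp)
    show "virasoro_module (tensor N N')" by (rule virasoro_module_tensor[OF D(2) D'(2)])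
  next
    fix F assume F: "F \<in> fsupp (X \<times> Y)"
    show "central (tensor N N') F = scal (c + c') F"
      using D(3)[OF sl[OF F]] D'(3)[OF sr[OF F]]
      by (auto simp: tensor_simps map_left_def map_right_def fun_eq_iff fn_apply algebra_simps)
    show "vir_L (tensor N N') 0 F = (\<lambda>p. of_nat (case p of (x, y) \<Rightarrow> d x + d' y) / 4 * F p)"
      using D(4)[OF sl[OF F]] D'(4)[OF sr[OF F]]
      by (auto simp: tensor_simps map_left_def map_right_def fun_eq_iff fn_apply algebra_simps add_divide_distrib)
    fix n show "vir_L (tensor N N') n (smul (\<lambda>(x, y). s x * s' y) F) = smul (\<lambda>(x, y). s x * s' y) (vir_L (tensor N N') n F)"
      by (rule gr[OF F])
    fix G assume G: "G \<in> fsupp (X \<times> Y)"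
    show "ip (vir_L (tensor N N') n F) G = ip F (vir_L (tensor N N') (- n) G)"
      using mem[OF F] mem[OF G] F G
      by (simp add: tensor_simps ip_add_left ip_add_right adj_left adj_right)
  next
    fix p assume "p \<in> X \<times> Y"
    then show "(case p of (x, y) \<Rightarrow> s x * s' y) = 1 \<or> (case p of (x, y) \<Rightarrow> s x * s' y) = - 1"
      using D(7) D'(7) by (fastforce split: prod.splits)
  qed
qed

lemma dsum_simps:
  "carr (dsum I M) = {f. (\<forall>i\<in>I. (\<lambda>x. f (i, x)) \<in> carr (M i)) \<and> (\<forall>i. i \<notin> I \<longrightarrow> (\<forall>x. f (i, x) = 0))}"
  "vir_L (dsum I M) n f (i, x) = (if i \<in> I then vir_L (M i) n (\<lambda>y. f (i, y)) x else 0)"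
  "central (dsum I M) f (i, x) = (if i \<in> I then central (M i) (\<lambda>y. f (i, y)) x else 0)"
  by (simp_all add: dsum_def)

lemma dsum2_simps:
  "carr (dsum2 M N) = {f. f \<circ> Inl \<in> carr M \<and> f \<circ> Inr \<in> carr N}"
  "vir_L (dsum2 M N) n f (Inl x) = vir_L M n (f \<circ> Inl) x"
  "vir_L (dsum2 M N) n f (Inr y) = vir_L N n (f \<circ> Inr) y"
  "central (dsum2 M N) f (Inl x) = central M (f \<circ> Inl) x"
  "central (dsum2 M N) f (Inr y) = central N (f \<circ> Inr) y"
  by (simp_all add: dsum2_def)

lemma slice_fn:
  "(\<lambda>x. (f + g) (i, x)) = (\<lambda>x. f (i, x)) + (\<lambda>x. g (i, x))"
  "(\<lambda>x. (f - g) (i, x)) = (\<lambda>x. f (i, x)) - (\<lambda>x. g (i, x))"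
  "(\<lambda>x. scal a f (i, x)) = scal a (\<lambda>x. f (i, x))"
  "(\<lambda>x. (0 :: ('i \<times> 'x) fn) (i, x)) = 0"
  by (auto simp: fn_apply fun_eq_iff)

lemma comp_fn:
  "(f + g) \<circ> h = (f \<circ> h) + (g \<circ> h)" "scal a f \<circ> h = scal a (f \<circ> h)" "(0 :: 'x fn) \<circ> h = 0"
  by (auto simp: fn_apply fun_eq_iff)

lemma slice_eqI: "(\<And>i. (\<lambda>x. f (i, x)) = (\<lambda>x. g (i, x))) \<Longrightarrow> f = g"
  by (auto simp: fun_eq_iff)

lemma sum_eqI: "f \<circ> Inl = g \<circ> Inl \<Longrightarrow> f \<circ> Inr = g \<circ> Inr \<Longrightarrow> f = g"
  unfolding fun_eq_iff by (metis comp_apply obj_sumE)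

lemma dsum_slice:
  "(\<lambda>x. vir_L (dsum I M) n f (i, x)) = (if i \<in> I then vir_L (M i) n (\<lambda>y. f (i, y)) else 0)"
  "(\<lambda>x. central (dsum I M) f (i, x)) = (if i \<in> I then central (M i) (\<lambda>y. f (i, y)) else 0)"
  by (auto simp: dsum_simps fun_eq_iff)

lemma dsum2_comp:
  "vir_L (dsum2 M N) n f \<circ> Inl = vir_L M n (f \<circ> Inl)" "vir_L (dsum2 M N) n f \<circ> Inr = vir_L N n (f \<circ> Inr)"
  "central (dsum2 M N) f \<circ> Inl = central M (f \<circ> Inl)" "central (dsum2 M N) f \<circ> Inr = central N (f \<circ> Inr)"
  by (auto simp: dsum2_simps fun_eq_iff)

lemma slice_if: "(\<lambda>x. (if b then f else g) (i, x)) = (if b then (\<lambda>x. f (i, x)) else (\<lambda>x. g (i, x)))"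
  and comp_if: "(if b then f' else g') \<circ> h = (if b then f' \<circ> h else g' \<circ> h)"
  by auto

lemma virasoro_module_dsum:
  assumes "\<And>i. i \<in> I \<Longrightarrow> virasoro_module (M i)"
  shows "virasoro_module (dsum I M)"
proof -
  note V = virasoro_moduleD[OF assms]
  have mem: "vir_L (M i) n f \<in> carr (M i)" "central (M i) f \<in> carr (M i)" if "i \<in> I" "f \<in> carr (M i)" for i n f
    using that V(2,3) linear_betweenD(1) by blast+
  have sub: "fn.subspace (carr (dsum I M))"
    by (rule fn.subspaceI; unfold dsum_simps(1) mem_Collect_eq slice_fn)
      (simp_all add: fn.subspace_0[OF V(1)] fn.subspace_add[OF V(1)] fn.subspace_scale[OF V(1)] fn_apply)
  have cI: "(\<lambda>x. f (i, x)) \<in> carr (M i)" if "f \<in> carr (dsum I M)" "i \<in> I" for f i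
    using that by (simp add: dsum_simps)
  have cO: "(\<lambda>x. f (i, x)) = 0" if "f \<in> carr (dsum I M)" "i \<notin> I" for f i
    using that by (simp add: dsum_simps zero_fun_def)
  have lin: "linear_between (carr (dsum I M)) (carr (dsum I M)) (vir_L (dsum I M) n)" for n
  proof (rule linear_betweenI)
    fix f assume f: "f \<in> carr (dsum I M)"
    then show "vir_L (dsum I M) n f \<in> carr (dsum I M)"
      by (auto simp: dsum_simps(1) dsum_slice mem) (simp add: dsum_simps)
    fix a show "vir_L (dsum I M) n (scal a f) = scal a (vir_L (dsum I M) n f)"
      by (rule slice_eqI) (use cI[OF f] in \<open>auto simp: dsum_slice slice_fn linear_betweenD(3)[OF V(2)]\<close>)
    fix g assume g: "g \<in> carr (dsum I M)"
    show "vir_L (dsum I M) n (f + g) = vir_L (dsum I M) n f + vir_L (dsum I M) n g"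
      by (rule slice_eqI) (use cI[OF f] cI[OF g] in \<open>auto simp: dsum_slice slice_fn linear_betweenD(2)[OF V(2)]\<close>)
  qed
  have linc: "linear_between (carr (dsum I M)) (carr (dsum I M)) (central (dsum I M))"
  proof (rule linear_betweenI)
    fix f assume f: "f \<in> carr (dsum I M)"
    then show "central (dsum I M) f \<in> carr (dsum I M)"
      by (auto simp: dsum_simps(1) dsum_slice mem) (simp add: dsum_simps)
    fix a show "central (dsum I M) (scal a f) = scal a (central (dsum I M) f)"
      by (rule slice_eqI) (use cI[OF f] in \<open>auto simp: dsum_slice slice_fn linear_betweenD(3)[OF V(3)]\<close>)
    fix g assume g: "g \<in> carr (dsum I M)"
    show "central (dsum I M) (f + g) = central (dsum I M) f + central (dsum I M) g"
      by (rule slice_eqI) (use cI[OF f] cI[OF g] in \<open>auto simp: dsum_slice slice_fn linear_betweenD(2)[OF V(3)]\<close>)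
  qed
  show ?thesis
    unfolding virasoro_module_def
  proof (intro conjI allI ballI sub lin linc)
    fix n f assume f: "f \<in> carr (dsum I M)"
    show "vir_L (dsum I M) n (central (dsum I M) f) = central (dsum I M) (vir_L (dsum I M) n f)"
      by (rule slice_eqI) (use cI[OF f] in \<open>auto simp: dsum_slice V(4)\<close>)
  next
    fix m n f assume f: "f \<in> carr (dsum I M)"
    show "vir_L (dsum I M) m (vir_L (dsum I M) n f) - vir_L (dsum I M) n (vir_L (dsum I M) m f) =
          scal (of_int (m - n)) (vir_L (dsum I M) (m + n) f)
          + (if m + n = 0 then scal (of_int (m ^ 3 - m) / 12) (central (dsum I M) f) else 0)"
    proof (rule slice_eqI)
      fix i show "(\<lambda>x. (vir_L (dsum I M) m (vir_L (dsum I M) n f) - vir_L (dsum I M) n (vir_L (dsum I M) m f)) (i, x)) =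
          (\<lambda>x. (scal (of_int (m - n)) (vir_L (dsum I M) (m + n) f)
          + (if m + n = 0 then scal (of_int (m ^ 3 - m) / 12) (central (dsum I M) f) else 0)) (i, x))"
        unfolding slice_fn slice_if dsum_slice
        using V(5)[OF _ cI[OF f], of i m n] by (cases "i \<in> I") simp_all
    qed
  qed
qed

lemma virasoro_module_dsum2:
  assumes M: "virasoro_module M" and N: "virasoro_module N"
  shows "virasoro_module (dsum2 M N)"
proof -
  note V = virasoro_moduleD[OF M] and W = virasoro_moduleD[OF N]
  note lV = linear_betweenD[OF V(2)] linear_betweenD[OF V(3)] and lW = linear_betweenD[OF W(2)] linear_betweenD[OF W(3)]
  have sub: "fn.subspace (carr (dsum2 M N))"
    by (rule fn.subspaceI)
      (simp_all add: dsum2_simps comp_fn fn.subspace_0[OF V(1)] fn.subspace_add[OF V(1)] fn.subspace_scale[OF V(1)]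
        fn.subspace_0[OF W(1)] fn.subspace_add[OF W(1)] fn.subspace_scale[OF W(1)])
  have c: "f \<circ> Inl \<in> carr M" "f \<circ> Inr \<in> carr N" if "f \<in> carr (dsum2 M N)" for f
    using that by (simp_all add: dsum2_simps)
  have lin: "linear_between (carr (dsum2 M N)) (carr (dsum2 M N)) (vir_L (dsum2 M N) n)" for n
    by (rule linear_betweenI; (rule sum_eqI)?) (simp_all add: dsum2_simps(1) dsum2_comp comp_fn lV lW)
  have linc: "linear_between (carr (dsum2 M N)) (carr (dsum2 M N)) (central (dsum2 M N))"
    by (rule linear_betweenI; (rule sum_eqI)?) (simp_all add: dsum2_simps(1) dsum2_comp comp_fn lV lW)
  have comp_diff: "(f - g) \<circ> h = (f \<circ> h) - (g \<circ> h)" for f g :: "('a + 'b) fn" and h :: "'c \<Rightarrow> 'a + 'b"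
    by (auto simp: fn_apply fun_eq_iff)
  show ?thesis
    unfolding virasoro_module_def
  proof (intro conjI allI ballI sub lin linc)
    fix n f assume f: "f \<in> carr (dsum2 M N)"
    show "vir_L (dsum2 M N) n (central (dsum2 M N) f) = central (dsum2 M N) (vir_L (dsum2 M N) n f)"
      by (rule sum_eqI) (use c[OF f] in \<open>simp_all add: dsum2_comp V(4) W(4)\<close>)
  next
    fix m n f assume f: "f \<in> carr (dsum2 M N)"
    show "vir_L (dsum2 M N) m (vir_L (dsum2 M N) n f) - vir_L (dsum2 M N) n (vir_L (dsum2 M N) m f) =
          scal (of_int (m - n)) (vir_L (dsum2 M N) (m + n) f)
          + (if m + n = 0 then scal (of_int (m ^ 3 - m) / 12) (central (dsum2 M N) f) else 0)"
      by (rule sum_eqI; unfold comp_diff comp_fn comp_if dsum2_comp) (rule V(5)[OF c(1)[OF f]] W(5)[OF c(2)[OF f]])+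
  qed
qed

lemma fsupp_Sigma:
  assumes "finite I"
  shows "f \<in> fsupp (Sigma I X) \<longleftrightarrow> (\<forall>i\<in>I. (\<lambda>x. f (i, x)) \<in> fsupp (X i)) \<and> (\<forall>i. i \<notin> I \<longrightarrow> (\<forall>x. f (i, x) = 0))"
    (is "?l \<longleftrightarrow> ?r")
proof
  assume l: ?l
  have "(\<lambda>x. f (i, x)) \<in> fsupp (X i)" for i
  proof (rule fsuppI)
    show "finite (snd ` {p. f p \<noteq> 0})" using l by (auto dest: fsuppD(1))
    show "f (i, x) = 0" if "x \<notin> snd ` {p. f p \<noteq> 0}" for x using that by (force simp: image_iff)
    show "f (i, x) = 0" if "x \<notin> X i" for x using l that by (auto intro: fsupp_outside)
  qed
  moreover have "f (i, x) = 0" if "i \<notin> I" for i x using l that by (auto intro: fsupp_outside)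
  ultimately show ?r by auto
next
  assume r: ?r
  show ?l
  proof (rule fsuppI)
    show "finite (SIGMA i:I. {x. f (i, x) \<noteq> 0})" using assms r by (auto dest: fsuppD(1))
    show "f p = 0" if "p \<notin> (SIGMA i:I. {x. f (i, x) \<noteq> 0})" for p using that r by (cases p) auto
    show "f p = 0" if "p \<notin> Sigma I X" for p using that r by (cases p) (auto dest: fsupp_outside)
  qed
qed

lemma ip_Sigma:
  assumes "finite I" "f \<in> fsupp (Sigma I X)"
  shows "ip f g = (\<Sum>i\<in>I. ip (\<lambda>x. f (i, x)) (\<lambda>x. g (i, x)))"
proof -
  have f: "\<And>i. i \<in> I \<Longrightarrow> finite {x. f (i, x) \<noteq> 0}" "\<And>i x. i \<notin> I \<Longrightarrow> f (i, x) = 0"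
    using assms(2) by (auto simp: fsupp_Sigma[OF assms(1)] dest: fsuppD(1))
  have "ip f g = (\<Sum>p\<in>(SIGMA i:I. {x. f (i, x) \<noteq> 0}). cnj (f p) * g p)"
    by (rule ip_eq) (use f assms(1) in auto)
  also have "\<dots> = (\<Sum>i\<in>I. \<Sum>x | f (i, x) \<noteq> 0. cnj (f (i, x)) * g (i, x))"
    by (subst sum.Sigma) (use f assms(1) in \<open>auto intro!: sum.cong\<close>)
  also have "\<dots> = (\<Sum>i\<in>I. ip (\<lambda>x. f (i, x)) (\<lambda>x. g (i, x)))"
    by (rule sum.cong) (use f in \<open>auto simp: ip_left\<close>)
  finally show ?thesis .
qed

lemma unitary_vir_dsum:
  assumes I: "finite I" and N: "\<And>i. i \<in> I \<Longrightarrow> unitary_vir (N i) (X i) (d i) c (s i)"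
  shows "unitary_vir (dsum I N) (Sigma I X) (\<lambda>(i, x). d i x) c (\<lambda>(i, x). s i x)"
proof -
  note D = unitary_virD[OF N]
  have V: "virasoro_module (dsum I N)" by (rule virasoro_module_dsum[OF D(2)])
  have car: "carr (dsum I N) = fsupp (Sigma I X)"
    by (auto simp: fsupp_Sigma[OF I] dsum_simps D(1))
  have cI: "(\<lambda>x. f (i, x)) \<in> fsupp (X i)" if "f \<in> fsupp (Sigma I X)" "i \<in> I" for f i
    using that by (simp add: fsupp_Sigma[OF I])
  have cO: "f (i, x) = 0" if "f \<in> fsupp (Sigma I X)" "i \<notin> I" for f i x
    using that by (simp add: fsupp_Sigma[OF I])
  have mem: "vir_L (dsum I N) n f \<in> fsupp (Sigma I X)" if "f \<in> fsupp (Sigma I X)" for f n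
    using linear_betweenD(1)[OF virasoro_moduleD(2)[OF V]] that by (simp add: car)
  show ?thesis
    unfolding unitary_vir_def
  proof (intro conjI ballI allI car V)
    fix f assume f: "f \<in> fsupp (Sigma I X)"
    show "central (dsum I N) f = scal c f"
    proof
      fix p show "central (dsum I N) f p = scal c f p"
        by (cases p) (auto simp: dsum_simps D(3) cI[OF f] cO[OF f] fn_apply)
    qed
    show "vir_L (dsum I N) 0 f = (\<lambda>p. of_nat (case p of (i, x) \<Rightarrow> d i x) / 4 * f p)"
    proof
      fix p show "vir_L (dsum I N) 0 f p = of_nat (case p of (i, x) \<Rightarrow> d i x) / 4 * f p"
        by (cases p) (auto simp: dsum_simps D(4) cI[OF f] cO[OF f] fn_apply)
    qed
    fix n
    show "vir_L (dsum I N) n (smul (\<lambda>(i, x). s i x) f) = smul (\<lambda>(i, x). s i x) (vir_L (dsum I N) n f)"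
    proof (rule slice_eqI)
      fix i
      have e: "(\<lambda>y. smul (\<lambda>(i, x). s i x) f (i, y)) = smul (s i) (\<lambda>y. f (i, y))" for i and f :: "('a \<times> 'b) fn"
        by (auto simp: smul_def)
      show "(\<lambda>x. vir_L (dsum I N) n (smul (\<lambda>(i, x). s i x) f) (i, x)) =
          (\<lambda>x. smul (\<lambda>(i, x). s i x) (vir_L (dsum I N) n f) (i, x))"
        unfolding dsum_slice e using D(6)[OF _ cI[OF f]] by (auto simp: smul_def)
    qed
    fix g assume g: "g \<in> fsupp (Sigma I X)"
    show "ip (vir_L (dsum I N) n f) g = ip f (vir_L (dsum I N) (- n) g)"
      unfolding ip_Sigma[OF I mem[OF f]] ip_Sigma[OF I f] dsum_slice
      by (rule sum.cong) (use D(5)[OF _ cI[OF f] cI[OF g]] in auto)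
  next
    fix p assume "p \<in> Sigma I X"
    then show "(case p of (i, x) \<Rightarrow> s i x) = 1 \<or> (case p of (i, x) \<Rightarrow> s i x) = - 1"
      using D(7) by fastforce
  qed
qed

lemma fsupp_Plus: "f \<in> fsupp (X <+> Y) \<longleftrightarrow> f \<circ> Inl \<in> fsupp X \<and> f \<circ> Inr \<in> fsupp Y" (is "?l \<longleftrightarrow> ?r")
proof
  assume l: ?l
  have fin: "finite (Inl -` {p. f p \<noteq> 0})" "finite (Inr -` {p. f p \<noteq> 0})"
    by (intro finite_vimageI fsuppD(1)[OF l] inj_Inl inj_Inr)+
  show ?r
  proof (intro conjI)
    show "f \<circ> Inl \<in> fsupp X"
      by (rule fsuppI[OF fin(1)]) (auto intro: fsupp_outside[OF l])
    show "f \<circ> Inr \<in> fsupp Y"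
      by (rule fsuppI[OF fin(2)]) (auto intro: fsupp_outside[OF l])
  qed
next
  assume r: ?r
  show ?l
  proof (rule fsuppI)
    show "finite ({x. (f \<circ> Inl) x \<noteq> 0} <+> {y. (f \<circ> Inr) y \<noteq> 0})"
      using fsuppD(1)[of "f \<circ> Inl" X] fsuppD(1)[of "f \<circ> Inr" Y] r by (simp only: finite_Plus)
    show "f p = 0" if "p \<notin> {x. (f \<circ> Inl) x \<noteq> 0} <+> {y. (f \<circ> Inr) y \<noteq> 0}" for p
      using that by (cases p) auto
    show "f p = 0" if "p \<notin> X <+> Y" for p
      using that r fsupp_outside[of "f \<circ> Inl" X] fsupp_outside[of "f \<circ> Inr" Y] by (cases p) auto
  qed
qed

lemma ip_Plus:
  assumes "f \<in> fsupp (X <+> Y)"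
  shows "ip f g = ip (f \<circ> Inl) (g \<circ> Inl) + ip (f \<circ> Inr) (g \<circ> Inr)"
proof -
  have fin: "finite {x. (f \<circ> Inl) x \<noteq> 0}" "finite {y. (f \<circ> Inr) y \<noteq> 0}"
    using assms fsuppD(1)[of "f \<circ> Inl" X] fsuppD(1)[of "f \<circ> Inr" Y] by (simp_all only: fsupp_Plus)
  have "ip f g = (\<Sum>p\<in>{x. (f \<circ> Inl) x \<noteq> 0} <+> {y. (f \<circ> Inr) y \<noteq> 0}. cnj (f p) * g p)"
  proof (rule ip_eq)
    show "f p = 0 \<or> g p = 0" if "p \<notin> {x. (f \<circ> Inl) x \<noteq> 0} <+> {y. (f \<circ> Inr) y \<noteq> 0}" for p
      using that by (cases p) auto
  qed (use fin in auto)
  then show ?thesis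
    by (simp only: sum.Plus[OF fin] ip_left[OF fin(1)] ip_left[OF fin(2)]) (simp only: comp_def)
qed

lemma unitary_vir_dsum2:
  assumes N: "unitary_vir N X d c s" and N': "unitary_vir N' Y d' c s'"
  shows "unitary_vir (dsum2 N N') (X <+> Y) (case_sum d d') c (case_sum s s')"
proof -
  note D = unitary_virD[OF N] and D' = unitary_virD[OF N']
  have V: "virasoro_module (dsum2 N N')" by (rule virasoro_module_dsum2[OF D(2) D'(2)])
  have car: "carr (dsum2 N N') = fsupp (X <+> Y)"
    by (auto simp: fsupp_Plus dsum2_simps D(1) D'(1))
  have c: "f \<circ> Inl \<in> fsupp X" "f \<circ> Inr \<in> fsupp Y" if "f \<in> fsupp (X <+> Y)" for f
    using that by (simp_all add: fsupp_Plus)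
  have mem: "vir_L (dsum2 N N') n f \<in> fsupp (X <+> Y)" if "f \<in> fsupp (X <+> Y)" for f n
    using linear_betweenD(1)[OF virasoro_moduleD(2)[OF V]] that by (simp add: car)
  have sm: "smul (case_sum s s') f \<circ> Inl = smul s (f \<circ> Inl)" "smul (case_sum s s') f \<circ> Inr = smul s' (f \<circ> Inr)" for f
    by (auto simp: smul_def)
  show ?thesis
    unfolding unitary_vir_def
  proof (intro conjI ballI allI car V)
    fix f assume f: "f \<in> fsupp (X <+> Y)"
    show "central (dsum2 N N') f = scal c f"
      by (rule sum_eqI) (simp_all add: dsum2_comp D(3) D'(3) c[OF f] comp_fn)
    show "vir_L (dsum2 N N') 0 f = (\<lambda>p. of_nat (case_sum d d' p) / 4 * f p)"
      by (rule sum_eqI) (auto simp: dsum2_comp D(4) D'(4) c[OF f])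
    fix n
    show "vir_L (dsum2 N N') n (smul (case_sum s s') f) = smul (case_sum s s') (vir_L (dsum2 N N') n f)"
      by (rule sum_eqI) (simp_all add: dsum2_comp sm D(6) D'(6) c[OF f])
    fix g assume g: "g \<in> fsupp (X <+> Y)"
    show "ip (vir_L (dsum2 N N') n f) g = ip f (vir_L (dsum2 N N') (- n) g)"
      by (simp add: ip_Plus[OF mem[OF f]] ip_Plus[OF f] dsum2_comp D(5) D'(5) c[OF f] c[OF g])
  next
    fix p assume "p \<in> X <+> Y"
    then show "case_sum s s' p = 1 \<or> case_sum s s' p = - 1"
      by (auto dest: D(7) D'(7))
  qed
qed

section \<open>A unitary Virasoro module is determined by its character\<close>

declare zero_fun_apply [simp del]

definition hproj :: "('x \<Rightarrow> nat) \<Rightarrow> nat \<Rightarrow> 'x fn \<Rightarrow> 'x fn" where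
  "hproj d h f = (\<lambda>x. if d x = h then f x else 0)"

lemma ip_zero: "ip 0 f = 0" "ip f 0 = 0"
  by (simp_all add: ip_def zero_fun_apply)

text \<open>Gram-Schmidt: over a finite set of vectors the orthogonal projection exists, without completeness.\<close>

lemma ip_orthogonal_component:
  assumes "finite B" "B \<subseteq> fsupp X" "u \<in> fsupp X"
  shows "\<exists>a\<in>fn.span B. \<forall>b\<in>B. ip b (u - a) = 0"
  using assms
proof (induction B arbitrary: u rule: finite_induct)
  case empty
  then show ?case by (auto intro: fn.span_zero)
next
  case (insert b B)
  have bX: "b \<in> fsupp X" and BX: "B \<subseteq> fsupp X" using insert.prems by auto
  have sp: "fn.span B \<subseteq> fsupp X" by (rule fn.span_minimal[OF BX subspace_fsupp])
  have mono: "fn.span B \<subseteq> fn.span (insert b B)" by (rule fn.span_mono) auto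
  obtain p where p: "p \<in> fn.span B" "\<forall>b'\<in>B. ip b' (b - p) = 0" using insert.IH[OF BX bX] by blast
  obtain a where a: "a \<in> fn.span B" "\<forall>b'\<in>B. ip b' (u - a) = 0" using insert.IH[OF BX insert.prems(2)] by blast
  define q where "q = b - p"
  have q: "q \<in> fn.span (insert b B)"
    unfolding q_def using p(1) mono by (intro fn.span_diff) (auto intro: fn.span_base)
  have qX: "q \<in> fsupp X" unfolding q_def using bX p(1) sp by (intro fn.subspace_diff[OF subspace_fsupp]) auto
  have pX: "p \<in> fsupp X" using p(1) sp by auto
  have orth_span: "ip z r = 0" if z: "z \<in> fn.span B" and r: "r \<in> fsupp X" "\<forall>b'\<in>B. ip b' r = 0" for z r
  proof -
    have "fn.subspace {z \<in> fsupp X. ip z r = 0}"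
    proof (rule fn.subspaceI)
      show "0 \<in> {z \<in> fsupp X. ip z r = 0}" by (simp add: fn.subspace_0[OF subspace_fsupp] ip_zero)
    qed (auto simp: ip_add_left[OF r(1)] ip_scal_left[OF r(1)] fn.subspace_add[OF subspace_fsupp] fn.subspace_scale[OF subspace_fsupp])
    then have "fn.span B \<subseteq> {z \<in> fsupp X. ip z r = 0}" using BX r(2) by (intro fn.span_minimal) auto
    with z show ?thesis by auto
  qed
  define t where "t = (if q = 0 then 0 else ip q (u - a) / ip q q)"
  have aX: "a \<in> fsupp X" using a(1) sp by auto
  have uaX: "u - a \<in> fsupp X" using insert.prems(2) aX by (rule fn.subspace_diff[OF subspace_fsupp])
  have rX: "u - (a + scal t q) \<in> fsupp X"
    using insert.prems(2) aX qX by (intro fn.subspace_diff fn.subspace_add fn.subspace_scale subspace_fsupp)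
  have eq: "u - (a + scal t q) = (u - a) - scal t q" by (simp add: algebra_simps)
  have B0: "\<forall>b'\<in>B. ip b' (u - (a + scal t q)) = 0"
  proof
    fix b' assume b': "b' \<in> B"
    then have b'X: "b' \<in> fsupp X" using BX by auto
    have "ip b' ((u - a) - scal t q) = ip b' (u - a) - t * ip b' q"
      by (simp only: ip_diff_right[OF b'X] ip_scal_right[OF b'X])
    also have "\<dots> = 0" using a(2) p(2) b' by (simp add: q_def)
    finally show "ip b' (u - (a + scal t q)) = 0" by (simp only: eq)
  qed
  have q0: "ip q (u - (a + scal t q)) = 0"
  proof (cases "q = 0")
    case True then show ?thesis by (simp add: ip_zero)
  next
    case False
    then have "t * ip q q = ip q (u - a)" using ip_self_eq_0[OF qX] by (auto simp: t_def)
    moreover have "ip q ((u - a) - scal t q) = ip q (u - a) - t * ip q q"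
      by (simp only: ip_diff_right[OF qX] ip_scal_right[OF qX])
    ultimately show ?thesis by (simp only: eq) simp
  qed
  have "ip b (u - (a + scal t q)) = ip (q + p) (u - (a + scal t q))" by (simp add: q_def)
  also have "\<dots> = 0" using q0 orth_span[OF p(1) rX B0] by (simp add: ip_add_left[OF rX])
  finally have "\<forall>b'\<in>insert b B. ip b' (u - (a + scal t q)) = 0" using B0 by auto
  moreover have "a + scal t q \<in> fn.span (insert b B)"
    using a(1) mono q by (intro fn.span_add fn.span_scale) auto
  ultimately show ?case by blast
qed

lemma ip_span_zero:
  assumes "z \<in> fn.span B" "B \<subseteq> fsupp X" "r \<in> fsupp X" "\<forall>b\<in>B. ip b r = 0" shows "ip z r = 0"
proof -
  have "fn.subspace {z. ip z r = 0}"
    by (rule fn.subspaceI) (auto simp: ip_add_left[OF assms(3)] ip_scal_left[OF assms(3)] ip_zero)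
  then have "fn.span B \<subseteq> {z. ip z r = 0}" using assms(4) by (intro fn.span_minimal) auto
  with assms(1) show ?thesis by auto
qed

lemma fsupp_finite_bound:
  assumes "finite X" "fn.independent B" "B \<subseteq> fsupp X"
  shows "finite B \<and> card B \<le> card X"
proof -
  have "finite B \<and> card B \<le> card (unit_fn ` X :: 'a fn set)"
    by (rule fn.independent_span_bound) (use assms fsupp_eq_span[of X] in auto)
  moreover have "card (unit_fn ` X :: 'a fn set) \<le> card X" by (rule card_image_le[OF assms(1)])
  ultimately show ?thesis by auto
qed

lemma orthogonal_unit_vector:
  assumes X: "finite X" and A: "fn.subspace A" "A \<subseteq> fsupp X" and u: "u \<in> fsupp X" "u \<notin> A"
  shows "\<exists>v\<in>fsupp X. ip v v = 1 \<and> (\<forall>a\<in>A. ip a v = 0)"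
proof -
  obtain B where B: "B \<subseteq> A" "fn.independent B" "A \<subseteq> fn.span B" by (rule fn.maximal_independent_subset)
  have "finite B" using fsupp_finite_bound[OF X B(2)] B(1) A(2) by auto
  then obtain a where a: "a \<in> fn.span B" "\<forall>b\<in>B. ip b (u - a) = 0"
    using ip_orthogonal_component[of B X u] B(1) A(2) u(1) by blast
  have aA: "a \<in> A" using a(1) fn.span_minimal[OF B(1) A(1)] by auto
  define r where "r = u - a"
  have rX: "r \<in> fsupp X" unfolding r_def using u(1) aA A(2) by (intro fn.subspace_diff subspace_fsupp) auto
  have r0: "r \<noteq> 0" using u(2) aA by (auto simp: r_def)
  define k where "k = (\<Sum>x | r x \<noteq> 0. (cmod (r x))\<^sup>2)"
  have kip: "ip r r = of_real k"
    unfolding ip_left[OF fsuppD(1)[OF rX]] k_def of_real_sum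
    by (rule sum.cong) (auto simp: complex_norm_square[symmetric] mult.commute)
  have "k \<noteq> 0" using ip_self_eq_0[OF rX] r0 kip by auto
  moreover have "k \<ge> 0" unfolding k_def by (rule sum_nonneg) auto
  ultimately have k: "k > 0" by simp
  define v where "v = scal (of_real (1 / sqrt k)) r"
  have vX: "v \<in> fsupp X" unfolding v_def using rX by (intro fn.subspace_scale subspace_fsupp)
  have "ip v v = of_real (1 / sqrt k) * (of_real (1 / sqrt k) * of_real k)"
    unfolding v_def ip_scal_left[OF vX[unfolded v_def]] ip_scal_right[OF rX] kip
    by (simp only: complex_cnj_complex_of_real)
  also have "\<dots> = of_real (1 / sqrt k * (1 / sqrt k * k))" by (simp only: of_real_mult)
  also have "1 / sqrt k * (1 / sqrt k * k) = 1" using k by (simp add: field_simps)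
  finally have "ip v v = 1" by simp
  moreover have "ip z v = 0" if "z \<in> A" for z
  proof -
    have zX: "z \<in> fsupp X" using that A(2) by auto
    have "ip z r = 0"
      by (rule ip_span_zero[of z B X]) (use that B A(2) rX a(2) in \<open>auto simp: r_def\<close>)
    then show ?thesis unfolding v_def by (simp add: ip_scal_right[OF zX])
  qed
  ultimately show ?thesis using vX by blast
qed

text \<open>Isometric partial isomorphisms between two modules, given by their graphs.\<close>

locale unitary_pair =
  fixes N :: "'x vir" and N' :: "'y vir" and X Y d d' c s s'
  assumes N: "unitary_vir N X d c s" and N': "unitary_vir N' Y d' c s'"
    and finX: "\<And>h. finite {x \<in> X. d x = h}" and finY: "\<And>h. finite {y \<in> Y. d' y = h}"
    and cards: "\<And>h. card {x \<in> X. d x = h} = card {y \<in> Y. d' y = h}"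
begin

lemma pair_sym: "unitary_pair N' N Y X d' d c s' s"
  by unfold_locales (use N N' finX finY cards in auto)

abbreviation L where "L \<equiv> vir_L N"
abbreviation L' where "L' \<equiv> vir_L N'"
abbreviation "XX \<equiv> fsupp X"
abbreviation "YY \<equiv> fsupp Y"

lemmas D = unitary_virD[OF N]
lemmas D' = unitary_virD[OF N']
lemmas Llin = linear_betweenD[OF unitary_vir_L[OF N]]
lemmas L'lin = linear_betweenD[OF unitary_vir_L[OF N']]
lemmas SX = subspace_fsupp[of X]
lemmas SY = subspace_fsupp[of Y]

lemma L_comm: "f \<in> XX \<Longrightarrow> L m (L n f) = L n (L m f) + (scal (of_int (m - n)) (L (m + n) f)
      + (if m + n = 0 then scal (of_int (m ^ 3 - m) / 12) (scal c f) else 0))"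
  using virasoro_moduleD(5)[OF D(2), of f m n] by (auto simp: D(1,3) algebra_simps)

lemma L_weight:
  assumes f: "f \<in> fsupp {x \<in> X. d x = h}" and x: "L n f x \<noteq> 0"
  shows "int (d x) = int h - 4 * n"
proof -
  have fX: "f \<in> XX" using f by (auto simp: fsupp_def)
  have "L 0 f = scal (of_nat h / 4) f"
    using D(4)[OF fX] fsuppD(2)[OF f] by (fastforce simp: fn_apply fun_eq_iff)
  then have "L n (L 0 f) = scal (of_nat h / 4) (L n f)" by (simp add: Llin(3)[OF fX])
  moreover have "L 0 (L n f) = L n (L 0 f) + (scal (of_int (0 - n)) (L (0 + n) f) +
      (if 0 + n = 0 then scal (of_int (0 ^ 3 - 0) / 12) (scal c f) else 0))"
    by (rule L_comm[OF fX])
  ultimately have "L 0 (L n f) = scal (of_nat h / 4) (L n f) + scal (of_int (- n)) (L n f)" by (auto split: if_splits)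
  then have "of_nat (d x) / 4 * L n f x = of_nat h / 4 * L n f x + of_int (- n) * L n f x"
    using D(4)[OF Llin(1)[OF fX], of n] by (simp add: fun_eq_iff fn_apply)
  then have "(of_nat (d x) / 4 - (of_nat h / 4 - of_int n)) * L n f x = 0" by (simp add: algebra_simps)
  with x have "of_nat (d x) / 4 = of_nat h / 4 - (of_int n :: complex)" by simp
  then have "of_int (int (d x)) = (of_int (int h - 4 * n) :: complex)" by (simp add: field_simps)
  then show ?thesis by (simp only: of_int_eq_iff)
qed

text \<open>The condition on pairs says that $\langle f,f'\rangle - \langle g,g'\rangle$ vanishes on the graph, which is a
  submodule of the direct sum.  By positivity such a graph is single-valued and injective.  In this form the
  relation is symmetric in the two modules.\<close>

definition null_sub :: "('x fn \<times> 'y fn) set \<Rightarrow> bool" where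
  "null_sub \<Phi> \<longleftrightarrow> \<Phi> \<subseteq> XX \<times> YY \<and> (0, 0) \<in> \<Phi> \<and>
     (\<forall>f g f' g'. (f, g) \<in> \<Phi> \<longrightarrow> (f', g') \<in> \<Phi> \<longrightarrow> (f + f', g + g') \<in> \<Phi> \<and> ip f f' = ip g g') \<and>
     (\<forall>a f g. (f, g) \<in> \<Phi> \<longrightarrow> (scal a f, scal a g) \<in> \<Phi>) \<and>
     (\<forall>n f g. (f, g) \<in> \<Phi> \<longrightarrow> (L n f, L' n g) \<in> \<Phi>)"

lemma null_subD:
  assumes "null_sub \<Phi>"
  shows "(f, g) \<in> \<Phi> \<Longrightarrow> f \<in> XX" "(f, g) \<in> \<Phi> \<Longrightarrow> g \<in> YY" "(0, 0) \<in> \<Phi>"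
    "(f, g) \<in> \<Phi> \<Longrightarrow> (f', g') \<in> \<Phi> \<Longrightarrow> (f + f', g + g') \<in> \<Phi>"
    "(f, g) \<in> \<Phi> \<Longrightarrow> (f', g') \<in> \<Phi> \<Longrightarrow> ip f f' = ip g g'"
    "(f, g) \<in> \<Phi> \<Longrightarrow> (scal a f, scal a g) \<in> \<Phi>" "(f, g) \<in> \<Phi> \<Longrightarrow> (L n f, L' n g) \<in> \<Phi>"
  using assms unfolding null_sub_def by blast+

lemma null_sub_converse: "null_sub \<Phi> \<Longrightarrow> unitary_pair.null_sub N' N Y X (\<Phi>\<inverse>)"
  unfolding unitary_pair.null_sub_def[OF pair_sym] null_sub_def
  by (auto simp: subset_iff)

text \<open>The graph is homogeneous: on vectors with finitely many weights the projection onto one weight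
  is a polynomial in $L(0)$, the same polynomial on both sides.\<close>

lemma null_sub_hproj:
  assumes \<Phi>: "null_sub \<Phi>" and fg: "(f, g) \<in> \<Phi>"
  shows "(hproj d h f, hproj d' h g) \<in> \<Phi>"
proof -
  note P = null_subD[OF \<Phi>]
  define H where "H = d ` {x. f x \<noteq> 0} \<union> d' ` {y. g y \<noteq> 0} - {h}"
  have finH: "finite H" using P(1,2)[OF fg] by (auto simp: H_def dest: fsuppD(1))
  have step: "((\<lambda>x. (of_nat (d x) - of_nat k) * f x), (\<lambda>y. (of_nat (d' y) - of_nat k) * g y)) \<in> \<Phi>"
    if "(f, g) \<in> \<Phi>" for f g and k :: nat
  proof -
    have "(scal 4 (L 0 f) + scal (- of_nat k) f, scal 4 (L' 0 g) + scal (- of_nat k) g) \<in> \<Phi>"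
      by (intro P(4) P(6) P(7) that)
    moreover have "scal 4 (L 0 f) + scal (- of_nat k) f = (\<lambda>x. (of_nat (d x) - of_nat k) * f x)"
      using D(4)[OF P(1)[OF that]] by (auto simp: fun_eq_iff fn_apply algebra_simps)
    moreover have "scal 4 (L' 0 g) + scal (- of_nat k) g = (\<lambda>y. (of_nat (d' y) - of_nat k) * g y)"
      using D'(4)[OF P(2)[OF that]] by (auto simp: fun_eq_iff fn_apply algebra_simps)
    ultimately show ?thesis by simp
  qed
  have poly: "((\<lambda>x. (\<Prod>k\<in>K. of_nat (d x) - of_nat k) * f x), (\<lambda>y. (\<Prod>k\<in>K. of_nat (d' y) - of_nat k) * g y)) \<in> \<Phi>"
    if "finite K" for K :: "nat set"
    using that
  proof (induction K rule: finite_induct)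
    case empty then show ?case using fg by simp
  next
    case (insert k K)
    then show ?case using step[OF insert.IH, of k] by (simp add: mult.assoc)
  qed
  define a :: complex where "a = (\<Prod>k\<in>H. of_nat h - of_nat k)"
  have a0: "a \<noteq> 0" using finH by (auto simp: a_def H_def)
  have zero: "(\<Prod>k\<in>H. of_nat e - of_nat k :: complex) = 0" if "e \<in> H" for e
    using that finH by (auto simp: prod_zero_iff)
  have 1: "scal (1 / a) (\<lambda>x. (\<Prod>k\<in>H. of_nat (d x) - of_nat k) * f x) = hproj d h f"
    using a0 zero by (auto simp: fun_eq_iff fn_apply hproj_def a_def H_def)
  have 2: "scal (1 / a) (\<lambda>y. (\<Prod>k\<in>H. of_nat (d' y) - of_nat k) * g y) = hproj d' h g"
    using a0 zero by (auto simp: fun_eq_iff fn_apply hproj_def a_def H_def)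
  show ?thesis using P(6)[OF poly[OF finH], of "1 / a"] by (simp only: 1 2)
qed

lemma subspace_fst: "null_sub \<Phi> \<Longrightarrow> fn.subspace (fst ` \<Phi>)"
  by (rule fn.subspaceI) (force dest: null_subD)+

lemma subspace_snd: "null_sub \<Phi> \<Longrightarrow> fn.subspace (snd ` \<Phi>)"
  by (rule fn.subspaceI) (force dest: null_subD)+

text \<open>An isometry onto all of one weight space hits all of the other, their dimensions being equal.\<close>

lemma full_weight_space:
  assumes \<Phi>: "null_sub \<Phi>" and full: "fsupp {x \<in> X. d x = h} \<subseteq> fst ` \<Phi>"
  shows "fsupp {y \<in> Y. d' y = h} \<subseteq> snd ` \<Phi>"
proof -
  note P = null_subD[OF \<Phi>]
  let ?X = "{x \<in> X. d x = h}" and ?Y = "{y \<in> Y. d' y = h}"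
  have "\<exists>g. (unit_fn x, g) \<in> \<Phi> \<and> g \<in> fsupp ?Y" if x: "x \<in> ?X" for x
  proof -
    have "unit_fn x \<in> fst ` \<Phi>" using full x unit_fn_fsupp[of x ?X] by auto
    then obtain g where g: "(unit_fn x, g) \<in> \<Phi>" by auto
    have "hproj d h (unit_fn x) = unit_fn x" using x by (auto simp: hproj_def unit_fn_def fun_eq_iff)
    then have "(unit_fn x, hproj d' h g) \<in> \<Phi>" using null_sub_hproj[OF \<Phi> g, of h] by simp
    moreover have "hproj d' h g \<in> fsupp ?Y"
      using P(2)[OF g] by (intro fsuppI[of "{y. g y \<noteq> 0}"]) (auto simp: hproj_def fsupp_outside dest: fsuppD(1))
    ultimately show ?thesis by blast
  qed
  then have "\<forall>x\<in>?X. \<exists>g. (unit_fn x, g) \<in> \<Phi> \<and> g \<in> fsupp ?Y" by (rule ballI)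
  from bchoice[OF this] obtain b where "\<forall>x\<in>?X. (unit_fn x, b x) \<in> \<Phi> \<and> b x \<in> fsupp ?Y" ..
  then have b: "\<And>x. x \<in> ?X \<Longrightarrow> (unit_fn x, b x) \<in> \<Phi>" "\<And>x. x \<in> ?X \<Longrightarrow> b x \<in> fsupp ?Y" by simp_all
  have on: "ip (b x) (b x') = (if x = x' then 1 else 0)" if "x \<in> ?X" "x' \<in> ?X" for x x'
  proof -
    have "ip (unit_fn x) (unit_fn x') = (if x = x' then 1 else 0 :: complex)"
      by (subst ip_eq[of "{x}"]) (auto simp: unit_fn_def)
    then show ?thesis using P(5)[OF b(1)[OF that(1)] b(1)[OF that(2)]] by simp
  qed
  have inj: "inj_on b ?X"
  proof (rule inj_onI)
    fix x x' assume xx: "x \<in> ?X" "x' \<in> ?X" "b x = b x'"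
    then show "x = x'" using on[OF xx(1,2)] on[OF xx(1,1)] by (auto split: if_splits)
  qed
  have ind: "fn.independent (b ` ?X)"
  proof (rule fn.independent_if_scalars_zero)
    show "finite (b ` ?X)" using finX by simp
  next
    fix u z assume sum0: "(\<Sum>z\<in>b ` ?X. scal (u z) z) = 0" and "z \<in> b ` ?X"
    then obtain x where x: "x \<in> ?X" "z = b x" by auto
    have "(\<Sum>x'\<in>?X. scal (u (b x')) (b x')) = 0" using sum0 by (simp add: sum.reindex[OF inj])
    then have "0 = ip (b x) (\<Sum>x'\<in>?X. scal (u (b x')) (b x'))" by (simp add: ip_zero)
    also have "\<dots> = (\<Sum>x'\<in>?X. ip (b x) (scal (u (b x')) (b x')))"
    proof -
      have "linear_between UNIV UNIV (\<lambda>g. \<lambda>_ :: unit. ip (b x) g)"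
        using b(2)[OF x(1)] by (intro linear_betweenI) (auto simp: ip_add_right ip_scal_right fun_eq_iff fn_apply)
      from linear_between_sum[OF this, of ?X "\<lambda>x'. scal (u (b x')) (b x')"]
      show ?thesis by (simp add: fun_eq_iff fn_apply)
    qed
    also have "\<dots> = (\<Sum>x'\<in>?X. if x = x' then u (b x') else 0)"
      by (rule sum.cong) (use on x b(2)[OF x(1)] in \<open>auto simp: ip_scal_right\<close>)
    also have "\<dots> = u z" using x finX by simp
    finally show "u z = 0" by simp
  qed
  have "g \<in> fn.span (b ` ?X)" if g: "g \<in> fsupp ?Y" for g
  proof (rule ccontr)
    assume ns: "g \<notin> fn.span (b ` ?X)"
    have ind': "fn.independent (insert g (b ` ?X))" by (rule fn.independent_insertI[OF ns ind])
    have "g \<notin> b ` ?X" using ns fn.span_base[of g "b ` ?X"] by blast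
    then have "card (insert g (b ` ?X)) = card ?X + 1" using finX by (simp add: card_image[OF inj])
    moreover have "card (insert g (b ` ?X)) \<le> card ?Y"
      using fsupp_finite_bound[OF finY ind'] g b(2) by auto
    ultimately show False using cards[of h] by simp
  qed
  moreover have "fn.span (b ` ?X) \<subseteq> snd ` \<Phi>"
    by (rule fn.span_minimal[OF _ subspace_snd[OF \<Phi>]]) (use b(1) in force)
  ultimately show ?thesis by auto
qed

text \<open>The submodule of the direct sum generated by a pair of vectors, both highest weight vectors.\<close>

inductive_set cyclic :: "'x fn \<Rightarrow> 'y fn \<Rightarrow> ('x fn \<times> 'y fn) set" for v w where
  zero: "(0, 0) \<in> cyclic v w"
| base: "(v, w) \<in> cyclic v w"
| add: "(p, q) \<in> cyclic v w \<Longrightarrow> (p', q') \<in> cyclic v w \<Longrightarrow> (p + p', q + q') \<in> cyclic v w"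
| scale: "(p, q) \<in> cyclic v w \<Longrightarrow> (scal a p, scal a q) \<in> cyclic v w"
| lower: "(p, q) \<in> cyclic v w \<Longrightarrow> n > 0 \<Longrightarrow> (L (- n) p, L' (- n) q) \<in> cyclic v w"

lemma cyclic_mem: 
  assumes "v \<in> XX" "w \<in> YY" "(p, q) \<in> cyclic v w" shows "p \<in> XX \<and> q \<in> YY"
  using assms(3)
  by induction (use assms(1,2) in \<open>simp_all add: Llin(1) L'lin(1) fn.subspace_0[OF SX] fn.subspace_0[OF SY]
      fn.subspace_add[OF SX] fn.subspace_add[OF SY] fn.subspace_scale[OF SX] fn.subspace_scale[OF SY]\<close>)

lemma L_zero: "L n 0 = 0" "L' n 0 = 0"
  using linear_between_0[OF unitary_vir_L[OF N] SX] linear_between_0[OF unitary_vir_L[OF N'] SY] by auto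

context
  fixes v w h
  assumes v: "v \<in> fsupp {x \<in> X. d x = h}" "ip v v = 1" "\<And>n. n > 0 \<Longrightarrow> L n v = 0"
    and w: "w \<in> fsupp {y \<in> Y. d' y = h}" "ip w w = 1" "\<And>n. n > 0 \<Longrightarrow> L' n w = 0"
begin

lemma vX: "v \<in> XX" and wY: "w \<in> YY"
  using v(1) w(1) by (auto simp: fsupp_def)

text \<open>Only lowering operators are needed to generate: the raising ones are moved to the right through the
  Virasoro relations until they annihilate the highest weight vectors.\<close>

lemma cyclic_closed: "(p, q) \<in> cyclic v w \<Longrightarrow> (L m p, L' m q) \<in> cyclic v w"
proof (induction arbitrary: m rule: cyclic.induct)
  case zero then show ?case by (simp add: L_zero cyclic.zero)
next
  case base
  consider "m > 0" | "m = 0" | "m < 0" by linarith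
  then show ?case
  proof cases
    case 1 then show ?thesis by (simp add: v w cyclic.zero)
  next
    case 2
    have "L 0 v = scal (of_nat h / 4) v" "L' 0 w = scal (of_nat h / 4) w"
      using D(4)[OF vX] fsuppD(2)[OF v(1)] D'(4)[OF wY] fsuppD(2)[OF w(1)]
      by (fastforce simp: fn_apply fun_eq_iff)+
    with 2 show ?thesis by (simp add: cyclic.scale cyclic.base)
  next
    case 3 then show ?thesis using cyclic.lower[OF cyclic.base, of "- m"] by simp
  qed
next
  case (add p q p' q')
  then show ?case
    using cyclic_mem[OF vX wY add.hyps(1)] cyclic_mem[OF vX wY add.hyps(2)]
    by (simp add: Llin(2) L'lin(2) cyclic.add)
next
  case (scale p q a)
  then show ?case using cyclic_mem[OF vX wY scale.hyps(1)] by (simp add: Llin(3) L'lin(3) cyclic.scale)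
next
  case (lower p q n)
  have pq: "p \<in> XX" "q \<in> YY" using cyclic_mem[OF vX wY lower.hyps(1)] by auto
  have z: "(if m + - n = 0 then scal (of_int (m ^ 3 - m) / 12) (scal c p) else 0,
         if m + - n = 0 then scal (of_int (m ^ 3 - m) / 12) (scal c q) else 0) \<in> cyclic v w"
    using lower.hyps(1) by (auto intro: cyclic.zero cyclic.scale)
  show ?case
    unfolding L_comm[OF pq(1), of m "- n"] unitary_pair.L_comm[OF pair_sym pq(2), of m "- n"]
    by (intro cyclic.add cyclic.lower cyclic.scale z lower.IH lower.hyps(2))
qed

text \<open>A pairing with the highest weight vector only sees the component along it, because the adjoint of a
  lowering operator annihilates that vector.\<close>

lemma cyclic_vac: "(p, q) \<in> cyclic v w \<Longrightarrow> ip v p = ip w q"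
proof (induction rule: cyclic.induct)
  case (lower p q n)
  have pq: "p \<in> XX" "q \<in> YY" using cyclic_mem[OF vX wY lower.hyps(1)] by auto
  show ?case
    using D(5)[OF vX pq(1), of n] D'(5)[OF wY pq(2), of n] lower.hyps(2) by (simp add: v w ip_zero)
qed (use vX wY in \<open>auto simp: v w ip_add_right ip_scal_right ip_zero\<close>)

text \<open>The form on a highest weight module is determined by the central charge and the highest weight, since
  all pairings are reduced to the highest weight vector by taking adjoints.\<close>

lemma cyclic_isometry: "(p', q') \<in> cyclic v w \<Longrightarrow> (p, q) \<in> cyclic v w \<Longrightarrow> ip p' p = ip q' q"
proof (induction arbitrary: p q rule: cyclic.induct)
  case (base) then show ?case by (rule cyclic_vac)
next
  case (lower p' q' n)
  have pq: "p \<in> XX" "q \<in> YY" using cyclic_mem[OF vX wY lower.prems] by auto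
  have pq': "p' \<in> XX" "q' \<in> YY" using cyclic_mem[OF vX wY lower.hyps(1)] by auto
  show ?case using D(5)[OF pq'(1) pq(1), of "- n"] D'(5)[OF pq'(2) pq(2), of "- n"]
    lower.IH[OF cyclic_closed[OF lower.prems], of n] by simp
next
  case (add p' q' p'' q'')
  have pq: "p \<in> XX" "q \<in> YY" using cyclic_mem[OF vX wY add.prems] by auto
  show ?case using add.IH add.prems by (simp add: ip_add_left[OF pq(1)] ip_add_left[OF pq(2)])
next
  case (scale p' q' a)
  have pq: "p \<in> XX" "q \<in> YY" using cyclic_mem[OF vX wY scale.prems] by auto
  show ?case using scale.IH scale.prems by (simp add: ip_scal_left[OF pq(1)] ip_scal_left[OF pq(2)])
qed (simp add: ip_zero)

text \<open>The orthogonal complement of a submodule is a submodule.\<close>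

lemma cyclic_orthogonal:
  assumes \<Phi>: "null_sub \<Phi>" and orth: "\<forall>f g. (f, g) \<in> \<Phi> \<longrightarrow> ip f v = 0"
  shows "(p, q) \<in> cyclic v w \<Longrightarrow> (f, g) \<in> \<Phi> \<Longrightarrow> ip f p = 0"
proof (induction arbitrary: f g rule: cyclic.induct)
  case base then show ?case using orth by blast
next
  case (lower p q n)
  have p: "p \<in> XX" using cyclic_mem[OF vX wY lower.hyps(1)] by auto
  show ?case using D(5)[OF null_subD(1)[OF \<Phi> lower.prems] p, of n] lower.IH[OF null_subD(7)[OF \<Phi> lower.prems], of n]
    by simp
next
  case (add p q p' q')
  then show ?case using ip_add_right[OF null_subD(1)[OF \<Phi> add.prems]] by simp
next
  case (scale p q a)
  then show ?case using ip_scal_right[OF null_subD(1)[OF \<Phi> scale.prems]] by simp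
qed (simp add: ip_zero)

text \<open>An isometry is extended by another with orthogonal domain and range.\<close>

lemma extend_null_sub:
  assumes \<Phi>: "null_sub \<Phi>" and orth: "\<forall>f g. (f, g) \<in> \<Phi> \<longrightarrow> ip f v = 0"
    and o': "\<And>p q f g. (p, q) \<in> cyclic v w \<Longrightarrow> (f, g) \<in> \<Phi> \<Longrightarrow> ip g q = 0"
  shows "null_sub {(f + p, g + q) | f g p q. (f, g) \<in> \<Phi> \<and> (p, q) \<in> cyclic v w}"
proof -
  note P = null_subD[OF \<Phi>]
  let ?\<Psi> = "{(f + p, g + q) | f g p q. (f, g) \<in> \<Phi> \<and> (p, q) \<in> cyclic v w}"
  note o = cyclic_orthogonal[OF \<Phi> orth]
  note m = cyclic_mem[OF vX wY]
  have I: "(f + p, g + q) \<in> ?\<Psi>" if "(f, g) \<in> \<Phi>" "(p, q) \<in> cyclic v w" for f g p q using that by blast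
  show ?thesis
    unfolding null_sub_def
  proof (intro conjI allI impI)
    show "?\<Psi> \<subseteq> XX \<times> YY" using P(1,2) m by (auto intro!: fn.subspace_add[OF SX] fn.subspace_add[OF SY])
    show "(0, 0) \<in> ?\<Psi>" using I[OF P(3) cyclic.zero] by simp
  next
    fix f g f' g' assume "(f, g) \<in> ?\<Psi>" "(f', g') \<in> ?\<Psi>"
    then obtain f1 g1 p1 q1 f2 g2 p2 q2 where
      e: "f = f1 + p1" "g = g1 + q1" "f' = f2 + p2" "g' = g2 + q2" and
      a: "(f1, g1) \<in> \<Phi>" "(p1, q1) \<in> cyclic v w" "(f2, g2) \<in> \<Phi>" "(p2, q2) \<in> cyclic v w" by blast
    have "f + f' = (f1 + f2) + (p1 + p2)" "g + g' = (g1 + g2) + (q1 + q2)" by (simp_all add: e algebra_simps)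
    then show "(f + f', g + g') \<in> ?\<Psi>" using I[OF P(4)[OF a(1,3)] cyclic.add[OF a(2,4)]] by simp
    have xs: "f1 \<in> XX" "p1 \<in> XX" "f2 \<in> XX" "p2 \<in> XX" "g1 \<in> YY" "q1 \<in> YY" "g2 \<in> YY" "q2 \<in> YY"
      using P(1,2) m a by blast+
    have z: "ip f1 p2 = 0" "ip g1 q2 = 0" "ip p1 f2 = 0" "ip q1 g2 = 0"
      using o[OF a(4,1)] o'[OF a(4,1)] o[OF a(2,3)] o'[OF a(2,3)] ip_cnj[of f2 p1] ip_cnj[of g2 q1] by simp_all
    have X2: "f2 + p2 \<in> XX" "g2 + q2 \<in> YY" using xs by (auto intro: fn.subspace_add[OF SX] fn.subspace_add[OF SY])
    show "ip f f' = ip g g'"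
      using P(5)[OF a(1,3)] cyclic_isometry[OF a(2,4)] z
      by (simp add: e ip_add_left[OF X2(1)] ip_add_left[OF X2(2)] ip_add_right[OF xs(1)] ip_add_right[OF xs(2)]
          ip_add_right[OF xs(5)] ip_add_right[OF xs(6)])
  next
    fix a f g assume "(f, g) \<in> ?\<Psi>"
    then obtain f1 g1 p1 q1 where e: "f = f1 + p1" "g = g1 + q1" and a: "(f1, g1) \<in> \<Phi>" "(p1, q1) \<in> cyclic v w" by blast
    show "(scal a f, scal a g) \<in> ?\<Psi>" unfolding e scal_add by (rule I[OF P(6)[OF a(1)] cyclic.scale[OF a(2)]])
  next
    fix n f g assume "(f, g) \<in> ?\<Psi>"
    then obtain f1 g1 p1 q1 where e: "f = f1 + p1" "g = g1 + q1" and a: "(f1, g1) \<in> \<Phi>" "(p1, q1) \<in> cyclic v w" by blast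
    have xs: "f1 \<in> XX" "p1 \<in> XX" "g1 \<in> YY" "q1 \<in> YY" using P(1,2) m a by blast+
    show "(L n f, L' n g) \<in> ?\<Psi>"
      unfolding e Llin(2)[OF xs(1,2)] L'lin(2)[OF xs(3,4)]
      by (rule I[OF P(7)[OF a(1)] cyclic_closed[OF a(2)]])
  qed
qed

end

lemma ip_hproj: 
  assumes "f \<in> XX" "v \<in> fsupp {x \<in> X. d x = h}" shows "ip f v = ip (hproj d h f) v"
proof -
  have v: "finite {x. v x \<noteq> 0}" using assms(2) by (rule fsuppD(1))
  show ?thesis unfolding ip_right[OF v] by (rule sum.cong) (use assms(2) in \<open>auto simp: hproj_def fsupp_def\<close>)
qed

text \<open>If all lower weight spaces are in the domain, a unit vector of weight \<open>h\<close> orthogonal to the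
  domain is a highest weight vector.\<close>

lemma new_highest_weight_vector:
  assumes \<Phi>: "null_sub \<Phi>" and low: "\<And>k. k < h \<Longrightarrow> fsupp {x \<in> X. d x = k} \<subseteq> fst ` \<Phi>"
    and nf: "\<not> fsupp {x \<in> X. d x = h} \<subseteq> fst ` \<Phi>"
  shows "\<exists>v\<in>fsupp {x \<in> X. d x = h}. ip v v = 1 \<and> (\<forall>f g. (f, g) \<in> \<Phi> \<longrightarrow> ip f v = 0) \<and> (\<forall>n>0. L n v = 0)"
proof -
  note P = null_subD[OF \<Phi>]
  let ?X = "{x \<in> X. d x = h}"
  have "fn.subspace (fst ` \<Phi> \<inter> fsupp ?X)"
    by (intro fn.subspace_inter subspace_fst[OF \<Phi>] subspace_fsupp)
  then obtain v where v: "v \<in> fsupp ?X" "ip v v = 1" "\<And>a. a \<in> fst ` \<Phi> \<inter> fsupp ?X \<Longrightarrow> ip a v = 0"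
    using orthogonal_unit_vector[OF finX, of "fst ` \<Phi> \<inter> fsupp ?X" h] nf by blast
  have vX: "v \<in> XX" using v(1) by (auto simp: fsupp_def)
  have orth: "ip f v = 0" if fg: "(f, g) \<in> \<Phi>" for f g
  proof -
    have "hproj d h f \<in> fst ` \<Phi>" using null_sub_hproj[OF \<Phi> fg, of h] by force
    moreover have "hproj d h f \<in> fsupp ?X"
      using P(1)[OF fg] by (intro fsuppI[of "{x. f x \<noteq> 0}"]) (auto simp: hproj_def fsupp_outside dest: fsuppD(1))
    ultimately show ?thesis using v(3) ip_hproj[OF P(1)[OF fg] v(1)] by auto
  qed
  have "L n v = 0" if n: "n > 0" for n
  proof -
    have LX: "L n v \<in> XX" by (rule Llin(1)[OF vX])
    have "L n v \<in> fst ` \<Phi>"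
    proof (cases "4 * n \<le> int h")
      case True
      define k where "k = nat (int h - 4 * n)"
      have "L n v \<in> fsupp {x \<in> X. d x = k}"
      proof -
        have "d x = k" if "L n v x \<noteq> 0" for x using L_weight[OF v(1) that] True by (simp add: k_def)
        then show ?thesis using LX by (auto simp: fsupp_def)
      qed
      moreover have "k < h" using n True by (simp add: k_def)
      ultimately show ?thesis using low by blast
    next
      case False
      have "L n v = 0"
      proof (rule ext, rule ccontr)
        fix x assume "L n v x \<noteq> 0 x"
        then have "int (d x) = int h - 4 * n" using L_weight[OF v(1)] by (simp add: fn_apply)
        with False show False by simp
      qed
      then show ?thesis using P(3) by force
    qed
    then obtain g where g: "(L n v, g) \<in> \<Phi>" by auto
    have "ip (L n v) (L n v) = cnj (ip (L (- n) (L n v)) v)"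
      using D(5)[OF LX vX, of "- n"] ip_cnj[of "L n v" "L n v"] by simp
    also have "\<dots> = 0" using orth[OF P(7)[OF g]] by simp
    finally show ?thesis by (rule ip_self_eq_0[OF LX])
  qed
  with v orth show ?thesis by blast
qed

lemma full_iff:
  assumes \<Phi>: "null_sub \<Phi>"
  shows "fsupp {x \<in> X. d x = h} \<subseteq> fst ` \<Phi> \<longleftrightarrow> fsupp {y \<in> Y. d' y = h} \<subseteq> snd ` \<Phi>"
proof -
  have "fst ` (\<Phi>\<inverse>) = snd ` \<Phi>" "snd ` (\<Phi>\<inverse>) = fst ` \<Phi>" by force+
  then show ?thesis
    using full_weight_space[OF \<Phi>, of h]
      unitary_pair.full_weight_space[OF pair_sym null_sub_converse[OF \<Phi>], of h] by auto
qed

text \<open>By induction on the weight: in the lowest weight where the domain is incomplete, both modules have a new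
  highest weight vector orthogonal to what is already matched, the one in the second module because the weight
  spaces have equal dimension.  These two vectors generate isometric submodules, contradicting maximality.\<close>

lemma maximal_null_sub_full:
  assumes \<Phi>: "null_sub \<Phi>" and max: "\<And>\<Psi>. null_sub \<Psi> \<Longrightarrow> \<Phi> \<subseteq> \<Psi> \<Longrightarrow> \<Psi> = \<Phi>"
  shows "fsupp {x \<in> X. d x = h} \<subseteq> fst ` \<Phi>"
proof (induction h rule: less_induct)
  case (less h)
  show ?case
  proof (rule ccontr)
    assume nf: "\<not> fsupp {x \<in> X. d x = h} \<subseteq> fst ` \<Phi>"
    have conv: "fst ` (\<Phi>\<inverse>) = snd ` \<Phi>" by force
    obtain v where v: "v \<in> fsupp {x \<in> X. d x = h}" "ip v v = 1" "\<forall>f g. (f, g) \<in> \<Phi> \<longrightarrow> ip f v = 0"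
      "\<And>n. n > 0 \<Longrightarrow> L n v = 0"
      using new_highest_weight_vector[OF \<Phi> less nf] by blast
    have low': "fsupp {y \<in> Y. d' y = k} \<subseteq> fst ` (\<Phi>\<inverse>)" if "k < h" for k
      using less[OF that] full_iff[OF \<Phi>] by (simp add: conv)
    have nf': "\<not> fsupp {y \<in> Y. d' y = h} \<subseteq> fst ` (\<Phi>\<inverse>)" using nf full_iff[OF \<Phi>] by (simp add: conv)
    obtain w where w: "w \<in> fsupp {y \<in> Y. d' y = h}" "ip w w = 1" "\<forall>g f. (g, f) \<in> \<Phi>\<inverse> \<longrightarrow> ip g w = 0"
      "\<And>n. n > 0 \<Longrightarrow> L' n w = 0"
      using unitary_pair.new_highest_weight_vector[OF pair_sym null_sub_converse[OF \<Phi>] low' nf'] by blast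
    let ?\<Psi> = "{(f + p, g + q) | f g p q. (f, g) \<in> \<Phi> \<and> (p, q) \<in> cyclic v w}"
    have swap: "(q, p) \<in> unitary_pair.cyclic N' N w v" if "(p, q) \<in> cyclic v w" for p q
      using that by induction (auto intro: unitary_pair.cyclic.intros[OF pair_sym])
    have o': "ip g q = 0" if "(p, q) \<in> cyclic v w" "(f, g) \<in> \<Phi>" for p q f g
      using unitary_pair.cyclic_orthogonal[OF pair_sym w(1,2,4) v(1,2,4) null_sub_converse[OF \<Phi>] w(3) swap[OF that(1)]] that(2)
      by blast
    have "null_sub ?\<Psi>" by (rule extend_null_sub[OF v(1,2,4) w(1,2,4) \<Phi> v(3) o'])
    moreover have "\<Phi> \<subseteq> ?\<Psi>" using cyclic.zero by force
    ultimately have "?\<Psi> = \<Phi>" by (rule max)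
    moreover have "(v, w) \<in> ?\<Psi>" using null_subD(3)[OF \<Phi>] cyclic.base by force
    ultimately have "(v, w) \<in> \<Phi>" by simp
    then show False using v(2,3) by fastforce
  qed
qed

text \<open>Zorn's lemma, the union of a chain of graphs being a graph.\<close>

lemma exists_maximal: "\<exists>\<Phi>. null_sub \<Phi> \<and> (\<forall>\<Psi>. null_sub \<Psi> \<longrightarrow> \<Phi> \<subseteq> \<Psi> \<longrightarrow> \<Psi> = \<Phi>)"
proof -
  have ne: "{(0, 0)} \<in> Collect null_sub"
    by (auto simp: null_sub_def L_zero fn.subspace_0[OF SX] fn.subspace_0[OF SY] ip_zero)
  have ch: "\<Union>C \<in> Collect null_sub" if "C \<noteq> {}" "subset.chain (Collect null_sub) C" for C
  proof -
    have n: "null_sub \<Phi>" if "\<Phi> \<in> C" for \<Phi> using \<open>subset.chain _ C\<close> that by (auto simp: subset.chain_def)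
    have two: "\<exists>\<Phi>\<in>C. p \<in> \<Phi> \<and> q \<in> \<Phi>" if pq: "p \<in> \<Union>C" "q \<in> \<Union>C" for p q
    proof -
      obtain \<Phi> \<Psi> where a: "\<Phi> \<in> C" "p \<in> \<Phi>" "\<Psi> \<in> C" "q \<in> \<Psi>" using pq by blast
      have "\<Phi> \<subseteq> \<Psi> \<or> \<Psi> \<subseteq> \<Phi>" using \<open>subset.chain _ C\<close> a(1,3) by (auto simp: subset.chain_def)
      with a show ?thesis by blast
    qed
    have "null_sub (\<Union>C)"
      unfolding null_sub_def
    proof (intro conjI allI impI)
      have "\<Phi> \<subseteq> XX \<times> YY" if "\<Phi> \<in> C" for \<Phi> using n[OF that] unfolding null_sub_def by (rule conjunct1)
      then show "\<Union>C \<subseteq> XX \<times> YY" by (rule Union_least)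
      obtain \<Phi> where \<Phi>: "\<Phi> \<in> C" using \<open>C \<noteq> {}\<close> by blast
      show "(0, 0) \<in> \<Union>C" by (rule UnionI[OF \<Phi> null_subD(3)[OF n[OF \<Phi>]]])
    next
      fix f g f' g' assume "(f, g) \<in> \<Union>C" "(f', g') \<in> \<Union>C"
      then obtain \<Phi> where \<Phi>: "\<Phi> \<in> C" "(f, g) \<in> \<Phi>" "(f', g') \<in> \<Phi>" using two by blast
      show "(f + f', g + g') \<in> \<Union>C" by (rule UnionI[OF \<Phi>(1) null_subD(4)[OF n[OF \<Phi>(1)] \<Phi>(2,3)]])
      show "ip f f' = ip g g'" by (rule null_subD(5)[OF n[OF \<Phi>(1)] \<Phi>(2,3)])
    next
      fix a f g assume "(f, g) \<in> \<Union>C"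
      then obtain \<Phi> where \<Phi>: "\<Phi> \<in> C" "(f, g) \<in> \<Phi>" by (rule UnionE)
      show "(scal a f, scal a g) \<in> \<Union>C" by (rule UnionI[OF \<Phi>(1) null_subD(6)[OF n[OF \<Phi>(1)] \<Phi>(2)]])
    next
      fix k f g assume "(f, g) \<in> \<Union>C"
      then obtain \<Phi> where \<Phi>: "\<Phi> \<in> C" "(f, g) \<in> \<Phi>" by (rule UnionE)
      show "(L k f, L' k g) \<in> \<Union>C" by (rule UnionI[OF \<Phi>(1) null_subD(7)[OF n[OF \<Phi>(1)] \<Phi>(2)]])
    qed
    then show ?thesis by simp
  qed
  obtain \<Phi> where "\<Phi> \<in> Collect null_sub" "\<forall>\<Psi>\<in>Collect null_sub. \<Phi> \<subseteq> \<Psi> \<longrightarrow> \<Psi> = \<Phi>"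
    using subset_Zorn_nonempty[OF _ ch] ne by blast
  then show ?thesis by blast
qed

theorem isomorphic: "virasoro_isomorphic N N'"
proof -
  obtain \<Phi> where \<Phi>: "null_sub \<Phi>" and max: "\<And>\<Psi>. null_sub \<Psi> \<Longrightarrow> \<Phi> \<subseteq> \<Psi> \<Longrightarrow> \<Psi> = \<Phi>"
    using exists_maximal by blast
  note P = null_subD[OF \<Phi>]
  have full: "fsupp {x \<in> X. d x = h} \<subseteq> fst ` \<Phi>" for h by (rule maximal_null_sub_full[OF \<Phi> max])
  then have full': "fsupp {y \<in> Y. d' y = h} \<subseteq> snd ` \<Phi>" for h using full_iff[OF \<Phi>] by blast
  have A: "XX \<subseteq> fst ` \<Phi>"
    unfolding fsupp_eq_span[of X]
  proof (rule fn.span_minimal[OF _ subspace_fst[OF \<Phi>]])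
    show "unit_fn ` X \<subseteq> fst ` \<Phi>"
    proof (rule image_subsetI)
      fix x assume "x \<in> X"
      then show "unit_fn x \<in> fst ` \<Phi>" by (intro subsetD[OF full[of "d x"]] unit_fn_fsupp) simp
    qed
  qed
  have B: "YY \<subseteq> snd ` \<Phi>"
    unfolding fsupp_eq_span[of Y]
  proof (rule fn.span_minimal[OF _ subspace_snd[OF \<Phi>]])
    show "unit_fn ` Y \<subseteq> snd ` \<Phi>"
    proof (rule image_subsetI)
      fix y assume "y \<in> Y"
      then show "unit_fn y \<in> snd ` \<Phi>" by (intro subsetD[OF full'[of "d' y"]] unit_fn_fsupp) simp
    qed
  qed
  have single: "g = g'" if "(f, g) \<in> \<Phi>" "(f, g') \<in> \<Phi>" for f g g'
  proof -
    have "(f + scal (-1) f, g + scal (-1) g') \<in> \<Phi>" by (intro P(4) P(6) that)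
    then have z: "(0, g - g') \<in> \<Phi>" by simp
    have "g - g' = 0" by (rule ip_self_eq_0[OF P(2)[OF z]]) (simp add: P(5)[OF z z, symmetric] ip_zero)
    then show ?thesis by simp
  qed
  have inj: "f = f'" if "(f, g) \<in> \<Phi>" "(f', g) \<in> \<Phi>" for f f' g
  proof -
    have "(f + scal (-1) f', g + scal (-1) g) \<in> \<Phi>" by (intro P(4) P(6) that)
    then have z: "(f - f', 0) \<in> \<Phi>" by simp
    have "f - f' = 0" by (rule ip_self_eq_0[OF P(1)[OF z]]) (simp add: P(5)[OF z z] ip_zero)
    then show ?thesis by simp
  qed
  define T where "T f = (THE g. (f, g) \<in> \<Phi>)" for f
  have T: "(f, T f) \<in> \<Phi>" if f: "f \<in> XX" for f
  proof -
    obtain g where g: "(f, g) \<in> \<Phi>" using subsetD[OF A f] by auto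
    show ?thesis unfolding T_def by (rule theI[of _ g]) (rule g, rule single[OF _ g])
  qed
  have Te: "T f = g" if "(f, g) \<in> \<Phi>" for f g by (rule single[OF T[OF P(1)[OF that]] that])
  have lin: "linear_between XX YY T"
    by (rule linear_betweenI) (auto intro: P(2)[OF T] Te P(4)[OF T T] P(6)[OF T])
  have bij: "bij_betw T XX YY"
    unfolding bij_betw_def
  proof
    show "inj_on T XX" by (rule inj_onI) (rule inj[OF T], assumption, simp add: T)
    show "T ` XX = YY"
    proof
      show "T ` XX \<subseteq> YY" using T P(2) by blast
      show "YY \<subseteq> T ` XX"
      proof
        fix g assume "g \<in> YY"
        then obtain f where "(f, g) \<in> \<Phi>" using B by force
        then show "g \<in> T ` XX" by (auto simp: image_iff Te intro!: bexI[of _ f] P(1))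
      qed
    qed
  qed
  have "T (central N f) = central N' (T f)" if "f \<in> XX" for f
    using that by (simp add: D(3) D'(3) linear_betweenD[OF lin])
  moreover have "T (L n f) = L' n (T f)" if "f \<in> XX" for f n
    using Te[OF P(7)[OF T[OF that]]] .
  ultimately show ?thesis
    unfolding virasoro_isomorphic_def D(1) D'(1) using lin bij D(2) D'(2) by blast
qed

end

section \<open>Modules isomorphic to unitary ones\<close>

text \<open>The isomorphism goes from the coordinate form to the module, so that every closure property of
  the module is inherited from its coordinate form.  The sign function \<open>\<sigma>\<close> on the labels of the
  module corresponds to the grading \<open>s\<close>.\<close>

definition unitary_model ::
  "'x vir \<Rightarrow> 'x fn \<Rightarrow> 'l set \<Rightarrow> ('l \<Rightarrow> nat) \<Rightarrow> complex \<Rightarrow> 'l fn \<Rightarrow> bool" where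
  "unitary_model M \<sigma> X d c s \<longleftrightarrow>
     (\<exists>N R. unitary_vir N X d c s \<and> linear_between (fsupp X) (carr M) R \<and> bij_betw R (fsupp X) (carr M) \<and>
        (\<forall>f\<in>fsupp X. R (scal c f) = central M (R f) \<and> (\<forall>n. R (vir_L N n f) = vir_L M n (R f)) \<and>
           R (smul s f) = smul \<sigma> (R f)))"

lemma unitary_modelI:
  assumes "unitary_vir N X d c s" "linear_between (fsupp X) (carr M) R" "bij_betw R (fsupp X) (carr M)"
    "\<And>f. f \<in> fsupp X \<Longrightarrow> R (scal c f) = central M (R f)"
    "\<And>f n. f \<in> fsupp X \<Longrightarrow> R (vir_L N n f) = vir_L M n (R f)"
    "\<And>f. f \<in> fsupp X \<Longrightarrow> R (smul s f) = smul \<sigma> (R f)"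
  shows "unitary_model M \<sigma> X d c s"
  unfolding unitary_model_def using assms by (intro exI[of _ N] exI[of _ R]) simp

lemma unitary_modelE:
  assumes "unitary_model M \<sigma> X d c s"
  obtains N R where "unitary_vir N X d c s" "linear_between (fsupp X) (carr M) R" "bij_betw R (fsupp X) (carr M)"
    "\<And>f. f \<in> fsupp X \<Longrightarrow> R (scal c f) = central M (R f)"
    "\<And>f n. f \<in> fsupp X \<Longrightarrow> R (vir_L N n f) = vir_L M n (R f)"
    "\<And>f. f \<in> fsupp X \<Longrightarrow> R (smul s f) = smul \<sigma> (R f)"
    "virasoro_module M" "\<And>f. f \<in> carr M \<Longrightarrow> central M f = scal c f"
proof -
  obtain N R where N: "unitary_vir N X d c s" and R: "linear_between (fsupp X) (carr M) R"
    and b: "bij_betw R (fsupp X) (carr M)"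
    and a: "\<forall>f\<in>fsupp X. R (scal c f) = central M (R f) \<and> (\<forall>n. R (vir_L N n f) = vir_L M n (R f)) \<and>
           R (smul s f) = smul \<sigma> (R f)"
    using assms unfolding unitary_model_def by blast
  note D = unitary_virD[OF N]
  have V: "virasoro_module M"
    by (rule virasoro_module_transport[OF D(2), of M R]) (use R b a in \<open>simp_all add: D(1,3)\<close>)
  have c: "central M f = scal c f" if f: "f \<in> carr M" for f
  proof -
    obtain f' where f': "f' \<in> fsupp X" "f = R f'" using b f by (auto simp: bij_betw_def)
    then show ?thesis using bspec[OF a f'(1)] linear_betweenD(3)[OF R f'(1), of c] by simp
  qed
  show thesis by (rule that[OF N R b]) (use a V c in simp_all)
qed

text \<open>The involution of a tensor product is the product of the involutions.\<close>

lemma unitary_model_tensor: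
  assumes "unitary_model M \<sigma> X d c s" and "unitary_model M' \<sigma>' Y d' c' s'"
  shows "unitary_model (tensor M M') (\<lambda>(x, y). \<sigma> x * \<sigma>' y) (X \<times> Y) (\<lambda>(x, y). d x + d' y) (c + c')
    (\<lambda>(x, y). s x * s' y)"
proof -
  obtain N R where N: "unitary_vir N X d c s" and R: "linear_between (fsupp X) (carr M) R"
    and bij: "bij_betw R (fsupp X) (carr M)"
    and RL: "\<And>f n. f \<in> fsupp X \<Longrightarrow> R (vir_L N n f) = vir_L M n (R f)"
    and Rs: "\<And>f. f \<in> fsupp X \<Longrightarrow> R (smul s f) = smul \<sigma> (R f)"
    and V: "virasoro_module M" and c: "\<And>f. f \<in> carr M \<Longrightarrow> central M f = scal c f"
    using assms(1) by (rule unitary_modelE) blast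
  obtain N' R' where N': "unitary_vir N' Y d' c' s'" and R': "linear_between (fsupp Y) (carr M') R'"
    and bij': "bij_betw R' (fsupp Y) (carr M')"
    and RL': "\<And>f n. f \<in> fsupp Y \<Longrightarrow> R' (vir_L N' n f) = vir_L M' n (R' f)"
    and Rs': "\<And>f. f \<in> fsupp Y \<Longrightarrow> R' (smul s' f) = smul \<sigma>' (R' f)"
    and V': "virasoro_module M'" and c': "\<And>f. f \<in> carr M' \<Longrightarrow> central M' f = scal c' f"
    using assms(2) by (rule unitary_modelE) blast
  note S = subspace_fsupp[of X] and S' = subspace_fsupp[of Y]
  note W = virasoro_moduleD(1)[OF V] and W' = virasoro_moduleD(1)[OF V']
  note L = unitary_vir_L[OF N] and L' = unitary_vir_L[OF N']
  let ?T = "\<lambda>F. map_left R (map_right R' F)"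
  have T1: "map_right R' F \<in> tens (fsupp X) (carr M')" if "F \<in> fsupp (X \<times> Y)" for F
    using linear_betweenD(1)[OF map_right_linear[OF R' S', where V = "fsupp X"], of F] that by (simp add: tens_fsupp)
  have lin: "linear_between (fsupp (X \<times> Y)) (tens (carr M) (carr M')) ?T"
    using linear_between_comp[OF map_right_linear[OF R' S', where V = "fsupp X"] map_left_linear[OF R S]]
    by (simp add: tens_fsupp)
  have T2: "?T F \<in> tens (carr M) (carr M')" if "F \<in> fsupp (X \<times> Y)" for F
    by (rule linear_betweenD(1)[OF lin that])
  have inj0: "F = 0" if F: "F \<in> fsupp (X \<times> Y)" and 0: "?T F = 0" for F
  proof -
    let ?G = "map_right R' F"
    have "(\<lambda>x. ?G (x, y)) = 0" for y
    proof -
      have "R (\<lambda>x. ?G (x, y)) = 0" using 0 by (auto simp: map_left_def fun_eq_iff fn_apply)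
      also have "0 = R 0" using linear_between_0[OF R S] by simp
      finally show ?thesis
        using bij_betw_imp_inj_on[OF bij] tens_slice_left[OF S T1[OF F]] fn.subspace_0[OF S] by (auto dest: inj_onD)
    qed
    then have G0: "?G (x, y) = 0" for x y by (auto simp: fun_eq_iff fn_apply)
    have "(\<lambda>y. F (x, y)) = 0" for x
    proof -
      have "R' (\<lambda>y. F (x, y)) = 0" using G0 by (auto simp: map_right_def fun_eq_iff fn_apply)
      also have "0 = R' 0" using linear_between_0[OF R' S'] by simp
      finally show ?thesis
        using bij_betw_imp_inj_on[OF bij'] tens_slice_right[OF S', of F "fsupp X"] fn.subspace_0[OF S'] F
        by (auto dest: inj_onD simp: tens_fsupp)
    qed
    then show ?thesis by (auto simp: fun_eq_iff fn_apply)
  qed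
  have inj: "inj_on ?T (fsupp (X \<times> Y))"
  proof (rule inj_onI)
    fix F G assume F: "F \<in> fsupp (X \<times> Y)" and G: "G \<in> fsupp (X \<times> Y)" and e: "?T F = ?T G"
    have "?T (F - G) = ?T F - ?T G" by (rule linear_between_diff[OF lin subspace_fsupp F G])
    then have "F - G = 0" using e by (intro inj0 fn.subspace_diff[OF subspace_fsupp] F G) simp
    then show "F = G" by simp
  qed
  have surj: "H \<in> ?T ` fsupp (X \<times> Y)" if "H \<in> tens (carr M) (carr M')" for H
  proof (rule tens_induct[OF that])
    show "fn.subspace (?T ` fsupp (X \<times> Y))"
    proof (rule fn.subspaceI)
      show "0 \<in> ?T ` fsupp (X \<times> Y)"
        using linear_between_0[OF lin subspace_fsupp] fn.subspace_0[OF subspace_fsupp] by (rule image_eqI[OF sym])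
    next
      fix f g assume "f \<in> ?T ` fsupp (X \<times> Y)" "g \<in> ?T ` fsupp (X \<times> Y)"
      then show "f + g \<in> ?T ` fsupp (X \<times> Y)"
        by (auto simp flip: linear_betweenD(2)[OF lin] intro!: imageI fn.subspace_add[OF subspace_fsupp])
    next
      fix a f assume "f \<in> ?T ` fsupp (X \<times> Y)"
      then show "scal a f \<in> ?T ` fsupp (X \<times> Y)"
        by (auto simp flip: linear_betweenD(3)[OF lin] intro!: imageI fn.subspace_scale[OF subspace_fsupp])
    qed
  next
    fix f g assume "f \<in> carr M" "g \<in> carr M'"
    then have "f \<in> R ` fsupp X" "g \<in> R' ` fsupp Y" using bij bij' by (simp_all add: bij_betw_def)
    then obtain f' g' where fg: "f = R f'" "f' \<in> fsupp X" "g = R' g'" "g' \<in> fsupp Y" by blast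
    have "prod_fn f g = ?T (prod_fn f' g')" 
      using fg by (simp add: map_right_prod[OF R'] map_left_prod[OF R])
    moreover have "prod_fn f' g' \<in> fsupp (X \<times> Y)" using prod_fn_tens[OF fg(2,4)] by (simp add: tens_fsupp)
    ultimately show "prod_fn f g \<in> ?T ` fsupp (X \<times> Y)" by simp
  qed
  show ?thesis
  proof (rule unitary_modelI[OF unitary_vir_tensor[OF N N']])
    show "linear_between (fsupp (X \<times> Y)) (carr (tensor M M')) ?T" using lin by (simp add: tensor_simps)
    show "bij_betw ?T (fsupp (X \<times> Y)) (carr (tensor M M'))"
      unfolding bij_betw_def tensor_simps using inj surj T2 by auto
  next
    fix F assume F: "F \<in> fsupp (X \<times> Y)"
    have F': "F \<in> tens (fsupp X) (fsupp Y)" using F by (simp add: tens_fsupp)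
    let ?G = "map_right R' F"
    have 1: "map_left (central M) (?T F) = scal c (?T F)"
      using c[OF tens_slice_left[OF W T2[OF F]]] by (auto simp: map_left_def fun_eq_iff fn_apply)
    have 2: "map_right (central M') (?T F) = scal c' (?T F)"
      using c'[OF tens_slice_right[OF W' T2[OF F]]] by (auto simp: map_right_def fun_eq_iff fn_apply)
    show "?T (scal (c + c') F) = central (tensor M M') (?T F)"
      unfolding tensor_simps 1 2 by (rule trans[OF linear_betweenD(3)[OF lin F] scal_add_left])
    fix n
    have mem: "map_left (vir_L N n) F \<in> fsupp (X \<times> Y)" "map_right (vir_L N' n) F \<in> fsupp (X \<times> Y)"
      using linear_betweenD(1)[OF map_left_linear[OF L S, where W = "fsupp Y"], of F n]
        linear_betweenD(1)[OF map_right_linear[OF L' S', where V = "fsupp X"], of F n] F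
      by (simp_all add: tens_fsupp)
    have a: "map_right R' (map_left (vir_L N n) F) = map_left (vir_L N n) ?G"
      by (rule map_left_right_commute[OF L S R' S' F', symmetric])
    have b: "map_left R (map_left (vir_L N n) ?G) = map_left (vir_L M n) (map_left R ?G)"
      using RL[OF tens_slice_left[OF S T1[OF F]]] by (auto simp: map_left_def fun_eq_iff)
    have d: "map_right R' (map_right (vir_L N' n) F) = map_right (vir_L M' n) ?G"
      using RL'[OF tens_slice_right[OF S' F']] by (auto simp: map_right_def fun_eq_iff)
    have e: "map_left R (map_right (vir_L M' n) ?G) = map_right (vir_L M' n) (map_left R ?G)"
      by (rule map_left_right_commute[OF R S virasoro_moduleD(2)[OF V'] W' T1[OF F]])
    show "?T (vir_L (tensor N N') n F) = vir_L (tensor M M') n (?T F)"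
      by (simp only: tensor_simps linear_betweenD(2)[OF lin mem] a b d e)
    let ?H = "map_right (smul s') F"
    have H: "?H \<in> tens (fsupp X) (fsupp Y)"
      using linear_betweenD(1)[OF map_right_linear[OF smul_linear S', where V = "fsupp X"], of F] F'
      by (simp add: tens_fsupp)
    then have H': "?H \<in> fsupp (X \<times> Y)" by (simp add: tens_fsupp)
    have f: "smul (\<lambda>(x, y). s x * s' y) F = map_left (smul s) ?H"
      by (auto simp: smul_def map_left_def map_right_def fun_eq_iff)
    have g: "map_right R' (map_left (smul s) ?H) = map_left (smul s) (map_right R' ?H)"
      by (rule map_left_right_commute[OF smul_linear S R' S' H, symmetric])
    have h: "map_left R (map_left (smul s) (map_right R' ?H)) = map_left (smul \<sigma>) (map_left R (map_right R' ?H))"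
      using Rs[OF tens_slice_left[OF S T1[OF H']]] by (auto simp: map_left_def fun_eq_iff)
    have i: "map_right R' ?H = map_right (smul \<sigma>') ?G"
      using Rs'[OF tens_slice_right[OF S' F']] by (auto simp: map_right_def fun_eq_iff)
    have sl: "linear_between (carr M') UNIV (smul \<sigma>')"
      by (rule linear_betweenI) (auto simp: smul_def fun_eq_iff fn_apply algebra_simps)
    have j: "map_left R (map_right (smul \<sigma>') ?G) = map_right (smul \<sigma>') (map_left R ?G)"
      by (rule map_left_right_commute[OF R S sl W' T1[OF F]])
    show "?T (smul (\<lambda>(x, y). s x * s' y) F) = smul (\<lambda>(x, y). \<sigma> x * \<sigma>' y) (?T F)"
      unfolding f g h unfolding i j by (auto simp: smul_def map_left_def map_right_def fun_eq_iff)
  qed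
qed

text \<open>The isomorphisms of the summands are applied slice by slice.\<close>

lemma unitary_model_dsum:
  assumes I: "finite I" and M: "\<And>i. i \<in> I \<Longrightarrow> unitary_model (M i) (\<sigma> i) (X i) (d i) c (s i)"
  shows "unitary_model (dsum I M) (\<lambda>(i, x). \<sigma> i x) (Sigma I X) (\<lambda>(i, x). d i x) c (\<lambda>(i, x). s i x)"
proof -
  have "\<forall>i\<in>I. \<exists>NR. unitary_vir (fst NR) (X i) (d i) c (s i) \<and> linear_between (fsupp (X i)) (carr (M i)) (snd NR) \<and>
      bij_betw (snd NR) (fsupp (X i)) (carr (M i)) \<and>
      (\<forall>f\<in>fsupp (X i). snd NR (scal c f) = central (M i) (snd NR f) \<and>
         (\<forall>n. snd NR (vir_L (fst NR) n f) = vir_L (M i) n (snd NR f)) \<and>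
         snd NR (smul (s i) f) = smul (\<sigma> i) (snd NR f))"
    using M unfolding unitary_model_def by fastforce
  from bchoice[OF this] obtain NR where "\<forall>i\<in>I. unitary_vir (fst (NR i)) (X i) (d i) c (s i) \<and>
      linear_between (fsupp (X i)) (carr (M i)) (snd (NR i)) \<and>
      bij_betw (snd (NR i)) (fsupp (X i)) (carr (M i)) \<and>
      (\<forall>f\<in>fsupp (X i). snd (NR i) (scal c f) = central (M i) (snd (NR i) f) \<and>
         (\<forall>n. snd (NR i) (vir_L (fst (NR i)) n f) = vir_L (M i) n (snd (NR i) f)) \<and>
         snd (NR i) (smul (s i) f) = smul (\<sigma> i) (snd (NR i) f))" ..
  then obtain N R where
    N: "\<And>i. i \<in> I \<Longrightarrow> unitary_vir (N i) (X i) (d i) c (s i)" and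
    R: "\<And>i. i \<in> I \<Longrightarrow> linear_between (fsupp (X i)) (carr (M i)) (R i)" and
    b: "\<And>i. i \<in> I \<Longrightarrow> bij_betw (R i) (fsupp (X i)) (carr (M i))" and
    Rc: "\<And>i f. i \<in> I \<Longrightarrow> f \<in> fsupp (X i) \<Longrightarrow> R i (scal c f) = central (M i) (R i f)" and
    RL: "\<And>i f n. i \<in> I \<Longrightarrow> f \<in> fsupp (X i) \<Longrightarrow> R i (vir_L (N i) n f) = vir_L (M i) n (R i f)" and
    Rs: "\<And>i f. i \<in> I \<Longrightarrow> f \<in> fsupp (X i) \<Longrightarrow> R i (smul (s i) f) = smul (\<sigma> i) (R i f)"
    by (rule_tac that[of "\<lambda>i. fst (NR i)" "\<lambda>i. snd (NR i)"]) simp_all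
  note U = unitary_vir_dsum[OF I N]
  define T where "T f = (\<lambda>(i, x). if i \<in> I then R i (\<lambda>y. f (i, y)) x else 0)" for f
  have sl: "(\<lambda>x. T f (i, x)) = (if i \<in> I then R i (\<lambda>y. f (i, y)) else 0)" for f i
    by (auto simp: T_def fn_apply)
  have cI: "(\<lambda>x. f (i, x)) \<in> fsupp (X i)" if "f \<in> fsupp (Sigma I X)" "i \<in> I" for f i
    using that by (simp add: fsupp_Sigma[OF I])
  have cO: "(\<lambda>x. f (i, x)) = 0" if "f \<in> fsupp (Sigma I X)" "i \<notin> I" for f i
    using that by (simp add: fsupp_Sigma[OF I] fun_eq_iff fn_apply)
  have eqI: "f = g" if "\<And>i. i \<in> I \<Longrightarrow> (\<lambda>x. f (i, x)) = (\<lambda>x. g (i, x))" "\<And>i x. i \<notin> I \<Longrightarrow> f (i, x) = g (i, x)"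
    for f g :: "('a \<times> 'd) fn"
    by (rule slice_eqI) (metis that)
  have mem: "T f \<in> carr (dsum I M)" if "f \<in> fsupp (Sigma I X)" for f
    using linear_betweenD(1)[OF R] cI[OF that] by (auto simp: dsum_simps sl) (simp add: T_def)
  show ?thesis
  proof (rule unitary_modelI[OF U])
    show "linear_between (fsupp (Sigma I X)) (carr (dsum I M)) T"
    proof (rule linear_betweenI[OF mem])
      fix f g assume f: "f \<in> fsupp (Sigma I X)" and g: "g \<in> fsupp (Sigma I X)"
      show "T (f + g) = T f + T g"
        by (rule slice_eqI) (use cI[OF f] cI[OF g] in \<open>auto simp: sl slice_fn linear_betweenD(2)[OF R]\<close>)
    next
      fix a f assume f: "f \<in> fsupp (Sigma I X)"
      show "T (scal a f) = scal a (T f)"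
        by (rule slice_eqI) (use cI[OF f] in \<open>auto simp: sl slice_fn linear_betweenD(3)[OF R]\<close>)
    qed
    show "bij_betw T (fsupp (Sigma I X)) (carr (dsum I M))"
      unfolding bij_betw_def
    proof
      show "inj_on T (fsupp (Sigma I X))"
      proof (rule inj_onI, rule slice_eqI)
        fix f g i assume f: "f \<in> fsupp (Sigma I X)" and g: "g \<in> fsupp (Sigma I X)" and e: "T f = T g"
        show "(\<lambda>x. f (i, x)) = (\<lambda>x. g (i, x))"
        proof (cases "i \<in> I")
          case True
          then have "R i (\<lambda>y. f (i, y)) = R i (\<lambda>y. g (i, y))" using sl[of f i] sl[of g i] e by simp
          then show ?thesis using bij_betw_imp_inj_on[OF b[OF True]] cI[OF f True] cI[OF g True] by (auto dest: inj_onD)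
        next
          case False
          then show ?thesis using cO[OF f] cO[OF g] by simp
        qed
      qed
      show "T ` fsupp (Sigma I X) = carr (dsum I M)"
      proof
        show "T ` fsupp (Sigma I X) \<subseteq> carr (dsum I M)" using mem by auto
        show "carr (dsum I M) \<subseteq> T ` fsupp (Sigma I X)"
        proof
          fix h assume h: "h \<in> carr (dsum I M)"
          have hI: "(\<lambda>x. h (i, x)) \<in> R i ` fsupp (X i)" if "i \<in> I" for i
            using h b[OF that] that by (auto simp: dsum_simps bij_betw_def)
          define f where "f = (\<lambda>(i, x). if i \<in> I then inv_into (fsupp (X i)) (R i) (\<lambda>x. h (i, x)) x else 0)"
          have fs: "(\<lambda>x. f (i, x)) = inv_into (fsupp (X i)) (R i) (\<lambda>x. h (i, x))" if "i \<in> I" for i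
            using that by (auto simp: f_def)
          have fX: "f \<in> fsupp (Sigma I X)"
            unfolding fsupp_Sigma[OF I] using inv_into_into[OF hI] by (auto simp: fs) (simp add: f_def)
          have "h = T f"
          proof (rule slice_eqI)
            fix i show "(\<lambda>x. h (i, x)) = (\<lambda>x. T f (i, x))"
              using h f_inv_into_f[OF hI, of i] by (auto simp: sl fs dsum_simps fn_apply)
          qed
          with fX show "h \<in> T ` fsupp (Sigma I X)" by auto
        qed
      qed
    qed
  next
    fix f assume f: "f \<in> fsupp (Sigma I X)"
    show "T (scal c f) = central (dsum I M) (T f)"
      by (rule slice_eqI) (use cI[OF f] in \<open>auto simp: sl slice_fn dsum_slice Rc\<close>)
    fix n show "T (vir_L (dsum I N) n f) = vir_L (dsum I M) n (T f)"
      by (rule slice_eqI) (use cI[OF f] in \<open>auto simp: sl slice_fn dsum_slice RL\<close>)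
    have sm: "(\<lambda>y. smul (\<lambda>(i, x). r i x) g (i, y)) = smul (r i) (\<lambda>y. g (i, y))"
      for r :: "'a \<Rightarrow> 'z fn" and i and g :: "('a \<times> 'z) fn"
      by (auto simp: smul_def)
    show "T (smul (\<lambda>(i, x). s i x) f) = smul (\<lambda>(i, x). \<sigma> i x) (T f)"
    proof (rule slice_eqI)
      fix i
      have "smul (\<sigma> i) 0 = 0" by (auto simp: smul_def fun_eq_iff fn_apply)
      then show "(\<lambda>x. T (smul (\<lambda>(i, x). s i x) f) (i, x)) = (\<lambda>x. smul (\<lambda>(i, x). \<sigma> i x) (T f) (i, x))"
        using Rs[OF _ cI[OF f]] by (simp only: sl sm split: if_split) simp
    qed
  qed
qed

lemma unitary_model_dsum2:
  assumes "unitary_model M \<sigma> X d c s" and "unitary_model M' \<sigma>' Y d' c s'"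
  shows "unitary_model (dsum2 M M') (case_sum \<sigma> \<sigma>') (X <+> Y) (case_sum d d') c (case_sum s s')"
proof -
  obtain N R where N: "unitary_vir N X d c s" and R: "linear_between (fsupp X) (carr M) R"
    and bij: "bij_betw R (fsupp X) (carr M)"
    and Rc: "\<And>f. f \<in> fsupp X \<Longrightarrow> R (scal c f) = central M (R f)"
    and RL: "\<And>f n. f \<in> fsupp X \<Longrightarrow> R (vir_L N n f) = vir_L M n (R f)"
    and Rs: "\<And>f. f \<in> fsupp X \<Longrightarrow> R (smul s f) = smul \<sigma> (R f)"
    using assms(1) by (rule unitary_modelE) blast
  obtain N' R' where N': "unitary_vir N' Y d' c s'" and R': "linear_between (fsupp Y) (carr M') R'"
    and bij': "bij_betw R' (fsupp Y) (carr M')"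
    and Rc': "\<And>f. f \<in> fsupp Y \<Longrightarrow> R' (scal c f) = central M' (R' f)"
    and RL': "\<And>f n. f \<in> fsupp Y \<Longrightarrow> R' (vir_L N' n f) = vir_L M' n (R' f)"
    and Rs': "\<And>f. f \<in> fsupp Y \<Longrightarrow> R' (smul s' f) = smul \<sigma>' (R' f)"
    using assms(2) by (rule unitary_modelE) blast
  define T where "T f = case_sum (R (f \<circ> Inl)) (R' (f \<circ> Inr))" for f
  have sl: "T f \<circ> Inl = R (f \<circ> Inl)" "T f \<circ> Inr = R' (f \<circ> Inr)" for f
    by (auto simp: T_def)
  have c: "f \<circ> Inl \<in> fsupp X" "f \<circ> Inr \<in> fsupp Y" if "f \<in> fsupp (X <+> Y)" for f
    using that by (simp_all add: fsupp_Plus)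
  have mem: "T f \<in> carr (dsum2 M M')" if "f \<in> fsupp (X <+> Y)" for f
    using linear_betweenD(1)[OF R c(1)[OF that]] linear_betweenD(1)[OF R' c(2)[OF that]] by (simp add: dsum2_simps sl)
  show ?thesis
  proof (rule unitary_modelI[OF unitary_vir_dsum2[OF N N']])
    show "linear_between (fsupp (X <+> Y)) (carr (dsum2 M M')) T"
    proof (rule linear_betweenI[OF mem])
      fix f g assume f: "f \<in> fsupp (X <+> Y)" and g: "g \<in> fsupp (X <+> Y)"
      show "T (f + g) = T f + T g"
        by (rule sum_eqI) (use c[OF f] c[OF g] in \<open>simp_all add: sl comp_fn linear_betweenD(2)[OF R] linear_betweenD(2)[OF R']\<close>)
    next
      fix a f assume f: "f \<in> fsupp (X <+> Y)"
      show "T (scal a f) = scal a (T f)"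
        by (rule sum_eqI) (use c[OF f] in \<open>simp_all add: sl comp_fn linear_betweenD(3)[OF R] linear_betweenD(3)[OF R']\<close>)
    qed
    show "bij_betw T (fsupp (X <+> Y)) (carr (dsum2 M M'))"
      unfolding bij_betw_def
    proof
      show "inj_on T (fsupp (X <+> Y))"
      proof (rule inj_onI)
        fix f g assume f: "f \<in> fsupp (X <+> Y)" and g: "g \<in> fsupp (X <+> Y)" and e: "T f = T g"
        have "R (f \<circ> Inl) = R (g \<circ> Inl)" "R' (f \<circ> Inr) = R' (g \<circ> Inr)" using sl[of f] sl[of g] e by auto
        then show "f = g"
          using inj_onD[OF bij_betw_imp_inj_on[OF bij] _ c(1)[OF f] c(1)[OF g]]
            inj_onD[OF bij_betw_imp_inj_on[OF bij'] _ c(2)[OF f] c(2)[OF g]] by (intro sum_eqI)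
      qed
      show "T ` fsupp (X <+> Y) = carr (dsum2 M M')"
      proof
        show "T ` fsupp (X <+> Y) \<subseteq> carr (dsum2 M M')" using mem by auto
        show "carr (dsum2 M M') \<subseteq> T ` fsupp (X <+> Y)"
        proof
          fix h assume "h \<in> carr (dsum2 M M')"
          then have "h \<circ> Inl \<in> R ` fsupp X" "h \<circ> Inr \<in> R' ` fsupp Y"
            using bij bij' by (auto simp: dsum2_simps bij_betw_def)
          then obtain f g where fg: "h \<circ> Inl = R f" "f \<in> fsupp X" "h \<circ> Inr = R' g" "g \<in> fsupp Y" by auto
          have e: "case_sum f g \<circ> Inl = f" "case_sum f g \<circ> Inr = g" by auto
          have "h = T (case_sum f g)" by (rule sum_eqI) (simp_all only: sl fg e)
          moreover have "case_sum f g \<in> fsupp (X <+> Y)" unfolding fsupp_Plus e using fg by simp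
          ultimately show "h \<in> T ` fsupp (X <+> Y)" by (rule image_eqI)
        qed
      qed
    qed
  next
    fix f assume f: "f \<in> fsupp (X <+> Y)"
    show "T (scal c f) = central (dsum2 M M') (T f)"
      by (rule sum_eqI) (simp_all only: sl comp_fn dsum2_comp Rc[OF c(1)[OF f]] Rc'[OF c(2)[OF f]])
    fix n show "T (vir_L (dsum2 N N') n f) = vir_L (dsum2 M M') n (T f)"
      by (rule sum_eqI) (simp_all only: sl comp_fn dsum2_comp RL[OF c(1)[OF f]] RL'[OF c(2)[OF f]])
    have sm: "smul (case_sum r r') g \<circ> Inl = smul r (g \<circ> Inl)" "smul (case_sum r r') g \<circ> Inr = smul r' (g \<circ> Inr)"
      for r r' and g :: "('z + 'w) fn"
      by (auto simp: smul_def)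
    show "T (smul (case_sum s s') f) = smul (case_sum \<sigma> \<sigma>') (T f)"
      by (rule sum_eqI) (simp_all only: sl sm Rs[OF c(1)[OF f]] Rs'[OF c(2)[OF f]])
  qed
qed

text \<open>On a summand the orbifold involution may differ from the fermion parity by a global sign.\<close>

lemma unitary_model_sign:
  assumes "unitary_model M \<sigma> X d c s" and e: "e = 1 \<or> e = - 1"
  shows "unitary_model M (\<lambda>x. e * \<sigma> x) X d c (\<lambda>x. e * s x)"
proof -
  obtain N R where *: "unitary_vir N X d c s" "linear_between (fsupp X) (carr M) R" "bij_betw R (fsupp X) (carr M)"
    "\<And>f. f \<in> fsupp X \<Longrightarrow> R (scal c f) = central M (R f)"
    "\<And>f n. f \<in> fsupp X \<Longrightarrow> R (vir_L N n f) = vir_L M n (R f)"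
    and s: "\<And>f. f \<in> fsupp X \<Longrightarrow> R (smul s f) = smul \<sigma> (R f)"
    using assms(1) by (rule unitary_modelE) blast
  have sm: "smul (\<lambda>x. e * r x) f = scal e (smul r f)" for f r :: "'z fn"
    by (auto simp: smul_def fun_eq_iff fn_apply)
  have "unitary_vir N X d c (\<lambda>x. e * s x)"
    unfolding unitary_vir_def
  proof (intro conjI ballI allI)
    fix n f assume f: "f \<in> fsupp X"
    show "vir_L N n (smul (\<lambda>x. e * s x) f) = smul (\<lambda>x. e * s x) (vir_L N n f)"
      unfolding sm linear_betweenD(3)[OF unitary_vir_L[OF *(1)] smul_fsupp[OF f]] unitary_virD(6)[OF *(1) f] ..
  next
    fix x assume "x \<in> X"
    then show "e * s x = 1 \<or> e * s x = - 1" using unitary_virD(7)[OF *(1)] e by fastforce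
  qed (use unitary_virD[OF *(1)] in auto)
  then show ?thesis
  proof (rule unitary_modelI)
    fix f assume f: "f \<in> fsupp X"
    show "R (smul (\<lambda>x. e * s x) f) = smul (\<lambda>x. e * \<sigma> x) (R f)"
      unfolding sm linear_betweenD(3)[OF *(2) smul_fsupp[OF f]] s[OF f] ..
  qed (use * in simp_all)
qed

text \<open>Since the involution is diagonal in the coordinates, the fixed points are spanned by the labels of sign 1.\<close>

lemma unitary_model_fixed:
  assumes "unitary_model M \<sigma> X d c s"
  shows "unitary_model (M\<lparr>carr := {f \<in> carr M. smul \<sigma> f = f}\<rparr>) (\<lambda>_. 1) {x \<in> X. s x = 1} d c (\<lambda>_. 1)"
proof -
  obtain N R where N: "unitary_vir N X d c s" and R: "linear_between (fsupp X) (carr M) R"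
    and bij: "bij_betw R (fsupp X) (carr M)"
    and Rc: "\<And>f. f \<in> fsupp X \<Longrightarrow> R (scal c f) = central M (R f)"
    and RL: "\<And>f n. f \<in> fsupp X \<Longrightarrow> R (vir_L N n f) = vir_L M n (R f)"
    and Rs: "\<And>f. f \<in> fsupp X \<Longrightarrow> R (smul s f) = smul \<sigma> (R f)"
    using assms by (rule unitary_modelE) blast
  note D = unitary_virD[OF N] and L = unitary_vir_L[OF N]
  let ?X = "{x \<in> X. s x = 1}" and ?C = "{f \<in> carr M. smul \<sigma> f = f}"
  have sub: "f \<in> fsupp X" if "f \<in> fsupp ?X" for f using that by (auto simp: fsupp_def)
  have fix_iff: "f \<in> fsupp ?X \<longleftrightarrow> f \<in> fsupp X \<and> smul s f = f" for f
  proof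
    assume f: "f \<in> fsupp ?X"
    have "s x * f x = f x" for x using fsupp_outside[OF f, of x] by (cases "x \<in> ?X") auto
    then show "f \<in> fsupp X \<and> smul s f = f" using sub[OF f] by (auto simp: smul_def)
  next
    assume f: "f \<in> fsupp X \<and> smul s f = f"
    have "s x = 1" if "f x \<noteq> 0" for x
    proof -
      have "s x * f x = f x" using f by (metis smul_def)
      with that show ?thesis by simp
    qed
    with f show "f \<in> fsupp ?X" by (auto simp: fsupp_def)
  qed
  have id: "smul (\<lambda>_. 1) f = f" for f :: "'z fn" by (simp add: smul_def)
  let ?N = "N\<lparr>carr := fsupp ?X\<rparr>"
  have Lfix: "vir_L N n f \<in> fsupp ?X" if "f \<in> fsupp ?X" for n f
  proof -
    have "f \<in> fsupp X" "smul s f = f" using that fix_iff by auto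
    then show ?thesis unfolding fix_iff using linear_betweenD(1)[OF L] D(6)[of f n] by simp
  qed
  note VN = virasoro_moduleD[OF D(2)]
  have "virasoro_module ?N"
    unfolding virasoro_module_def
  proof (intro conjI allI ballI)
    fix n show "linear_between (carr ?N) (carr ?N) (vir_L ?N n)"
      by (rule linear_betweenI) (auto simp: Lfix linear_betweenD(2,3)[OF L] sub)
  next
    show "linear_between (carr ?N) (carr ?N) (central ?N)"
      by (rule linear_betweenI)
        (simp_all add: D(3) sub scal_add scal_scal mult.commute fn.subspace_add[OF subspace_fsupp] fn.subspace_scale[OF subspace_fsupp])
  qed (use VN(4,5) sub D(1) in \<open>simp_all add: subspace_fsupp\<close>)
  then have UN: "unitary_vir ?N ?X d c (\<lambda>_. 1)"
    unfolding unitary_vir_def using D(3,4,5) sub by (simp add: id)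
  have RC: "R f \<in> ?C" if "f \<in> fsupp ?X" for f
  proof -
    have f: "f \<in> fsupp X" "smul s f = f" using that fix_iff by auto
    show ?thesis using linear_betweenD(1)[OF R f(1)] Rs[OF f(1)] f(2) by simp
  qed
  show ?thesis
  proof (rule unitary_modelI[OF UN])
    show "linear_between (fsupp ?X) (carr (M\<lparr>carr := ?C\<rparr>)) R"
      by (rule linear_betweenI) (use RC sub in \<open>simp_all add: linear_betweenD(2,3)[OF R]\<close>)
    show "bij_betw R (fsupp ?X) (carr (M\<lparr>carr := ?C\<rparr>))"
      unfolding bij_betw_def
    proof
      show "inj_on R (fsupp ?X)" by (rule inj_on_subset[OF bij_betw_imp_inj_on[OF bij]]) (use sub in blast)
      have "g \<in> R ` fsupp ?X" if g: "g \<in> ?C" for g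
      proof -
        obtain f where f: "f \<in> fsupp X" "g = R f" using g bij by (auto simp: bij_betw_def)
        have "R (smul s f) = R f" using g f Rs by simp
        then have "smul s f = f"
          by (rule inj_onD[OF bij_betw_imp_inj_on[OF bij] _ smul_fsupp[OF f(1)] f(1)])
        then show ?thesis using f fix_iff by blast
      qed
      then show "R ` fsupp ?X = carr (M\<lparr>carr := ?C\<rparr>)" using RC by auto
    qed
  qed (use Rc RL sub in \<open>simp_all add: smul_def\<close>)
qed

theorem unitary_models_isomorphic:
  assumes "unitary_model M \<sigma> X d c s" and "unitary_model M' \<sigma>' Y d' c s'"
    and "\<And>h. finite {x \<in> X. d x = h}" "\<And>h. finite {y \<in> Y. d' y = h}"
    and "\<And>h. card {x \<in> X. d x = h} = card {y \<in> Y. d' y = h}"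
  shows "virasoro_isomorphic M M'"
proof -
  obtain N R where N: "unitary_vir N X d c s" and R: "linear_between (fsupp X) (carr M) R"
    and bij: "bij_betw R (fsupp X) (carr M)"
    and Rc: "\<And>f. f \<in> fsupp X \<Longrightarrow> R (scal c f) = central M (R f)"
    and RL: "\<And>f n. f \<in> fsupp X \<Longrightarrow> R (vir_L N n f) = vir_L M n (R f)"
    and V: "virasoro_module M"
    using assms(1) by (rule unitary_modelE) blast
  obtain N' R' where N': "unitary_vir N' Y d' c s'" and R': "linear_between (fsupp Y) (carr M') R'"
    and bij': "bij_betw R' (fsupp Y) (carr M')"
    and Rc': "\<And>f. f \<in> fsupp Y \<Longrightarrow> R' (scal c f) = central M' (R' f)"
    and RL': "\<And>f n. f \<in> fsupp Y \<Longrightarrow> R' (vir_L N' n f) = vir_L M' n (R' f)"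
    and V': "virasoro_module M'"
    using assms(2) by (rule unitary_modelE) blast
  note D = unitary_virD[OF N] and D' = unitary_virD[OF N']
  interpret unitary_pair N N' X Y d d' c s s' by unfold_locales (use N N' assms(3-5) in auto)
  obtain T where T: "linear_between (fsupp X) (fsupp Y) T" and bT: "bij_betw T (fsupp X) (fsupp Y)"
    and TL: "\<And>f n. f \<in> fsupp X \<Longrightarrow> T (vir_L N n f) = vir_L N' n (T f)"
    using isomorphic unfolding virasoro_isomorphic_def D(1) D'(1) by blast
  let ?I = "inv_into (fsupp X) R"
  have im: "R ` fsupp X = carr M" and inj: "inj_on R (fsupp X)" using bij by (auto simp: bij_betw_def)
  have IR: "?I (R f) = f" if "f \<in> fsupp X" for f by (rule inv_into_f_f[OF inj that])
  define Q where "Q g = R' (T (?I g))" for g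
  have QR: "Q (R f) = R' (T f)" if "f \<in> fsupp X" for f by (simp add: Q_def IR[OF that])
  have TX: "T f \<in> fsupp Y" if "f \<in> fsupp X" for f by (rule linear_betweenD(1)[OF T that])
  have ex: "\<exists>f. f \<in> fsupp X \<and> g = R f" if "g \<in> carr M" for g using that im by blast
  have cl: "f + g \<in> fsupp X" "scal a f \<in> fsupp X" if "f \<in> fsupp X" "g \<in> fsupp X" for f g a
    using that by (auto intro: fn.subspace_add[OF subspace_fsupp] fn.subspace_scale[OF subspace_fsupp])
  have "linear_between (carr M) (carr M') Q"
  proof (rule linear_betweenI)
    fix g assume "g \<in> carr M"
    with ex obtain f where f: "f \<in> fsupp X" "g = R f" by blast
    show "Q g \<in> carr M'" unfolding f(2) QR[OF f(1)] by (rule linear_betweenD(1)[OF R' TX[OF f(1)]])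
    fix a
    have "Q (scal a g) = Q (R (scal a f))" by (simp add: f linear_betweenD(3)[OF R])
    also have "\<dots> = scal a (Q g)"
      using f by (simp add: QR cl[of f f] linear_betweenD(3)[OF T] linear_betweenD(3)[OF R'] TX)
    finally show "Q (scal a g) = scal a (Q g)" .
    fix g' assume "g' \<in> carr M"
    with ex obtain f' where f': "f' \<in> fsupp X" "g' = R f'" by blast
    have "Q (g + g') = Q (R (f + f'))" by (simp add: f f' linear_betweenD(2)[OF R])
    also have "\<dots> = Q g + Q g'"
      using f f' by (simp add: QR cl linear_betweenD(2)[OF T] linear_betweenD(2)[OF R'] TX)
    finally show "Q (g + g') = Q g + Q g'" .
  qed
  moreover have "bij_betw Q (carr M) (carr M')"
    using bij_betw_trans[OF bij_betw_inv_into[OF bij] bij_betw_trans[OF bT bij']]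
    by (simp add: Q_def[abs_def] comp_def)
  moreover have "Q (central M g) = central M' (Q g) \<and> (\<forall>n. Q (vir_L M n g) = vir_L M' n (Q g))" if "g \<in> carr M" for g
  proof -
    from that ex obtain f where f: "f \<in> fsupp X" "g = R f" by blast
    have "Q (central M g) = R' (T (scal c f))" using f by (simp add: Rc[symmetric] QR cl[of f f])
    also have "\<dots> = central M' (Q g)" using f by (simp add: linear_betweenD(3)[OF T] Rc' TX QR)
    finally have 1: "Q (central M g) = central M' (Q g)" .
    have 2: "Q (vir_L M n g) = vir_L M' n (Q g)" for n
      using f linear_betweenD(1)[OF unitary_vir_L[OF N] f(1), of n] by (simp add: RL[symmetric] QR TL RL' TX)
    show ?thesis using 1 2 by simp
  qed
  ultimately show ?thesis unfolding virasoro_isomorphic_def using V V' by blast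
qed

section \<open>Virasoro relations from primary fields\<close>

text \<open>In a module generated from vacuum vectors by the modes \<open>a i j\<close> of primary fields, which $L(n)$
  shifts by $n$, the defect $[L(m),L(n)]-(m-n)L(m+n)$ commutes with all modes.  It therefore acts on a
  vacuum by a scalar, and vanishes if that scalar is zero.  Only the central term is left to compute,
  on the vacuum.\<close>

locale primary_fields =
  fixes X :: "'x set" and L :: "int \<Rightarrow> 'x fn \<Rightarrow> 'x fn" and I :: "'i set" and a :: "'i \<Rightarrow> int \<Rightarrow> 'x fn \<Rightarrow> 'x fn"
    and \<alpha> :: "int \<Rightarrow> 'i \<Rightarrow> int \<Rightarrow> complex" and Vac :: "'x set" and w :: "'x \<Rightarrow> complex" and sz :: "'x \<Rightarrow> nat" and c :: complex
  assumes L: "linear_between (fsupp X) (fsupp X) (L n)"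
    and a: "i \<in> I \<Longrightarrow> linear_between (fsupp X) (fsupp X) (a i j)"
    and primary: "i \<in> I \<Longrightarrow> f \<in> fsupp X \<Longrightarrow> L n (a i j f) = a i j (L n f) + scal (\<alpha> n i j) (a i (j + n) f)"
    and cocycle: "i \<in> I \<Longrightarrow> \<alpha> n i j * \<alpha> m i (j + n) - \<alpha> m i j * \<alpha> n i (j + m) = of_int (m - n) * \<alpha> (m + n) i j"
    and Vac: "Vac \<subseteq> X"
    and generate: "x \<in> X \<Longrightarrow> x \<notin> Vac \<Longrightarrow> \<exists>i\<in>I. \<exists>j k y. y \<in> X \<and> sz y < sz x \<and>
        unit_fn x = scal k (a i j (unit_fn y)) \<and> w x = w y + \<alpha> 0 i j"
    and L0_vac: "v \<in> Vac \<Longrightarrow> L 0 (unit_fn v) = scal (w v) (unit_fn v)"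
    and commutant: "v \<in> Vac \<Longrightarrow> linear_between (fsupp X) (fsupp X) T \<Longrightarrow>
        (\<And>i j f. i \<in> I \<Longrightarrow> f \<in> fsupp X \<Longrightarrow> T (a i j f) = a i j (T f)) \<Longrightarrow>
        T (unit_fn v) = scal (T (unit_fn v) v) (unit_fn v)"
    and vac_diag: "v \<in> Vac \<Longrightarrow> n \<noteq> 0 \<Longrightarrow> L n (unit_fn v) v = 0"
    and vac_pos: "v \<in> Vac \<Longrightarrow> n > 0 \<Longrightarrow> L n (unit_fn v) = 0"
    and vac_central: "v \<in> Vac \<Longrightarrow> n > 0 \<Longrightarrow>
        L n (L (- n) (unit_fn v)) v = 2 * of_int n * w v + of_int (n ^ 3 - n) / 12 * c"
begin

lemmas Ll = linear_betweenD[OF L]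
lemmas al = linear_betweenD[OF a]

lemma L0: "f \<in> fsupp X \<Longrightarrow> L 0 f = smul w f"
proof (rule linear_fsupp_eqI[OF L smul_linear])
  fix x assume "x \<in> X"
  then show "L 0 (unit_fn x) = smul w (unit_fn x)"
  proof (induction "sz x" arbitrary: x rule: less_induct)
    case less
    have sm: "smul w (unit_fn z) = scal (w z) (unit_fn z)" for z
      by (auto simp: smul_def unit_fn_def fun_eq_iff fn_apply)
    show ?case
    proof (cases "x \<in> Vac")
      case True then show ?thesis using L0_vac sm by simp
    next
      case False
      then obtain i j k y where *: "i \<in> I" "y \<in> X" "sz y < sz x" "unit_fn x = scal k (a i j (unit_fn y))" "w x = w y + \<alpha> 0 i j"
        using generate[OF less.prems] by blast
      have u: "unit_fn y \<in> fsupp X" using *(2) by (rule unit_fn_fsupp)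
      have au: "a i j (unit_fn y) \<in> fsupp X" by (rule al(1)[OF *(1) u])
      have "L 0 (unit_fn y) = scal (w y) (unit_fn y)" using less.hyps[OF *(3) *(2)] sm by simp
      then have "L 0 (a i j (unit_fn y)) = scal (w x) (a i j (unit_fn y))"
        using primary[OF *(1) u, of 0 j] by (simp add: al(3)[OF *(1) u] *(5) scal_add_left)
      then show ?thesis unfolding sm by (simp add: *(4) Ll(3)[OF au] scal_scal mult.commute)
    qed
  qed
qed

definition defect :: "int \<Rightarrow> int \<Rightarrow> 'x fn \<Rightarrow> 'x fn" where
  "defect m n f = (L m (L n f) - L n (L m f)) -
     (scal (of_int (m - n)) (L (m + n) f) + scal (if m + n = 0 then of_int (m ^ 3 - m) / 12 * c else 0) f)"

lemma defect_linear: "linear_between (fsupp X) (fsupp X) (defect m n)"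
  unfolding defect_def[abs_def]
  by (intro linear_between_sub linear_between_add linear_between_scal subspace_fsupp L
      linear_between_comp[OF L L] linear_between_scal[where S = "\<lambda>f. f"]) (auto simp: linear_between_def)

text \<open>This is where the cocycle condition on the shift coefficients enters: the shifts of a mode by the
  two sides of the Virasoro relation agree.\<close>

lemma defect_commutes:
  assumes i: "i \<in> I" and f: "f \<in> fsupp X"
  shows "defect m n (a i j f) = a i j (defect m n f)"
proof -
  note P = primary[OF i] and A = al[OF i]
  note mem = Ll(1)[OF f] A(1)[OF f] Ll(1)[OF Ll(1)[OF f]] A(1)[OF Ll(1)[OF f]]
  have sc: "scal b (a i k f) \<in> fsupp X" for b k by (intro fn.subspace_scale[OF subspace_fsupp] mem)
  have LL: "L m (L n (a i j f)) = a i j (L m (L n f)) + scal (\<alpha> m i j) (a i (j + m) (L n f))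
      + scal (\<alpha> n i j) (a i (j + n) (L m f)) + scal (\<alpha> n i j * \<alpha> m i (j + n)) (a i (j + m + n) f)" for m n
    unfolding P[OF f, of n]
    by (simp only: Ll(2)[OF mem(4) sc] Ll(3)[OF mem(2)] P[OF f] P[OF mem(1)] scal_add scal_scal add_ac)
  have R: "a i j (defect m n f) = (a i j (L m (L n f)) - a i j (L n (L m f))) -
     (scal (of_int (m - n)) (a i j (L (m + n) f)) + scal (if m + n = 0 then of_int (m ^ 3 - m) / 12 * c else 0) (a i j f))"
    unfolding defect_def
    by (simp only: linear_between_diff[OF a[OF i] subspace_fsupp] A(2) A(3) mem f
        fn.subspace_diff[OF subspace_fsupp] fn.subspace_add[OF subspace_fsupp] fn.subspace_scale[OF subspace_fsupp])
  have "defect m n (a i j f) - a i j (defect m n f) =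
     scal (\<alpha> n i j * \<alpha> m i (j + n) - \<alpha> m i j * \<alpha> n i (j + m) - of_int (m - n) * \<alpha> (m + n) i j) (a i (j + m + n) f)"
    unfolding R unfolding defect_def LL P[OF f, of "m + n"]
    by (auto simp: fun_eq_iff fn_apply algebra_simps)
  then show ?thesis using cocycle[OF i, of n j m] by simp
qed

text \<open>An operator commuting with all modes is determined by its values on the vacuum vectors, which it
  multiplies by a scalar.\<close>

lemma defect_zero:
  assumes vac: "\<And>v. v \<in> Vac \<Longrightarrow> defect m n (unit_fn v) v = 0" and f: "f \<in> fsupp X"
  shows "defect m n f = 0"
proof -
  have z: "linear_between (fsupp X) (fsupp X) (\<lambda>_. 0)"
    by (rule linear_betweenI) (auto simp: fn.subspace_0[OF subspace_fsupp])
  have "defect m n (unit_fn x) = 0" if "x \<in> X" for x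
    using that
  proof (induction "sz x" arbitrary: x rule: less_induct)
    case less
    show ?case
    proof (cases "x \<in> Vac")
      case True
      have "defect m n (unit_fn x) = scal (defect m n (unit_fn x) x) (unit_fn x)"
        by (rule commutant[OF True defect_linear defect_commutes])
      also have "\<dots> = 0" by (simp add: vac[OF True])
      finally show ?thesis .
    next
      case False
      then obtain i j k y where *: "i \<in> I" "y \<in> X" "sz y < sz x" "unit_fn x = scal k (a i j (unit_fn y))"
        using generate[OF less.prems] by blast
      have u: "unit_fn y \<in> fsupp X" using *(2) by (rule unit_fn_fsupp)
      have "defect m n (unit_fn x) = scal k (a i j (defect m n (unit_fn y)))"
        using linear_betweenD(3)[OF defect_linear al(1)[OF *(1) u]] defect_commutes[OF *(1) u] *(4) by simp
      then show ?thesis using less.hyps[OF *(3) *(2)] linear_between_0[OF a[OF *(1)] subspace_fsupp] by simp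
    qed
  qed
  then show ?thesis using linear_fsupp_eqI[OF defect_linear z _ f] by simp
qed

lemma L0_Ln: "f \<in> fsupp X \<Longrightarrow> L 0 (L n f) = L n (L 0 f) + scal (of_int (- n)) (L n f)"
proof -
  assume f: "f \<in> fsupp X"
  have "defect 0 n f = 0"
  proof (rule defect_zero[OF _ f])
    fix v assume v: "v \<in> Vac"
    have u: "unit_fn v \<in> fsupp X" by (rule unit_fn_fsupp[OF subsetD[OF Vac v]])
    show "defect 0 n (unit_fn v) v = 0"
      unfolding defect_def fn_apply L0_vac[OF v] Ll(3)[OF u] L0[OF Ll(1)[OF u]]
      using vac_diag[OF v, of n] by (cases "n = 0") (auto simp: smul_def)
  qed
  then show ?thesis by (auto simp: defect_def algebra_simps)
qed

text \<open>For $m+n\neq 0$ the defect changes the weight, so that the scalar on the vacuum is zero.  For $m+n=0$ it is the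
  central term.\<close>

theorem virasoro_relation:
  assumes f: "f \<in> fsupp X"
  shows "L m (L n f) - L n (L m f) =
    scal (of_int (m - n)) (L (m + n) f) + (if m + n = 0 then scal (of_int (m ^ 3 - m) / 12) (scal c f) else 0)"
proof -
  have "defect m n f = 0"
  proof (rule defect_zero[OF _ f])
    fix v assume v: "v \<in> Vac"
    have u: "unit_fn v \<in> fsupp X" by (rule unit_fn_fsupp[OF subsetD[OF Vac v]])
    show "defect m n (unit_fn v) v = 0"
    proof (cases "m + n = 0")
      case False
      have "L m (L n (unit_fn v)) v = 0" if "m + n \<noteq> 0" for m n
      proof -
        note mem = Ll(1)[OF u, of n]
        have "L 0 (L m (L n (unit_fn v))) = scal (w v - of_int n - of_int m) (L m (L n (unit_fn v)))"
        proof -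
          have "L 0 (L n (unit_fn v)) = scal (w v - of_int n) (L n (unit_fn v))"
            by (simp add: L0_Ln[OF u, of n] L0_vac[OF v] Ll(3)[OF u] fn.scale_left_diff_distrib)
          then show ?thesis
            by (simp only: L0_Ln[OF mem, of m] Ll(3)[OF mem]) (simp add: fn.scale_left_diff_distrib)
        qed
        moreover have "L 0 (L m (L n (unit_fn v))) v = w v * L m (L n (unit_fn v)) v"
          by (simp add: L0[OF Ll(1)[OF mem]] smul_def)
        ultimately have "w v * L m (L n (unit_fn v)) v = (w v - of_int n - of_int m) * L m (L n (unit_fn v)) v"
          by (simp only: scal_apply)
        then have "(of_int (m + n) :: complex) * L m (L n (unit_fn v)) v = 0"
          by (simp add: algebra_simps)
        then show ?thesis using that by (simp only: mult_eq_0_iff of_int_eq_0_iff) simp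
      qed
      from this[of m n] this[of n m] show ?thesis
        using False vac_diag[OF v, of "m + n"] by (simp add: defect_def fn_apply add.commute)
    next
      case True
      then have n: "n = - m" by simp
      have pos: "L k (unit_fn v) = 0" "L k (L (- k) (unit_fn v)) v = 2 * of_int k * w v + of_int (k ^ 3 - k) / 12 * c"
        if "k > 0" for k
        using vac_pos[OF v that] vac_central[OF v that] by auto
      have uv: "unit_fn v v = (1 :: complex)" by (simp add: unit_fn_def)
      have L00: "L 0 (unit_fn v) v = w v" by (simp add: L0_vac[OF v] fn_apply uv)
      have Lz: "L k 0 = 0" for k by (rule linear_between_0[OF L subspace_fsupp])
      consider "m = 0" | "m > 0" | "m < 0" by linarith
      then show ?thesis
      proof cases
        case 1 then show ?thesis by (simp add: defect_def n fn_apply)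
      next
        case 2 then show ?thesis by (simp add: defect_def n fn_apply pos Lz L00 uv)
      next
        case 3
        then have "L (- m) (unit_fn v) = 0" "L (- m) (L m (unit_fn v)) v = 2 * of_int (- m) * w v + of_int ((- m) ^ 3 - (- m)) / 12 * c"
          using pos[of "- m"] by auto
        then show ?thesis by (simp add: defect_def n fn_apply Lz L00 uv algebra_simps diff_divide_distrib)
      qed
    qed
  qed
  then have "L m (L n f) - L n (L m f) =
     scal (of_int (m - n)) (L (m + n) f) + scal (if m + n = 0 then of_int (m ^ 3 - m) / 12 * c else 0) f"
    by (simp add: defect_def)
  then show ?thesis by (auto simp: scal_scal)
qed

theorem virasoro_module: "virasoro_module \<lparr>carr = fsupp X, vir_L = L, central = scal c\<rparr>"
  unfolding virasoro_module_def
proof (intro conjI allI ballI)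
  have "linear_between (fsupp X) (fsupp X) (scal c)"
    by (rule linear_betweenI) (auto simp: fn.subspace_scale[OF subspace_fsupp] scal_add scal_scal mult.commute)
  then show "linear_between (carr \<lparr>carr = fsupp X, vir_L = L, central = scal c\<rparr>) (carr \<lparr>carr = fsupp X, vir_L = L, central = scal c\<rparr>)
     (central \<lparr>carr = fsupp X, vir_L = L, central = scal c\<rparr>)" by simp
qed (use virasoro_relation L in \<open>simp_all add: subspace_fsupp Ll(3)\<close>)

end

section \<open>Exterior multiplication and contraction\<close>

lemma fsum_eq:
  assumes "finite A" "\<And>k. k \<notin> A \<Longrightarrow> t k = 0" shows "fsum t = (\<Sum>k\<in>A. t k)"
  unfolding fsum_def by (rule sum.mono_neutral_left) (use assms in auto)

definition before :: "'n::linorder \<times> int \<Rightarrow> 'n \<times> int \<Rightarrow> bool" where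
  "before t s \<longleftrightarrow> snd t < snd s \<or> (snd t = snd s \<and> fst t < fst s)"

lemma before_cases: "s \<noteq> t \<Longrightarrow> before s t = (\<not> before t s)"
  unfolding before_def by (cases s; cases t) auto

lemma before_irrefl [simp]: "\<not> before s s"
  by (simp add: before_def)

lemma before_trans: "before s t \<Longrightarrow> before t u \<Longrightarrow> before s u"
  by (auto simp: before_def)

lemma koszul_sign_before: "koszul_sign s S = (- 1) ^ card {t \<in> S. before t s}"
  by (simp add: koszul_sign_def before_def)

text \<open>A new element changes the sign exactly when it has to be passed.\<close>

lemma koszul_sign_insert:
  assumes "finite S" "t \<notin> S"
  shows "koszul_sign s (insert t S) = (if before t s then - koszul_sign s S else koszul_sign s S)"
proof -
  have "{u \<in> insert t S. before u s} = (if before t s then insert t {u \<in> S. before u s} else {u \<in> S. before u s})"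
    by auto
  then show ?thesis using assms by (simp add: koszul_sign_before)
qed

lemma koszul_sign_remove:
  assumes "finite S" "t \<in> S"
  shows "koszul_sign s (S - {t}) = (if before t s then - koszul_sign s S else koszul_sign s S)"
  using koszul_sign_insert[of "S - {t}" t s] assms by (simp add: insert_absorb)

lemma koszul_sign_sq [simp]: "koszul_sign s S * koszul_sign s S = 1"
  by (simp add: koszul_sign_def flip: power_mult_distrib)

lemma koszul_sign_sq' [simp]: "koszul_sign s S * (koszul_sign s S * x) = x"
  by (simp flip: mult.assoc)

lemma koszul_sign_cnj [simp]: "cnj (koszul_sign s S) = koszul_sign s S"
  by (simp add: koszul_sign_def)

abbreviation fin_sets :: "'a set set" where "fin_sets \<equiv> {S. finite S}"

lemma infinite_zero: "f \<in> fsupp fin_sets \<Longrightarrow> infinite S \<Longrightarrow> f S = 0"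
  by (auto dest: fsupp_outside)

lemma wedge_wedge:
  assumes "f \<in> fsupp fin_sets"
  shows "wedge_basis s (wedge_basis t f) = - wedge_basis t (wedge_basis s f)"
proof
  fix S show "wedge_basis s (wedge_basis t f) S = (- wedge_basis t (wedge_basis s f)) S"
  proof (cases "finite S \<and> s \<in> S \<and> t \<in> S \<and> s \<noteq> t")
    case True
    then show ?thesis using before_cases[of s t]
      by (auto simp: wedge_basis_def fn_apply koszul_sign_remove insert_commute Diff_insert2[symmetric] Diff_insert[symmetric])
  next
    case False
    then show ?thesis using infinite_zero[OF assms, of "S - {s} - {t}"] infinite_zero[OF assms, of "S - {t} - {s}"]
      by (auto simp: wedge_basis_def fn_apply)
  qed
qed

lemma contract_contract:
  assumes "f \<in> fsupp fin_sets"
  shows "contract_basis s (contract_basis t f) = - contract_basis t (contract_basis s f)"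
proof
  fix S show "contract_basis s (contract_basis t f) S = (- contract_basis t (contract_basis s f)) S"
  proof (cases "finite S \<and> s \<notin> S \<and> t \<notin> S \<and> s \<noteq> t")
    case True
    then show ?thesis using before_cases[of s t]
      by (auto simp: contract_basis_def fn_apply koszul_sign_insert insert_commute)
  next
    case False
    then show ?thesis using infinite_zero[OF assms, of "insert s (insert t S)"]
      by (auto simp: contract_basis_def fn_apply insert_commute)
  qed
qed

lemma contract_wedge:
  assumes "f \<in> fsupp fin_sets"
  shows "contract_basis s (wedge_basis t f) = (if s = t then f else 0) - wedge_basis t (contract_basis s f)"
proof
  fix S show "contract_basis s (wedge_basis t f) S = ((if s = t then f else 0) - wedge_basis t (contract_basis s f)) S"
  proof (cases "finite S")
    case True
    show ?thesis
    proof (cases "s = t")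
      case True
      have "koszul_sign t (insert t S) = koszul_sign t S" if "t \<notin> S"
        using koszul_sign_insert[OF \<open>finite S\<close> that, of t] by simp
      moreover have "koszul_sign t (S - {t}) = koszul_sign t S" if "t \<in> S"
        using koszul_sign_remove[OF \<open>finite S\<close> that, of t] by simp
      ultimately show ?thesis using True
        by (auto simp: contract_basis_def wedge_basis_def fn_apply insert_absorb)
    next
      case False
      have "insert s S - {t} = insert s (S - {t})" using False by auto
      with False show ?thesis using before_cases[of s t] \<open>finite S\<close>
        by (auto simp: contract_basis_def wedge_basis_def fn_apply koszul_sign_insert koszul_sign_remove)
    qed
  next
    case False
    then show ?thesis using infinite_zero[OF assms, of "insert s S - {t}"] infinite_zero[OF assms, of "insert s (S - {t})"]
        infinite_zero[OF assms, of S]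
      by (auto simp: contract_basis_def wedge_basis_def fn_apply)
  qed
qed

lemma wedge_fsupp:
  assumes "f \<in> fsupp X" "\<And>S. S \<in> X \<Longrightarrow> insert s S \<in> X"
  shows "wedge_basis s f \<in> fsupp X"
proof (rule fsuppI)
  show "finite (insert s ` {S. f S \<noteq> 0})" using fsuppD(1)[OF assms(1)] by simp
  show "wedge_basis s f S = 0" if "S \<notin> insert s ` {S. f S \<noteq> 0}" for S
  proof (rule ccontr)
    assume "wedge_basis s f S \<noteq> 0"
    then have "f (S - {s}) \<noteq> 0" "S = insert s (S - {s})" by (auto simp: wedge_basis_def split: if_splits)
    with that show False by blast
  qed
  show "wedge_basis s f S = 0" if "S \<notin> X" for S
  proof (rule ccontr)
    assume "wedge_basis s f S \<noteq> 0"
    then have "f (S - {s}) \<noteq> 0" "S = insert s (S - {s})" by (auto simp: wedge_basis_def split: if_splits)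
    with that assms(2)[OF fsuppD(2)[OF assms(1)]] show False by metis
  qed
qed

lemma contract_fsupp:
  assumes "f \<in> fsupp X" "\<And>S. S \<in> X \<Longrightarrow> S - {s} \<in> X"
  shows "contract_basis s f \<in> fsupp X"
proof (rule fsuppI)
  show "finite ((\<lambda>S. S - {s}) ` {S. f S \<noteq> 0})" using fsuppD(1)[OF assms(1)] by simp
  show "contract_basis s f S = 0" if "S \<notin> (\<lambda>S. S - {s}) ` {S. f S \<noteq> 0}" for S
  proof (rule ccontr)
    assume "contract_basis s f S \<noteq> 0"
    then have "f (insert s S) \<noteq> 0" "S = insert s S - {s}" by (auto simp: contract_basis_def split: if_splits)
    with that show False by blast
  qed
  show "contract_basis s f S = 0" if "S \<notin> X" for S
  proof (rule ccontr)
    assume "contract_basis s f S \<noteq> 0"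
    then have "f (insert s S) \<noteq> 0" "S = insert s S - {s}" by (auto simp: contract_basis_def split: if_splits)
    with that assms(2)[OF fsuppD(2)[OF assms(1)]] show False by metis
  qed
qed

lemma wedge_contract_algebra:
  "wedge_basis s (f + g) = wedge_basis s f + wedge_basis s g" "wedge_basis s (scal k f) = scal k (wedge_basis s f)"
  "contract_basis s (f + g) = contract_basis s f + contract_basis s g"
  "contract_basis s (scal k f) = scal k (contract_basis s f)"
  by (auto simp: wedge_basis_def contract_basis_def fun_eq_iff fn_apply algebra_simps)

text \<open>In the basis of monomials, left multiplication and contraction by the same element are transposes.\<close>

lemma ip_wedge:
  assumes f: "f \<in> fsupp fin_sets" and g: "g \<in> fsupp fin_sets"
  shows "ip (wedge_basis s f) g = ip f (contract_basis s g)"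
proof -
  let ?B = "{S. f S \<noteq> 0 \<and> s \<notin> S}"
  have fin: "finite ?B" using fsuppD(1)[OF f] by (rule finite_subset[rotated]) auto
  have inj: "inj_on (insert s) ?B" by (auto simp: inj_on_def)
  have "ip (wedge_basis s f) g = (\<Sum>S\<in>insert s ` ?B. cnj (wedge_basis s f S) * g S)"
  proof (rule ip_eq)
    fix S assume "S \<notin> insert s ` ?B"
    then have "\<not> (s \<in> S \<and> f (S - {s}) \<noteq> 0)" using insert_Diff[of s S] by blast
    then show "wedge_basis s f S = 0 \<or> g S = 0" by (auto simp: wedge_basis_def)
  qed (use fin in simp)
  also have "\<dots> = (\<Sum>S\<in>?B. cnj (f S) * contract_basis s g S)"
    unfolding sum.reindex[OF inj]
  proof (rule sum.cong)
    fix S assume S: "S \<in> ?B"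
    then have "finite S" using fsuppD(2)[OF f, of S] by auto
    then have "koszul_sign s (insert s S) = koszul_sign s S" using koszul_sign_insert[of S s s] S by simp
    then show "((\<lambda>S. cnj (wedge_basis s f S) * g S) \<circ> insert s) S = cnj (f S) * contract_basis s g S"
      using S by (simp add: wedge_basis_def contract_basis_def)
  qed simp
  also have "\<dots> = ip f (contract_basis s g)"
    by (rule ip_eq[symmetric]) (use fin in \<open>auto simp: contract_basis_def\<close>)
  finally show ?thesis .
qed

lemma ip_contract:
  assumes f: "f \<in> fsupp fin_sets" and g: "g \<in> fsupp fin_sets"
  shows "ip (contract_basis s f) g = ip f (wedge_basis s g)"
  using ip_wedge[OF g f, of s] ip_cnj[of "wedge_basis s g" f] ip_cnj[of g "contract_basis s f"] by simp

definition parity :: "'a set fn" where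
  "parity S = (- 1) ^ card S"

lemma parity_wedge:
  assumes "f \<in> fsupp fin_sets"
  shows "wedge_basis s (smul parity f) = - smul parity (wedge_basis s f)"
proof
  fix S show "wedge_basis s (smul parity f) S = (- smul parity (wedge_basis s f)) S"
  proof (cases "finite S \<and> s \<in> S")
    case True
    then have "card S = Suc (card (S - {s}))" by (metis card.remove)
    then have "parity S = - parity (S - {s})" by (simp add: parity_def)
    with True show ?thesis by (simp add: wedge_basis_def smul_def fn_apply)
  next
    case False
    then show ?thesis using infinite_zero[OF assms, of "S - {s}"] by (auto simp: wedge_basis_def smul_def fn_apply)
  qed
qed

lemma parity_contract:
  assumes "f \<in> fsupp fin_sets"
  shows "contract_basis s (smul parity f) = - smul parity (contract_basis s f)"
proof
  fix S show "contract_basis s (smul parity f) S = (- smul parity (contract_basis s f)) S"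
  proof (cases "finite S \<and> s \<notin> S")
    case True
    then have "parity (insert s S) = - parity S" by (simp add: parity_def)
    with True show ?thesis by (simp add: contract_basis_def smul_def fn_apply)
  next
    case False
    then show ?thesis using infinite_zero[OF assms, of "insert s S"] by (auto simp: contract_basis_def smul_def fn_apply)
  qed
qed

lemma ip_sum_left: "g \<in> fsupp X \<Longrightarrow> ip (\<Sum>a\<in>A. f a) g = (\<Sum>a\<in>A. ip (f a) g)"
  by (induction A rule: infinite_finite_induct) (simp_all add: ip_add_left ip_zero)

lemma ip_sum_right: "f \<in> fsupp X \<Longrightarrow> ip f (\<Sum>a\<in>A. g a) = (\<Sum>a\<in>A. ip f (g a))"
  by (induction A rule: infinite_finite_induct) (simp_all add: ip_add_right ip_zero)

section \<open>Charged fermions\<close>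

text \<open>The standard Fock space of \<open>m\<close> pairs of charged fermions.  A label is a finite set of modes
  \<open>(i, j)\<close> at which the state differs from the vacuum: \<open>\<psi> i j\<close> creates for \<open>j < 0\<close> and annihilates for
  \<open>j \<ge> 0\<close>, and \<open>\<psi>' i j\<close> is its adjoint.  The mode number \<open>\<kappa> j\<close> is twice the energy; it is odd in the
  untwisted and even in the twisted sector.\<close>

locale fermions =
  fixes m :: nat and tw :: bool
  assumes even_m: "even m"
begin

definition \<kappa> :: "int \<Rightarrow> int" where
  "\<kappa> j = (if tw then 2 * j + 2 else 2 * j + 1)"

definition labels :: "nat modes set" where
  "labels = {S. finite S \<and> fst ` S \<subseteq> {..<m}}"

definition \<psi> :: "nat \<Rightarrow> int \<Rightarrow> nat modes fn \<Rightarrow> nat modes fn" where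
  "\<psi> i j = (if j < 0 then wedge_basis (i, j) else contract_basis (i, j))"

definition \<psi>' :: "nat \<Rightarrow> int \<Rightarrow> nat modes fn \<Rightarrow> nat modes fn" where
  "\<psi>' i j = (if j < 0 then contract_basis (i, j) else wedge_basis (i, j))"

text \<open>The normally ordered product of \<open>\<psi> i p\<close> and \<open>\<psi>' i q\<close>.\<close>

definition no :: "nat \<Rightarrow> int \<Rightarrow> int \<Rightarrow> nat modes fn \<Rightarrow> nat modes fn" where
  "no i p q f = \<psi> i p (\<psi>' i q f) - (if p = q \<and> p \<ge> 0 then f else 0)"

definition coef :: "int \<Rightarrow> int \<Rightarrow> complex" where
  "coef n j = of_int (n - \<kappa> j) / 2"

text \<open>The weight of the vacuum: $\frac1{16}$ for each of the \<open>2 * m\<close> real fermions in the twisted sector.\<close>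

definition h0 :: complex where
  "h0 = (if tw then of_nat m / 8 else 0)"

definition FL :: "int \<Rightarrow> nat modes fn \<Rightarrow> nat modes fn" where
  "FL n f = (\<Sum>i<m. fsum (\<lambda>j. scal (coef n j) (no i j (j - n) f))) + (if n = 0 then scal h0 f else 0)"

abbreviation "F \<equiv> fsupp labels"

lemma labels_fin: "labels \<subseteq> fin_sets"
  by (auto simp: labels_def)

lemma F_fin: "f \<in> F \<Longrightarrow> f \<in> fsupp fin_sets"
  using labels_fin by (auto simp: fsupp_def)

lemma basis_F:
  assumes "i < m" "f \<in> F" shows "wedge_basis (i, j) f \<in> F" "contract_basis (i, j) f \<in> F"
  using assms by (auto intro!: wedge_fsupp contract_fsupp simp: labels_def)

lemma \<psi>_F: "i < m \<Longrightarrow> f \<in> F \<Longrightarrow> \<psi> i j f \<in> F" and \<psi>'_F: "i < m \<Longrightarrow> f \<in> F \<Longrightarrow> \<psi>' i j f \<in> F"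
  by (simp_all add: \<psi>_def \<psi>'_def basis_F)

lemma \<psi>_add: "\<psi> i j (f + g) = \<psi> i j f + \<psi> i j g" and \<psi>_scal: "\<psi> i j (scal k f) = scal k (\<psi> i j f)"
  and \<psi>'_add: "\<psi>' i j (f + g) = \<psi>' i j f + \<psi>' i j g" and \<psi>'_scal: "\<psi>' i j (scal k f) = scal k (\<psi>' i j f)"
  by (simp_all add: \<psi>_def \<psi>'_def wedge_contract_algebra)

lemma \<psi>_linear: "i < m \<Longrightarrow> linear_between F F (\<psi> i j)" and \<psi>'_linear: "i < m \<Longrightarrow> linear_between F F (\<psi>' i j)"
  by (auto intro!: linear_betweenI simp: \<psi>_F \<psi>'_F \<psi>_add \<psi>_scal \<psi>'_add \<psi>'_scal)

lemma \<psi>_zero [simp]: "\<psi> i j 0 = 0" and \<psi>'_zero [simp]: "\<psi>' i j 0 = 0"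
  using \<psi>_scal[of i j 0 0] \<psi>'_scal[of i j 0 0] by simp_all

lemma \<psi>_diff: "\<psi> i j (f - g) = \<psi> i j f - \<psi> i j g" and \<psi>'_diff: "\<psi>' i j (f - g) = \<psi>' i j f - \<psi>' i j g"
  using \<psi>_add[of i j "f - g" g] \<psi>'_add[of i j "f - g" g] by simp_all

lemma \<psi>_minus: "\<psi> i j (- f) = - \<psi> i j f" and \<psi>'_minus: "\<psi>' i j (- f) = - \<psi>' i j f"
  using \<psi>_diff[of i j 0 f] \<psi>'_diff[of i j 0 f] by simp_all

lemma \<psi>_sum: "\<psi> i j (\<Sum>x\<in>A. f x) = (\<Sum>x\<in>A. \<psi> i j (f x))"
  and \<psi>'_sum: "\<psi>' i j (\<Sum>x\<in>A. f x) = (\<Sum>x\<in>A. \<psi>' i j (f x))"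
  by (induction A rule: infinite_finite_induct) (simp_all add: \<psi>_add \<psi>'_add)

text \<open>The creation and annihilation operators of a charged pair satisfy the canonical anticommutation relations.\<close>

lemma anticommute:
  assumes "f \<in> F"
  shows "\<psi> i p (\<psi> i' q f) = - \<psi> i' q (\<psi> i p f)" "\<psi>' i p (\<psi>' i' q f) = - \<psi>' i' q (\<psi>' i p f)"
    "\<psi>' i q (\<psi> i' p f) = (if i = i' \<and> p = q then f else 0) - \<psi> i' p (\<psi>' i q f)"
  using wedge_wedge[OF F_fin[OF assms], of "(i, p)" "(i', q)"] contract_contract[OF F_fin[OF assms], of "(i, p)" "(i', q)"]
    contract_wedge[OF F_fin[OF assms], of "(i, p)" "(i', q)"] contract_wedge[OF F_fin[OF assms], of "(i', q)" "(i, p)"]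
    contract_wedge[OF F_fin[OF assms], of "(i, q)" "(i', p)"] contract_wedge[OF F_fin[OF assms], of "(i', p)" "(i, q)"]
    wedge_wedge[OF F_fin[OF assms], of "(i, q)" "(i', p)"] contract_contract[OF F_fin[OF assms], of "(i, q)" "(i', p)"]
  unfolding \<psi>_def \<psi>'_def by auto

lemma no_F: "i < m \<Longrightarrow> f \<in> F \<Longrightarrow> no i p q f \<in> F"
  unfolding no_def by (auto intro!: fn.subspace_diff[OF subspace_fsupp] \<psi>_F \<psi>'_F simp: fn.subspace_0[OF subspace_fsupp])

lemma no_add: "no i p q (f + g) = no i p q f + no i p q g" and no_scal: "no i p q (scal k f) = scal k (no i p q f)"
  by (simp_all add: no_def \<psi>_add \<psi>'_add \<psi>_scal \<psi>'_scal scal_diff)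

lemma no_\<psi>:
  assumes "i < m" "i' < m" "f \<in> F"
  shows "no i p q (\<psi> i' r f) = \<psi> i' r (no i p q f) + (if i = i' \<and> q = r then \<psi> i p f else 0)"
proof -
  have 1: "\<psi> i p (\<psi>' i q (\<psi> i' r f)) =
      \<psi> i p (if i = i' \<and> r = q then f else 0) + \<psi> i' r (\<psi> i p (\<psi>' i q f))"
  proof -
    have "\<psi>' i q (\<psi> i' r f) = (if i = i' \<and> r = q then f else 0) - \<psi> i' r (\<psi>' i q f)"
      by (rule anticommute(3)[OF assms(3)])
    moreover have "\<psi> i p (\<psi> i' r (\<psi>' i q f)) = - \<psi> i' r (\<psi> i p (\<psi>' i q f))"
      by (rule anticommute(1)[OF \<psi>'_F[OF assms(1,3)]])
    ultimately show ?thesis by (simp only: \<psi>_diff diff_minus_eq_add)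
  qed
  have 2: "\<psi> i' r (if P then f else 0) = (if P then \<psi> i' r f else 0)" for i' r P by simp
  show ?thesis by (simp only: no_def 1 2 \<psi>_diff) (auto simp: algebra_simps)
qed

lemma no_\<psi>':
  assumes "i < m" "i' < m" "f \<in> F"
  shows "no i p q (\<psi>' i' r f) = \<psi>' i' r (no i p q f) - (if i = i' \<and> p = r then \<psi>' i q f else 0)"
proof -
  have 1: "\<psi> i p (\<psi>' i q (\<psi>' i' r f)) =
      \<psi>' i' r (\<psi> i p (\<psi>' i q f)) - (if i = i' \<and> p = r then \<psi>' i q f else 0)"
  proof -
    have "\<psi>' i q (\<psi>' i' r f) = - \<psi>' i' r (\<psi>' i q f)" by (rule anticommute(2)[OF assms(3)])
    moreover have "\<psi>' i' r (\<psi> i p (\<psi>' i q f)) =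
        (if i' = i \<and> p = r then \<psi>' i q f else 0) - \<psi> i p (\<psi>' i' r (\<psi>' i q f))"
      by (rule anticommute(3)[OF \<psi>'_F[OF assms(1,3)]])
    ultimately show ?thesis by (auto simp: \<psi>_minus)
  qed
  have 2: "\<psi>' i' r (if P then f else 0) = (if P then \<psi>' i' r f else 0)" for i' r P by simp
  show ?thesis by (simp only: no_def 1 2 \<psi>'_diff) (auto simp: algebra_simps)
qed

lemma annihilated:
  assumes "f \<in> F"
  shows "\<exists>K\<ge>0. \<forall>i j. (j > K \<longrightarrow> \<psi> i j f = 0) \<and> (j < - K \<longrightarrow> \<psi>' i j f = 0)"
proof -
  define U where "U = snd ` \<Union>{S. f S \<noteq> 0}"
  have "finite U" using assms by (auto simp: U_def labels_def dest: fsuppD)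
  then obtain K where K: "\<forall>u\<in>U. \<bar>u\<bar> \<le> K" using finite_set_of_finite_funs by (metis finite_imageI Max_ge imageI)
  have c: "contract_basis (i, j) f = 0" if "\<bar>j\<bar> > K" for i j
  proof
    fix S show "contract_basis (i, j) f S = 0 S"
    proof (rule ccontr)
      assume "contract_basis (i, j) f S \<noteq> 0 S"
      then have "f (insert (i, j) S) \<noteq> 0" by (auto simp: contract_basis_def fn_apply split: if_splits)
      then have "j \<in> U" by (force simp: U_def)
      with K that show False by auto
    qed
  qed
  show ?thesis
    by (rule exI[of _ "\<bar>K\<bar>"]) (auto simp: \<psi>_def \<psi>'_def intro!: c)
qed

lemma no_vanish:
  assumes f: "f \<in> F"
  shows "\<exists>A. finite A \<and> (\<forall>i j. i < m \<longrightarrow> j \<notin> A \<longrightarrow> no i j (j - n) f = 0)"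
proof -
  obtain K where K: "K \<ge> 0" "\<And>i j. j > K \<Longrightarrow> \<psi> i j f = 0" "\<And>i j. j < - K \<Longrightarrow> \<psi>' i j f = 0"
    using annihilated[OF f] by blast
  have "no i j (j - n) f = 0" if i: "i < m" and j: "j \<notin> {- K - \<bar>n\<bar>..K + \<bar>n\<bar>}" for i j
  proof (cases "j > K + \<bar>n\<bar>")
    case True
    then have "\<psi> i j f = 0" "j > K" using K by auto
    then show ?thesis using anticommute(3)[OF f, of i "j - n" i j] K(1) by (auto simp: no_def algebra_simps)
  next
    case False
    then have "j - n < - K" using j by auto
    then show ?thesis using K(1) K(3)[of "j - n" i] by (auto simp: no_def)
  qed
  then show ?thesis by (intro exI[of _ "{- K - \<bar>n\<bar>..K + \<bar>n\<bar>}"]) auto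
qed

text \<open>On a given vector the sum over modes may be taken over any large enough finite set.\<close>

lemma FL_finite:
  assumes f: "f \<in> F"
  obtains A where "finite A" "\<And>i j. i < m \<Longrightarrow> j \<notin> A \<Longrightarrow> no i j (j - n) f = 0"
    "\<And>B. finite B \<Longrightarrow> A \<subseteq> B \<Longrightarrow>
      FL n f = (\<Sum>i<m. \<Sum>j\<in>B. scal (coef n j) (no i j (j - n) f)) + (if n = 0 then scal h0 f else 0)"
proof -
  obtain A where A: "finite A" "\<And>i j. i < m \<Longrightarrow> j \<notin> A \<Longrightarrow> no i j (j - n) f = 0"
    using no_vanish[OF f, of n] by blast
  show thesis
  proof (rule that[OF A])
    fix B :: "int set" assume B: "finite B" "A \<subseteq> B"
    show "FL n f = (\<Sum>i<m. \<Sum>j\<in>B. scal (coef n j) (no i j (j - n) f)) + (if n = 0 then scal h0 f else 0)"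
      unfolding FL_def by (intro arg_cong2[where f = "(+)"] sum.cong fsum_eq refl) (use A B in auto)
  qed
qed

lemma FL_linear: "linear_between F F (FL n)"
proof (rule linear_betweenI)
  fix f assume f: "f \<in> F"
  obtain A where A: "finite A" "\<And>B. finite B \<Longrightarrow> A \<subseteq> B \<Longrightarrow>
      FL n f = (\<Sum>i<m. \<Sum>j\<in>B. scal (coef n j) (no i j (j - n) f)) + (if n = 0 then scal h0 f else 0)"
    by (rule FL_finite[OF f, of n]) blast
  show "FL n f \<in> F"
    unfolding A(2)[OF A(1) order_refl]
    by (intro fn.subspace_add[OF subspace_fsupp] fn.subspace_sum[OF subspace_fsupp] fn.subspace_scale[OF subspace_fsupp] no_F)
      (auto simp: f fn.subspace_0[OF subspace_fsupp] intro: fn.subspace_scale[OF subspace_fsupp])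
  fix k
  obtain B where B: "finite B" "\<And>C. finite C \<Longrightarrow> B \<subseteq> C \<Longrightarrow>
      FL n (scal k f) = (\<Sum>i<m. \<Sum>j\<in>C. scal (coef n j) (no i j (j - n) (scal k f))) + (if n = 0 then scal h0 (scal k f) else 0)"
    by (rule FL_finite[OF fn.subspace_scale[OF subspace_fsupp f, of k], of n]) blast
  show "FL n (scal k f) = scal k (FL n f)"
    unfolding A(2)[of "A \<union> B", OF finite_UnI[OF A(1) B(1)] Un_upper1] B(2)[of "A \<union> B", OF finite_UnI[OF A(1) B(1)] Un_upper2]
    by (simp add: no_scal scal_add scal_sum scal_scal mult.commute)
  fix g assume g: "g \<in> F"
  obtain C where C: "finite C" "\<And>B. finite B \<Longrightarrow> C \<subseteq> B \<Longrightarrow>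
      FL n g = (\<Sum>i<m. \<Sum>j\<in>B. scal (coef n j) (no i j (j - n) g)) + (if n = 0 then scal h0 g else 0)"
    by (rule FL_finite[OF g, of n]) blast
  obtain D where D: "finite D" "\<And>B. finite B \<Longrightarrow> D \<subseteq> B \<Longrightarrow>
      FL n (f + g) = (\<Sum>i<m. \<Sum>j\<in>B. scal (coef n j) (no i j (j - n) (f + g))) + (if n = 0 then scal h0 (f + g) else 0)"
    by (rule FL_finite[OF fn.subspace_add[OF subspace_fsupp f g], of n]) blast
  let ?E = "A \<union> C \<union> D"
  have E: "finite ?E" "A \<subseteq> ?E" "C \<subseteq> ?E" "D \<subseteq> ?E" using A C D by auto
  show "FL n (f + g) = FL n f + FL n g"
    unfolding A(2)[OF E(1,2)] C(2)[OF E(1,3)] D(2)[OF E(1,4)]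
    by (simp add: no_add scal_add sum.distrib add_ac)
qed

text \<open>Only one term of each bilinear survives in the commutator with a mode; the coefficient is that of a field of
  weight $\frac12$.\<close>

lemma FL_\<psi>:
  assumes i: "i < m" and f: "f \<in> F"
  shows "FL n (\<psi> i r f) = \<psi> i r (FL n f) + scal (- of_int (n + \<kappa> r) / 2) (\<psi> i (r + n) f)"
proof -
  obtain A where A: "finite A" "\<And>B. finite B \<Longrightarrow> A \<subseteq> B \<Longrightarrow>
      FL n f = (\<Sum>i<m. \<Sum>j\<in>B. scal (coef n j) (no i j (j - n) f)) + (if n = 0 then scal h0 f else 0)"
    by (rule FL_finite[OF f, of n]) blast
  obtain B where B: "finite B" "\<And>C. finite C \<Longrightarrow> B \<subseteq> C \<Longrightarrow>
      FL n (\<psi> i r f) = (\<Sum>i'<m. \<Sum>j\<in>C. scal (coef n j) (no i' j (j - n) (\<psi> i r f))) + (if n = 0 then scal h0 (\<psi> i r f) else 0)"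
    by (rule FL_finite[OF \<psi>_F[OF i f, of r], of n]) blast
  have c: "- of_int (n + \<kappa> r) / 2 = coef n (r + n)" by (simp add: coef_def \<kappa>_def field_simps)
  let ?E = "insert (r + n) (A \<union> B)"
  have E: "finite ?E" "A \<subseteq> ?E" "B \<subseteq> ?E" using A B by auto
  have "(\<Sum>i'<m. \<Sum>j\<in>?E. scal (coef n j) (no i' j (j - n) (\<psi> i r f)))
     = (\<Sum>i'<m. \<Sum>j\<in>?E. \<psi> i r (scal (coef n j) (no i' j (j - n) f)) +
          (if i' = i then if j = r + n then scal (coef n j) (\<psi> i j f) else 0 else 0))"
  proof (intro sum.cong refl)
    fix i' j assume "i' \<in> {..<m}"
    then show "scal (coef n j) (no i' j (j - n) (\<psi> i r f)) = \<psi> i r (scal (coef n j) (no i' j (j - n) f)) +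
          (if i' = i then if j = r + n then scal (coef n j) (\<psi> i j f) else 0 else 0)"
      using no_\<psi>[OF _ i f, of i' j "j - n" r] by (auto simp: scal_add \<psi>_scal algebra_simps)
  qed
  also have "\<dots> = \<psi> i r (\<Sum>i'<m. \<Sum>j\<in>?E. scal (coef n j) (no i' j (j - n) f)) + scal (coef n (r + n)) (\<psi> i (r + n) f)"
  proof -
    have "(\<Sum>j\<in>?E. if i' = i then if j = r + n then scal (coef n j) (\<psi> i j f) else 0 else 0)
       = (if i' = i then scal (coef n (r + n)) (\<psi> i (r + n) f) else 0)" for i'
      using E(1) by (cases "i' = i") (simp_all add: sum.delta)
    then show ?thesis using i by (simp only: sum.distrib \<psi>_sum) (simp add: sum.delta)
  qed
  finally show ?thesis
    unfolding A(2)[OF E(1,2)] B(2)[OF E(1,3)] c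
    by (simp add: \<psi>_add \<psi>_scal add_ac)
qed

lemma FL_\<psi>':
  assumes i: "i < m" and f: "f \<in> F"
  shows "FL n (\<psi>' i r f) = \<psi>' i r (FL n f) + scal (- of_int (n - \<kappa> r) / 2) (\<psi>' i (r - n) f)"
proof -
  obtain A where A: "finite A" "\<And>B. finite B \<Longrightarrow> A \<subseteq> B \<Longrightarrow>
      FL n f = (\<Sum>i<m. \<Sum>j\<in>B. scal (coef n j) (no i j (j - n) f)) + (if n = 0 then scal h0 f else 0)"
    by (rule FL_finite[OF f, of n]) blast
  obtain B where B: "finite B" "\<And>C. finite C \<Longrightarrow> B \<subseteq> C \<Longrightarrow>
      FL n (\<psi>' i r f) = (\<Sum>i'<m. \<Sum>j\<in>C. scal (coef n j) (no i' j (j - n) (\<psi>' i r f))) + (if n = 0 then scal h0 (\<psi>' i r f) else 0)"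
    by (rule FL_finite[OF \<psi>'_F[OF i f, of r], of n]) blast
  have c: "- of_int (n - \<kappa> r) / 2 = - coef n r" by (simp add: coef_def field_simps)
  let ?E = "insert r (A \<union> B)"
  have E: "finite ?E" "A \<subseteq> ?E" "B \<subseteq> ?E" using A B by auto
  have "(\<Sum>i'<m. \<Sum>j\<in>?E. scal (coef n j) (no i' j (j - n) (\<psi>' i r f)))
     = (\<Sum>i'<m. \<Sum>j\<in>?E. \<psi>' i r (scal (coef n j) (no i' j (j - n) f)) +
          (if i' = i then if j = r then scal (- coef n j) (\<psi>' i (j - n) f) else 0 else 0))"
  proof (intro sum.cong refl)
    fix i' j assume "i' \<in> {..<m}"
    then show "scal (coef n j) (no i' j (j - n) (\<psi>' i r f)) = \<psi>' i r (scal (coef n j) (no i' j (j - n) f)) +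
          (if i' = i then if j = r then scal (- coef n j) (\<psi>' i (j - n) f) else 0 else 0)"
      using no_\<psi>'[OF _ i f, of i' j "j - n" r] by (auto simp: scal_diff \<psi>'_scal scal_minus_left)
  qed
  also have "\<dots> = \<psi>' i r (\<Sum>i'<m. \<Sum>j\<in>?E. scal (coef n j) (no i' j (j - n) f)) + scal (- coef n r) (\<psi>' i (r - n) f)"
  proof -
    have "(\<Sum>j\<in>?E. if i' = i then if j = r then scal (- coef n j) (\<psi>' i (j - n) f) else 0 else 0)
       = (if i' = i then scal (- coef n r) (\<psi>' i (r - n) f) else 0)" for i'
      using E(1) by (cases "i' = i") (simp_all add: sum.delta)
    then show ?thesis using i by (simp only: sum.distrib \<psi>'_sum) (simp add: sum.delta)
  qed
  finally show ?thesis
    unfolding A(2)[OF E(1,2)] B(2)[OF E(1,3)] c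
    by (simp add: \<psi>'_add \<psi>'_scal add_ac)
qed

abbreviation vac :: "nat modes fn" where "vac \<equiv> unit_fn {}"

lemma vac_F: "vac \<in> F"
  by (rule unit_fn_fsupp) (simp add: labels_def)

lemma contract_vac: "contract_basis s vac = 0"
  by (auto simp: contract_basis_def unit_fn_def fun_eq_iff fn_apply)

lemma \<psi>_vac: "j \<ge> 0 \<Longrightarrow> \<psi> i j vac = 0" and \<psi>'_vac: "j < 0 \<Longrightarrow> \<psi>' i j vac = 0"
  by (simp_all add: \<psi>_def \<psi>'_def contract_vac)

lemma no_vac: "p \<ge> 0 \<or> q < 0 \<Longrightarrow> no i p q vac = 0"
  using anticommute(3)[OF vac_F, of i q i p] by (auto simp: no_def \<psi>_vac \<psi>'_vac)

lemma FL_vac: "FL n vac = (\<Sum>i<m. \<Sum>j\<in>{n..-1}. scal (coef n j) (\<psi> i j (\<psi>' i (j - n) vac))) + (if n = 0 then scal h0 vac else 0)"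
proof -
  have "fsum (\<lambda>j. scal (coef n j) (no i j (j - n) vac)) = (\<Sum>j\<in>{n..-1}. scal (coef n j) (\<psi> i j (\<psi>' i (j - n) vac)))" for i
  proof -
    have "fsum (\<lambda>j. scal (coef n j) (no i j (j - n) vac)) = (\<Sum>j\<in>{n..-1}. scal (coef n j) (no i j (j - n) vac))"
    proof (rule fsum_eq)
      fix j assume "j \<notin> {n..-1}"
      then have "no i j (j - n) vac = 0" by (intro no_vac) auto
      then show "scal (coef n j) (no i j (j - n) vac) = 0" by simp
    qed simp
    also have "\<dots> = (\<Sum>j\<in>{n..-1}. scal (coef n j) (\<psi> i j (\<psi>' i (j - n) vac)))"
      by (rule sum.cong) (auto simp: no_def)
    finally show ?thesis .
  qed
  then show ?thesis by (simp add: FL_def)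
qed

lemma \<psi>_at_empty: "j < 0 \<Longrightarrow> \<psi> i j f {} = 0"
  by (simp add: \<psi>_def wedge_basis_def)

text \<open>The sum giving the central charge.\<close>

lemma sum_squares_shifted:
  fixes b :: complex
  shows "(\<Sum>j\<in>{- int n..-1}. (b + 2 * of_int j)\<^sup>2) = of_nat n * b\<^sup>2 - 2 * b * of_nat n * (of_nat n + 1)
     + 2 / 3 * of_nat n * (of_nat n + 1) * (2 * of_nat n + 1)"
proof (induction n)
  case (Suc n)
  have "{- int (Suc n)..-1} = insert (- int (Suc n)) {- int n..-1}" by auto
  then have "(\<Sum>j\<in>{- int (Suc n)..-1}. (b + 2 * of_int j)\<^sup>2) = (b + 2 * of_int (- int (Suc n)))\<^sup>2 + (\<Sum>j\<in>{- int n..-1}. (b + 2 * of_int j)\<^sup>2)"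
    by simp
  then show ?case unfolding Suc.IH by (simp add: field_simps power2_eq_square)
qed simp

definition wt :: "nat modes \<Rightarrow> complex" where
  "wt S = (\<Sum>(i, j)\<in>S. of_int \<bar>\<kappa> j\<bar> / 2) + h0"

definition fld :: "nat \<times> bool \<Rightarrow> int \<Rightarrow> nat modes fn \<Rightarrow> nat modes fn" where
  "fld ib j = (if snd ib then \<psi>' (fst ib) (- j) else \<psi> (fst ib) j)"

definition shift_coef :: "int \<Rightarrow> nat \<times> bool \<Rightarrow> int \<Rightarrow> complex" where
  "shift_coef n ib j = (if snd ib then - of_int (n - \<kappa> (- j)) / 2 else - of_int (n + \<kappa> j) / 2)"

text \<open>Of the bilinears in $L(-n)$ only those with both factors creating act on the vacuum, and $L(n)$ takes
  them back with a scalar quadratic in the mode number.\<close>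

lemma central_sum:
  assumes n: "n > 0"
  shows "FL n (FL (- n) vac) {} = 2 * of_int n * h0 + of_int (n ^ 3 - n) / 12 * of_nat m"
proof -
  have FLn: "FL n vac = 0" unfolding FL_vac using n by simp
  note lin = linear_betweenD[OF FL_linear]
  let ?t = "\<lambda>i j. \<psi> i j (\<psi>' i (j + n) vac)"
  have tF: "?t i j \<in> F" if "i < m" for i j using that by (intro \<psi>_F \<psi>'_F vac_F)
  have tval: "FL n (?t i j) {} = - of_int (n + \<kappa> j) / 2" if i: "i < m" and j: "j \<in> {- n..-1}" for i j
  proof -
    have "\<psi> i (j + n) (\<psi>' i (j + n) vac) = vac"
      using anticommute(3)[OF vac_F, of i "j + n" i "j + n"] j by (simp add: \<psi>_vac algebra_simps)
    then show ?thesis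
      using FL_\<psi>[OF i \<psi>'_F[OF i vac_F], of n j "j + n"] j by (simp add: fn_apply \<psi>_at_empty unit_fn_def)
  qed
  have "FL (- n) vac = (\<Sum>i<m. \<Sum>j\<in>{-n..-1}. scal (coef (- n) j) (?t i j))"
    unfolding FL_vac using n by simp
  then have "FL n (FL (- n) vac) = (\<Sum>i<m. FL n (\<Sum>j\<in>{-n..-1}. scal (coef (- n) j) (?t i j)))"
    by (simp only:) (intro linear_between_sum[OF FL_linear subspace_fsupp] fn.subspace_sum[OF subspace_fsupp]
        fn.subspace_scale[OF subspace_fsupp] tF, simp)
  also have "\<dots> = (\<Sum>i<m. \<Sum>j\<in>{-n..-1}. scal (coef (- n) j) (FL n (?t i j)))"
  proof (rule sum.cong)
    fix i assume i: "i \<in> {..<m}"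
    have "FL n (\<Sum>j\<in>{-n..-1}. scal (coef (- n) j) (?t i j)) = (\<Sum>j\<in>{-n..-1}. FL n (scal (coef (- n) j) (?t i j)))"
      by (intro linear_between_sum[OF FL_linear subspace_fsupp] fn.subspace_scale[OF subspace_fsupp] tF) (use i in simp)
    then show "FL n (\<Sum>j\<in>{-n..-1}. scal (coef (- n) j) (?t i j)) = (\<Sum>j\<in>{-n..-1}. scal (coef (- n) j) (FL n (?t i j)))"
      using i by (simp add: lin(3) tF)
  qed simp
  finally have "FL n (FL (- n) vac) {} = (\<Sum>i<m. \<Sum>j\<in>{-n..-1}. coef (- n) j * FL n (?t i j) {})"
    by (simp add: fn_apply)
  also have "\<dots> = (\<Sum>i<m. \<Sum>j\<in>{-n..-1}. ((of_int n + (if tw then 2 else 1)) + 2 * of_int j)\<^sup>2 / 4)"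
    by (intro sum.cong refl) (simp add: tval coef_def \<kappa>_def power2_eq_square field_simps)
  also have "\<dots> = of_nat m * (\<Sum>j\<in>{-n..-1}. ((of_int n + (if tw then 2 else 1)) + 2 * of_int j)\<^sup>2) / 4"
    by (simp flip: sum_divide_distrib)
  also have "\<dots> = 2 * of_int n * h0 + of_int (n ^ 3 - n) / 12 * of_nat m"
  proof -
    obtain k where k: "n = int k" using n by (metis zero_less_imp_eq_int)
    show ?thesis unfolding k sum_squares_shifted h0_def
      by (cases tw) (simp_all add: field_simps power2_eq_square power3_eq_cube)
  qed
  finally show ?thesis .
qed

sublocale primary_fields labels FL "{..<m} \<times> (UNIV :: bool set)" fld shift_coef "{{}}" wt card "of_nat m"
proof
  show "linear_between F F (FL n)" for n by (rule FL_linear)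
next
  fix i :: "nat \<times> bool" and j assume "i \<in> {..<m} \<times> UNIV"
  then show "linear_between F F (fld i j)" by (auto simp: fld_def \<psi>_linear \<psi>'_linear)
next
  fix i :: "nat \<times> bool" and j f n assume "i \<in> {..<m} \<times> UNIV" "f \<in> F"
  then show "FL n (fld i j f) = fld i j (FL n f) + scal (shift_coef n i j) (fld i (j + n) f)"
    using FL_\<psi>[of "fst i" f n j] FL_\<psi>'[of "fst i" f n "- j"] by (auto simp: fld_def shift_coef_def)
next
  fix i :: "nat \<times> bool" and n j k
  have e: "\<kappa> (j + n) = \<kappa> j + 2 * n" "\<kappa> (j + k) = \<kappa> j + 2 * k" "\<kappa> (- j - n) = \<kappa> (- j) - 2 * n" "\<kappa> (- j - k) = \<kappa> (- j) - 2 * k"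
    by (auto simp: \<kappa>_def)
  show "shift_coef n i j * shift_coef k i (j + n) - shift_coef k i j * shift_coef n i (j + k) =
       of_int (k - n) * shift_coef (k + n) i j"
    by (cases "snd i") (simp_all add: shift_coef_def e field_simps)
next
  show "{{}} \<subseteq> labels" by (simp add: labels_def)
next
  fix S assume S: "S \<in> labels" "S \<notin> {{}}"
  then obtain i j where ij: "(i, j) \<in> S" by auto
  let ?T = "S - {(i, j)}"
  have fS: "finite S" and T: "?T \<in> labels" and i: "i < m" using S ij by (auto simp: labels_def)
  have u: "unit_fn S = scal (koszul_sign (i, j) S) (wedge_basis (i, j) (unit_fn ?T))"
  proof
    fix S' show "unit_fn S S' = scal (koszul_sign (i, j) S) (wedge_basis (i, j) (unit_fn ?T)) S'"
      using ij by (cases "S' = S") (auto simp: unit_fn_def wedge_basis_def fn_apply)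
  qed
  have w: "wt S = wt ?T + of_int \<bar>\<kappa> j\<bar> / 2"
    unfolding wt_def by (subst sum.remove[OF fS ij]) simp
  have c: "card ?T < card S" using fS ij by (rule card_Diff1_less)
  show "\<exists>i\<in>{..<m} \<times> UNIV. \<exists>j k y. y \<in> labels \<and> card y < card S \<and>
          unit_fn S = scal k (fld i j (unit_fn y)) \<and> wt S = wt y + shift_coef 0 i j"
  proof (cases "j < 0")
    case True
    then show ?thesis using u w c T i
      by (intro bexI[of _ "(i, False)"] exI[of _ j] exI[of _ "koszul_sign (i, j) S"] exI[of _ ?T])
        (auto simp: fld_def shift_coef_def \<psi>_def \<kappa>_def)
  next
    case False
    then show ?thesis using u w c T i
      by (intro bexI[of _ "(i, True)"] exI[of _ "- j"] exI[of _ "koszul_sign (i, j) S"] exI[of _ ?T])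
        (auto simp: fld_def shift_coef_def \<psi>'_def \<kappa>_def)
  qed
next
  fix v :: "nat modes" assume "v \<in> {{}}"
  then show "FL 0 (unit_fn v) = scal (wt v) (unit_fn v)" by (simp add: FL_vac wt_def)
next
  fix v :: "nat modes" and T assume v: "v \<in> {{}}" and T: "linear_between F F T"
    and comm: "\<And>i j f. i \<in> {..<m} \<times> UNIV \<Longrightarrow> f \<in> F \<Longrightarrow> T (fld i j f) = fld i j (T f)"
  have T0: "T 0 = 0" by (rule linear_between_0[OF T subspace_fsupp])
  have c: "contract_basis (i, j) (T vac) = 0" if "i < m" for i j
    using comm[of "(i, j < 0)" vac "if j < 0 then - j else j"] that vac_F T0
    by (cases "j < 0") (auto simp: fld_def \<psi>_def \<psi>'_def contract_vac)
  have z: "T vac S = 0" if ne: "S \<noteq> {}" for S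
  proof (rule ccontr)
    assume nz: "T vac S \<noteq> 0"
    have S: "S \<in> labels" by (rule fsuppD(2)[OF linear_betweenD(1)[OF T vac_F] nz])
    obtain i j where ij: "(i, j) \<in> S" using ne by auto
    then have "i < m" using S by (auto simp: labels_def)
    then have "contract_basis (i, j) (T vac) (S - {(i, j)}) = 0" using c by (simp add: fn_apply)
    then have "T vac S = 0" by (simp add: contract_basis_def insert_absorb[OF ij] koszul_sign_def)
    with nz show False by simp
  qed
  have "T vac = scal (T vac {}) vac"
  proof
    fix S show "T vac S = scal (T vac {}) vac S"
      using z[of S] by (cases "S = {}") (simp_all add: fn_apply unit_fn_def[of "{}"])
  qed
  then show "T (unit_fn v) = scal (T (unit_fn v) v) (unit_fn v)" using v by simp
next
  fix v :: "nat modes" and n :: int assume v: "v \<in> {{}}" and n: "n \<noteq> 0"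
  show "FL n (unit_fn v) v = 0"
    using v n by (simp add: FL_vac fn_apply \<psi>_at_empty)
next
  fix v :: "nat modes" and n :: int assume v: "v \<in> {{}}" and n: "n > 0"
  show "FL n (unit_fn v) = 0" using v n by (simp add: FL_vac)
  show "FL n (FL (- n) (unit_fn v)) v = 2 * of_int n * wt v + of_int (n ^ 3 - n) / 12 * of_nat m"
    using v central_sum[OF n] by (simp add: wt_def)
qed

lemma ip_\<psi>: "f \<in> F \<Longrightarrow> g \<in> F \<Longrightarrow> ip (\<psi> i j f) g = ip f (\<psi>' i j g)"
  and ip_\<psi>': "f \<in> F \<Longrightarrow> g \<in> F \<Longrightarrow> ip (\<psi>' i j f) g = ip f (\<psi> i j g)"
  by (auto simp: \<psi>_def \<psi>'_def ip_wedge ip_contract F_fin)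

lemma ip_no: "i < m \<Longrightarrow> f \<in> F \<Longrightarrow> g \<in> F \<Longrightarrow> ip (no i p q f) g = ip f (no i q p g)"
  by (auto simp: no_def ip_diff_left ip_diff_right ip_\<psi> ip_\<psi>' \<psi>_F \<psi>'_F ip_zero)

text \<open>Exchanging the two factors of a bilinear takes the adjoint, and reindexing the modes turns $L(n)$
  into $L(-n)$ with the same coefficients.\<close>

lemma FL_adjoint:
  assumes f: "f \<in> F" and g: "g \<in> F"
  shows "ip (FL n f) g = ip f (FL (- n) g)"
proof -
  obtain A where A: "finite A" "\<And>B. finite B \<Longrightarrow> A \<subseteq> B \<Longrightarrow>
      FL n f = (\<Sum>i<m. \<Sum>j\<in>B. scal (coef n j) (no i j (j - n) f)) + (if n = 0 then scal h0 f else 0)"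
    by (rule FL_finite[OF f, of n]) blast
  obtain B where B: "finite B" "\<And>C. finite C \<Longrightarrow> B \<subseteq> C \<Longrightarrow>
      FL (- n) g = (\<Sum>i<m. \<Sum>j\<in>C. scal (coef (- n) j) (no i j (j - - n) g)) + (if - n = 0 then scal h0 g else 0)"
    by (rule FL_finite[OF g, of "- n"]) blast
  define E where "E = A \<union> (\<lambda>j. j + n) ` B"
  have E: "finite E" "A \<subseteq> E" using A B by (auto simp: E_def)
  have "x \<in> (\<lambda>j. j - n) ` E" if "x \<in> B" for x
    by (rule image_eqI[of _ _ "x + n"]) (use that in \<open>auto simp: E_def\<close>)
  then have E': "finite ((\<lambda>j. j - n) ` E)" "B \<subseteq> (\<lambda>j. j - n) ` E" using E by auto
  have cc: "cnj (coef n j) = coef (- n) (j - n)" for j by (simp add: coef_def \<kappa>_def)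
  have hh: "cnj h0 = h0" by (simp add: h0_def)
  have inj: "inj_on (\<lambda>j. j - n) E" by (auto simp: inj_on_def)
  have "ip (FL n f) g = (\<Sum>i<m. \<Sum>j\<in>E. cnj (coef n j) * ip (no i j (j - n) f) g) + (if n = 0 then h0 * ip f g else 0)"
    unfolding A(2)[OF E] by (simp add: ip_add_left[OF g] ip_sum_left[OF g] ip_scal_left[OF g] hh ip_zero)
  also have "\<dots> = (\<Sum>i<m. \<Sum>j\<in>E. coef (- n) (j - n) * ip f (no i (j - n) j g)) + (if n = 0 then h0 * ip f g else 0)"
    by (intro arg_cong2[where f = "(+)"] sum.cong refl) (simp add: cc ip_no f g)
  also have "\<dots> = ip f (FL (- n) g)"
    unfolding B(2)[OF E'] sum.reindex[OF inj]
    by (simp add: ip_add_right[OF f] ip_sum_right[OF f] ip_scal_right[OF f] ip_zero)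
  finally show ?thesis .
qed

lemma FL_parity:
  assumes f: "f \<in> F" shows "FL n (smul parity f) = smul parity (FL n f)"
proof -
  have neg: "\<psi> i j (smul parity f) = - smul parity (\<psi> i j f)" "\<psi>' i j (smul parity f) = - smul parity (\<psi>' i j f)"
    if "f \<in> F" for i j f
    using that by (simp_all add: \<psi>_def \<psi>'_def parity_wedge parity_contract F_fin)
  have no: "no i p q (smul parity f) = smul parity (no i p q f)" if "i < m" for i p q
    using that neg(1)[OF \<psi>'_F[OF that f]] neg(2)[OF f]
    by (simp add: no_def \<psi>_minus) (auto simp: smul_def fun_eq_iff fn_apply algebra_simps)
  obtain A where A: "finite A" "\<And>B. finite B \<Longrightarrow> A \<subseteq> B \<Longrightarrow>
      FL n f = (\<Sum>i<m. \<Sum>j\<in>B. scal (coef n j) (no i j (j - n) f)) + (if n = 0 then scal h0 f else 0)"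
    by (rule FL_finite[OF f, of n]) blast
  obtain B where B: "finite B" "\<And>C. finite C \<Longrightarrow> B \<subseteq> C \<Longrightarrow>
      FL n (smul parity f) = (\<Sum>i<m. \<Sum>j\<in>C. scal (coef n j) (no i j (j - n) (smul parity f))) + (if n = 0 then scal h0 (smul parity f) else 0)"
    by (rule FL_finite[OF smul_fsupp[OF f], of n parity]) blast
  have E: "finite (A \<union> B)" "A \<subseteq> A \<union> B" "B \<subseteq> A \<union> B" using A(1) B(1) by auto
  show ?thesis
    unfolding A(2)[OF E(1,2)] B(2)[OF E(1,3)]
    by (simp add: no) (auto simp: smul_def fun_eq_iff fn_apply sum_distrib_left algebra_simps)
qed

text \<open>Four times the conformal weight.\<close>

definition deg :: "nat modes \<Rightarrow> nat" where
  "deg S = (\<Sum>(i, j)\<in>S. 2 * nat \<bar>\<kappa> j\<bar>) + (if tw then m div 2 else 0)"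

lemma deg_wt: "of_nat (deg S) / 4 = wt S"
proof -
  have "(of_nat (\<Sum>(i, j)\<in>S. 2 * nat \<bar>\<kappa> j\<bar>) :: complex) / 4 = (\<Sum>(i, j)\<in>S. of_int \<bar>\<kappa> j\<bar> / 2)"
    unfolding of_nat_sum sum_divide_distrib by (rule sum.cong) (auto simp: field_simps)
  moreover have "(of_nat (if tw then m div 2 else 0) :: complex) / 4 = h0"
    using even_m by (auto simp: h0_def elim!: evenE)
  ultimately show ?thesis by (simp add: deg_def wt_def add_divide_distrib)
qed

theorem unitary: "unitary_vir \<lparr>carr = F, vir_L = FL, central = scal (of_nat m)\<rparr> labels deg (of_nat m) parity"
  unfolding unitary_vir_def
proof (intro conjI ballI allI)
  show "virasoro_module \<lparr>carr = F, vir_L = FL, central = scal (of_nat m)\<rparr>" by (rule virasoro_module)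
next
  fix S show "parity S = 1 \<or> parity S = - 1" by (simp add: parity_def) (metis minus_one_power_iff)
qed (use L0 FL_adjoint FL_parity in \<open>auto simp: deg_wt smul_def[of wt]\<close>)

end

section \<open>Bases adapted to a polarization\<close>

lemma polarized_spaceD:
  assumes "polarized_space b"
  shows "form b u (v + w) = form b u v + form b u w" "form b u (a *s v) = a * form b u v"
    "form b u w = form b w u" "(\<And>w. form b u w = 0) \<Longrightarrow> u = 0"
    "form b (onb b i) (onb b j) = (if i = j then 1 else 0)"
    "vec.subspace (minus_part b)" "vec.subspace (plus_part b)"
    "u \<in> minus_part b \<Longrightarrow> w \<in> minus_part b \<Longrightarrow> form b u w = 0"
    "u \<in> plus_part b \<Longrightarrow> w \<in> plus_part b \<Longrightarrow> form b u w = 0"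
    "\<exists>!p. p \<in> minus_part b \<and> u - p \<in> plus_part b"
  using assms unfolding polarized_space_def Vector_Spaces.linear_iff by blast+

locale polarized =
  fixes b :: "'n::finite polarized_space"
  assumes b: "polarized_space b"
begin

abbreviation B where "B \<equiv> form b"

lemmas P = polarized_spaceD[OF b]

lemma B_add: "B u (v + w) = B u v + B u w" "B (v + w) u = B v u + B w u"
  and B_scale: "B u (a *s v) = a * B u v" "B (a *s v) u = a * B v u"
  by (simp_all add: P(1,2) P(3)[of _ u])

lemma B_zero [simp]: "B u 0 = 0" "B 0 u = 0"
  using B_scale(1)[of u 0 0] B_scale(2)[of 0 0 u] by simp_all

lemma B_diff: "B u (v - w) = B u v - B u w" "B (v - w) u = B v u - B w u"
  using B_add(1)[of u "v - w" w] B_add(2)[of "v - w" w u] by simp_all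

lemma B_sum: "B u (\<Sum>i\<in>A. f i) = (\<Sum>i\<in>A. B u (f i))" "B (\<Sum>i\<in>A. f i) u = (\<Sum>i\<in>A. B (f i) u)"
  by (induction A rule: infinite_finite_induct) (simp_all add: B_add)

lemma minus_proj: "minus_proj b u \<in> minus_part b" "u - minus_proj b u \<in> plus_part b"
  using theI'[OF P(10)[of u]] by (simp_all add: minus_proj_def)

lemma minus_proj_unique: "p \<in> minus_part b \<Longrightarrow> u - p \<in> plus_part b \<Longrightarrow> minus_proj b u = p"
  using P(10)[of u] minus_proj[of u] by blast

lemma minus_proj_add: "minus_proj b (u + v) = minus_proj b u + minus_proj b v"
proof (rule minus_proj_unique)
  show "minus_proj b u + minus_proj b v \<in> minus_part b"
    by (intro vec.subspace_add[OF P(6)] minus_proj)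
  have "(u - minus_proj b u) + (v - minus_proj b v) \<in> plus_part b"
    by (intro vec.subspace_add[OF P(7)] minus_proj)
  then show "u + v - (minus_proj b u + minus_proj b v) \<in> plus_part b" by (simp add: algebra_simps)
qed

lemma minus_proj_scale: "minus_proj b (a *s u) = a *s minus_proj b u"
proof (rule minus_proj_unique)
  show "a *s minus_proj b u \<in> minus_part b" by (intro vec.subspace_scale[OF P(6)] minus_proj)
  have "a *s (u - minus_proj b u) \<in> plus_part b" by (intro vec.subspace_scale[OF P(7)] minus_proj)
  then show "a *s u - a *s minus_proj b u \<in> plus_part b" by (simp add: vec.scale_right_diff_distrib)
qed

lemma minus_proj_minus: "p \<in> minus_part b \<Longrightarrow> minus_proj b p = p"
  by (rule minus_proj_unique) (simp_all add: vec.subspace_0[OF P(7)])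

lemma minus_proj_plus: "q \<in> plus_part b \<Longrightarrow> minus_proj b q = 0"
  by (rule minus_proj_unique) (simp_all add: vec.subspace_0[OF P(6)])

text \<open>A vector orthogonal to both halves vanishes, so each half is its own orthogonal complement.\<close>

lemma orthogonal_both:
  assumes "\<And>w. w \<in> minus_part b \<Longrightarrow> B u w = 0" "\<And>w. w \<in> plus_part b \<Longrightarrow> B u w = 0"
  shows "u = 0"
proof (rule P(4))
  fix w
  have "B u w = B u (minus_proj b w) + B u (w - minus_proj b w)" by (simp flip: B_add)
  also have "\<dots> = 0" using assms minus_proj by simp
  finally show "B u w = 0" .
qed

text \<open>Nondegeneracy makes the injective linear map into the dual surjective, the dimensions being equal.\<close>

lemma represent_functional:
  assumes "\<And>v w. f (v + w) = f v + f w" "\<And>a v. f (a *s v) = a * f v"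
  shows "\<exists>u. \<forall>w. B u w = f w"
proof -
  define \<Phi> where "\<Phi> u = (\<chi> i. B u (axis i 1))" for u
  have lin: "Vector_Spaces.linear (*s) (*s) \<Phi>"
    by (simp add: Vector_Spaces.linear_iff \<Phi>_def vec_eq_iff B_add B_scale vec.vector_space_axioms)
  have expand: "w = (\<Sum>i\<in>UNIV. (w $ i) *s axis i 1)" for w :: "'n cvec" by (rule basis_expansion[symmetric])
  have inj: "inj \<Phi>"
  proof (rule injI)
    fix u v assume "\<Phi> u = \<Phi> v"
    then have e: "B (u - v) (axis i 1) = 0" for i by (simp add: \<Phi>_def vec_eq_iff B_diff)
    have "B (u - v) w = 0" for w by (subst expand) (simp add: B_sum B_scale e)
    then have "u - v = 0" by (rule P(4))
    then show "u = v" by simp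
  qed
  have "surj \<Phi>" by (rule vec.linear_inj_imp_surj[OF lin inj])
  then obtain u where u: "\<Phi> u = (\<chi> i. f (axis i 1))" by (metis surjD)
  have fsum: "f (\<Sum>i\<in>A. g i) = (\<Sum>i\<in>A. f (g i))" for A :: "'n set" and g
    by (induction A rule: infinite_finite_induct) (use assms(1) assms(2)[of 0 0] in auto)
  have "B u (axis i 1) = f (axis i 1)" for i using u by (simp add: \<Phi>_def vec_eq_iff)
  then have "B u w = f w" for w by (subst (1 2) expand) (simp add: B_sum B_scale fsum assms(2))
  then show ?thesis by blast
qed

text \<open>Dual bases of the two halves: the functional reading off a coordinate of the first half and
  vanishing on the second is represented by a vector of the second.\<close>

lemma adapted_basis:
  "\<exists>m x y. (\<forall>i<m. x i \<in> minus_part b \<and> y i \<in> plus_part b) \<and> (\<forall>i<m. \<forall>j<m. B (x i) (y j) = (if i = j then 1 else 0)) \<and>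
     (\<forall>u. u = (\<Sum>i<(m::nat). B u (y i) *s x i + B u (x i) *s y i))"
proof -
  obtain X where X: "X \<subseteq> minus_part b" "vec.independent X" "minus_part b \<subseteq> vec.span X"
    by (rule vec.maximal_independent_subset)
  have fin: "finite X" using X(2) by (rule vec.finiteI_independent)
  then obtain x where x: "bij_betw x {0..<card X} X" using ex_bij_betw_nat_finite by blast
  define m where "m = card X"
  have Xx: "X = x ` {..<m}" using x by (simp add: bij_betw_def m_def atLeast0LessThan)
  have xX: "x i \<in> X" if "i < m" for i using x that by (auto simp: bij_betw_def m_def)
  have xm: "x i \<in> minus_part b" if "i < m" for i using xX[OF that] X(1) by auto
  have inj: "x i = x j \<longleftrightarrow> i = j" if "i < m" "j < m" for i j
    using x that by (auto simp: bij_betw_def inj_on_def m_def)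
  define R where "R u v = vec.representation X (minus_proj b u) v" for u v
  have sp: "minus_proj b u \<in> vec.span X" for u using minus_proj(1) X(3) by auto
  have "\<exists>u. \<forall>w. B u w = R w (x j)" for j
    by (rule represent_functional)
      (simp_all add: R_def minus_proj_add minus_proj_scale vec.representation_add[OF X(2)] vec.representation_scale[OF X(2)] sp)
  then obtain y where y: "\<And>j w. B (y j) w = R w (x j)" by metis
  have Rx: "R (x i) (x j) = (if i = j then 1 else 0)" if "i < m" "j < m" for i j
    using that by (auto simp: R_def minus_proj_minus xm vec.representation_basis[OF X(2)] xX inj)
  have Rp: "R q v = 0" if "q \<in> plus_part b" for q v
    using that by (simp add: R_def minus_proj_plus vec.representation_zero)
  have yp: "y j \<in> plus_part b" for j
  proof -
    let ?p = "minus_proj b (y j)"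
    have "?p = 0"
    proof (rule orthogonal_both)
      fix w assume "w \<in> minus_part b"
      then show "B ?p w = 0" using minus_proj(1) P(8) by blast
    next
      fix w assume w: "w \<in> plus_part b"
      have "B ?p w = B (y j) w - B (y j - ?p) w" by (simp flip: B_diff)
      also have "\<dots> = 0" using Rp[OF w] P(9)[OF minus_proj(2) w] by (simp add: y)
      finally show "B ?p w = 0" .
    qed
    then show ?thesis using minus_proj(2)[of "y j"] by simp
  qed
  have dual: "B (x i) (y j) = (if i = j then 1 else 0)" if "i < m" "j < m" for i j
    using y[of j "x i"] Rx[OF that] P(3)[of "x i" "y j"] by simp
  have expand: "u = (\<Sum>i<m. B u (y i) *s x i + B u (x i) *s y i)" for u
  proof -
    define v where "v = u - (\<Sum>i<m. B u (y i) *s x i + B u (x i) *s y i)"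
    have vx: "B v (x k) = 0" if k: "k < m" for k
    proof -
      have "B (\<Sum>i<m. B u (y i) *s x i + B u (x i) *s y i) (x k) = (\<Sum>i<m. if k = i then B u (x i) else 0)"
        unfolding B_sum by (rule sum.cong)
          (use k dual[OF k] P(8)[OF xm xm[OF k]] P(3)[of _ "x k"] in \<open>auto simp: B_add B_scale\<close>)
      then show ?thesis using k by (simp add: v_def B_diff)
    qed
    have vy: "B v (y k) = 0" if k: "k < m" for k
    proof -
      have "B (\<Sum>i<m. B u (y i) *s x i + B u (x i) *s y i) (y k) = (\<Sum>i<m. if i = k then B u (y i) else 0)"
        unfolding B_sum by (rule sum.cong)
          (use k dual[OF _ k] P(9)[OF yp yp] in \<open>auto simp: B_add B_scale\<close>)
      then show ?thesis using k by (simp add: v_def B_diff)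
    qed
    have vm: "B v w = 0" if "w \<in> minus_part b" for w
    proof -
      have "vec.subspace {w. B v w = 0}" by (rule vec.subspaceI) (simp_all add: B_add B_scale)
      moreover have "X \<subseteq> {w. B v w = 0}"
      proof
        fix z assume "z \<in> X"
        then obtain k where "k < m" "z = x k" using Xx by blast
        then show "z \<in> {w. B v w = 0}" using vx by simp
      qed
      ultimately have "vec.span X \<subseteq> {w. B v w = 0}" by (intro vec.span_minimal)
      then show ?thesis using that X(3) by auto
    qed
    let ?p = "minus_proj b v"
    have "v - ?p = 0"
    proof (rule orthogonal_both)
      fix w assume w: "w \<in> minus_part b"
      show "B (v - ?p) w = 0" using vm[OF w] P(8)[OF minus_proj(1) w] by (simp add: B_diff)
    next
      fix w assume "w \<in> plus_part b"
      then show "B (v - ?p) w = 0" using P(9)[OF minus_proj(2)] by simp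
    qed
    then have vp: "v = ?p" by simp
    have "v = (\<Sum>z\<in>X. vec.representation X ?p z *s z)"
      using vec.sum_representation_eq[OF X(2) sp fin order_refl, of v] vp by simp
    also have "\<dots> = 0"
    proof (rule sum.neutral, rule ballI)
      fix z assume "z \<in> X"
      then obtain k where k: "k < m" "z = x k" using Xx by blast
      then show "vec.representation X ?p z *s z = 0"
        using vy[OF k(1)] y[of k v] P(3)[of v "y k"] by (simp add: R_def)
    qed
    finally show ?thesis by (simp add: v_def)
  qed
  show ?thesis
    by (rule exI[of _ m], rule exI[of _ x], rule exI[of _ y]) (use xm yp dual expand in blast)
qed

lemma onb_expand: "u = (\<Sum>i\<in>UNIV. B u (onb b i) *s onb b i)"
proof -
  let ?E = "range (onb b)"
  have inj: "inj (onb b)"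
  proof (rule injI)
    fix i j assume "onb b i = onb b j"
    then show "i = j" using P(5)[of i j] P(5)[of j j] by (auto split: if_splits)
  qed
  have coef: "B (\<Sum>i\<in>UNIV. f i *s onb b i) (onb b j) = f j" for f j
    by (simp add: B_sum B_scale P(5) if_distrib cong: if_cong)
  have "vec.independent ?E"
  proof (rule vec.independent_if_scalars_zero)
    fix f z assume s: "(\<Sum>z\<in>?E. f z *s z) = 0" and "z \<in> ?E"
    then obtain j where z: "z = onb b j" by auto
    have "(\<Sum>i\<in>UNIV. f (onb b i) *s onb b i) = 0" using s by (simp add: sum.reindex[OF inj])
    then show "f z = 0" using coef[of "\<lambda>i. f (onb b i)" j] by (simp add: z)
  qed simp
  then have sp: "UNIV \<subseteq> vec.span ?E"
    by (intro vec.card_ge_dim_independent) (simp_all only: subset_UNIV vec_dim_card card_image[OF inj] order_refl not_False_eq_True)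
  define Q where "Q v = (\<Sum>i\<in>UNIV. B v (onb b i) *s onb b i)" for v
  have Q: "Q (v + w) = Q v + Q w" "Q (a *s v) = a *s Q v" for v w a
    by (simp_all add: Q_def B_add B_scale vec.scale_left_distrib sum.distrib vec.scale_sum_right)
  have "vec.subspace {v. Q v = v}"
    by (rule vec.subspaceI) (simp_all add: Q, simp add: Q_def)
  moreover have "?E \<subseteq> {v. Q v = v}"
    by (auto simp: Q_def P(5) if_distrib[of "\<lambda>c. c *s _"] sum.delta cong: if_cong)
  ultimately have "vec.span ?E \<subseteq> {v. Q v = v}" by (intro vec.span_minimal)
  then have "Q u = u" using sp by blast
  then show ?thesis by (simp add: Q_def)
qed

text \<open>The Casimir element does not depend on the pair of dual bases.\<close>

lemma casimir:
  fixes \<beta> :: "'n cvec \<Rightarrow> 'n cvec \<Rightarrow> 'x fn"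
  assumes add: "\<And>u v w. \<beta> u (v + w) = \<beta> u v + \<beta> u w" "\<And>u v w. \<beta> (v + w) u = \<beta> v u + \<beta> w u"
    and scale: "\<And>a u v. \<beta> u (a *s v) = scal a (\<beta> u v)" "\<And>a u v. \<beta> (a *s v) u = scal a (\<beta> v u)"
    and expand: "\<And>u. u = (\<Sum>i<(m::nat). B u (y i) *s x i + B u (x i) *s y i)"
  shows "(\<Sum>i\<in>UNIV. \<beta> (onb b i) (onb b i)) = (\<Sum>j<m. \<beta> (x j) (y j) + \<beta> (y j) (x j))"
proof -
  have zero: "\<beta> u 0 = 0" "\<beta> 0 u = 0" for u using scale(1)[of u 0 0] scale(2)[of 0 0 u] by simp_all
  have sumr: "\<beta> u (\<Sum>i\<in>A. g i) = (\<Sum>i\<in>A. \<beta> u (g i))" for u g and A :: "'i set"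
    by (induction A rule: infinite_finite_induct) (simp_all add: add zero)
  have suml: "\<beta> (\<Sum>i\<in>A. g i) u = (\<Sum>i\<in>A. \<beta> (g i) u)" for u g and A :: "'i set"
    by (induction A rule: infinite_finite_induct) (simp_all add: add zero)
  let ?e = "onb b"
  have "(\<Sum>i\<in>UNIV. \<beta> (?e i) (?e i)) = (\<Sum>i\<in>UNIV. \<Sum>j<m. scal (B (?e i) (y j)) (\<beta> (?e i) (x j)) + scal (B (?e i) (x j)) (\<beta> (?e i) (y j)))"
  proof (rule sum.cong)
    fix i
    have "\<beta> (?e i) (?e i) = \<beta> (?e i) (\<Sum>j<m. B (?e i) (y j) *s x j + B (?e i) (x j) *s y j)"
      using expand[of "?e i"] by (rule arg_cong)
    also have "\<dots> = (\<Sum>j<m. scal (B (?e i) (y j)) (\<beta> (?e i) (x j)) + scal (B (?e i) (x j)) (\<beta> (?e i) (y j)))"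
      by (simp only: sumr add scale)
    finally show "\<beta> (?e i) (?e i) = (\<Sum>j<m. scal (B (?e i) (y j)) (\<beta> (?e i) (x j)) + scal (B (?e i) (x j)) (\<beta> (?e i) (y j)))" .
  qed simp
  also have "\<dots> = (\<Sum>j<m. (\<Sum>i\<in>UNIV. scal (B (?e i) (y j)) (\<beta> (?e i) (x j))) + (\<Sum>i\<in>UNIV. scal (B (?e i) (x j)) (\<beta> (?e i) (y j))))"
    by (subst sum.swap) (simp add: sum.distrib)
  also have "\<dots> = (\<Sum>j<m. \<beta> (y j) (x j) + \<beta> (x j) (y j))"
  proof -
    have "(\<Sum>i\<in>UNIV. scal (B (?e i) u) (\<beta> (?e i) v)) = \<beta> u v" for u v
    proof -
      have "\<beta> u v = \<beta> (\<Sum>i\<in>UNIV. B u (?e i) *s ?e i) v" using onb_expand[of u] by (rule arg_cong)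
      also have "\<dots> = (\<Sum>i\<in>UNIV. scal (B u (?e i)) (\<beta> (?e i) v))" by (simp only: suml scale)
      finally show ?thesis by (simp only: P(3)[of u])
    qed
    then show ?thesis by simp
  qed
  finally show ?thesis by (simp add: add.commute)
qed

text \<open>The trace of the identity, computed in two ways.\<close>

lemma adapted_basis_card:
  assumes expand: "\<And>u. u = (\<Sum>i<(m::nat). B u (y i) *s x i + B u (x i) *s y i)"
    and dual: "\<And>i j. i < m \<Longrightarrow> j < m \<Longrightarrow> B (x i) (y j) = (if i = j then 1 else 0)"
  shows "CARD('n) = 2 * m"
proof -
  define \<beta> :: "'n cvec \<Rightarrow> 'n cvec \<Rightarrow> unit fn" where "\<beta> u v = (\<lambda>_. B u v)" for u v
  have "(\<Sum>i\<in>UNIV. \<beta> (onb b i) (onb b i)) = (\<Sum>j<m. \<beta> (x j) (y j) + \<beta> (y j) (x j))"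
    by (rule casimir[OF _ _ _ _ expand]) (auto simp: \<beta>_def fun_eq_iff fn_apply B_add B_scale)
  then have "(\<Sum>i\<in>UNIV. \<beta> (onb b i) (onb b i)) () = (\<Sum>j<m. \<beta> (x j) (y j) + \<beta> (y j) (x j)) ()" by simp
  then have "(of_nat CARD('n) :: complex) = (\<Sum>j<m. B (x j) (y j) + B (y j) (x j))"
    by (simp add: fn_apply \<beta>_def P(5))
  also have "\<dots> = (\<Sum>j<m. 2)"
  proof (rule sum.cong)
    fix j assume "j \<in> {..<m}"
    then show "B (x j) (y j) + B (y j) (x j) = 2" using dual[of j j] P(3)[of "y j" "x j"] by simp
  qed simp
  finally have "(of_nat CARD('n) :: complex) = of_nat (2 * m)" by simp
  then show ?thesis by (simp only: of_nat_eq_iff)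
qed

end

section \<open>Clifford modules as Fock spaces\<close>

lemma wedge_linear_u:
  "wedge (u + v) k f = wedge u k f + wedge v k f" "wedge (a *s u) k f = scal a (wedge u k f)"
  by (simp_all add: wedge_def scal_add_left sum.distrib scal_sum scal_scal)

lemma wedge_linear_f:
  "wedge u k (f + g) = wedge u k f + wedge u k g" "wedge u k (scal c f) = scal c (wedge u k f)"
  by (simp_all add: wedge_def wedge_contract_algebra scal_add sum.distrib scal_sum scal_scal mult.commute)

lemma contract_linear_f:
  "contract b u k (f + g) = contract b u k f + contract b u k g" "contract b u k (scal c f) = scal c (contract b u k f)"
  by (simp_all add: contract_def wedge_contract_algebra scal_add sum.distrib scal_sum scal_scal mult.commute sum_negf sum_subtractf)

lemma wedge_zero [simp]: "wedge u k 0 = 0" "wedge 0 k f = 0"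
  using wedge_linear_f(2)[of u k 0 0] wedge_linear_u(2)[of 0 0 k f] by simp_all

lemma contract_zero [simp]: "contract b u k 0 = 0"
  using contract_linear_f(2)[of b u k 0 0] by simp

lemma wedge_contract_minus: "wedge u k (- f) = - wedge u k f" "contract b u k (- f) = - contract b u k f"
  using wedge_linear_f(2)[of u k "-1" f] contract_linear_f(2)[of b u k "-1" f] by simp_all

abbreviation FS :: "'a modes fn set" where "FS \<equiv> fsupp fin_sets"

lemma wedge_FS: "f \<in> FS \<Longrightarrow> wedge u k f \<in> FS"
  unfolding wedge_def
  by (intro fn.subspace_sum[OF subspace_fsupp] fn.subspace_scale[OF subspace_fsupp] wedge_fsupp) auto

lemma contract_FS: "f \<in> FS \<Longrightarrow> contract b u k f \<in> FS"
  unfolding contract_def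
  by (intro fn.subspace_sum[OF subspace_fsupp] fn.subspace_scale[OF subspace_fsupp] contract_fsupp) auto

lemma basis_sum:
  "wedge_basis s (\<Sum>i\<in>A. f i) = (\<Sum>i\<in>A. wedge_basis s (f i))" "contract_basis s (\<Sum>i\<in>A. f i) = (\<Sum>i\<in>A. contract_basis s (f i))"
  using wedge_contract_algebra(2)[of s 0 0] wedge_contract_algebra(4)[of s 0 0]
  by (induction A rule: infinite_finite_induct) (simp_all add: wedge_contract_algebra)

lemma wedge_anticommute:
  assumes "f \<in> FS" shows "wedge u k (wedge w l f) = - wedge w l (wedge u k f)"
proof -
  have "wedge u k (wedge w l f) = (\<Sum>i\<in>UNIV. \<Sum>j\<in>UNIV. scal (u $ i * w $ j) (wedge_basis (i, k) (wedge_basis (j, l) f)))"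
    by (simp add: wedge_def basis_sum wedge_contract_algebra scal_sum scal_scal)
  also have "\<dots> = (\<Sum>i\<in>UNIV. \<Sum>j\<in>UNIV. - scal (w $ j * u $ i) (wedge_basis (j, l) (wedge_basis (i, k) f)))"
    by (intro sum.cong refl) (simp add: wedge_wedge[OF assms, of "(_, k)" "(_, l)"] scal_minus mult.commute)
  also have "\<dots> = - (\<Sum>j\<in>UNIV. \<Sum>i\<in>UNIV. scal (w $ j * u $ i) (wedge_basis (j, l) (wedge_basis (i, k) f)))"
    by (subst sum.swap) (simp add: sum_negf)
  also have "(\<Sum>j\<in>UNIV. \<Sum>i\<in>UNIV. scal (w $ j * u $ i) (wedge_basis (j, l) (wedge_basis (i, k) f))) = wedge w l (wedge u k f)"
    by (simp add: wedge_def basis_sum wedge_contract_algebra scal_sum scal_scal)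
  finally show ?thesis .
qed

text \<open>The factors of a monomial are ordered as in the fermionic Fock space, so that both carry the same signs.\<close>

definition lt_list :: "(nat \<times> int) set \<Rightarrow> (nat \<times> int) list" where
  "lt_list S = (SOME xs. sorted_wrt before xs \<and> set xs = S)"

fun ins :: "nat \<times> int \<Rightarrow> (nat \<times> int) list \<Rightarrow> (nat \<times> int) list" where
  "ins s [] = [s]"
| "ins s (t # xs) = (if before s t then s # t # xs else t # ins s xs)"

lemma set_ins: "set (ins s xs) = insert s (set xs)"
  by (induction xs) auto

lemma sorted_ins: "sorted_wrt before xs \<Longrightarrow> s \<notin> set xs \<Longrightarrow> sorted_wrt before (ins s xs)"
proof (induction xs)
  case (Cons t xs)
  then show ?case using before_trans[of s t] before_cases[of s t] by (auto simp: set_ins)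
qed simp

lemma sorted_before_unique: "sorted_wrt before xs \<Longrightarrow> sorted_wrt before ys \<Longrightarrow> set xs = set ys \<Longrightarrow> xs = ys"
proof (induction xs arbitrary: ys)
  case (Cons x xs)
  then obtain y ys' where ys: "ys = y # ys'" by (cases ys) auto
  have notin: "x \<notin> set xs" "y \<notin> set ys'" using Cons.prems ys by auto
  have "x = y"
  proof (rule ccontr)
    assume "x \<noteq> y"
    then have "before y x" "before x y" using Cons.prems ys by auto
    then show False using before_trans[of x y x] by simp
  qed
  moreover from this have "set xs = set ys'" using Cons.prems(3) ys notin by auto
  ultimately show ?case using Cons ys by auto
qed simp

lemma lt_list: "finite S \<Longrightarrow> sorted_wrt before (lt_list S) \<and> set (lt_list S) = S"
  unfolding lt_list_def
proof (rule someI_ex)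
  assume "finite S"
  then show "\<exists>xs. sorted_wrt before xs \<and> set xs = S"
  proof (induction S rule: finite_induct)
    case empty show ?case by (rule exI[of _ "[]"]) simp
  next
    case (insert s S)
    then obtain xs where "sorted_wrt before xs \<and> set xs = S" by blast
    then show ?case using insert(2) by (intro exI[of _ "ins s xs"]) (simp add: set_ins sorted_ins)
  qed
qed

lemma lt_list_insert: "finite S \<Longrightarrow> s \<notin> S \<Longrightarrow> lt_list (insert s S) = ins s (lt_list S)"
  using lt_list[of S] lt_list[of "insert s S"] by (intro sorted_before_unique) (auto simp: set_ins sorted_ins)

lemma lt_list_empty: "lt_list {} = []"
  using lt_list[of "{}"] by simp

locale clifford_fock = polarized b + fermions m tw
  for b :: "'n::{finite,linorder} polarized_space" and m tw +
  fixes x y :: "nat \<Rightarrow> 'n cvec"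
  assumes x: "i < m \<Longrightarrow> x i \<in> minus_part b" and y: "i < m \<Longrightarrow> y i \<in> plus_part b"
    and dual: "i < m \<Longrightarrow> j < m \<Longrightarrow> form b (x i) (y j) = (if i = j then 1 else 0)"
    and expand: "u = (\<Sum>i<m. form b u (y i) *s x i + form b u (x i) *s y i)"
    and card: "CARD('n) = 2 * m"
begin

lemma contract_wedge_u:
  assumes "f \<in> FS"
  shows "contract b u k (wedge w l f) = scal (if l = - k then - 2 * B u w else 0) f - wedge w l (contract b u k f)"
proof -
  define U where "U i = - 2 * form b u (axis i 1)" for i
  have c: "contract b u k f = (\<Sum>i\<in>UNIV. scal (U i) (contract_basis (i, - k) f))" for f
    by (simp add: contract_def U_def)
  have "contract b u k (wedge w l f) = (\<Sum>i\<in>UNIV. \<Sum>j\<in>UNIV. scal (U i * w $ j) (contract_basis (i, -k) (wedge_basis (j, l) f)))"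
    by (simp add: c wedge_def basis_sum wedge_contract_algebra scal_sum scal_scal)
  also have "\<dots> = (\<Sum>i\<in>UNIV. \<Sum>j\<in>UNIV. (if j = i then scal (if l = - k then U i * w $ j else 0) f else 0) -
      scal (U i * w $ j) (wedge_basis (j, l) (contract_basis (i, -k) f)))"
    by (intro sum.cong refl) (auto simp: contract_wedge[OF assms] scal_diff scal_minus)
  also have "\<dots> = (\<Sum>i\<in>UNIV. scal (if l = - k then U i * w $ i else 0) f) -
      (\<Sum>j\<in>UNIV. \<Sum>i\<in>UNIV. scal (w $ j * U i) (wedge_basis (j, l) (contract_basis (i, -k) f)))"
    by (subst (2) sum.swap) (simp add: sum_subtractf sum.delta mult.commute)
  also have "(\<Sum>j\<in>UNIV. \<Sum>i\<in>UNIV. scal (w $ j * U i) (wedge_basis (j, l) (contract_basis (i, -k) f))) = wedge w l (contract b u k f)"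
    by (simp add: c wedge_def basis_sum wedge_contract_algebra scal_sum scal_scal)
  also have "(\<Sum>i\<in>UNIV. scal (if l = - k then U i * w $ i else 0) f) = scal (if l = - k then - 2 * B u w else 0) f"
  proof -
    have "B u w = B u (\<Sum>i\<in>UNIV. (w $ i) *s axis i 1)" by (simp add: basis_expansion)
    also have "\<dots> = (\<Sum>i\<in>UNIV. w $ i * B u (axis i 1))" by (simp add: B_sum B_scale)
    finally have "- 2 * B u w = (\<Sum>i\<in>UNIV. U i * w $ i)" by (simp add: U_def sum_distrib_left mult_ac sum_negf)
    then show ?thesis by (simp add: fn.scale_sum_left)
  qed
  finally show ?thesis .
qed

lemma contract_linear_u: "contract b (u + v) k f = contract b u k f + contract b v k f"
  "contract b (a *s u) k f = scal a (contract b u k f)"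
  by (simp_all add: contract_def B_add B_scale algebra_simps scal_sum scal_scal sum.distrib sum_subtractf sum_negf)

lemma contract_zero_u [simp]: "contract b 0 k f = 0"
  by (simp add: contract_def)

text \<open>The factor $-\frac12$ turns the Clifford relation $\{u, w\} = -2\langle u,w\rangle$ into
  $\{\psi,\psi^*\} = 1$.\<close>

definition Cr :: "nat \<times> int \<Rightarrow> 'n modes fn \<Rightarrow> 'n modes fn" where
  "Cr s f = (if snd s < 0 then wedge (x (fst s)) (\<kappa> (snd s)) f else scal (- 1 / 2) (wedge (y (fst s)) (- \<kappa> (snd s)) f))"

definition An :: "nat \<times> int \<Rightarrow> 'n modes fn \<Rightarrow> 'n modes fn" where
  "An s f = (if snd s < 0 then scal (- 1 / 2) (contract b (y (fst s)) (- \<kappa> (snd s)) f) else contract b (x (fst s)) (\<kappa> (snd s)) f)"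

abbreviation "modes \<equiv> {..<m} \<times> (UNIV :: int set)"

lemma \<kappa>_inj: "\<kappa> j = \<kappa> j' \<longleftrightarrow> j = j'"
  by (auto simp: \<kappa>_def)

lemma Cr_FS: "f \<in> FS \<Longrightarrow> Cr s f \<in> FS" and An_FS: "f \<in> FS \<Longrightarrow> An s f \<in> FS"
  by (auto simp: Cr_def An_def wedge_FS contract_FS fn.subspace_scale[OF subspace_fsupp] fn.subspace_neg[OF subspace_fsupp])

lemma Cr_add: "Cr s (f + g) = Cr s f + Cr s g" and Cr_scal: "Cr s (scal c f) = scal c (Cr s f)"
  and An_add: "An s (f + g) = An s f + An s g" and An_scal: "An s (scal c f) = scal c (An s f)"
  by (simp_all add: Cr_def An_def wedge_linear_f contract_linear_f scal_add scal_scal scal_minus)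

lemma Cr_zero [simp]: "Cr s 0 = 0" and An_zero [simp]: "An s 0 = 0"
  by (simp_all add: Cr_def An_def)

lemma Cr_minus: "Cr s (- f) = - Cr s f"
  using Cr_scal[of s "-1" f] by simp

lemma Cr_Cr: "f \<in> FS \<Longrightarrow> Cr s (Cr t f) = - Cr t (Cr s f)"
  by (auto simp: Cr_def wedge_linear_f scal_scal scal_minus wedge_contract_minus wedge_anticommute[of f _ "\<kappa> (snd s)"]
      wedge_anticommute[of f _ "- \<kappa> (snd s)"])

lemma An_Cr:
  assumes f: "f \<in> FS" and s: "s \<in> modes" and t: "t \<in> modes"
  shows "An s (Cr t f) = (if s = t then f else 0) - Cr t (An s f)"
proof -
  have st: "fst s < m" "fst t < m" using s t by auto
  have xy: "B (x i) (x j) = 0" "B (y i) (y j) = 0" "B (y i) (x j) = (if i = j then 1 else 0)" if "i < m" "j < m" for i j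
    using that P(8)[OF x x] P(9)[OF y y] dual[of j i] P(3)[of "y i"] by auto
  have eq: "s = t \<longleftrightarrow> fst s = fst t \<and> snd s = snd t" by (rule prod_eq_iff)
  show ?thesis
    by (cases "snd s < 0"; cases "snd t < 0")
      (auto simp: An_def Cr_def contract_linear_f wedge_linear_f contract_wedge_u[OF f] xy[OF st] dual[OF st] eq \<kappa>_inj
        xy[OF st(2) st(2)] dual[OF st(2) st(2)] wedge_contract_minus scal_diff scal_scal scal_minus)
qed

abbreviation vacb :: "'n modes fn" where "vacb \<equiv> unit_fn {}"

lemma vacb_FS: "vacb \<in> FS"
  by (rule unit_fn_fsupp) simp

lemma contract_basis_vacb: "contract_basis s vacb = 0"
  by (auto simp: contract_basis_def unit_fn_def fun_eq_iff fn_apply)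

lemma An_vacb: "An s vacb = 0"
  by (simp add: An_def contract_def contract_basis_vacb)

definition vect :: "nat modes \<Rightarrow> 'n modes fn" where
  "vect S = foldr Cr (lt_list S) vacb"

lemma foldr_FS: "foldr Cr xs vacb \<in> FS"
  by (induction xs) (simp_all add: vacb_FS Cr_FS)

lemma vect_FS: "vect S \<in> FS"
  by (simp add: vect_def foldr_FS)

lemma Cr_foldr: "sorted_wrt before xs \<Longrightarrow>
   Cr s (foldr Cr xs vacb) = (if s \<in> set xs then 0 else scal (koszul_sign s (set xs)) (foldr Cr (ins s xs) vacb))"
proof (induction xs)
  case Nil then show ?case by (simp add: koszul_sign_def)
next
  case (Cons t xs)
  let ?v = "foldr Cr xs vacb"
  have tn: "t \<notin> set xs" using Cons.prems by auto
  have sq: "Cr t (Cr t ?v) = 0"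
  proof -
    have "Cr t (Cr t ?v) + Cr t (Cr t ?v) = 0" using Cr_Cr[OF foldr_FS, of t t xs] by simp
    then show ?thesis by (auto simp: fun_eq_iff fn_apply)
  qed
  show ?case
  proof (cases "s = t")
    case True then show ?thesis using sq by simp
  next
    case ne: False
    show ?thesis
    proof (cases "before s t")
      case True
      have "\<not> before u s" if "u \<in> insert t (set xs)" for u
      proof
        assume "before u s"
        moreover have "before s u" using that True Cons.prems before_trans[of s t u] by auto
        ultimately show False using before_trans[of s u s] by simp
      qed
      then have "{u \<in> insert t (set xs). before u s} = {}" by blast
      then have "koszul_sign s (insert t (set xs)) = 1" by (simp only: koszul_sign_before card.empty power_0)
      moreover have "s \<notin> set xs"
      proof
        assume "s \<in> set xs"
        then have "before t s" using Cons.prems by simp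
        with True before_trans[of s t s] show False by simp
      qed
      ultimately show ?thesis using ne True by simp
    next
      case False
      then have b: "before t s" using ne before_cases[of s t] by simp
      have "Cr s (Cr t ?v) = - Cr t (Cr s ?v)" by (rule Cr_Cr[OF foldr_FS])
      then show ?thesis
        using Cons ne False b koszul_sign_insert[of "set xs" t s] tn
        by (auto simp: Cr_minus Cr_scal scal_minus_left)
    qed
  qed
qed

lemma Cr_vect: "finite S \<Longrightarrow> Cr s (vect S) = (if s \<in> S then 0 else scal (koszul_sign s S) (vect (insert s S)))"
  using Cr_foldr[of "lt_list S" s] lt_list[of S] by (simp add: vect_def lt_list_insert)

text \<open>The comparison map from the Fock space of charged fermions, sending the monomial with label \<open>S\<close> to the product
  of the corresponding creation operators on the vacuum.\<close>

definition T :: "nat modes fn \<Rightarrow> 'n modes fn" where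
  "T f = (\<Sum>S | f S \<noteq> 0. scal (f S) (vect S))"

lemma T_finite: "finite A \<Longrightarrow> (\<And>S. S \<notin> A \<Longrightarrow> f S = 0) \<Longrightarrow> T f = (\<Sum>S\<in>A. scal (f S) (vect S))"
  unfolding T_def by (rule sum.mono_neutral_left) auto

lemma T_linear: "linear_between F FS T"
proof (rule linear_betweenI)
  fix f assume f: "f \<in> F"
  show "T f \<in> FS" unfolding T_def
    by (intro fn.subspace_sum[OF subspace_fsupp] fn.subspace_scale[OF subspace_fsupp] vect_FS)
  fix c
  have "T (scal c f) = (\<Sum>S | f S \<noteq> 0. scal (scal c f S) (vect S))"
    by (rule T_finite) (use f in \<open>auto simp: fn_apply dest: fsuppD(1)\<close>)
  then show "T (scal c f) = scal c (T f)" by (simp add: T_def scal_sum scal_scal fn_apply)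
  fix g assume g: "g \<in> F"
  let ?A = "{S. f S \<noteq> 0} \<union> {S. g S \<noteq> 0}"
  have fin: "finite ?A" using f g by (auto dest: fsuppD(1))
  have "T (f + g) = (\<Sum>S\<in>?A. scal ((f + g) S) (vect S))" "T f = (\<Sum>S\<in>?A. scal (f S) (vect S))"
    "T g = (\<Sum>S\<in>?A. scal (g S) (vect S))"
    by (rule T_finite[OF fin]; auto simp: fn_apply)+
  then show "T (f + g) = T f + T g" by (simp add: fn_apply scal_add_left sum.distrib)
qed

lemmas Tl = linear_betweenD[OF T_linear]

lemma T_zero [simp]: "T 0 = 0"
  by (rule linear_between_0[OF T_linear subspace_fsupp])

lemma T_unit: "T (unit_fn S) = vect S"
  by (subst T_finite[of "{S}"]) (auto simp: unit_fn_def)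

lemma T_vac: "T vac = vacb"
  by (simp add: T_unit vect_def lt_list_empty)

lemma Cr_linear: "linear_between FS FS (Cr s)" and An_linear: "linear_between FS FS (An s)"
  by (auto intro!: linear_betweenI simp: Cr_FS An_FS Cr_add An_add Cr_scal An_scal)

lemma basis_linear: "s \<in> modes \<Longrightarrow> linear_between F F (wedge_basis s)" "s \<in> modes \<Longrightarrow> linear_between F F (contract_basis s)"
  by (auto intro!: linear_betweenI basis_F simp: wedge_contract_algebra)

lemma unit_F: "S \<in> labels \<Longrightarrow> unit_fn S \<in> F"
  by (rule unit_fn_fsupp)

lemma wedge_unit: "wedge_basis s (unit_fn S) = (if s \<in> S then 0 else scal (koszul_sign s (insert s S)) (unit_fn (insert s S)))"
proof
  fix S' show "wedge_basis s (unit_fn S) S' = (if s \<in> S then 0 else scal (koszul_sign s (insert s S)) (unit_fn (insert s S))) S'"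
    by (auto simp: wedge_basis_def unit_fn_def fn_apply)
qed

lemma T_wedge:
  assumes s: "s \<in> modes" and f: "f \<in> F" shows "T (wedge_basis s f) = Cr s (T f)"
proof (rule linear_fsupp_eqI[OF linear_between_comp[OF basis_linear(1)[OF s] T_linear] linear_between_comp[OF T_linear Cr_linear] _ f])
  fix S assume S: "S \<in> labels"
  then have fin: "finite S" by (simp add: labels_def)
  have i: "insert s S \<in> labels" using S s by (auto simp: labels_def)
  show "T (wedge_basis s (unit_fn S)) = Cr s (T (unit_fn S))"
    using koszul_sign_insert[OF fin, of s s]
    by (auto simp: wedge_unit T_unit Cr_vect[OF fin] Tl(3)[OF unit_F[OF i]])
qed

text \<open>By induction on the length of the monomial, moving the annihilation operator to the right.\<close>

lemma T_contract_unit: "s \<in> modes \<Longrightarrow> S \<in> labels \<Longrightarrow> T (contract_basis s (unit_fn S)) = An s (T (unit_fn S))"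
proof (induction "card S" arbitrary: S)
  case 0
  then have "S = {}" by (simp add: labels_def)
  then show ?case by (simp add: contract_vac T_vac An_vacb)
next
  case (Suc n)
  then have "S \<noteq> {}" by auto
  then obtain t where t: "t \<in> S" by blast
  define S' where "S' = S - {t}"
  have fin: "finite S" and S': "S' \<in> labels" "card S' = n"
    using Suc t by (auto simp: S'_def labels_def)
  have "fst t \<in> {..<m}" using Suc.prems(2) imageI[OF t, of fst] unfolding labels_def by blast
  then have tm: "t \<in> modes" by (cases t) simp
  have u: "unit_fn S = scal (koszul_sign t S) (wedge_basis t (unit_fn S'))"
    using t by (simp add: wedge_unit S'_def insert_absorb scal_scal)
  note uF = unit_F[OF S'(1)]
  have cF: "contract_basis s (unit_fn S') \<in> F" by (rule linear_betweenD(1)[OF basis_linear(2)[OF Suc.prems(1)] uF])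
  have wF: "wedge_basis t (unit_fn S') \<in> F" by (rule linear_betweenD(1)[OF basis_linear(1)[OF tm] uF])
  have cw: "contract_basis s (wedge_basis t (unit_fn S')) = (if s = t then unit_fn S' else 0) - wedge_basis t (contract_basis s (unit_fn S'))"
    by (rule contract_wedge[OF F_fin[OF uF]])
  have "T (contract_basis s (wedge_basis t (unit_fn S'))) = T (if s = t then unit_fn S' else 0) - T (wedge_basis t (contract_basis s (unit_fn S')))"
    unfolding cw by (rule linear_between_diff[OF T_linear subspace_fsupp])
      (auto simp: uF fn.subspace_0[OF subspace_fsupp] intro: linear_betweenD(1)[OF basis_linear(1)[OF tm] cF])
  also have "\<dots> = (if s = t then T (unit_fn S') else 0) - Cr t (An s (T (unit_fn S')))"
    using Suc.hyps(1)[OF S'(2)[symmetric] Suc.prems(1) S'(1)] T_wedge[OF tm cF] by simp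
  also have "\<dots> = An s (Cr t (T (unit_fn S')))"
    using An_Cr[OF Tl(1)[OF uF] Suc.prems(1) tm] by simp
  also have "\<dots> = An s (T (wedge_basis t (unit_fn S')))" by (simp add: T_wedge[OF tm uF])
  finally have e: "T (contract_basis s (wedge_basis t (unit_fn S'))) = An s (T (wedge_basis t (unit_fn S')))" .
  have "contract_basis s (wedge_basis t (unit_fn S')) \<in> F" by (rule linear_betweenD(1)[OF basis_linear(2)[OF Suc.prems(1)] wF])
  then show ?case by (simp add: u wedge_contract_algebra Tl(3) wF An_scal e)
qed

lemma T_contract:
  assumes s: "s \<in> modes" and f: "f \<in> F" shows "T (contract_basis s f) = An s (T f)"
  by (rule linear_fsupp_eqI[OF linear_between_comp[OF basis_linear(2)[OF s] T_linear] linear_between_comp[OF T_linear An_linear] _ f])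
    (rule T_contract_unit[OF s])

text \<open>A vector in the kernel is annihilated by all contractions, down to a multiple of the vacuum.\<close>

lemma T_injective:
  assumes "f \<in> F" "T f = 0" shows "f = 0"
proof -
  obtain N where N: "\<forall>S. f S \<noteq> 0 \<longrightarrow> card S \<le> N"
    using fsuppD(1)[OF assms(1)] finite_nat_set_iff_bounded_le[of "card ` {S. f S \<noteq> 0}"] by auto
  from assms N show ?thesis
  proof (induction N arbitrary: f)
    case (0 f)
    have "f S = 0" if "S \<noteq> {}" for S
      using 0 that fsuppD(2)[OF 0(1), of S] by (auto simp: labels_def)
    then have "f = scal (f {}) vac" by (auto simp: fun_eq_iff fn_apply unit_fn_def)
    moreover have "f {} = 0"
    proof -
      have "T f = scal (f {}) vacb" by (subst \<open>f = _\<close>) (simp add: Tl(3)[OF vac_F] T_vac)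
      moreover have "T f {} = 0" using 0 by (simp add: zero_fun_apply)
      moreover have "(scal (f {}) vacb) {} = f {}" by (simp add: scal_apply unit_fn_def)
      ultimately show ?thesis by (simp only:)
    qed
    ultimately show ?case by simp
  next
    case (Suc N f)
    have c: "contract_basis s f = 0" if s: "s \<in> modes" for s
    proof (rule Suc.IH)
      show "contract_basis s f \<in> F" by (rule linear_betweenD(1)[OF basis_linear(2)[OF s] Suc.prems(1)])
      show "T (contract_basis s f) = 0" using T_contract[OF s Suc.prems(1)] Suc.prems(2) by simp
      show "\<forall>S. contract_basis s f S \<noteq> 0 \<longrightarrow> card S \<le> N"
      proof (intro allI impI)
        fix S assume "contract_basis s f S \<noteq> 0"
        then have ns: "s \<notin> S" "f (insert s S) \<noteq> 0" by (auto simp: contract_basis_def split: if_splits)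
        have "finite S" using fsuppD(2)[OF Suc.prems(1) ns(2)] by (simp add: labels_def)
        then show "card S \<le> N" using Suc.prems(3) ns by force
      qed
    qed
    have z: "f S = 0" if ne: "S \<noteq> {}" for S
    proof (rule ccontr)
      assume nz: "f S \<noteq> 0"
      have S: "S \<in> labels" by (rule fsuppD(2)[OF Suc.prems(1) nz])
      obtain i j where ij: "(i, j) \<in> S" using ne by auto
      then have "(i, j) \<in> modes" using S by (auto simp: labels_def)
      then have "contract_basis (i, j) f (S - {(i, j)}) = 0" using c by (simp add: fn_apply)
      then have "f S = 0" by (simp add: contract_basis_def insert_absorb[OF ij] koszul_sign_def)
      with nz show False by simp
    qed
    then have e: "f = scal (f {}) vac" by (auto simp: fun_eq_iff fn_apply unit_fn_def)
    moreover have "f {} = 0"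
    proof -
      have "T f = scal (f {}) vacb" by (subst e) (simp add: Tl(3)[OF vac_F] T_vac)
      moreover have "T f {} = 0" using Suc.prems(2) by (simp add: zero_fun_apply)
      moreover have "(scal (f {}) vacb) {} = f {}" by (simp add: scal_apply unit_fn_def)
      ultimately show ?thesis by (simp only:)
    qed
    ultimately show ?case by simp
  qed
qed

abbreviation "CS \<equiv> cliff_space b tw"

lemma wedge_CS:
  assumes c: "(u, k) \<in> creating b tw" and f: "f \<in> CS" shows "wedge u k f \<in> CS"
proof -
  have "fn.subspace {f. wedge u k f \<in> CS}"
    by (rule fn.subspaceI) (simp_all add: wedge_linear_f cliff_space_def fn.span_zero fn.span_add fn.span_scale)
  moreover have "{foldr (\<lambda>(u, k). wedge u k) us vacb | us. set us \<subseteq> creating b tw} \<subseteq> {f. wedge u k f \<in> CS}"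
  proof
    fix g assume "g \<in> {foldr (\<lambda>(u, k). wedge u k) us vacb | us. set us \<subseteq> creating b tw}"
    then obtain us where us: "g = foldr (\<lambda>(u, k). wedge u k) us vacb" "set us \<subseteq> creating b tw" by blast
    have "wedge u k g = foldr (\<lambda>(u, k). wedge u k) ((u, k) # us) vacb" by (simp add: us)
    moreover have "set ((u, k) # us) \<subseteq> creating b tw" using us c by simp
    ultimately have "wedge u k g \<in> {foldr (\<lambda>(u, k). wedge u k) us vacb | us. set us \<subseteq> creating b tw}" by blast
    then show "g \<in> {f. wedge u k f \<in> CS}" by (simp add: cliff_space_def fn.span_base)
  qed
  ultimately have "CS \<subseteq> {f. wedge u k f \<in> CS}" unfolding cliff_space_def[of b tw] by (intro fn.span_minimal) auto
  with f show ?thesis by auto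
qed

lemma vacb_CS: "vacb \<in> CS"
  unfolding cliff_space_def by (rule fn.span_base) (auto intro!: exI[of _ "[]"])

lemma Cr_CS: "s \<in> modes \<Longrightarrow> f \<in> CS \<Longrightarrow> Cr s f \<in> CS"
proof -
  assume s: "s \<in> modes" and f: "f \<in> CS"
  have sub: "scal c g \<in> CS" "- g \<in> CS" if "g \<in> CS" for c g
    using that by (simp_all add: cliff_space_def fn.span_scale fn.span_neg)
  have 1: "snd s < 0 \<Longrightarrow> (x (fst s), \<kappa> (snd s)) \<in> creating b tw"
    using s x[of "fst s"] by (auto simp: creating_def \<kappa>_def)
  have 2: "snd s \<ge> 0 \<Longrightarrow> (y (fst s), - \<kappa> (snd s)) \<in> creating b tw"
    by (auto simp: creating_def \<kappa>_def)
  show ?thesis using 1 2 wedge_CS[OF _ f] sub by (auto simp: Cr_def)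
qed

lemma T_CS: "f \<in> F \<Longrightarrow> T f \<in> CS"
proof -
  assume f: "f \<in> F"
  have v: "foldr Cr xs vacb \<in> CS" if "set xs \<subseteq> modes" for xs
    using that by (induction xs) (simp_all add: vacb_CS Cr_CS)
  have "vect S \<in> CS" if "f S \<noteq> 0" for S
  proof -
    have "S \<in> labels" using f that by (auto dest: fsuppD(2))
    then have "set (lt_list S) \<subseteq> modes" using lt_list[of S] by (auto simp: labels_def)
    then show ?thesis unfolding vect_def by (rule v)
  qed
  then show "T f \<in> CS"
    unfolding T_def cliff_space_def by (intro fn.span_sum fn.span_scale) auto
qed

lemma subspace_TF: "fn.subspace (T ` F)"
proof (rule fn.subspaceI)
  show "0 \<in> T ` F" by (rule image_eqI[of _ _ 0]) (simp_all add: fn.subspace_0[OF subspace_fsupp])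
next
  fix f g assume "f \<in> T ` F" "g \<in> T ` F"
  then show "f + g \<in> T ` F"
    by (auto simp flip: Tl(2) intro!: imageI fn.subspace_add[OF subspace_fsupp])
next
  fix a f assume "f \<in> T ` F"
  then show "scal a f \<in> T ` F"
    by (auto simp flip: Tl(3) intro!: imageI fn.subspace_scale[OF subspace_fsupp])
qed

lemma TF_Cr: "s \<in> modes \<Longrightarrow> g \<in> T ` F \<Longrightarrow> Cr s g \<in> T ` F"
proof -
  assume s: "s \<in> modes" and "g \<in> T ` F"
  then obtain f where f: "f \<in> F" "g = T f" by blast
  have "Cr s g = T (wedge_basis s f)" using T_wedge[OF s f(1)] f(2) by simp
  then show "Cr s g \<in> T ` F" using linear_betweenD(1)[OF basis_linear(1)[OF s] f(1)] by simp
qed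

lemma TF_wedge:
  assumes c: "(u, k) \<in> creating b tw" and g: "g \<in> T ` F" shows "wedge u k g \<in> T ` F"
proof -
  have sc: "scal a h \<in> T ` F" if "h \<in> T ` F" for a h by (rule fn.subspace_scale[OF subspace_TF that])
  have X: "wedge (x i) k g \<in> T ` F" if "i < m" for i
  proof -
    define j where "j = (if tw then (k - 2) div 2 else (k - 1) div 2)"
    have "\<kappa> j = k" "j < 0" using c by (auto simp: creating_def \<kappa>_def j_def split: if_splits elim!: evenE oddE)
    then show ?thesis using TF_Cr[of "(i, j)", OF _ g] that by (simp add: Cr_def)
  qed
  have Y: "wedge (y i) k g \<in> T ` F" if "i < m" "k \<noteq> 0" for i
  proof -
    define j where "j = (if tw then (- k - 2) div 2 else (- k - 1) div 2)"
    have "\<kappa> j = - k" "j \<ge> 0" using c that(2) by (auto simp: creating_def \<kappa>_def j_def split: if_splits elim!: evenE oddE)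
    then have "wedge (y i) k g = scal (- 2) (Cr (i, j) g)" by (simp add: Cr_def scal_scal)
    then show ?thesis using sc[OF TF_Cr[of "(i, j)", OF _ g], of "-2"] that by simp
  qed
  have z: "wedge (\<Sum>i\<in>A. h i) k g = (\<Sum>i\<in>A. wedge (h i) k g)" for A :: "nat set" and h
    by (induction A rule: infinite_finite_induct) (simp_all add: wedge_linear_u)
  have "wedge u k g = (\<Sum>i<m. scal (B u (y i)) (wedge (x i) k g) + scal (B u (x i)) (wedge (y i) k g))"
    by (subst (1) expand[of u]) (simp only: z wedge_linear_u)
  also have "\<dots> \<in> T ` F"
  proof (rule fn.subspace_sum[OF subspace_TF], rule fn.subspace_add[OF subspace_TF])
    fix i assume i: "i \<in> {..<m}"
    show "scal (B u (y i)) (wedge (x i) k g) \<in> T ` F" using X i by (intro sc) simp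
    show "scal (B u (x i)) (wedge (y i) k g) \<in> T ` F"
    proof (cases "k = 0")
      case True
      then have "u \<in> minus_part b" using c by (auto simp: creating_def split: if_splits)
      then have "B u (x i) = 0" using P(8) x i by simp
      then show ?thesis using fn.subspace_0[OF subspace_TF] by simp
    next
      case False then show ?thesis using Y i by (intro sc) simp
    qed
  qed
  finally show ?thesis .
qed

text \<open>The creating elements are linear combinations of the adapted ones, hence the image is closed under them.\<close>

lemma T_surj: "T ` F = CS"
proof
  show "T ` F \<subseteq> CS" using T_CS by auto
  have "foldr (\<lambda>(u, k). wedge u k) us vacb \<in> T ` F" if "set us \<subseteq> creating b tw" for us
    using that
  proof (induction us)
    case Nil
    have "vacb = T vac" by (simp add: T_vac)
    then show ?case using vac_F by simp
  next
    case (Cons p us)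
    then show ?case using TF_wedge[of "fst p" "snd p"] by (simp add: case_prod_beta)
  qed
  then show "CS \<subseteq> T ` F" unfolding cliff_space_def by (intro fn.span_minimal subspace_TF) auto
qed

lemma T_bij: "bij_betw T F CS"
proof -
  have "inj_on T F"
  proof (rule inj_onI)
    fix f g assume fg: "f \<in> F" "g \<in> F" "T f = T g"
    have "T (f - g) = 0" using linear_between_diff[OF T_linear subspace_fsupp fg(1,2)] fg(3) by simp
    then have "f - g = 0" by (intro T_injective fn.subspace_diff[OF subspace_fsupp] fg(1,2))
    then show "f = g" by simp
  qed
  then show ?thesis by (simp add: bij_betw_def T_surj)
qed

lemma T_parity:
  assumes f: "f \<in> F" shows "T (smul parity f) = smul parity (T f)"
proof -
  have neg: "smul s (- f) = - smul s f" "smul s (f + g) = smul s f + smul s g" "smul s (scal a f) = scal a (smul s f)"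
    for s f g :: "'z fn" and a by (auto simp: smul_def fun_eq_iff fn_apply algebra_simps)
  have w: "smul parity (wedge u k f) = - wedge u k (smul parity f)" if "f \<in> FS" for u :: "'n cvec" and k f
  proof
    fix S
    have ap: "smul s g S = s S * g S" for s g :: "'n modes fn" by (simp add: smul_def)
    have "wedge_basis (i, k) (smul parity f) S = - (parity S * wedge_basis (i, k) f S)" for i
      by (simp add: parity_wedge[OF that] fn_apply ap)
    then show "smul parity (wedge u k f) S = (- wedge u k (smul parity f)) S"
      by (simp add: wedge_def fn_apply ap sum_distrib_left sum_negf mult_ac)
  qed
  have Crp: "smul parity (Cr s f) = - Cr s (smul parity f)" if "f \<in> FS" for s f
    using that by (simp add: Cr_def w neg scal_minus)
  have v: "smul parity (foldr Cr xs vacb) = scal ((- 1) ^ length xs) (foldr Cr xs vacb)" for xs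
  proof (induction xs)
    case Nil show ?case by (auto simp: smul_def unit_fn_def parity_def fun_eq_iff fn_apply)
  next
    case (Cons s xs)
    then show ?case by (simp add: Crp[OF foldr_FS] Cr_scal scal_minus_left)
  qed
  have vp: "smul parity (vect S) = scal (parity S) (vect S)" if "finite S" for S
  proof -
    have "distinct xs" if "sorted_wrt before xs" for xs :: "(nat \<times> int) list"
      using that by (induction xs) auto
    then have "distinct (lt_list S)" using lt_list[OF that] by blast
    then have "length (lt_list S) = card S" using lt_list[OF that] distinct_card by fastforce
    then show ?thesis by (simp add: vect_def v parity_def)
  qed
  have "T (smul parity f) = (\<Sum>S | f S \<noteq> 0. scal (smul parity f S) (vect S))"
    by (rule T_finite) (use f in \<open>auto simp: smul_def dest: fsuppD(1)\<close>)
  also have "\<dots> = (\<Sum>S | f S \<noteq> 0. smul parity (scal (f S) (vect S)))"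
  proof (rule sum.cong)
    fix S assume "S \<in> {S. f S \<noteq> 0}"
    then have "finite S" using fsuppD(2)[OF f] by (auto simp: labels_def)
    then show "scal (smul parity f S) (vect S) = smul parity (scal (f S) (vect S))"
      by (simp add: neg vp scal_scal smul_def[of parity f] mult.commute)
  qed simp
  also have "\<dots> = smul parity (T f)"
    unfolding T_def by (auto simp: smul_def fun_eq_iff fn_apply sum_distrib_left)
  finally show ?thesis .
qed

end

section \<open>The Virasoro action on Clifford modules\<close>

lemma fsum_scal: "fsum (\<lambda>k. scal c (t k)) = scal c (fsum t)"
proof (cases "c = 0")
  case False
  then have "{k. scal c (t k) \<noteq> 0} = {k. t k \<noteq> 0}" by simp
  then show ?thesis unfolding fsum_def by (simp add: scal_sum)
qed (simp add: fsum_def)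

lemma fsum_add:
  assumes "finite {k. s k \<noteq> 0}" "finite {k. t k \<noteq> 0}"
  shows "fsum (\<lambda>k. s k + t k) = fsum s + fsum t"
proof -
  let ?A = "{k. s k \<noteq> 0} \<union> {k. t k \<noteq> 0}"
  have "fsum (\<lambda>k. s k + t k) = (\<Sum>k\<in>?A. s k + t k)" "fsum s = (\<Sum>k\<in>?A. s k)" "fsum t = (\<Sum>k\<in>?A. t k)"
    by (rule fsum_eq; use assms in auto)+
  then show ?thesis by (simp add: sum.distrib)
qed

lemma fsum_sum:
  assumes "finite I" "\<And>i. i \<in> I \<Longrightarrow> finite {k. t i k \<noteq> 0}"
  shows "(\<Sum>i\<in>I. fsum (t i)) = fsum (\<lambda>k. \<Sum>i\<in>I. t i k)"
proof -
  let ?A = "\<Union>i\<in>I. {k. t i k \<noteq> 0}"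
  have fin: "finite ?A" using assms by auto
  have "fsum (t i) = (\<Sum>k\<in>?A. t i k)" if "i \<in> I" for i
    by (rule fsum_eq[OF fin]) (use that in auto)
  then have "(\<Sum>i\<in>I. fsum (t i)) = (\<Sum>i\<in>I. \<Sum>k\<in>?A. t i k)" by simp
  also have "\<dots> = (\<Sum>k\<in>?A. \<Sum>i\<in>I. t i k)" by (rule sum.swap)
  also have "\<dots> = fsum (\<lambda>k. \<Sum>i\<in>I. t i k)"
    by (rule fsum_eq[OF fin, symmetric]) (auto intro!: sum.neutral)
  finally show ?thesis .
qed

lemma fsum_reindex:
  assumes "inj \<pi>" "\<And>k. k \<notin> range \<pi> \<Longrightarrow> t k = 0"
  shows "fsum t = fsum (\<lambda>j. t (\<pi> j))"
proof -
  have "k \<in> \<pi> ` {j. t (\<pi> j) \<noteq> 0}" if "t k \<noteq> 0" for k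
  proof -
    have "k \<in> range \<pi>" using assms(2) that by blast
    with that show ?thesis by auto
  qed
  then have "{k. t k \<noteq> 0} = \<pi> ` {j. t (\<pi> j) \<noteq> 0}" by auto
  then show ?thesis
    unfolding fsum_def using inj_on_subset[OF assms(1)] by (simp add: sum.reindex)
qed

context clifford_fock
begin

lemma cliff_linear_u:
  "cliff b (u + v) k f = cliff b u k f + cliff b v k f" "cliff b (a *s u) k f = scal a (cliff b u k f)"
proof -
  have d: "u + v - (minus_proj b u + minus_proj b v) = (u - minus_proj b u) + (v - minus_proj b v)"
    "a *s u - a *s minus_proj b u = a *s (u - minus_proj b u)"
    by (simp_all add: vec.scale_right_diff_distrib)
  show "cliff b (u + v) k f = cliff b u k f + cliff b v k f" "cliff b (a *s u) k f = scal a (cliff b u k f)"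
    by (cases "k < 0"; cases "k > 0"; simp only: cliff_def minus_proj_add minus_proj_scale d
        wedge_linear_u contract_linear_u scal_add if_True if_False add_ac)+
qed

lemma cliff_linear_f:
  "cliff b u k (f + g) = cliff b u k f + cliff b u k g" "cliff b u k (scal c f) = scal c (cliff b u k f)"
  by (auto simp: cliff_def wedge_linear_f contract_linear_f scal_add)

lemma cliff_zero [simp]: "cliff b u k 0 = 0"
  by (simp add: cliff_def)

text \<open>Bilinearity lets the orthonormal basis be exchanged for the adapted one.\<close>

lemma normal_ordered_bilinear:
  "normal_ordered b u k (v + w) l f = normal_ordered b u k v l f + normal_ordered b u k w l f"
  "normal_ordered b (v + w) k u l f = normal_ordered b v k u l f + normal_ordered b w k u l f"
  "normal_ordered b u k (a *s v) l f = scal a (normal_ordered b u k v l f)"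
  "normal_ordered b (a *s v) k u l f = scal a (normal_ordered b v k u l f)"
  by (auto simp: normal_ordered_def cliff_linear_u cliff_linear_f scal_add scal_diff scal_minus scal_scal mult.commute)

lemma cliff_vanish:
  assumes f: "f \<in> FS" shows "\<exists>K\<ge>0. \<forall>u. \<forall>k>K. cliff b u k f = 0"
proof -
  define U where "U = snd ` \<Union>{S. f S \<noteq> 0}"
  have "finite U" using f by (auto simp: U_def dest: fsuppD)
  then obtain K where K: "\<forall>u\<in>U. \<bar>u\<bar> \<le> K" by (metis finite_imageI Max_ge imageI)
  have c: "contract_basis (i, - k) f = 0" if "k > \<bar>K\<bar>" for i k
  proof
    fix S show "contract_basis (i, - k) f S = 0 S"
    proof (rule ccontr)
      assume "contract_basis (i, - k) f S \<noteq> 0 S"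
      then have "f (insert (i, - k) S) \<noteq> 0" by (auto simp: contract_basis_def fn_apply split: if_splits)
      then have "- k \<in> U" by (force simp: U_def)
      with K that show False by fastforce
    qed
  qed
  show ?thesis by (rule exI[of _ "\<bar>K\<bar>"]) (auto simp: cliff_def contract_def c)
qed

lemma normal_ordered_vanish:
  assumes f: "f \<in> FS" shows "\<exists>A. finite A \<and> (\<forall>u w. \<forall>k. k \<notin> A \<longrightarrow> normal_ordered b u k w (2 * n - k) f = 0)"
proof -
  obtain K where K: "K \<ge> 0" "\<And>u k. k > K \<Longrightarrow> cliff b u k f = 0" using cliff_vanish[OF f] by blast
  have "normal_ordered b u k w (2 * n - k) f = 0" if "k \<notin> {- \<bar>2 * n\<bar> - K..\<bar>2 * n\<bar> + K}" for u w k
  proof (cases "k > K")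
    case True then show ?thesis using K by (simp add: normal_ordered_def)
  next
    case False
    then have "2 * n - k > K" "k < 0" using that K(1) by auto
    then show ?thesis using K(2)[of "2 * n - k" w] by (simp add: normal_ordered_def)
  qed
  then show ?thesis by (intro exI[of _ "{- \<bar>2 * n\<bar> - K..\<bar>2 * n\<bar> + K}"]) auto
qed

lemma cliff_x:
  assumes i: "i < m" and g: "g \<in> F" shows "cliff b (x i) (\<kappa> j) (T g) = T (\<psi> i j g)"
proof -
  have "(i, j) \<in> modes" using i by simp
  note TT = T_wedge[OF this g] T_contract[OF this g]
  show ?thesis
  proof (cases "j < 0")
    case True
    then have "\<kappa> j \<le> 0" by (auto simp: \<kappa>_def)
    then show ?thesis using True TT(1) minus_proj_minus[OF x[OF i]] by (auto simp: \<psi>_def cliff_def Cr_def)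
  next
    case False
    then have "\<kappa> j > 0" by (auto simp: \<kappa>_def)
    then show ?thesis using False TT(2) by (auto simp: \<psi>_def cliff_def An_def)
  qed
qed

lemma cliff_y:
  assumes i: "i < m" and g: "g \<in> F" shows "cliff b (y i) (- \<kappa> j) (T g) = scal (- 2) (T (\<psi>' i j g))"
proof -
  have "(i, j) \<in> modes" using i by simp
  note TT = T_wedge[OF this g] T_contract[OF this g]
  show ?thesis
  proof (cases "j < 0")
    case True
    then have "\<kappa> j \<le> 0" by (auto simp: \<kappa>_def)
    then show ?thesis using True TT(2) minus_proj_plus[OF y[OF i]] by (auto simp: \<psi>'_def cliff_def An_def scal_scal scal_minus)
  next
    case False
    then have "\<kappa> j > 0" by (auto simp: \<kappa>_def)
    then show ?thesis using False TT(1) by (auto simp: \<psi>'_def cliff_def Cr_def scal_scal scal_minus)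
  qed
qed

lemma cliff_xy:
  assumes i: "i < m" and f: "f \<in> F"
  shows "cliff b (x i) (\<kappa> j) (cliff b (y i) (- \<kappa> j') (T f)) = scal (- 2) (T (\<psi> i j (\<psi>' i j' f)))"
    and "cliff b (y i) (- \<kappa> j') (cliff b (x i) (\<kappa> j) (T f)) =
      scal (- 2) ((if j = j' then T f else 0) - T (\<psi> i j (\<psi>' i j' f)))"
proof -
  show "cliff b (x i) (\<kappa> j) (cliff b (y i) (- \<kappa> j') (T f)) = scal (- 2) (T (\<psi> i j (\<psi>' i j' f)))"
    by (simp only: cliff_y[OF i f] cliff_linear_f(2) cliff_x[OF i \<psi>'_F[OF i f]])
  have "T (\<psi>' i j' (\<psi> i j f)) = T (if j = j' then f else 0) - T (\<psi> i j (\<psi>' i j' f))"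
    using anticommute(3)[OF f, of i j' i j] linear_between_diff[OF T_linear subspace_fsupp _ \<psi>_F[OF i \<psi>'_F[OF i f]]] f
    by (auto simp: fn.subspace_0[OF subspace_fsupp])
  then show "cliff b (y i) (- \<kappa> j') (cliff b (x i) (\<kappa> j) (T f)) =
      scal (- 2) ((if j = j' then T f else 0) - T (\<psi> i j (\<psi>' i j' f)))"
    by (simp only: cliff_x[OF i f] cliff_y[OF i \<psi>_F[OF i f]]) simp
qed

lemma T_no:
  assumes i: "i < m" and f: "f \<in> F"
  shows "T (no i j j' f) = T (\<psi> i j (\<psi>' i j' f)) - (if j = j' \<and> j \<ge> 0 then T f else 0)"
  using linear_between_diff[OF T_linear subspace_fsupp \<psi>_F[OF i \<psi>'_F[OF i f]] f]
  by (auto simp: no_def)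

text \<open>On a zero mode the antisymmetrized product differs from the normally ordered one by a scalar,
  which cancels between the two orders.\<close>

lemma normal_ordered_xy:
  assumes i: "i < m" and f: "f \<in> F"
  shows "normal_ordered b (x i) (\<kappa> j) (y i) (- \<kappa> j') (T f) =
      scal (- 2) (T (no i j j' f)) + (if j = j' \<and> \<kappa> j = 0 then T f else 0)" (is ?A)
    and "normal_ordered b (y i) (- \<kappa> j') (x i) (\<kappa> j) (T f) =
      scal 2 (T (no i j j' f)) - (if j = j' \<and> \<kappa> j = 0 then T f else 0)" (is ?B)
proof -
  note S = normal_ordered_def cliff_xy[OF i f] T_no[OF i f]
  have k: "\<kappa> j < 0 \<longrightarrow> j < 0" "\<kappa> j > 0 \<longleftrightarrow> j \<ge> 0" "\<kappa> j = 0 \<longrightarrow> j = - 1" for j by (auto simp: \<kappa>_def)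
  consider "\<kappa> j < 0" "j < 0" | "\<kappa> j > 0" "j \<ge> 0" | "\<kappa> j = 0" "j < 0" using k[of j] by linarith
  then show ?A
  proof cases
    case 3
    then show ?thesis using cliff_xy(1)[OF i f, of j j'] cliff_xy(2)[OF i f, of j' j]
      by (simp add: normal_ordered_def T_no[OF i f]) (auto simp: fun_eq_iff fn_apply)
  qed (auto simp: S fun_eq_iff fn_apply)
  consider "\<kappa> j' < 0" "j' < 0" | "\<kappa> j' > 0" "j' \<ge> 0" | "\<kappa> j' = 0" "j' < 0" using k[of j'] by linarith
  then show ?B
  proof cases
    case 3
    then show ?thesis using cliff_xy(1)[OF i f, of j j'] cliff_xy(2)[OF i f, of j' j]
      by (simp add: normal_ordered_def T_no[OF i f]) (auto simp: fun_eq_iff fn_apply)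
  qed (auto simp: S fun_eq_iff fn_apply)
qed

lemma T_FL:
  assumes f: "f \<in> F"
  shows "T (FL n f) = (\<Sum>i<m. fsum (\<lambda>j. scal (coef n j) (T (no i j (j - n) f)))) + (if n = 0 then scal h0 (T f) else 0)"
proof -
  obtain A where A: "finite A" "\<And>i j. i < m \<Longrightarrow> j \<notin> A \<Longrightarrow> no i j (j - n) f = 0" "\<And>B. finite B \<Longrightarrow> A \<subseteq> B \<Longrightarrow>
      FL n f = (\<Sum>i<m. \<Sum>j\<in>B. scal (coef n j) (no i j (j - n) f)) + (if n = 0 then scal h0 f else 0)"
    by (rule FL_finite[OF f, of n]) blast
  have mem: "scal (coef n j) (no i j (j - n) f) \<in> F" if "i < m" for i j
    using that f by (intro fn.subspace_scale[OF subspace_fsupp] no_F)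
  have mem2: "(\<Sum>j\<in>A. scal (coef n j) (no i j (j - n) f)) \<in> F" if "i < m" for i
    using mem[OF that] by (intro fn.subspace_sum[OF subspace_fsupp])
  have mem3: "(\<Sum>i<m. \<Sum>j\<in>A. scal (coef n j) (no i j (j - n) f)) \<in> F"
    by (rule fn.subspace_sum[OF subspace_fsupp]) (simp add: mem2)
  have mem4: "(if n = 0 then scal h0 f else 0) \<in> F"
    using f by (simp add: fn.subspace_scale[OF subspace_fsupp] fn.subspace_0[OF subspace_fsupp])
  have "T (FL n f) = T (\<Sum>i<m. \<Sum>j\<in>A. scal (coef n j) (no i j (j - n) f)) + T (if n = 0 then scal h0 f else 0)"
    unfolding A(3)[OF A(1) order_refl] by (rule Tl(2)[OF mem3 mem4])
  also have "T (\<Sum>i<m. \<Sum>j\<in>A. scal (coef n j) (no i j (j - n) f)) = (\<Sum>i<m. T (\<Sum>j\<in>A. scal (coef n j) (no i j (j - n) f)))"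
    using mem2 by (intro linear_between_sum[OF T_linear subspace_fsupp]) simp
  also have "\<dots> = (\<Sum>i<m. fsum (\<lambda>j. scal (coef n j) (T (no i j (j - n) f))))"
  proof (rule sum.cong)
    fix i assume i: "i \<in> {..<m}"
    have "T (\<Sum>j\<in>A. scal (coef n j) (no i j (j - n) f)) = (\<Sum>j\<in>A. T (scal (coef n j) (no i j (j - n) f)))"
      using mem i by (intro linear_between_sum[OF T_linear subspace_fsupp]) simp
    also have "\<dots> = (\<Sum>j\<in>A. scal (coef n j) (T (no i j (j - n) f)))"
      using i f by (simp add: Tl(3) no_F)
    also have "\<dots> = fsum (\<lambda>j. scal (coef n j) (T (no i j (j - n) f)))"
      by (rule fsum_eq[symmetric, OF A(1)]) (use A(2) i in simp)
    finally show "T (\<Sum>j\<in>A. scal (coef n j) (no i j (j - n) f)) = fsum (\<lambda>j. scal (coef n j) (T (no i j (j - n) f)))" .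
  qed simp
  also have "T (if n = 0 then scal h0 f else 0) = (if n = 0 then scal h0 (T f) else 0)" by (simp add: Tl(3) f)
  finally show ?thesis .
qed

text \<open>In the adapted basis each pair of dual vectors contributes two equal sums after reindexing.  The scalars from
  the antisymmetrized zero modes and from the shift by $\frac1{16}\dim\mathfrak b$ agree on both sides.\<close>

lemma cliff_L_T:
  assumes f: "f \<in> F"
  shows "cliff_L b tw n (T f) = T (FL n f)"
proof -
  define c :: "int \<Rightarrow> complex" where "c k = - of_int k / 2 - 1 / 2" for k
  define N where "N k u w = normal_ordered b u k w (2 * n - k) (T f)" for k u w
  define D where "D i j = T (no i j (j - n) f)" for i j
  define E where "E j = (if n = 0 \<and> \<kappa> j = 0 then T f else 0)" for j
  obtain A where A: "finite A" "\<And>u w k. k \<notin> A \<Longrightarrow> N k u w = 0"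
    using normal_ordered_vanish[OF Tl(1)[OF f], of n] unfolding N_def by blast
  have bil: "N k u (v + w) = N k u v + N k u w" "N k (v + w) u = N k v u + N k w u"
    "N k u (a *s v) = scal a (N k u v)" "N k (a *s v) u = scal a (N k v u)" for k u v w a
    unfolding N_def by (rule normal_ordered_bilinear)+
  have fin: "finite {k. (if even k = tw then scal (c k) (N k u w) else 0) \<noteq> 0}" for u w
    by (rule finite_subset[OF _ A(1)]) (use A(2) in auto)
  have "(\<Sum>i\<in>UNIV. fsum (\<lambda>k. if even k = tw then scal (c k) (N k (onb b i) (onb b i)) else 0))
     = fsum (\<lambda>k. \<Sum>i\<in>UNIV. if even k = tw then scal (c k) (N k (onb b i) (onb b i)) else 0)"
    by (rule fsum_sum) (simp_all add: fin)
  also have "\<dots> = fsum (\<lambda>k. \<Sum>i<m. (if even k = tw then scal (c k) (N k (x i) (y i)) else 0) +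
        (if even k = tw then scal (c k) (N k (y i) (x i)) else 0))"
  proof (rule arg_cong[where f = fsum], rule ext)
    fix k
    have "(\<Sum>i\<in>UNIV. N k (onb b i) (onb b i)) = (\<Sum>i<m. N k (x i) (y i) + N k (y i) (x i))"
      by (rule casimir[OF bil expand])
    then show "(\<Sum>i\<in>UNIV. if even k = tw then scal (c k) (N k (onb b i) (onb b i)) else 0) =
      (\<Sum>i<m. (if even k = tw then scal (c k) (N k (x i) (y i)) else 0) +
        (if even k = tw then scal (c k) (N k (y i) (x i)) else 0))"
      by (cases "even k = tw") (simp_all flip: scal_sum scal_add)
  qed
  also have "\<dots> = (\<Sum>i<m. fsum (\<lambda>k. if even k = tw then scal (c k) (N k (x i) (y i)) else 0) +
        fsum (\<lambda>k. if even k = tw then scal (c k) (N k (y i) (x i)) else 0))"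
  proof -
    have "finite {k. (if even k = tw then scal (c k) (N k (x i) (y i)) else 0) +
        (if even k = tw then scal (c k) (N k (y i) (x i)) else 0) \<noteq> 0}" for i
      by (rule finite_subset[OF _ A(1)]) (use A(2) in auto)
    then show ?thesis by (simp only: fsum_sum[symmetric] finite_lessThan fsum_add[OF fin fin])
  qed
  also have "\<dots> = (\<Sum>i<m. fsum (\<lambda>j. scal (- 4 * coef n j) (D i j)))"
  proof (rule sum.cong)
    fix i assume "i \<in> {..<m}"
    then have i: "i < m" by simp
    have k1: "2 * n - \<kappa> j = - \<kappa> (j - n)" for j by (simp add: \<kappa>_def)
    have par: "even (\<kappa> j) = tw" "even (2 * n - \<kappa> j) = tw" for j by (simp_all add: \<kappa>_def)
    have ran: "k \<in> range \<kappa>" "k \<in> range (\<lambda>j. 2 * n - \<kappa> j)" if "even k = tw" for k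
    proof -
      have *: "\<exists>j. k = \<kappa> j" if "even k = tw" for k
        using that by (intro exI[of _ "if tw then k div 2 - 1 else k div 2"]) (auto simp: \<kappa>_def elim!: evenE oddE)
      from *[OF that] show "k \<in> range \<kappa>" by auto
      have "even (2 * n - k) = tw" using that by simp
      then obtain j where "2 * n - k = \<kappa> j" using * by blast
      then show "k \<in> range (\<lambda>j. 2 * n - \<kappa> j)" by (intro image_eqI[of _ _ j]) auto
    qed
    have D0: "finite {j. D i j \<noteq> 0}"
    proof -
      obtain A where "finite A" "\<forall>i j. i < m \<longrightarrow> j \<notin> A \<longrightarrow> no i j (j - n) f = 0" using no_vanish[OF f, of n] by blast
      then show ?thesis by (elim finite_subset[rotated]) (use i in \<open>auto simp: D_def\<close>)
    qed
    have E0: "finite {j. E j \<noteq> 0}"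
      by (rule finite_subset[of _ "{-1}"]) (auto simp: E_def \<kappa>_def split: if_splits)
    have fsc: "finite {j. scal (r j) (D i j) + scal (r' j) (E j) \<noteq> 0}" for r r'
      by (rule finite_subset[OF _ finite_UnI[OF D0 E0]]) auto
    have e1: "N (\<kappa> j) (x i) (y i) = scal (- 2) (D i j) + E j" for j
      unfolding N_def k1 normal_ordered_xy(1)[OF i f] D_def E_def by simp
    have e2: "N (2 * n - \<kappa> j) (y i) (x i) = scal 2 (D i j) + scal (- 1) (E j)" for j
    proof -
      have "2 * n - (2 * n - \<kappa> j) = \<kappa> j" by simp
      then show ?thesis unfolding N_def k1 by (simp add: normal_ordered_xy(2)[OF i f] D_def E_def)
    qed
    have 1: "fsum (\<lambda>k. if even k = tw then scal (c k) (N k (x i) (y i)) else 0)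
        = fsum (\<lambda>j. scal (c (\<kappa> j) * (- 2)) (D i j) + scal (c (\<kappa> j)) (E j))"
    proof -
      have "fsum (\<lambda>k. if even k = tw then scal (c k) (N k (x i) (y i)) else 0) =
          fsum (\<lambda>j. if even (\<kappa> j) = tw then scal (c (\<kappa> j)) (N (\<kappa> j) (x i) (y i)) else 0)"
        by (rule fsum_reindex) (use ran(1) in \<open>auto simp: inj_def \<kappa>_inj\<close>)
      then show ?thesis by (simp only: par e1 scal_add scal_scal if_True simp_thms)
    qed
    have 2: "fsum (\<lambda>k. if even k = tw then scal (c k) (N k (y i) (x i)) else 0)
        = fsum (\<lambda>j. scal (c (2 * n - \<kappa> j) * 2) (D i j) + scal (c (2 * n - \<kappa> j) * (- 1)) (E j))"
    proof -
      have "fsum (\<lambda>k. if even k = tw then scal (c k) (N k (y i) (x i)) else 0) =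
          fsum (\<lambda>j. if even (2 * n - \<kappa> j) = tw then scal (c (2 * n - \<kappa> j)) (N (2 * n - \<kappa> j) (y i) (x i)) else 0)"
        by (rule fsum_reindex) (use ran(2) in \<open>auto simp: inj_def \<kappa>_inj\<close>)
      then show ?thesis by (simp only: par e2 scal_add scal_scal if_True simp_thms)
    qed
    have "fsum (\<lambda>k. if even k = tw then scal (c k) (N k (x i) (y i)) else 0) +
        fsum (\<lambda>k. if even k = tw then scal (c k) (N k (y i) (x i)) else 0)
      = fsum (\<lambda>j. (scal (c (\<kappa> j) * (- 2)) (D i j) + scal (c (\<kappa> j)) (E j)) +
         (scal (c (2 * n - \<kappa> j) * 2) (D i j) + scal (c (2 * n - \<kappa> j) * (- 1)) (E j)))"
      unfolding 1 2 by (rule fsum_add[OF fsc fsc, symmetric])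
    also have "\<dots> = fsum (\<lambda>j. scal (- 4 * coef n j) (D i j))"
      by (rule arg_cong[where f = fsum]) (auto simp: fun_eq_iff fn_apply c_def coef_def E_def field_simps)
    finally show "fsum (\<lambda>k. if even k = tw then scal (c k) (N k (x i) (y i)) else 0) +
        fsum (\<lambda>k. if even k = tw then scal (c k) (N k (y i) (x i)) else 0) = fsum (\<lambda>j. scal (- 4 * coef n j) (D i j))" .
  qed simp
  also have "\<dots> = scal (- 4) (\<Sum>i<m. fsum (\<lambda>j. scal (coef n j) (D i j)))"
    by (simp only: scal_sum fsum_scal[symmetric] scal_scal)
  finally have main: "scal (- 1 / 4) (\<Sum>i\<in>UNIV. fsum (\<lambda>k. if even k = tw then scal (c k) (N k (onb b i) (onb b i)) else 0))
     = (\<Sum>i<m. fsum (\<lambda>j. scal (coef n j) (D i j)))"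
    by (simp add: scal_scal)
  have h: "of_nat CARD('n) / 16 = (of_nat m / 8 :: complex)" by (simp add: card)
  show ?thesis
    unfolding cliff_L_def T_FL[OF f] D_def[symmetric] main[symmetric] unfolding c_def N_def h h0_def by auto
qed

end

text \<open>The Fock space of charged fermions, transported along the comparison map \<open>T\<close>.\<close>

theorem clifford_model:
  fixes b :: "'n::{finite,linorder} polarized_space"
  assumes b: "polarized_space b" and card: "CARD('n) = 2 * m" and m: "even m"
  shows "unitary_model (clifford b tw) parity (fermions.labels m) (fermions.deg m tw) (of_nat m) parity"
proof -
  interpret polarized b by unfold_locales (rule b)
  obtain m' x y where xy: "\<forall>i<m'. x i \<in> minus_part b \<and> y i \<in> plus_part b"
    and dual: "\<forall>i<m'. \<forall>j<m'. form b (x i) (y j) = (if i = j then 1 else 0)"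
    and expand: "\<forall>u. u = (\<Sum>i<(m'::nat). form b u (y i) *s x i + form b u (x i) *s y i)"
    using adapted_basis by blast
  have "CARD('n) = 2 * m'"
    by (rule adapted_basis_card[where m = m' and x = x and y = y]) (rule spec[OF expand], use dual in simp)
  then have "m' = m" using card by simp
  then interpret clifford_fock b m tw x y
    by unfold_locales (use xy dual expand card m in blast)+
  show ?thesis
  proof (rule unitary_modelI[OF unitary])
    show "linear_between (fsupp labels) (carr (clifford b tw)) T"
      by (rule linear_betweenI) (simp_all add: clifford_def T_CS Tl)
    show "bij_betw T (fsupp labels) (carr (clifford b tw))" using T_bij by (simp add: clifford_def)
  next
    fix f assume f: "f \<in> fsupp labels"
    show "T (scal (of_nat m) f) = central (clifford b tw) (T f)"
      using Tl(3)[OF f] by (simp add: clifford_def card)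
    show "T (smul parity f) = smul parity (T f)" by (rule T_parity[OF f])
    fix n show "T (vir_L \<lparr>carr = fsupp labels, vir_L = FL, central = scal (of_nat m)\<rparr> n f) = vir_L (clifford b tw) n (T f)"
      using cliff_L_T[OF f] by (simp add: clifford_def)
  qed
qed

section \<open>Lattice modules\<close>

text \<open>An orthogonal basis suffices for unitarity: it may be normalized.\<close>

lemma weighted_unitary:
  fixes s :: "'x \<Rightarrow> real"
  assumes M: "virasoro_module M" and car: "carr M = fsupp X" and cen: "\<And>f. f \<in> fsupp X \<Longrightarrow> central M f = scal c f"
    and L0: "\<And>f. f \<in> fsupp X \<Longrightarrow> vir_L M 0 f = (\<lambda>x. of_nat (d x) / 4 * f x)"
    and s: "\<And>x. s x > 0"
    and adj: "\<And>f g n. f \<in> fsupp X \<Longrightarrow> g \<in> fsupp X \<Longrightarrow>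
        ip (smul (\<lambda>x. of_real (s x ^ 2)) (vir_L M n f)) g = ip (smul (\<lambda>x. of_real (s x ^ 2)) f) (vir_L M (- n) g)"
  shows "unitary_model M (\<lambda>_. 1) X d c (\<lambda>_. 1)"
proof -
  define S where "S = smul (\<lambda>x. of_real (s x) :: complex)"
  define S' where "S' = smul (\<lambda>x. of_real (1 / s x) :: complex)"
  have sx: "s x \<noteq> 0" for x using s[of x] by simp
  have SS': "S (S' f) = f" and S'S: "S' (S f) = f" for f
    using sx by (auto simp: S_def S'_def smul_def fun_eq_iff)
  have SX: "S f \<in> fsupp X" and SX': "S' f \<in> fsupp X" if "f \<in> fsupp X" for f
    using that by (simp_all add: S_def S'_def smul_fsupp)
  have Sl: "linear_between (fsupp X) (fsupp X) S" and Sl': "linear_between (fsupp X) (fsupp X) S'"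
    unfolding S_def S'_def by (rule smul_linear)+
  define N where "N = \<lparr>carr = fsupp X, vir_L = (\<lambda>n f. S (vir_L M n (S' f))), central = scal c\<rparr>"
  note V = virasoro_moduleD[OF M, unfolded car]
  have Lm: "vir_L M n f \<in> fsupp X" if "f \<in> fsupp X" for n f by (rule linear_betweenD(1)[OF V(2) that])
  have "virasoro_module N"
  proof (rule virasoro_module_transport[OF M, of N S])
    show "linear_between (carr M) (carr N) S" using Sl by (simp add: car N_def)
    show "bij_betw S (carr M) (carr N)"
      by (rule bij_betw_byWitness[of _ S']) (auto simp: car N_def SS' S'S SX SX')
  next
    fix f assume f: "f \<in> carr M"
    show "S (central M f) = central N (S f)"
      using f linear_betweenD(3)[OF Sl] by (simp add: N_def cen car)
    fix n show "S (vir_L M n f) = vir_L N n (S f)" by (simp add: N_def S'S)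
  qed
  moreover have "ip (vir_L N n f) g = ip f (vir_L N (- n) g)" if f: "f \<in> fsupp X" and g: "g \<in> fsupp X" for n f g
  proof -
    have sw: "ip (S f) (S g) = ip (smul (\<lambda>x. of_real (s x ^ 2)) f) g" if "g \<in> fsupp X" for f g
    proof -
      have "ip (S f) (S g) = (\<Sum>x | g x \<noteq> 0. cnj (S f x) * S g x)"
        by (rule ip_eq) (use that in \<open>auto simp: S_def smul_def dest: fsuppD(1)\<close>)
      also have "\<dots> = (\<Sum>x | g x \<noteq> 0. cnj (smul (\<lambda>x. of_real (s x ^ 2)) f x) * g x)"
        by (rule sum.cong) (auto simp: S_def smul_def power2_eq_square)
      also have "\<dots> = ip (smul (\<lambda>x. of_real (s x ^ 2)) f) g"
        by (rule ip_right[symmetric]) (use that in \<open>auto dest: fsuppD(1)\<close>)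
      finally show ?thesis .
    qed
    have "ip (vir_L N n f) g = ip (S (vir_L M n (S' f))) (S (S' g))" by (simp add: N_def SS')
    also have "\<dots> = ip (smul (\<lambda>x. of_real (s x ^ 2)) (S' f)) (vir_L M (- n) (S' g))"
      using adj[OF SX'[OF f] SX'[OF g]] by (simp add: sw SX'[OF g])
    also have "\<dots> = ip (S (S' f)) (S (vir_L M (- n) (S' g)))" by (simp add: sw Lm SX'[OF g])
    finally show ?thesis by (simp add: N_def SS')
  qed
  moreover have "vir_L N 0 f = (\<lambda>x. of_nat (d x) / 4 * f x)" if "f \<in> fsupp X" for f
    using sx by (simp add: N_def L0 SX'[OF that]) (auto simp: S_def S'_def smul_def fun_eq_iff)
  moreover have "smul (\<lambda>_. 1) f = f" for f :: "'x fn" by (simp add: smul_def)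
  ultimately have U: "unitary_vir N X d c (\<lambda>_. 1)"
    unfolding unitary_vir_def by (simp add: N_def)
  show ?thesis
  proof (rule unitary_modelI[OF U, of M S'])
    show "linear_between (fsupp X) (carr M) S'" using Sl' by (simp add: car)
    show "bij_betw S' (fsupp X) (carr M)"
      by (rule bij_betw_byWitness[of _ S]) (auto simp: car SS' S'S SX SX')
  qed (auto simp: N_def S'S cen SX' linear_betweenD(3)[OF Sl'] smul_def[of "\<lambda>_. 1"])
qed

text \<open>The Heisenberg relations $[h_i(k), h_j(l)] = k\delta_{ij}\delta_{k+l,0}$.\<close>

lemma heis_comm:
  "heis i k (heis j l f) = heis j l (heis i k f) + scal (if i = j \<and> k + l = 0 then of_int k else 0) f"
proof
  fix p show "heis i k (heis j l f) p = (heis j l (heis i k f) + scal (if i = j \<and> k + l = 0 then of_int k else 0) f) p"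
  proof (cases p)
    case (Pair P v)
    let ?x = "(i, nat (- k))" and ?y = "(j, nat (- l))" and ?X = "(i, nat k)" and ?Y = "(j, nat l)"
    consider "k < 0" "l < 0" | "k < 0" "l > 0" | "k > 0" "l < 0" | "k > 0" "l > 0" | "k = 0" | "l = 0" by linarith
    then show ?thesis
    proof cases
      case 1
      have "(?x \<in># P \<and> ?y \<in># P - {#?x#}) \<longleftrightarrow> (?y \<in># P \<and> ?x \<in># P - {#?y#})"
        by (cases "?x = ?y") (auto simp: in_diff_count)
      moreover have "P - {#?y, ?x#} = P - {#?x, ?y#}" by (simp only: add_mset_commute)
      ultimately show ?thesis using 1 by (auto simp: heis_def Pair fn_apply)
    next
      case 2
      show ?thesis
      proof (cases "i = j \<and> l = - k")
        case True
        then show ?thesis using 2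
          by (cases "?x \<in># P") (auto simp: heis_def Pair fn_apply count_eq_zero_iff algebra_simps in_diff_count
              dest!: multi_member_split)
      next
        case False
        then have ne: "?x \<noteq> ?Y" using 2 by auto
        have d1: "add_mset ?Y P - {#?x#} = add_mset ?Y (P - {#?x#})" using ne by (intro diff_add_mset_swap) auto
        have d2: "count (P - {#?x#}) ?Y = count P ?Y" "?x \<in># add_mset ?Y P \<longleftrightarrow> ?x \<in># P" using ne by auto
        have d3: "\<not> (i = j \<and> k + l = 0)" using False by auto
        show ?thesis using 2 by (simp only: heis_def Pair fn_apply d1 d2 d3 split_conv if_False if_True) simp
      qed
    next
      case 3
      show ?thesis
      proof (cases "i = j \<and> k = - l")
        case True
        then show ?thesis using 3
          by (cases "?y \<in># P") (auto simp: heis_def Pair fn_apply count_eq_zero_iff algebra_simps in_diff_count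
              dest!: multi_member_split)
      next
        case False
        then have ne: "?y \<noteq> ?X" using 3 by auto
        have d1: "add_mset ?X P - {#?y#} = add_mset ?X (P - {#?y#})" using ne by (intro diff_add_mset_swap) auto
        have d2: "count (P - {#?y#}) ?X = count P ?X" "?y \<in># add_mset ?X P \<longleftrightarrow> ?y \<in># P" using ne by auto
        have d3: "\<not> (i = j \<and> k + l = 0)" using False by auto
        show ?thesis using 3 by (simp only: heis_def Pair fn_apply d1 d2 d3 split_conv if_False if_True) simp
      qed
    next
      case 4
      then show ?thesis by (cases "?X = ?Y") (auto simp: heis_def Pair fn_apply add_mset_commute)
    next
      case 5
      then show ?thesis by (auto simp: heis_def Pair fn_apply)
    next
      case 6
      then show ?thesis by (auto simp: heis_def Pair fn_apply)
    qed
  qed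
qed

lemma heis_add: "heis i k (f + g) = heis i k f + heis i k g" and heis_scal: "heis i k (scal c f) = scal c (heis i k f)"
  by (auto simp: heis_def fun_eq_iff fn_apply algebra_simps)

lemma heis_zero [simp]: "heis i k 0 = 0"
  using heis_scal[of i k 0 0] by simp

lemma heis_sum: "heis i k (\<Sum>a\<in>A. f a) = (\<Sum>a\<in>A. heis i k (f a))"
  by (induction A rule: infinite_finite_induct) (simp_all add: heis_add)

text \<open>The square norm of the monomial \<open>P\<close> for the form in which $h_i(m)$ is adjoint to $h_i(-m)$.\<close>

definition pnorm :: "('n \<times> nat) multiset \<Rightarrow> real" where
  "pnorm P = (\<Prod>x\<in>set_mset P. of_nat (max 1 (snd x)) ^ count P x * fact (count P x))"

lemma pnorm_pos: "pnorm P > 0"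
  unfolding pnorm_def by (intro prod_pos ballI mult_pos_pos zero_less_power) auto

lemma pnorm_add:
  assumes "snd x \<ge> 1" shows "pnorm (add_mset x P) = of_nat (snd x) * of_nat (count P x + 1) * pnorm P"
proof -
  let ?g = "\<lambda>P y. of_nat (max 1 (snd y)) ^ count P y * fact (count P y) :: real"
  let ?A = "insert x (set_mset P)"
  have p: "pnorm Q = (\<Prod>y\<in>?A. ?g Q y)" if "set_mset Q \<subseteq> ?A" for Q
    unfolding pnorm_def by (rule prod.mono_neutral_left) (use that in \<open>auto simp: not_in_iff\<close>)
  have "pnorm (add_mset x P) = (\<Prod>y\<in>?A. ?g (add_mset x P) y)" by (rule p) auto
  also have "\<dots> = ?g (add_mset x P) x * (\<Prod>y\<in>?A - {x}. ?g (add_mset x P) y)" by (rule prod.remove) auto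
  also have "(\<Prod>y\<in>?A - {x}. ?g (add_mset x P) y) = (\<Prod>y\<in>?A - {x}. ?g P y)" by (rule prod.cong) auto
  also have "?g (add_mset x P) x = of_nat (snd x) * of_nat (count P x + 1) * ?g P x"
    using assms by (simp add: max_def algebra_simps)
  also have "of_nat (snd x) * of_nat (count P x + 1) * ?g P x * (\<Prod>y\<in>?A - {x}. ?g P y)
     = of_nat (snd x) * of_nat (count P x + 1) * (?g P x * (\<Prod>y\<in>?A - {x}. ?g P y))" by (simp only: mult.assoc)
  also have "?g P x * (\<Prod>y\<in>?A - {x}. ?g P y) = (\<Prod>y\<in>?A. ?g P y)" by (rule prod.remove[symmetric]) auto
  also have "\<dots> = pnorm P" by (rule p[symmetric]) auto
  finally show ?thesis .
qed

locale lattice_coset =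
  fixes K :: "(real ^ 'n::finite) set"
  assumes integral: "v \<in> K \<Longrightarrow> 2 * (v \<bullet> v) \<in> \<int>"
begin

definition lat :: "'n lattice_label set" where
  "lat = {(P, v). v \<in> K \<and> (\<forall>(i, m)\<in>#P. m \<ge> 1)}"

lemma carr_lattice: "carr (lattice_module K) = fsupp lat"
  by (simp add: lattice_module_def fsupp_def lat_def subset_iff split_paired_All)

abbreviation "H \<equiv> fsupp lat"

lemma heis_H: assumes f: "f \<in> H" shows "heis i k f \<in> H"
proof -
  let ?A = "{p. f p \<noteq> 0}"
  let ?B = "(\<lambda>(P, v). (add_mset (i, nat (- k)) P, v)) ` ?A \<union> (\<lambda>(P, v). (P - {#(i, nat k)#}, v)) ` ?A \<union> ?A"
  have fin: "finite ?A" using f by (rule fsuppD(1))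
  show ?thesis
  proof (rule fsuppI)
    show "finite ?B" using fin by simp
    have *: "heis i k f p = 0 \<or> (p \<in> ?B \<and> p \<in> lat)" for p
    proof (cases p)
      case (Pair P v)
      consider "k < 0" | "k > 0" | "k = 0" by linarith
      then show ?thesis
      proof cases
        case 1
        show ?thesis
        proof (cases "(i, nat (- k)) \<in># P \<and> f (P - {#(i, nat (- k))#}, v) \<noteq> 0")
          case True
          then obtain Q where Q: "P = add_mset (i, nat (- k)) Q" by (auto dest: multi_member_split)
          then have "f (Q, v) \<noteq> 0" using True by simp
          moreover from this have "(Q, v) \<in> lat" by (rule fsuppD(2)[OF f])
          ultimately show ?thesis using 1 Q unfolding Pair by (force simp: lat_def)
        qed (use 1 in \<open>auto simp: heis_def Pair\<close>)
      next
        case 2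
        show ?thesis
        proof (cases "f (add_mset (i, nat k) P, v) = 0")
          case False
          moreover from this have "(add_mset (i, nat k) P, v) \<in> lat" by (rule fsuppD(2)[OF f])
          ultimately show ?thesis using 2 unfolding Pair by (force simp: lat_def)
        qed (use 2 in \<open>auto simp: heis_def Pair\<close>)
      next
        case 3 then show ?thesis using fsuppD(2)[OF f, of p] by (cases "f p = 0") (auto simp: heis_def Pair)
      qed
    qed
    show "heis i k f p = 0" if "p \<notin> ?B" for p using *[of p] that by blast
    show "heis i k f p = 0" if "p \<notin> lat" for p using *[of p] that by blast
  qed
qed

lemma heis_linear: "linear_between H H (heis i k)"
  by (rule linear_betweenI) (simp_all add: heis_H heis_add heis_scal)

text \<open>The normally ordered product $h_i(k)h_i(n-k)$ of which $L(n)$ is half the sum.\<close>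

definition bil :: "int \<Rightarrow> 'n \<Rightarrow> int \<Rightarrow> 'n lattice_label fn \<Rightarrow> 'n lattice_label fn" where
  "bil n i k f = (if k \<le> n - k then heis i k (heis i (n - k) f) else heis i (n - k) (heis i k f))"

lemma lattice_L_bil: "lattice_L n f = scal (1 / 2) (\<Sum>i\<in>UNIV. fsum (\<lambda>k. bil n i k f))"
  by (simp add: lattice_L_def bil_def)

lemma bil_H: "f \<in> H \<Longrightarrow> bil n i k f \<in> H"
  by (simp add: bil_def heis_H)

lemma bil_add: "bil n i k (f + g) = bil n i k f + bil n i k g" and bil_scal: "bil n i k (scal c f) = scal c (bil n i k f)"
  by (simp_all add: bil_def heis_add heis_scal)

lemma bil_heis:
  "bil n i k (heis j l f) = heis j l (bil n i k f) +
     (if i = j then (if k = - l then scal (- of_int l) (heis j (l + n) f) else 0) +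
        (if k = l + n then scal (- of_int l) (heis j (l + n) f) else 0) else 0)"
proof -
  have *: "heis i a (heis i b (heis j l f)) = heis j l (heis i a (heis i b f)) +
      (if i = j then (if a = - l then scal (- of_int l) (heis j b f) else 0) +
         (if b = - l then scal (- of_int l) (heis j a f) else 0) else 0)" for a b
    unfolding heis_comm[of i b j l] heis_add heis_scal heis_comm[of i a j l]
    by (auto simp: add_eq_0_iff algebra_simps)
  show ?thesis
    by (cases "k \<le> n - k") (auto simp: bil_def * add.commute[of n l])
qed

lemma heis_vanish: "f \<in> H \<Longrightarrow> \<exists>N\<ge>0. \<forall>i k. k > N \<longrightarrow> heis i k f = 0"
proof -
  assume f: "f \<in> H"
  define U where "U = (\<Union>(P, v)\<in>{p. f p \<noteq> 0}. snd ` set_mset P)"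
  have "finite U" using fsuppD(1)[OF f] by (auto simp: U_def)
  then obtain N where N: "\<forall>u\<in>U. u \<le> N" using finite_nat_set_iff_bounded_le by auto
  have "heis i k f = 0" if "k > int N" for i k
  proof
    fix p show "heis i k f p = 0 p"
    proof (cases p)
      case (Pair P v)
      have "f (add_mset (i, nat k) P, v) = 0"
      proof (rule ccontr)
        assume "f (add_mset (i, nat k) P, v) \<noteq> 0"
        then have "nat k \<in> U" by (force simp: U_def)
        with N that show False by fastforce
      qed
      then show ?thesis using that by (simp add: heis_def Pair fn_apply)
    qed
  qed
  then show ?thesis by (intro exI[of _ "int N"]) auto
qed

lemma lattice_L_finite:
  assumes f: "f \<in> H"
  obtains A where "finite A" "\<And>i k. k \<notin> A \<Longrightarrow> bil n i k f = 0"
    "\<And>B. finite B \<Longrightarrow> A \<subseteq> B \<Longrightarrow> lattice_L n f = scal (1 / 2) (\<Sum>i\<in>UNIV. \<Sum>k\<in>B. bil n i k f)"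
proof -
  obtain N where N: "N \<ge> 0" "\<And>i k. k > N \<Longrightarrow> heis i k f = 0" using heis_vanish[OF f] by blast
  let ?A = "{n - N - \<bar>n\<bar>..N + \<bar>n\<bar>}"
  have v: "bil n i k f = 0" if "k \<notin> ?A" for i k
  proof (cases "k \<le> n - k")
    case True
    then have "n - k > N" using that N(1) by auto
    then show ?thesis using True by (simp add: bil_def N(2))
  next
    case False
    then have "k > N" using that N(1) by auto
    then show ?thesis using False by (simp add: bil_def N(2))
  qed
  show thesis
  proof (rule that[of ?A])
    fix B :: "int set" assume B: "finite B" "?A \<subseteq> B"
    show "lattice_L n f = scal (1 / 2) (\<Sum>i\<in>UNIV. \<Sum>k\<in>B. bil n i k f)"
      unfolding lattice_L_bil by (intro arg_cong[where f = "scal _"] sum.cong fsum_eq refl B v) (use B in blast)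
  qed (use v in auto)
qed

lemma lattice_L_linear: "linear_between H H (lattice_L n)"
proof (rule linear_betweenI)
  fix f assume f: "f \<in> H"
  obtain A where A: "finite A" "\<And>B. finite B \<Longrightarrow> A \<subseteq> B \<Longrightarrow> lattice_L n f = scal (1 / 2) (\<Sum>i\<in>UNIV. \<Sum>k\<in>B. bil n i k f)"
    by (rule lattice_L_finite[OF f, of n]) blast
  show "lattice_L n f \<in> H"
    unfolding A(2)[OF A(1) order_refl]
    by (intro fn.subspace_sum[OF subspace_fsupp] fn.subspace_scale[OF subspace_fsupp] bil_H f)
  fix c
  obtain B where B: "finite B" "\<And>C. finite C \<Longrightarrow> B \<subseteq> C \<Longrightarrow> lattice_L n (scal c f) = scal (1 / 2) (\<Sum>i\<in>UNIV. \<Sum>k\<in>C. bil n i k (scal c f))"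
    by (rule lattice_L_finite[OF fn.subspace_scale[OF subspace_fsupp f, of c], of n]) blast
  have E: "finite (A \<union> B)" "A \<subseteq> A \<union> B" "B \<subseteq> A \<union> B" using A(1) B(1) by auto
  show "lattice_L n (scal c f) = scal c (lattice_L n f)"
    unfolding A(2)[OF E(1,2)] B(2)[OF E(1,3)] by (simp add: bil_scal scal_sum scal_scal mult.commute)
  fix g assume g: "g \<in> H"
  obtain C where C: "finite C" "\<And>B. finite B \<Longrightarrow> C \<subseteq> B \<Longrightarrow> lattice_L n g = scal (1 / 2) (\<Sum>i\<in>UNIV. \<Sum>k\<in>B. bil n i k g)"
    by (rule lattice_L_finite[OF g, of n]) blast
  obtain D where D: "finite D" "\<And>B. finite B \<Longrightarrow> D \<subseteq> B \<Longrightarrow> lattice_L n (f + g) = scal (1 / 2) (\<Sum>i\<in>UNIV. \<Sum>k\<in>B. bil n i k (f + g))"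
    by (rule lattice_L_finite[OF fn.subspace_add[OF subspace_fsupp f g], of n]) blast
  let ?E = "A \<union> C \<union> D"
  have E: "finite ?E" "A \<subseteq> ?E" "C \<subseteq> ?E" "D \<subseteq> ?E" using A(1) C(1) D(1) by auto
  show "lattice_L n (f + g) = lattice_L n f + lattice_L n g"
    unfolding A(2)[OF E(1,2)] C(2)[OF E(1,3)] D(2)[OF E(1,4)] by (simp add: bil_add scal_add sum.distrib)
qed

text \<open>Two terms of $L(n)$ fail to commute with $h_j(l)$, each contributing $-l\,h_j(l+n)$, and the factor
  $\frac12$ of $L(n)$ leaves one of them.\<close>

lemma lattice_L_heis:
  assumes f: "f \<in> H"
  shows "lattice_L n (heis j l f) = heis j l (lattice_L n f) + scal (- of_int l) (heis j (l + n) f)"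
proof -
  obtain A where A: "finite A" "\<And>B. finite B \<Longrightarrow> A \<subseteq> B \<Longrightarrow> lattice_L n f = scal (1 / 2) (\<Sum>i\<in>UNIV. \<Sum>k\<in>B. bil n i k f)"
    by (rule lattice_L_finite[OF f, of n]) blast
  obtain B where B: "finite B" "\<And>C. finite C \<Longrightarrow> B \<subseteq> C \<Longrightarrow> lattice_L n (heis j l f) = scal (1 / 2) (\<Sum>i\<in>UNIV. \<Sum>k\<in>C. bil n i k (heis j l f))"
    by (rule lattice_L_finite[OF heis_H[OF f, of j l], of n]) blast
  define E where "E = insert (- l) (insert (l + n) (A \<union> B))"
  have E: "finite E" "A \<subseteq> E" "B \<subseteq> E" "- l \<in> E" "l + n \<in> E" using A(1) B(1) by (auto simp: E_def)
  let ?t = "scal (- of_int l) (heis j (l + n) f)"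
  have "(\<Sum>k\<in>E. bil n i k (heis j l f)) = heis j l (\<Sum>k\<in>E. bil n i k f) + (if i = j then ?t + ?t else 0)" for i
  proof -
    have "(\<Sum>k\<in>E. bil n i k (heis j l f)) = (\<Sum>k\<in>E. heis j l (bil n i k f)) +
       (if i = j then (\<Sum>k\<in>E. if k = - l then ?t else 0) + (\<Sum>k\<in>E. if k = l + n then ?t else 0) else 0)"
      unfolding bil_heis by (cases "i = j") (simp_all add: sum.distrib)
    also have "(\<Sum>k\<in>E. if k = - l then ?t else 0) = ?t" using E by (subst sum.delta) auto
    also have "(\<Sum>k\<in>E. if k = l + n then ?t else 0) = ?t" using E by (subst sum.delta) auto
    finally show ?thesis by (simp only: heis_sum)
  qed
  then have "(\<Sum>i\<in>UNIV. \<Sum>k\<in>E. bil n i k (heis j l f)) = heis j l (\<Sum>i\<in>UNIV. \<Sum>k\<in>E. bil n i k f) + (?t + ?t)"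
    by (simp only: sum.distrib heis_sum) (simp add: sum.delta)
  moreover have "scal (1 / 2) (s + (t + t)) = scal (1 / 2) s + t" for s t :: "'n lattice_label fn"
    by (auto simp: fun_eq_iff fn_apply field_simps)
  ultimately show ?thesis
    unfolding A(2)[OF E(1,2)] B(2)[OF E(1,3)] by (simp only: heis_scal)
qed

definition wtl :: "'n lattice_label \<Rightarrow> complex" where
  "wtl = (\<lambda>(P, v). of_real (v \<bullet> v) / 2 + of_nat (\<Sum>(i, m)\<in>#P. m))"

lemma heis_vac: "k > 0 \<Longrightarrow> heis i k (unit_fn ({#}, v)) = 0" "heis i 0 (unit_fn ({#}, v)) = scal (of_real (v $ i)) (unit_fn ({#}, v))"
  by (auto simp: heis_def unit_fn_def fun_eq_iff fn_apply)

lemma bil_vac: "k > 0 \<or> n - k > 0 \<Longrightarrow> bil n i k (unit_fn ({#}, v)) = 0"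
  by (auto simp: bil_def heis_vac)

lemma lattice_L_vac: "lattice_L n (unit_fn ({#}, v)) = scal (1 / 2) (\<Sum>i\<in>UNIV. \<Sum>k\<in>{n..0}. bil n i k (unit_fn ({#}, v)))"
  unfolding lattice_L_bil by (intro arg_cong[where f = "scal _"] sum.cong fsum_eq refl bil_vac) auto

lemma heis_at_vac: "k < 0 \<Longrightarrow> heis i k f ({#}, v) = 0"
  by (simp add: heis_def)

text \<open>The sum of $k(n-k)$ over $0\le k\le n$.\<close>

lemma sum_products: "(\<Sum>k\<in>{- int n..0}. (of_int k * of_int (- int n - k) :: complex)) = of_int (int n ^ 3 - int n) / 6"
proof -
  have "(\<Sum>k\<in>{- int n..0}. (of_int k * of_int (- int n - k) :: complex)) = (\<Sum>k\<in>{..n}. of_nat k * (of_nat n - of_nat k))"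
    by (rule sum.reindex_bij_witness[of _ "\<lambda>k. - int k" "\<lambda>k. nat (- k)"]) (auto simp: algebra_simps)
  also have "\<dots> = of_nat n * (\<Sum>k\<in>{..n}. of_nat k) - (\<Sum>k\<in>{..n}. of_nat k * of_nat k)"
    by (simp add: algebra_simps sum_subtractf sum_distrib_left)
  also have "(\<Sum>k\<in>{..n}. of_nat k :: complex) = of_nat n * (of_nat n + 1) / 2"
    by (induction n) (auto simp: field_simps)
  also have "(\<Sum>k\<in>{..n}. of_nat k * of_nat k :: complex) = of_nat n * (of_nat n + 1) * (2 * of_nat n + 1) / 6"
    by (induction n) (auto simp: field_simps)
  finally have e: "(\<Sum>k\<in>{- int n..0}. (of_int k * of_int (- int n - k) :: complex)) =
      of_nat n * (of_nat n * (of_nat n + 1) / 2) - of_nat n * (of_nat n + 1) * (2 * of_nat n + 1) / 6" .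
  show ?thesis unfolding e by (simp add: field_simps power3_eq_cube)
qed

text \<open>The momentum contributes $n\,v^2$ through the two terms with a zero mode, and the other terms give the
  sum of $k(n-k)$, hence the central charge.\<close>

lemma central_lattice:
  assumes v: "v \<in> K" and n: "n > 0"
  shows "lattice_L n (lattice_L (- n) (unit_fn ({#}, v))) ({#}, v) =
    2 * of_int n * wtl ({#}, v) + of_int (n ^ 3 - n) / 12 * of_nat CARD('n)"
proof -
  let ?e = "unit_fn ({#}, v) :: 'n lattice_label fn"
  have eH: "?e \<in> H" by (rule unit_fn_fsupp) (simp add: lat_def v)
  have Lne: "lattice_L n ?e = 0" unfolding lattice_L_vac using n by simp
  have ev: "?e ({#}, v) = 1" by (simp add: unit_fn_def)
  have bH: "bil (- n) i k ?e \<in> H" for i k by (rule bil_H[OF eH])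
  have tval: "lattice_L n (bil (- n) i k ?e) ({#}, v) =
     (if k = 0 then of_int n * of_real (v $ i) ^ 2 else 0) + (if k = - n then of_int n * of_real (v $ i) ^ 2 else 0)
       + of_int k * of_int (- n - k)" if k: "k \<in> {- n..0}" for i k
  proof -
    define l where "l = - n - k"
    have kl: "k \<le> 0" "l \<le> 0" "k + n = - l" "l + n = - k" "k + l = - n" using k by (auto simp: l_def)
    have b: "bil (- n) i k ?e = heis i k (heis i l ?e)"
      using heis_comm[of i l i k ?e] kl n by (auto simp: bil_def l_def)
    have "lattice_L n (bil (- n) i k ?e) = heis i k (lattice_L n (heis i l ?e)) + scal (- of_int k) (heis i (- l) (heis i l ?e))"
      using lattice_L_heis[OF heis_H[OF eH], of n i k i l] kl b by simp
    also have "lattice_L n (heis i l ?e) = scal (- of_int l) (heis i (- k) ?e)"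
      using lattice_L_heis[OF eH, of n i l] kl Lne by simp
    also have "heis i k (scal (- of_int l) (heis i (- k) ?e)) = scal (- of_int l) (heis i k (heis i (- k) ?e))"
      by (rule heis_scal)
    finally have e: "lattice_L n (bil (- n) i k ?e) ({#}, v) =
       - of_int l * heis i k (heis i (- k) ?e) ({#}, v) - of_int k * heis i (- l) (heis i l ?e) ({#}, v)"
      by (simp add: fn_apply)
    have 1: "heis i k (heis i (- k) ?e) ({#}, v) = (if k = 0 then of_real (v $ i) ^ 2 else 0)"
      using kl(1) by (cases "k = 0") (auto simp: heis_vac heis_scal fn_apply ev power2_eq_square)
    have 2: "heis i (- l) (heis i l ?e) ({#}, v) = (if l = 0 then of_real (v $ i) ^ 2 else - of_int l)"
    proof (cases "l = 0")
      case True then show ?thesis by (simp add: heis_vac heis_scal fn_apply ev power2_eq_square)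
    next
      case False
      then have "l < 0" using kl by simp
      then show ?thesis using heis_comm[of i "- l" i l ?e] by (simp add: heis_vac fn_apply ev)
    qed
    have "lattice_L n (bil (- n) i k ?e) ({#}, v) = - of_int l * (if k = 0 then of_real (v $ i) ^ 2 else 0)
        - of_int k * (if l = 0 then of_real (v $ i) ^ 2 else - of_int l)"
      using e unfolding 1 2 .
    moreover have "l = 0 \<longleftrightarrow> k = - n" by (auto simp: l_def)
    ultimately show ?thesis using n unfolding l_def by (auto simp: algebra_simps)
  qed
  have "lattice_L n (lattice_L (- n) ?e) = scal (1 / 2) (\<Sum>i\<in>UNIV. \<Sum>k\<in>{- n..0}. lattice_L n (bil (- n) i k ?e))"
  proof -
    have m: "(\<Sum>k\<in>{- n..0}. bil (- n) i k ?e) \<in> H" for i by (intro fn.subspace_sum[OF subspace_fsupp] bH)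
    have "lattice_L n (lattice_L (- n) ?e) = scal (1 / 2) (lattice_L n (\<Sum>i\<in>UNIV. \<Sum>k\<in>{- n..0}. bil (- n) i k ?e))"
      unfolding lattice_L_vac[of "- n"] by (rule linear_betweenD(3)[OF lattice_L_linear fn.subspace_sum[OF subspace_fsupp m]])
    also have "lattice_L n (\<Sum>i\<in>UNIV. \<Sum>k\<in>{- n..0}. bil (- n) i k ?e) = (\<Sum>i\<in>UNIV. lattice_L n (\<Sum>k\<in>{- n..0}. bil (- n) i k ?e))"
      by (rule linear_between_sum[OF lattice_L_linear subspace_fsupp m])
    also have "\<dots> = (\<Sum>i\<in>UNIV. \<Sum>k\<in>{- n..0}. lattice_L n (bil (- n) i k ?e))"
      by (rule sum.cong[OF refl]) (rule linear_between_sum[OF lattice_L_linear subspace_fsupp bH])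
    finally show ?thesis .
  qed
  then have "lattice_L n (lattice_L (- n) ?e) ({#}, v) = (\<Sum>i\<in>UNIV. \<Sum>k\<in>{- n..0}. lattice_L n (bil (- n) i k ?e) ({#}, v)) / 2"
    by (simp add: fn_apply)
  also have "\<dots> = (\<Sum>i\<in>UNIV. \<Sum>k\<in>{- n..0}. (if k = 0 then of_int n * of_real (v $ i) ^ 2 else 0) +
       (if k = - n then of_int n * of_real (v $ i) ^ 2 else 0) + of_int k * of_int (- n - k)) / 2"
    using tval by simp
  also have "\<dots> = (\<Sum>i\<in>UNIV. 2 * of_int n * of_real (v $ i) ^ 2 + of_int (n ^ 3 - n) / 6) / 2"
  proof -
    obtain k where k: "n = int k" using n by (metis zero_less_imp_eq_int)
    have "(\<Sum>k\<in>{- n..0}. (of_int k * of_int (- n - k) :: complex)) = of_int (n ^ 3 - n) / 6"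
      using sum_products[of k] unfolding k[symmetric] .
    moreover have "(\<Sum>k\<in>{- n..0}. if k = 0 then c else 0) = c" "(\<Sum>k\<in>{- n..0}. if k = - n then c else 0) = c"
      for c :: complex using n by auto
    ultimately have "(\<Sum>k\<in>{- n..0}. (if k = 0 then c else 0) + (if k = - n then c else 0) + of_int k * of_int (- n - k))
        = 2 * c + of_int (n ^ 3 - n) / 6" for c :: complex by (simp only: sum.distrib) simp
    then show ?thesis by (simp only: mult.assoc)
  qed
  also have "\<dots> = of_int n * (\<Sum>i\<in>UNIV. of_real (v $ i) ^ 2) + of_int (n ^ 3 - n) / 12 * of_nat CARD('n)"
    by (simp only: sum.distrib mult.assoc sum_distrib_left[symmetric] sum_constant) (simp add: field_simps)
  also have "(\<Sum>i\<in>UNIV. of_real (v $ i) ^ 2) = (of_real (v \<bullet> v) :: complex)"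
    by (simp add: inner_vec_def power2_eq_square)
  finally show ?thesis by (simp add: wtl_def)
qed

sublocale primary_fields lat lattice_L "UNIV :: 'n set" heis "\<lambda>n i j. - of_int j" "{p \<in> lat. fst p = {#}}" wtl "\<lambda>p. size (fst p)" "of_nat CARD('n)"
proof
  show "linear_between H H (lattice_L n)" for n by (rule lattice_L_linear)
  show "linear_between H H (heis i j)" for i j by (rule heis_linear)
  show "lattice_L n (heis i j f) = heis i j (lattice_L n f) + scal (- of_int j) (heis i (j + n) f)" if "f \<in> H" for n i j f
    by (rule lattice_L_heis[OF that])
  show "- of_int j * - of_int (j + n) - - of_int j * - of_int (j + m) = of_int (m - n) * (- of_int j :: complex)" for j n m
    by (simp add: algebra_simps)
  show "{p \<in> lat. fst p = {#}} \<subseteq> lat" by auto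
next
  fix p assume p: "p \<in> lat" "p \<notin> {p \<in> lat. fst p = {#}}"
  obtain P v where pv: "p = (P, v)" by (cases p)
  then have "P \<noteq> {#}" using p by auto
  then obtain i m where im: "(i, m) \<in># P" by (cases P) auto
  then obtain Q where Q: "P = add_mset (i, m) Q" by (auto dest: multi_member_split)
  have m1: "m \<ge> 1" using p im by (auto simp: lat_def pv)
  have "unit_fn p = scal 1 (heis i (- int m) (unit_fn (Q, v)))"
  proof
    fix p' show "unit_fn p p' = scal 1 (heis i (- int m) (unit_fn (Q, v))) p'"
    proof (cases p')
      case (Pair P' v')
      have "P' = add_mset (i, m) Q \<longleftrightarrow> (i, m) \<in># P' \<and> P' - {#(i, m)#} = Q"
        by (metis add_mset_remove_trivial insert_DiffM union_single_eq_member)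
      then show ?thesis using m1 by (simp add: unit_fn_def heis_def pv Q Pair fn_apply)
    qed
  qed
  moreover have "(Q, v) \<in> lat" using p by (auto simp: lat_def pv Q)
  moreover have "wtl p = wtl (Q, v) + - of_int (- int m)" by (simp add: wtl_def pv Q)
  ultimately show "\<exists>i\<in>UNIV. \<exists>j k y. y \<in> lat \<and> size (fst y) < size (fst p) \<and>
      unit_fn p = scal k (heis i j (unit_fn y)) \<and> wtl p = wtl y + - of_int j"
    by (intro bexI[of _ i] exI[of _ "- int m"] exI[of _ 1] exI[of _ "(Q, v)"]) (auto simp: pv Q)
next
  fix p assume "p \<in> {p \<in> lat. fst p = {#}}"
  then obtain v where p: "p = ({#}, v)" and v: "v \<in> K" by (cases p) (auto simp: lat_def)
  have "bil 0 i 0 (unit_fn p) = scal (of_real (v $ i * v $ i)) (unit_fn p)" for i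
    by (simp add: bil_def p heis_vac heis_scal scal_scal)
  then have "lattice_L 0 (unit_fn p) = scal (1 / 2) (\<Sum>i\<in>UNIV. scal (of_real (v $ i * v $ i)) (unit_fn p))"
    unfolding p lattice_L_vac by simp
  also have "\<dots> = scal (1 / 2 * (\<Sum>i\<in>UNIV. of_real (v $ i * v $ i))) (unit_fn p)"
    by (simp only: fn.scale_sum_left[symmetric] scal_scal)
  finally show "lattice_L 0 (unit_fn p) = scal (wtl p) (unit_fn p)" by (simp add: wtl_def p inner_vec_def)
next
  fix p T assume "p \<in> {p \<in> lat. fst p = {#}}" and T: "linear_between H H T"
    and comm: "\<And>i j f. i \<in> UNIV \<Longrightarrow> f \<in> H \<Longrightarrow> T (heis i j f) = heis i j (T f)"
  then obtain v where p: "p = ({#}, v)" and v: "v \<in> K" by (cases p) (auto simp: lat_def)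
  have pH: "unit_fn p \<in> H" by (rule unit_fn_fsupp) (simp add: lat_def v p)
  have T0: "T 0 = 0" by (rule linear_between_0[OF T subspace_fsupp])
  have ann: "heis i k (T (unit_fn p)) = 0" if "k > 0" for i k
    using comm[of i "unit_fn p" k] pH that T0 by (simp add: p heis_vac)
  have mom: "heis i 0 (T (unit_fn p)) = scal (of_real (v $ i)) (T (unit_fn p))" for i
    using comm[of i "unit_fn p" 0] pH linear_betweenD(3)[OF T pH] by (simp add: p heis_vac)
  have z: "T (unit_fn p) (P, u) = 0" if ne: "(P, u) \<noteq> p" for P u
  proof (rule ccontr)
    assume nz: "T (unit_fn p) (P, u) \<noteq> 0"
    have "u $ i = v $ i" for i using fun_cong[OF mom[of i], of "(P, u)"] nz by (simp add: heis_def fn_apply)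
    then have "u = v" by (simp add: vec_eq_iff)
    then have "P \<noteq> {#}" using ne p by simp
    then obtain i m where im: "(i, m) \<in># P" by (cases P) auto
    then obtain Q where Q: "P = add_mset (i, m) Q" by (auto dest: multi_member_split)
    have "(P, u) \<in> lat" by (rule fsuppD(2)[OF linear_betweenD(1)[OF T pH] nz])
    then have "m \<ge> 1" using im by (auto simp: lat_def)
    then have "of_int (int m) * of_nat (count Q (i, m) + 1) * T (unit_fn p) (P, u) = 0"
      using fun_cong[OF ann[of "int m" i], of "(Q, u)"] by (simp add: heis_def fn_apply Q)
    with nz \<open>m \<ge> 1\<close> show False by (simp del: of_nat_Suc of_nat_add)
  qed
  show "T (unit_fn p) = scal (T (unit_fn p) p) (unit_fn p)"
  proof
    fix q show "T (unit_fn p) q = scal (T (unit_fn p) p) (unit_fn p) q"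
      using z[of "fst q" "snd q"] by (cases "q = p") (simp_all add: fn_apply unit_fn_def[of p])
  qed
next
  fix p and n :: int assume "p \<in> {p \<in> lat. fst p = {#}}" and n: "n \<noteq> 0"
  then obtain v where p: "p = ({#}, v)" and v: "v \<in> K" by (cases p) (auto simp: lat_def)
  have "bil n i k (unit_fn p) p = 0" if "k \<in> {n..0}" for i k
    using that n by (cases "k \<le> n - k") (auto simp: bil_def p heis_at_vac)
  then show "lattice_L n (unit_fn p) p = 0" unfolding p lattice_L_vac by (simp add: fn_apply)
next
  fix p and n :: int assume "p \<in> {p \<in> lat. fst p = {#}}" and n: "n > 0"
  then obtain v where p: "p = ({#}, v)" and v: "v \<in> K" by (cases p) (auto simp: lat_def)
  show "lattice_L n (unit_fn p) = 0" unfolding p lattice_L_vac using n by simp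
  show "lattice_L n (lattice_L (- n) (unit_fn p)) p = 2 * of_int n * wtl p + of_int (n ^ 3 - n) / 12 * of_nat CARD('n)"
    unfolding p by (rule central_lattice[OF v n])
qed

text \<open>The annihilation operator multiplies by the mode number and by the multiplicity; this is the quotient of
  the norms of the two monomials.\<close>

lemma heis_adjoint_pos:
  assumes f: "f \<in> H" and g: "g \<in> H" and k: "k > 0"
  shows "ip (smul (\<lambda>(P, v). of_real (pnorm P)) (heis i k f)) g = ip (smul (\<lambda>(P, v). of_real (pnorm P)) f) (heis i (- k) g)"
proof -
  let ?r = "\<lambda>(P, v). of_real (pnorm P) :: complex"
  let ?B = "{p. g p \<noteq> 0}" and ?a = "\<lambda>(P :: ('n \<times> nat) multiset, v :: real ^ 'n). (add_mset (i, nat k) P, v)"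
  have fin: "finite ?B" using g by (rule fsuppD(1))
  have inj: "inj_on ?a ?B" by (auto simp: inj_on_def)
  have "ip (smul ?r f) (heis i (- k) g) = (\<Sum>p\<in>?a ` ?B. cnj (smul ?r f p) * heis i (- k) g p)"
  proof (rule ip_eq)
    fix p assume np: "p \<notin> ?a ` ?B"
    have "heis i (- k) g p = 0"
    proof (rule ccontr)
      assume nz: "heis i (- k) g p \<noteq> 0"
      obtain P v where p: "p = (P, v)" by (cases p)
      have "(i, nat k) \<in># P" "g (P - {#(i, nat k)#}, v) \<noteq> 0" using nz k by (auto simp: heis_def p split: if_splits)
      then have "p = ?a (P - {#(i, nat k)#}, v)" "(P - {#(i, nat k)#}, v) \<in> ?B" by (auto simp: p)
      with np show False by blast
    qed
    then show "smul ?r f p = 0 \<or> heis i (- k) g p = 0" by simp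
  qed (use fin in simp)
  also have "\<dots> = (\<Sum>p\<in>?B. cnj (smul ?r (heis i k f) p) * g p)"
    unfolding sum.reindex[OF inj] comp_def
  proof (rule sum.cong[OF refl])
    fix p :: "'n lattice_label" obtain P v where p: "p = (P, v)" by (cases p)
    have "pnorm (add_mset (i, nat k) P) = of_int k * of_nat (count P (i, nat k) + 1) * pnorm P"
      using pnorm_add[of "(i, nat k)" P] k by simp
    then show "cnj (smul ?r f (?a p)) * heis i (- k) g (?a p) = cnj (smul ?r (heis i k f) p) * g p"
      using k by (simp add: p smul_def heis_def mult_ac)
  qed
  also have "\<dots> = ip (smul ?r (heis i k f)) g" by (rule ip_right[OF fin, symmetric])
  finally show ?thesis ..
qed

lemma heis_adjoint:
  assumes f: "f \<in> H" and g: "g \<in> H"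
  shows "ip (smul (\<lambda>(P, v). of_real (pnorm P)) (heis i k f)) g = ip (smul (\<lambda>(P, v). of_real (pnorm P)) f) (heis i (- k) g)"
proof -
  let ?r = "\<lambda>(P, v). of_real (pnorm P) :: complex"
  have move: "ip (smul ?r f) g = ip f (smul ?r g)" for f g :: "'n lattice_label fn"
  proof -
    have "pnorm P \<noteq> 0" for P :: "('n \<times> nat) multiset" using pnorm_pos[of P] by simp
    then have "{x. smul ?r f x \<noteq> 0 \<and> g x \<noteq> 0} = {x. f x \<noteq> 0 \<and> smul ?r g x \<noteq> 0}" by (auto simp: smul_def)
    then show ?thesis unfolding ip_def by (intro sum.cong) (auto simp: smul_def split: prod.splits)
  qed
  consider "k > 0" | "k = 0" | "k < 0" by linarith
  then show ?thesis
  proof cases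
    case 1 then show ?thesis by (rule heis_adjoint_pos[OF f g])
  next
    case 2
    have z: "heis i 0 h = smul (\<lambda>(P, v). of_real (v $ i)) h" for h by (auto simp: heis_def smul_def)
    have "ip (smul ?r (heis i 0 f)) g = (\<Sum>p | g p \<noteq> 0. cnj (smul ?r (heis i 0 f) p) * g p)"
      by (rule ip_right[OF fsuppD(1)[OF g]])
    also have "\<dots> = (\<Sum>p | g p \<noteq> 0. cnj (smul ?r f p) * heis i 0 g p)"
      by (rule sum.cong) (auto simp: z smul_def)
    also have "\<dots> = ip (smul ?r f) (heis i 0 g)"
      by (rule ip_eq[symmetric]) (use fsuppD(1)[OF g] in \<open>auto simp: z smul_def\<close>)
    finally show ?thesis using 2 by simp
  next
    case 3
    have "ip (smul ?r g) (heis i k f) = ip (smul ?r (heis i (- k) g)) f"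
      using heis_adjoint_pos[OF g f, of "- k" i] 3 by simp
    then have "cnj (ip (smul ?r g) (heis i k f)) = cnj (ip (smul ?r (heis i (- k) g)) f)" by (rule arg_cong)
    then show ?thesis unfolding ip_cnj by (simp add: move)
  qed
qed

lemma bil_adjoint:
  assumes f: "f \<in> H" and g: "g \<in> H"
  shows "ip (smul (\<lambda>(P, v). of_real (pnorm P)) (bil n i k f)) g = ip (smul (\<lambda>(P, v). of_real (pnorm P)) f) (bil (- n) i (- k) g)"
proof (cases "k \<le> n - k")
  case True
  then have "- k \<ge> - n - - k" by simp
  then have "bil (- n) i (- k) g = heis i (- (n - k)) (heis i (- k) g)"
    by (auto simp: bil_def algebra_simps)
  then show ?thesis using True by (simp add: bil_def heis_adjoint heis_H f g)
next
  case False
  then have "bil (- n) i (- k) g = heis i (- k) (heis i (- (n - k)) g)"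
    by (auto simp: bil_def algebra_simps)
  then show ?thesis using False by (simp add: bil_def heis_adjoint heis_H f g)
qed

lemma lattice_L_adjoint:
  assumes f: "f \<in> H" and g: "g \<in> H"
  shows "ip (smul (\<lambda>(P, v). of_real (pnorm P)) (lattice_L n f)) g = ip (smul (\<lambda>(P, v). of_real (pnorm P)) f) (lattice_L (- n) g)"
proof -
  let ?r = "\<lambda>(P, v). of_real (pnorm P) :: complex"
  obtain A where A: "finite A" "\<And>B. finite B \<Longrightarrow> A \<subseteq> B \<Longrightarrow> lattice_L n f = scal (1 / 2) (\<Sum>i\<in>UNIV. \<Sum>k\<in>B. bil n i k f)"
    by (rule lattice_L_finite[OF f, of n]) blast
  obtain B where B: "finite B" "\<And>C. finite C \<Longrightarrow> B \<subseteq> C \<Longrightarrow> lattice_L (- n) g = scal (1 / 2) (\<Sum>i\<in>UNIV. \<Sum>k\<in>C. bil (- n) i k g)"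
    by (rule lattice_L_finite[OF g, of "- n"]) blast
  define E where "E = A \<union> uminus ` B"
  have E: "finite E" "A \<subseteq> E" using A(1) B(1) by (auto simp: E_def)
  have "x \<in> uminus ` E" if "x \<in> B" for x
    by (rule image_eqI[of _ _ "- x"]) (use that in \<open>auto simp: E_def\<close>)
  then have E': "finite (uminus ` E)" "B \<subseteq> uminus ` E" using E by auto
  have inj: "inj_on uminus E" by (auto simp: inj_on_def)
  have rs: "smul ?r (scal c h) = scal c (smul ?r h)" "smul ?r (\<Sum>a\<in>S. t a) = (\<Sum>a\<in>S. smul ?r (t a))"
    for c h and S :: "'s set" and t
    by (auto simp: smul_def fun_eq_iff fn_apply sum_distrib_left)
  have rs2: "smul ?r (\<Sum>a\<in>S. t a) = (\<Sum>a\<in>S. smul ?r (t a))" for S :: "'n set" and t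
    by (auto simp: smul_def fun_eq_iff fn_apply sum_distrib_left)
  have rs3: "smul ?r (\<Sum>a\<in>S. t a) = (\<Sum>a\<in>S. smul ?r (t a))" for S :: "int set" and t
    by (auto simp: smul_def fun_eq_iff fn_apply sum_distrib_left)
  have "ip (smul ?r (lattice_L n f)) g = 1 / 2 * (\<Sum>i\<in>UNIV. \<Sum>k\<in>E. ip (smul ?r (bil n i k f)) g)"
    unfolding A(2)[OF E] rs(1) rs2 rs3 by (simp add: ip_scal_left[OF g] ip_sum_left[OF g])
  also have "\<dots> = 1 / 2 * (\<Sum>i\<in>UNIV. \<Sum>k\<in>E. ip (smul ?r f) (bil (- n) i (- k) g))"
    by (simp add: bil_adjoint[OF f g])
  also have "\<dots> = ip (smul ?r f) (lattice_L (- n) g)"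
    unfolding B(2)[OF E'] sum.reindex[OF inj] by (simp add: ip_scal_right[OF smul_fsupp[OF f]] ip_sum_right[OF smul_fsupp[OF f]])
  finally show ?thesis .
qed

definition ldeg :: "'n lattice_label \<Rightarrow> nat" where
  "ldeg = (\<lambda>(P, v). nat \<lfloor>2 * (v \<bullet> v)\<rfloor> + 4 * (\<Sum>(i, m)\<in>#P. m))"

lemma ldeg_wtl: "p \<in> lat \<Longrightarrow> of_nat (ldeg p) / 4 = wtl p"
proof -
  assume "p \<in> lat"
  then obtain P v where p: "p = (P, v)" "v \<in> K" by (cases p) (auto simp: lat_def)
  have "of_int \<lfloor>2 * (v \<bullet> v)\<rfloor> = 2 * (v \<bullet> v)" using integral[OF p(2)] by (auto elim: Ints_cases)
  moreover have "\<lfloor>2 * (v \<bullet> v)\<rfloor> \<ge> 0" by simp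
  ultimately have "real (nat \<lfloor>2 * (v \<bullet> v)\<rfloor>) = 2 * (v \<bullet> v)" by (metis of_nat_nat of_int_of_nat_eq)
  then have "(of_nat (nat \<lfloor>2 * (v \<bullet> v)\<rfloor>) :: complex) = of_real (2 * (v \<bullet> v))" by (metis of_real_of_nat_eq)
  then show ?thesis by (simp add: ldeg_def wtl_def p(1) add_divide_distrib)
qed

theorem lattice_model: "unitary_model (lattice_module K) (\<lambda>_. 1) lat ldeg (of_nat CARD('n)) (\<lambda>_. 1)"
proof (rule weighted_unitary[where s = "\<lambda>(P, v). sqrt (pnorm P)"])
  have e: "lattice_module K = \<lparr>carr = H, vir_L = lattice_L, central = scal (of_nat CARD('n))\<rparr>"
    using carr_lattice by (simp add: lattice_module_def)
  show "virasoro_module (lattice_module K)" unfolding e by (rule virasoro_module)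
  show "carr (lattice_module K) = H" by (rule carr_lattice)
  show "central (lattice_module K) f = scal (of_nat CARD('n)) f" for f by (simp add: lattice_module_def)
  show "vir_L (lattice_module K) 0 f = (\<lambda>p. of_nat (ldeg p) / 4 * f p)" if f: "f \<in> H" for f
  proof
    fix p show "vir_L (lattice_module K) 0 f p = of_nat (ldeg p) / 4 * f p"
      using L0[OF f] ldeg_wtl[of p] fsupp_outside[OF f, of p]
      by (cases "p \<in> lat") (simp_all add: lattice_module_def smul_def)
  qed
  show "(case p of (P, v) \<Rightarrow> sqrt (pnorm P)) > 0" for p :: "'n lattice_label"
    by (cases p) (simp add: pnorm_pos)
  have sq: "(\<lambda>p. of_real ((case p of (P, v) \<Rightarrow> sqrt (pnorm P)) ^ 2)) = (\<lambda>(P, v). of_real (pnorm P) :: complex)"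
    by (auto simp: fun_eq_iff pnorm_pos[THEN less_imp_le] simp del: of_real_power)
  show "ip (smul (\<lambda>p. of_real ((case p of (P, v) \<Rightarrow> sqrt (pnorm P)) ^ 2)) (vir_L (lattice_module K) n f)) g =
      ip (smul (\<lambda>p. of_real ((case p of (P, v) \<Rightarrow> sqrt (pnorm P)) ^ 2)) f) (vir_L (lattice_module K) (- n) g)"
    if "f \<in> H" "g \<in> H" for f g n
    unfolding sq using lattice_L_adjoint[OF that] by (simp add: lattice_module_def)
qed

end

section \<open>The Jacobi triple product as a bijection\<close>

text \<open>A finite set of integers stands for a state of one charged pair: its negative members are excited modes of the one
  field, its nonnegative members of the other, and member \<open>d\<close> has energy \<open>\<bar>2 * d + 1\<bar>\<close>, in units of
  $\frac12$.\<close>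

definition charge :: "int set \<Rightarrow> int" where
  "charge S = (\<Sum>d\<in>S. if d < 0 then 1 else - 1)"

definition energy :: "int set \<Rightarrow> int" where
  "energy S = (\<Sum>d\<in>S. \<bar>2 * d + 1\<bar>)"

text \<open>The positions occupied in the Dirac sea picture.  All sufficiently negative positions are empty and all
  sufficiently large ones are filled.\<close>

definition filled :: "int set \<Rightarrow> int \<Rightarrow> bool" where
  "filled S d \<longleftrightarrow> (d \<in> S \<longleftrightarrow> d < 0)"

definition toggle :: "int \<Rightarrow> int set \<Rightarrow> int set" where
  "toggle d S = (if d \<in> S then S - {d} else insert d S)"

lemma toggle_toggle [simp]: "toggle d (toggle d S) = S"
  by (auto simp: toggle_def)

lemma finite_toggle [simp]: "finite (toggle d S) \<longleftrightarrow> finite S"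
  by (auto simp: toggle_def)

lemma filled_toggle: "filled (toggle d S) d' \<longleftrightarrow> (if d' = d then \<not> filled S d else filled S d')"
  by (auto simp: toggle_def filled_def)

text \<open>Emptying a filled position \<open>d\<close> removes an excitation if \<open>d\<close> is negative and adds one otherwise.
  Both change charge and energy by the same formula.\<close>

lemma toggle_filled:
  assumes "finite S" "filled S d"
  shows "charge (toggle d S) = charge S - 1" "energy (toggle d S) = energy S + 2 * d + 1"
  using assms unfolding toggle_def filled_def charge_def energy_def
  by (cases "d \<in> S"; simp add: sum_diff1)+

lemma toggle_empty:
  assumes "finite S" "\<not> filled S d"
  shows "charge (toggle d S) = charge S + 1" "energy (toggle d S) = energy S - 2 * d - 1"
  using toggle_filled[of "toggle d S" d] assms by (simp_all add: filled_toggle)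

text \<open>Distinct odd numbers add up to at least the sum of the first ones.\<close>

lemma sum_odds_ge: "finite T \<Longrightarrow> (int (card T)) ^ 2 \<le> (\<Sum>t\<in>T. 2 * int t + 1)"
proof (induction "card T" arbitrary: T)
  case (Suc k)
  define t where "t = Max T"
  have ne: "T \<noteq> {}" using Suc(2) by auto
  have t: "t \<in> T" using Suc.prems ne by (simp add: t_def)
  have "T \<subseteq> {..t}" using Suc.prems by (auto simp: t_def)
  then have "card T \<le> card {..t}" by (rule card_mono[rotated]) simp
  then have k: "k \<le> t" using Suc(2) by simp
  have "card (T - {t}) = k" using Suc(2) Suc.prems t by simp
  then have "(int k) ^ 2 \<le> (\<Sum>t\<in>T - {t}. 2 * int t + 1)" using Suc(1)[of "T - {t}"] Suc.prems by simp
  moreover have "(\<Sum>t\<in>T. 2 * int t + 1) = (2 * int t + 1) + (\<Sum>t\<in>T - {t}. 2 * int t + 1)"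
    by (rule sum.remove[OF Suc.prems t])
  moreover have "int (card T) = int k + 1" using Suc(2) by simp
  ultimately show ?case using k by (simp add: power2_eq_square algebra_simps)
qed simp

lemma sum_odds: "(\<Sum>t<k. 2 * int t + 1) = (int k) ^ 2"
  by (induction k) (simp_all add: power2_eq_square algebra_simps)

definition neg_part :: "int set \<Rightarrow> nat set" where "neg_part S = {t. - int t - 1 \<in> S}"
definition pos_part :: "int set \<Rightarrow> nat set" where "pos_part S = {t. int t \<in> S}"

lemma parts:
  assumes "finite S"
  shows "finite (neg_part S)" "finite (pos_part S)" "charge S = int (card (neg_part S)) - int (card (pos_part S))"
    "energy S = (\<Sum>t\<in>neg_part S. 2 * int t + 1) + (\<Sum>t\<in>pos_part S. 2 * int t + 1)"
    "S = (\<lambda>t. - int t - 1) ` neg_part S \<union> int ` pos_part S"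
proof -
  show e: "S = (\<lambda>t. - int t - 1) ` neg_part S \<union> int ` pos_part S"
  proof (intro set_eqI iffI)
    fix d assume d: "d \<in> S"
    show "d \<in> (\<lambda>t. - int t - 1) ` neg_part S \<union> int ` pos_part S"
    proof (cases "d < 0")
      case True
      have "d = - int (nat (- d - 1)) - 1" using True by simp
      moreover from this d have "nat (- d - 1) \<in> neg_part S" by (simp add: neg_part_def)
      ultimately show ?thesis by blast
    next
      case False
      have "d = int (nat d)" using False by simp
      moreover from this d have "nat d \<in> pos_part S" by (simp add: pos_part_def)
      ultimately show ?thesis by blast
    qed
  qed (auto simp: neg_part_def pos_part_def)
  have i: "inj_on (\<lambda>t. - int t - 1) A" "inj_on int A" for A by (auto simp: inj_on_def)
  have "(\<lambda>t. - int t - 1) ` neg_part S \<subseteq> S" "int ` pos_part S \<subseteq> S" by (auto simp: neg_part_def pos_part_def)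
  then have "finite ((\<lambda>t. - int t - 1) ` neg_part S)" "finite (int ` pos_part S)" using assms finite_subset by blast+
  then show f: "finite (neg_part S)" "finite (pos_part S)" by (simp_all add: finite_image_iff[OF i(1)] finite_image_iff[OF i(2)])
  have split: "(\<Sum>d\<in>S. h d) = (\<Sum>t\<in>neg_part S. h (- int t - 1)) + (\<Sum>t\<in>pos_part S. h (int t))" for h :: "int \<Rightarrow> int"
    by (subst e, subst sum.union_disjoint) (auto simp: f sum.reindex[OF i(1)] sum.reindex[OF i(2)])
  show "charge S = int (card (neg_part S)) - int (card (pos_part S))" unfolding charge_def split by simp
  have "\<bar>2 * (- int t - 1) + 1\<bar> = 2 * int t + 1" "\<bar>2 * int t + 1\<bar> = 2 * int t + 1" for t by auto
  then show "energy S = (\<Sum>t\<in>neg_part S. 2 * int t + 1) + (\<Sum>t\<in>pos_part S. 2 * int t + 1)"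
    unfolding energy_def split by simp
qed

text \<open>The two kinds of excitations have at least the energies $a^2$ and $b^2$, while the charge is $a-b$.\<close>

lemma charge_sq_le_energy: assumes "finite S" shows "(charge S) ^ 2 \<le> energy S"
proof -
  let ?a = "int (card (neg_part S))" and ?b = "int (card (pos_part S))"
  have "(?a - ?b) ^ 2 \<le> ?a ^ 2 + ?b ^ 2" by (simp add: power2_diff)
  also have "\<dots> \<le> energy S" using sum_odds_ge parts(1,2,4)[OF assms] by (simp add: add_mono)
  finally show ?thesis using parts(3)[OF assms] by simp
qed

lemma even_charge: "finite S \<Longrightarrow> even (charge S) \<longleftrightarrow> even (card S)"
  unfolding charge_def by (induction rule: finite_induct) auto

lemma even_energy: "finite S \<Longrightarrow> even (energy S) \<longleftrightarrow> even (card S)"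
  unfolding energy_def by (induction rule: finite_induct) auto

text \<open>The states of charge \<open>n\<close> whose energy exceeds the minimum \<open>n^2\<close> by \<open>2 * w\<close> and whose first filled position
  is at most \<open>l\<close> below that of the minimal state.  They correspond to the partitions of \<open>w\<close> with parts of size
  at most \<open>l\<close>: the distance of the first filled position is the largest part.\<close>

definition diagrams :: "int \<Rightarrow> nat \<Rightarrow> nat \<Rightarrow> int set set" where
  "diagrams n l w = {S. finite S \<and> charge S = n \<and> energy S = n ^ 2 + 2 * int w \<and> (\<forall>d < - n - int l. \<not> filled S d)}"

definition partitions :: "nat \<Rightarrow> nat \<Rightarrow> nat multiset set" where
  "partitions l w = {P. (\<forall>m\<in>#P. 1 \<le> m \<and> m \<le> l) \<and> \<Sum>\<^sub># P = w}"

text \<open>Only the minimal state has its first filled position where the charge requires.\<close>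

lemma diagrams_0: "diagrams n 0 w = (if w = 0 then {if n \<ge> 0 then (\<lambda>t. - int t - 1) ` {..<nat n} else int ` {..<nat (- n)}} else {})"
proof -
  define V where "V = (if n \<ge> 0 then (\<lambda>t. - int t - 1) ` {..<nat n} else int ` {..<nat (- n)})"
  have fV: "finite V" by (simp add: V_def)
  have pV: "neg_part V = (if n \<ge> 0 then {..<nat n} else {})" "pos_part V = (if n \<ge> 0 then {} else {..<nat (- n)})"
    by (auto simp: V_def neg_part_def pos_part_def)
  have cV: "charge V = n" "energy V = n ^ 2" using parts(3,4)[OF fV] by (auto simp: pV sum_odds)
  have uniq: "S = V" if S: "finite S" "charge S = n" "\<forall>d < - n. \<not> filled S d" for S
  proof (cases "n \<ge> 0")
    case True
    have "neg_part S \<subseteq> {..<nat n}"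
    proof
      fix t assume t: "t \<in> neg_part S"
      then have "filled S (- int t - 1)" by (simp add: neg_part_def filled_def)
      with S(3) have "\<not> (- int t - 1 < - n)" by blast
      then show "t \<in> {..<nat n}" by auto
    qed
    moreover from this have "card (neg_part S) \<le> nat n" using card_mono[of "{..<nat n}"] by fastforce
    ultimately have c: "card (neg_part S) = nat n" "card (pos_part S) = 0" using parts(3)[OF S(1)] S(2) True by auto
    then have "neg_part S = {..<nat n}" "pos_part S = {}"
      using card_subset_eq[OF _ \<open>neg_part S \<subseteq> _\<close>] parts(2)[OF S(1)] by auto
    then show ?thesis using parts(5)[OF S(1)] True by (simp add: V_def)
  next
    case False
    have sub: "{..<nat (- n)} \<subseteq> pos_part S"
    proof
      fix t assume "t \<in> {..<nat (- n)}"
      then have "\<not> filled S (int t)" using S(3) False by auto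
      then show "t \<in> pos_part S" by (simp add: pos_part_def filled_def)
    qed
    have neg: "neg_part S = {}"
    proof (rule ccontr)
      assume "neg_part S \<noteq> {}"
      then obtain t where "- int t - 1 \<in> S" by (auto simp: neg_part_def)
      then have "filled S (- int t - 1)" by (simp add: filled_def)
      with S(3) have "\<not> (- int t - 1 < - n)" by blast
      then show False using False by simp
    qed
    then have "card (pos_part S) = nat (- n)" using parts(3)[OF S(1)] S(2) False by simp
    then have "{..<nat (- n)} = pos_part S" by (intro card_subset_eq[OF parts(2)[OF S(1)] sub]) simp
    then show ?thesis using parts(5)[OF S(1)] neg False by (simp add: V_def)
  qed
  have nV: "\<forall>d < - n. \<not> filled V d"
  proof (intro allI impI)
    fix d assume d: "d < - n"
    show "\<not> filled V d"
    proof (cases "n \<ge> 0")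
      case True then show ?thesis using d by (auto simp: filled_def V_def)
    next
      case False
      have "d \<in> V" if "d \<ge> 0" using that d False by (auto simp: V_def intro!: image_eqI[of _ _ "nat d"])
      then show ?thesis using False by (auto simp: filled_def V_def)
    qed
  qed
  have "S \<in> diagrams n 0 w \<longleftrightarrow> w = 0 \<and> S = V" for S
  proof
    assume "S \<in> diagrams n 0 w"
    then have S: "finite S" "charge S = n" "energy S = n ^ 2 + 2 * int w" "\<forall>d < - n. \<not> filled S d"
      unfolding diagrams_def by simp_all
    have "S = V" by (rule uniq[OF S(1,2,4)])
    then show "w = 0 \<and> S = V" using S(3) cV(2) by simp
  next
    assume "w = 0 \<and> S = V"
    then show "S \<in> diagrams n 0 w" using cV fV nV by (simp add: diagrams_def)
  qed
  then have "diagrams n 0 w = (if w = 0 then {V} else {})" by auto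
  then show ?thesis by (simp only: V_def)
qed

text \<open>Emptying the first filled position, when it is at distance \<open>Suc l\<close>, removes the largest part and lowers the charge
  by one.\<close>

lemma diagrams_Suc:
  "diagrams n (Suc l) w = diagrams n l w \<union>
     (if Suc l \<le> w then toggle (- n - int (Suc l)) ` diagrams (n - 1) (Suc l) (w - Suc l) else {})" (is "?A = ?B \<union> ?C")
proof (intro set_eqI iffI)
  let ?d = "- n - int (Suc l)"
  fix S assume S: "S \<in> ?A"
  then have S': "finite S" "charge S = n" "energy S = n ^ 2 + 2 * int w" "\<forall>d < ?d. \<not> filled S d"
    by (auto simp: diagrams_def)
  show "S \<in> ?B \<union> ?C"
  proof (cases "filled S ?d")
    case False
    have "\<not> filled S d" if "d < - n - int l" for d using S'(4) False that by (cases "d = ?d") auto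
    then show ?thesis using S' by (simp add: diagrams_def)
  next
    case True
    let ?T = "toggle ?d S"
    have T: "finite ?T" "charge ?T = n - 1" "energy ?T = (n - 1) ^ 2 + 2 * (int w - int (Suc l))"
      using toggle_filled[OF S'(1) True] S' by (auto simp: power2_eq_square algebra_simps)
    then have le: "Suc l \<le> w" using charge_sq_le_energy[OF T(1)] by simp
    have "\<not> filled ?T d" if "d < - (n - 1) - int (Suc l)" for d
      using S'(4) that True by (cases "d = ?d") (auto simp: filled_toggle)
    then have "?T \<in> diagrams (n - 1) (Suc l) (w - Suc l)" using T le by (simp add: diagrams_def)
    then have "toggle ?d ?T \<in> toggle ?d ` diagrams (n - 1) (Suc l) (w - Suc l)" by (rule imageI)
    then have "S \<in> toggle ?d ` diagrams (n - 1) (Suc l) (w - Suc l)" by (simp only: toggle_toggle)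
    then show ?thesis using le by simp
  qed
next
  let ?d = "- n - int (Suc l)"
  fix S assume "S \<in> ?B \<union> ?C"
  then show "S \<in> ?A"
  proof
    assume "S \<in> ?C"
    then obtain T where le: "Suc l \<le> w" and T: "T \<in> diagrams (n - 1) (Suc l) (w - Suc l)" and S: "S = toggle ?d T"
      by (auto split: if_splits)
    have T': "finite T" "charge T = n - 1" "energy T = (n - 1) ^ 2 + 2 * int (w - Suc l)"
      "\<And>d. d < - (n - 1) - int (Suc l) \<Longrightarrow> \<not> filled T d"
      using T by (auto simp: diagrams_def)
    have nf: "\<not> filled T ?d" by (rule T'(4)) simp
    have "charge S = n" "energy S = n ^ 2 + 2 * int w"
      unfolding S using toggle_empty[OF T'(1) nf] T' le by (auto simp: power2_eq_square algebra_simps of_nat_diff)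
    moreover have "\<not> filled S d" if "d < ?d" for d using T'(4)[of d] that by (auto simp: S filled_toggle)
    ultimately show ?thesis using T'(1) by (simp add: diagrams_def S)
  qed (auto simp: diagrams_def)
qed

text \<open>The same recursion as for the diagrams: the largest part is \<open>Suc l\<close> or smaller.\<close>

lemma partitions_Suc:
  "partitions (Suc l) w = partitions l w \<union> (if Suc l \<le> w then add_mset (Suc l) ` partitions (Suc l) (w - Suc l) else {})"
  (is "?A = ?B \<union> ?C")
proof (intro set_eqI iffI)
  fix P assume P: "P \<in> ?A"
  show "P \<in> ?B \<union> ?C"
  proof (cases "Suc l \<in># P")
    case True
    then obtain Q where Q: "P = add_mset (Suc l) Q" by (auto dest: multi_member_split)
    then have "Q \<in> partitions (Suc l) (w - Suc l)" "Suc l \<le> w" using P by (auto simp: partitions_def)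
    then show ?thesis using Q by auto
  next
    case False
    then have "m \<le> l" if "m \<in># P" for m
      using that P by (cases "m = Suc l") (auto simp: partitions_def le_Suc_eq)
    then show ?thesis using P by (auto simp: partitions_def)
  qed
qed (auto simp: partitions_def le_Suc_eq split: if_splits)

lemma partitions_0: "partitions 0 w = (if w = 0 then {{#}} else {})"
proof -
  have "P = {#}" if "\<forall>m\<in>#P. 1 \<le> m \<and> m \<le> 0" for P :: "nat multiset" using that by (cases P) auto
  then show ?thesis by (auto simp: partitions_def)
qed

lemma card_diagrams: "finite (diagrams n l w) \<and> finite (partitions l w) \<and> card (diagrams n l w) = card (partitions l w)"
proof (induction "w + l" arbitrary: n l w rule: less_induct)
  case less
  show ?case
  proof (cases l)
    case 0 then show ?thesis by (simp add: diagrams_0 partitions_0)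
  next
    case (Suc k)
    have 1: "finite (diagrams n k w)" "finite (partitions k w)" "card (diagrams n k w) = card (partitions k w)"
      using less[of w k n] Suc by auto
    show ?thesis
    proof (cases "Suc k \<le> w")
      case False then show ?thesis using 1 by (simp add: Suc diagrams_Suc[of n k w] partitions_Suc[of k w])
    next
      case True
      let ?d = "- n - int (Suc k)"
      let ?D = "diagrams (n - 1) (Suc k) (w - Suc k)" and ?P = "partitions (Suc k) (w - Suc k)"
      have 2: "finite ?D" "finite ?P" "card ?D = card ?P" using less[of "w - Suc k" "Suc k" "n - 1"] Suc True by auto
      have "inj_on (toggle ?d) ?D" by (rule inj_on_inverseI[of _ "toggle ?d"]) simp
      then have ci: "card (toggle ?d ` ?D) = card ?D" by (rule card_image)
      have dis: "diagrams n k w \<inter> toggle ?d ` ?D = {}"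
      proof (rule ccontr)
        assume "diagrams n k w \<inter> toggle ?d ` ?D \<noteq> {}"
        then obtain T where T: "T \<in> ?D" "toggle ?d T \<in> diagrams n k w" by blast
        have "\<not> filled T ?d" using T(1) unfolding diagrams_def by simp
        moreover have "\<not> filled (toggle ?d T) ?d" using T(2) unfolding diagrams_def by simp
        ultimately show False by (simp add: filled_toggle)
      qed
      have e: "diagrams n l w = diagrams n k w \<union> toggle ?d ` ?D"
        unfolding Suc using diagrams_Suc[of n k w] True by (simp only: if_True)
      have e': "partitions l w = partitions k w \<union> add_mset (Suc k) ` ?P"
        unfolding Suc using partitions_Suc[of k w] True by (simp only: if_True)
      have dis': "partitions k w \<inter> add_mset (Suc k) ` ?P = {}"
      proof (rule ccontr)
        assume "partitions k w \<inter> add_mset (Suc k) ` ?P \<noteq> {}"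
        then obtain Q where "add_mset (Suc k) Q \<in> partitions k w" by blast
        then show False unfolding partitions_def by simp
      qed
      have ci': "card (add_mset (Suc k) ` ?P) = card ?P" by (rule card_image) (simp add: inj_on_def)
      have "card (diagrams n l w) = card (diagrams n k w) + card ?D"
        unfolding e using card_Un_disjoint[OF 1(1) finite_imageI[OF 2(1)] dis] ci by simp
      moreover have "card (partitions l w) = card (partitions k w) + card ?P"
        unfolding e' using card_Un_disjoint[OF 1(2) finite_imageI[OF 2(2)] dis'] ci' by simp
      moreover have "finite (diagrams n l w)" "finite (partitions l w)"
        unfolding e e' using 1(1,2) 2(1,2) by simp_all
      ultimately show ?thesis using 1(3) 2(3) by simp
    qed
  qed
qed

lemma all_diagrams: "{S. finite S \<and> charge S = n \<and> energy S = n ^ 2 + 2 * int w} = diagrams n w w"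
proof (intro set_eqI iffI)
  fix S assume "S \<in> {S. finite S \<and> charge S = n \<and> energy S = n ^ 2 + 2 * int w}"
  then have S: "finite S" "charge S = n" "energy S = n ^ 2 + 2 * int w" by auto
  have stab: "diagrams n (w + k) w = diagrams n w w" for k
    by (induction k) (simp_all add: diagrams_Suc)
  obtain m where m: "\<And>d. d \<in> S \<Longrightarrow> m \<le> d"
    using bdd_below_finite[OF S(1)] by (auto simp: bdd_below_def)
  define k where "k = nat (- n - min m 0)"
  have "\<not> filled S d" if "d < - n - int (w + k)" for d
  proof -
    have "int k \<ge> - n - min m 0" unfolding k_def by linarith
    then have "d < min m 0" using that by linarith
    then show ?thesis using m[of d] by (auto simp: filled_def)
  qed
  then have "S \<in> diagrams n (w + k) w" using S by (simp add: diagrams_def)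
  then show "S \<in> diagrams n w w" by (simp add: stab)
qed (auto simp: diagrams_def)

lemma all_partitions: "{P. (\<forall>m\<in>#P. 1 \<le> m) \<and> \<Sum>\<^sub># P = w} = partitions w w"
proof -
  have "m \<le> \<Sum>\<^sub># P" if "m \<in># P" for m and P :: "nat multiset" using that by (auto dest: multi_member_split)
  then show ?thesis by (auto simp: partitions_def)
qed

text \<open>The Jacobi triple product identity, with the power series identity refined to a bijection: the charge is
  preserved, and the energy is the square of the charge plus twice the size of a partition.\<close>

theorem fermion_boson_bijection:
  obtains B :: "int set \<Rightarrow> int \<times> nat multiset"
  where "bij_betw B {S. finite S} (UNIV \<times> {P. \<forall>m\<in>#P. 1 \<le> m})"
    and "\<And>S. finite S \<Longrightarrow> fst (B S) = charge S"
    and "\<And>S. finite S \<Longrightarrow> energy S = charge S ^ 2 + 2 * int (\<Sum>\<^sub># (snd (B S)))"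
proof -
  let ?D = "\<lambda>n w. {S. finite S \<and> charge S = n \<and> energy S = n ^ 2 + 2 * int w}"
  let ?P = "\<lambda>w. {P. (\<forall>m\<in>#P. 1 \<le> m) \<and> \<Sum>\<^sub># P = w}"
  have ex: "\<exists>h. bij_betw h (?D n w) (?P w)" for n w
    unfolding all_diagrams all_partitions by (rule finite_same_card_bij) (simp_all only: card_diagrams)
  define h where "h n w = (SOME h. bij_betw h (?D n w) (?P w))" for n w
  have h: "bij_betw (h n w) (?D n w) (?P w)" for n w
    unfolding h_def by (rule someI_ex[OF ex])
  define wt where "wt S = nat ((energy S - charge S ^ 2) div 2)" for S
  have wt: "energy S = charge S ^ 2 + 2 * int (wt S)" if S: "finite S" for S
  proof -
    have "even (energy S - charge S ^ 2)" using even_charge[OF S] even_energy[OF S] by simp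
    then show ?thesis using charge_sq_le_energy[OF S] by (auto simp: wt_def elim!: evenE)
  qed
  define B where "B S = (charge S, h (charge S) (wt S) S)" for S
  have hm: "h (charge S) (wt S) S \<in> {P. (\<forall>m\<in>#P. 1 \<le> m) \<and> \<Sum>\<^sub># P = wt S}" if "finite S" for S
    using bij_betw_apply[OF h[of "charge S" "wt S"], of S] wt[OF that] that by simp
  show thesis
  proof (rule that[of B])
    show "bij_betw B {S. finite S} (UNIV \<times> {P. \<forall>m\<in>#P. 1 \<le> m})"
    proof (rule bij_betw_imageI[OF inj_onI subset_antisym[OF subsetI subsetI]])
      fix S T assume S: "S \<in> {S. finite S}" and T: "T \<in> {S. finite S}" and e: "B S = B T"
      have c: "charge S = charge T" using e by (simp add: B_def)
      have "wt S = \<Sum>\<^sub># (snd (B S))" "wt T = \<Sum>\<^sub># (snd (B T))" using hm[of S] hm[of T] S T by (simp_all add: B_def)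
      then have w: "wt S = wt T" using e by simp
      have 1: "h (charge S) (wt S) S = h (charge S) (wt S) T" using e unfolding B_def c w by simp
      have 2: "S \<in> ?D (charge S) (wt S)" using wt[of S] S by simp
      have 3: "T \<in> ?D (charge S) (wt S)" using wt[of T] T unfolding c w by simp
      show "S = T" by (rule inj_onD[OF bij_betw_imp_inj_on[OF h] 1 2 3])
    next
      fix x assume "x \<in> B ` {S. finite S}"
      then show "x \<in> UNIV \<times> {P. \<forall>m\<in>#P. 1 \<le> m}" using hm by (auto simp: B_def)
    next
      fix x :: "int \<times> nat multiset" assume x: "x \<in> UNIV \<times> {P. \<forall>m\<in>#P. 1 \<le> m}"
      obtain n P where np: "x = (n, P)" by (cases x)
      define w where "w = \<Sum>\<^sub># P"
      have "P \<in> ?P w" using x np by (simp add: w_def)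
      then have "P \<in> h n w ` ?D n w" using bij_betw_imp_surj_on[OF h[of n w]] by simp
      then obtain S where S: "finite S" "charge S = n" "energy S = n ^ 2 + 2 * int w" "P = h n w S" by auto
      have "wt S = w" using S by (simp add: wt_def)
      then show "x \<in> B ` {S. finite S}" using S np by (auto simp: B_def intro!: image_eqI[of _ _ S])
    qed
  qed (use hm wt in \<open>simp_all add: B_def\<close>)
qed

section \<open>Graded dimensions\<close>

definition graded_finite :: "'x set \<Rightarrow> ('x \<Rightarrow> nat) \<Rightarrow> bool" where
  "graded_finite X d \<longleftrightarrow> (\<forall>n. finite {x \<in> X. d x = n})"

definition ch :: "'x set \<Rightarrow> ('x \<Rightarrow> nat) \<Rightarrow> int fps" where
  "ch X d = Abs_fps (\<lambda>n. int (card {x \<in> X. d x = n}))"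

lemma ch_nth: "fps_nth (ch X d) n = int (card {x \<in> X. d x = n})"
  by (simp add: ch_def)

lemma ch_eq_iff: "ch X d = ch Y e \<longleftrightarrow> (\<forall>n. card {x \<in> X. d x = n} = card {y \<in> Y. e y = n})"
  by (simp add: fps_eq_iff ch_nth)

lemma ch_bij:
  assumes h: "bij_betw h X Y" and d: "\<And>x. x \<in> X \<Longrightarrow> e (h x) = d x"
  shows "ch X d = ch Y e" and "graded_finite X d \<longleftrightarrow> graded_finite Y e"
proof -
  have b: "bij_betw h {x \<in> X. d x = n} {y \<in> Y. e y = n}" for n
    using h d unfolding bij_betw_def inj_on_def by (auto simp: image_iff)
  show "ch X d = ch Y e" unfolding ch_eq_iff using bij_betw_same_card[OF b] by blast
  show "graded_finite X d \<longleftrightarrow> graded_finite Y e" unfolding graded_finite_def using bij_betw_finite[OF b] by simp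
qed

lemma ch_times:
  assumes X: "graded_finite X d" and Y: "graded_finite Y e"
  shows "ch (X \<times> Y) (\<lambda>(x, y). d x + e y) = ch X d * ch Y e" and "graded_finite (X \<times> Y) (\<lambda>(x, y). d x + e y)"
proof -
  let ?A = "\<lambda>n i. {x \<in> X. d x = i} \<times> {y \<in> Y. e y = n - i}"
  have u: "{p \<in> X \<times> Y. (case p of (x, y) \<Rightarrow> d x + e y) = n} = (\<Union>i\<in>{0..n}. ?A n i)" for n by auto
  have f: "finite (?A n i)" for n i using X Y by (simp add: graded_finite_def)
  show "graded_finite (X \<times> Y) (\<lambda>(x, y). d x + e y)" unfolding graded_finite_def u using f by blast
  show "ch (X \<times> Y) (\<lambda>(x, y). d x + e y) = ch X d * ch Y e"
  proof (rule fps_ext)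
    fix n
    have "card (\<Union>i\<in>{0..n}. ?A n i) = (\<Sum>i\<in>{0..n}. card (?A n i))"
      by (rule card_UN_disjoint) (use f in auto)
    then show "fps_nth (ch (X \<times> Y) (\<lambda>(x, y). d x + e y)) n = fps_nth (ch X d * ch Y e) n"
      by (simp add: ch_nth u fps_mult_nth card_cartesian_product)
  qed
qed

lemma ch_Un:
  assumes X: "graded_finite X d" and Y: "graded_finite Y d" and dis: "X \<inter> Y = {}"
  shows "ch (X \<union> Y) d = ch X d + ch Y d" and "graded_finite (X \<union> Y) d"
proof -
  have u: "{x \<in> X \<union> Y. d x = n} = {x \<in> X. d x = n} \<union> {x \<in> Y. d x = n}" for n by auto
  show "graded_finite (X \<union> Y) d" using X Y unfolding graded_finite_def u by simp
  have "card ({x \<in> X. d x = n} \<union> {x \<in> Y. d x = n}) = card {x \<in> X. d x = n} + card {x \<in> Y. d x = n}" for n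
    by (rule card_Un_disjoint) (use X Y dis in \<open>auto simp: graded_finite_def\<close>)
  then show "ch (X \<union> Y) d = ch X d + ch Y d" unfolding fps_eq_iff fps_add_nth ch_nth u by simp
qed

lemma ch_Plus:
  assumes X: "graded_finite X d" and Y: "graded_finite Y e"
  shows "ch (X <+> Y) (case_sum d e) = ch X d + ch Y e" and "graded_finite (X <+> Y) (case_sum d e)"
proof -
  have l: "bij_betw Inl X (Inl ` X)" and r: "bij_betw Inr Y (Inr ` Y)" by (auto simp: bij_betw_def inj_on_def)
  have 1: "ch X d = ch (Inl ` X) (case_sum d e)" "graded_finite (Inl ` X) (case_sum d e)"
    using ch_bij[OF l, of "case_sum d e" d] X by auto
  have 2: "ch Y e = ch (Inr ` Y) (case_sum d e)" "graded_finite (Inr ` Y) (case_sum d e)"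
    using ch_bij[OF r, of "case_sum d e" e] Y by auto
  have "Inl ` X \<inter> Inr ` Y = {}" by auto
  from ch_Un[OF 1(2) 2(2) this]
  show "ch (X <+> Y) (case_sum d e) = ch X d + ch Y e" "graded_finite (X <+> Y) (case_sum d e)"
    by (simp_all add: 1(1) 2(1) Plus_def)
qed

lemma ch_Sigma:
  assumes "finite I" and "\<And>i. i \<in> I \<Longrightarrow> graded_finite (X i) (d i)"
  shows "ch (Sigma I X) (\<lambda>(i, x). d i x) = (\<Sum>i\<in>I. ch (X i) (d i)) \<and> graded_finite (Sigma I X) (\<lambda>(i, x). d i x)"
  using assms
proof (induction rule: finite_induct)
  case empty
  then show ?case by (simp add: graded_finite_def fps_eq_iff ch_nth)
next
  case (insert i I)
  have b: "bij_betw (Pair i) (X i) ({i} \<times> X i)" by (auto simp: bij_betw_def inj_on_def)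
  have 1: "ch (X i) (d i) = ch ({i} \<times> X i) (\<lambda>(i, x). d i x)" "graded_finite ({i} \<times> X i) (\<lambda>(i, x). d i x)"
    using ch_bij[OF b, of "\<lambda>(i, x). d i x" "d i"] insert.prems by auto
  have e: "Sigma (insert i I) X = ({i} \<times> X i) \<union> Sigma I X" by auto
  have dis: "({i} \<times> X i) \<inter> Sigma I X = {}" using insert.hyps by auto
  have IH: "ch (Sigma I X) (\<lambda>(i, x). d i x) = (\<Sum>i\<in>I. ch (X i) (d i))" "graded_finite (Sigma I X) (\<lambda>(i, x). d i x)"
    using insert.IH insert.prems by auto
  show ?case unfolding e using ch_Un[OF 1(2) IH(2) dis] insert.hyps by (simp add: 1(1)[symmetric] IH(1))
qed

section \<open>Fermionic characters\<close>

text \<open>The parity \<open>e\<close> is \<open>True\<close> for even exterior degree.\<close>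

definition fermion_labels :: "nat \<Rightarrow> bool \<Rightarrow> nat modes set" where
  "fermion_labels m e = {S. finite S \<and> fst ` S \<subseteq> {..<m} \<and> even (card S) = e}"

definition fermion_deg :: "bool \<Rightarrow> nat \<Rightarrow> nat modes \<Rightarrow> nat" where
  "fermion_deg tw m S = (\<Sum>(i, j)\<in>S. 2 * nat \<bar>if tw then 2 * j + 2 else 2 * j + 1\<bar>) + (if tw then m div 2 else 0)"

abbreviation fch :: "bool \<Rightarrow> nat \<Rightarrow> bool \<Rightarrow> int fps" where
  "fch tw m e \<equiv> ch (fermion_labels m e) (fermion_deg tw m)"

text \<open>In the twisted sector zero modes cost no energy, but there are finitely many of them.\<close>

lemma graded_finite_fermion: "graded_finite (fermion_labels m e) (fermion_deg tw m)"
  unfolding graded_finite_def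
proof
  fix n
  have "S \<in> Pow ({..<m} \<times> {- int n - 2..int n + 2})" if S: "S \<in> fermion_labels m e" "fermion_deg tw m S = n" for S
  proof -
    have fin: "finite S" and sub: "fst ` S \<subseteq> {..<m}" using S(1) by (simp_all add: fermion_labels_def)
    have "i < m \<and> j \<in> {- int n - 2..int n + 2}" if ij: "(i, j) \<in> S" for i j
    proof -
      have "(case (i, j) of (i, j) \<Rightarrow> 2 * nat \<bar>if tw then 2 * j + 2 else 2 * j + 1\<bar>) \<le>
          (\<Sum>(i, j)\<in>S. 2 * nat \<bar>if tw then 2 * j + 2 else 2 * j + 1\<bar>)"
        by (rule member_le_sum[OF ij _ fin]) auto
      then have "2 * nat \<bar>if tw then 2 * j + 2 else 2 * j + 1\<bar> \<le> n" using S(2) by (simp add: fermion_deg_def)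
      then have "j \<in> {- int n - 2..int n + 2}" by (cases tw) auto
      moreover have "i < m" using sub ij by force
      ultimately show ?thesis by simp
    qed
    then show ?thesis by auto
  qed
  then have "{S \<in> fermion_labels m e. fermion_deg tw m S = n} \<subseteq> Pow ({..<m} \<times> {- int n - 2..int n + 2})" by blast
  then show "finite {S \<in> fermion_labels m e. fermion_deg tw m S = n}" by (rule finite_subset) simp
qed

text \<open>Pairs of sets of modes of given total parity.\<close>

definition fermion_pairs :: "nat \<Rightarrow> nat \<Rightarrow> bool \<Rightarrow> (nat modes \<times> nat modes) set" where
  "fermion_pairs a b e = (fermion_labels a True \<times> fermion_labels b e) \<union> (fermion_labels a False \<times> fermion_labels b (\<not> e))"

lemma ch_fermion_pairs:
  "ch (fermion_pairs a b e) (\<lambda>(S, T). fermion_deg tw a S + fermion_deg tw b T) =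
     fch tw a True * fch tw b e + fch tw a False * fch tw b (\<not> e)"
  "graded_finite (fermion_pairs a b e) (\<lambda>(S, T). fermion_deg tw a S + fermion_deg tw b T)"
proof -
  note t = ch_times[OF graded_finite_fermion[where tw = tw] graded_finite_fermion[where tw = tw]]
  have dis: "(fermion_labels a True \<times> fermion_labels b e) \<inter> (fermion_labels a False \<times> fermion_labels b (\<not> e)) = {}"
    by (auto simp: fermion_labels_def)
  show "ch (fermion_pairs a b e) (\<lambda>(S, T). fermion_deg tw a S + fermion_deg tw b T) =
     fch tw a True * fch tw b e + fch tw a False * fch tw b (\<not> e)"
    "graded_finite (fermion_pairs a b e) (\<lambda>(S, T). fermion_deg tw a S + fermion_deg tw b T)"
    unfolding fermion_pairs_def using ch_Un[OF t(2) t(2) dis] by (simp_all add: t(1))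
qed

text \<open>The modes of the first \<open>a\<close> and of the remaining \<open>b\<close> pairs are chosen independently, and parities add up.\<close>

lemma fch_add:
  assumes "even a" "even b"
  shows "fch tw (a + b) e = ch (fermion_pairs a b e) (\<lambda>(S, T). fermion_deg tw a S + fermion_deg tw b T)"
proof -
  define sh where "sh = (\<lambda>(i, j :: int). (a + i, j))"
  define us where "us = (\<lambda>(i, j :: int). (i - a, j))"
  have us: "us (sh x) = x" for x by (cases x) (simp add: us_def sh_def)
  have inj: "inj sh" by (rule inj_on_inverseI[of _ us]) (rule us)
  let ?f = "\<lambda>(S, T). S \<union> sh ` T" and ?g = "\<lambda>U. ({x \<in> U. fst x < a}, us ` {x \<in> U. \<not> fst x < a})"
  have sub: "fst x < a" if "S \<in> fermion_labels a e'" "x \<in> S" for S e' x using that by (auto simp: fermion_labels_def)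
  have dis: "S \<inter> sh ` T = {}" if "S \<in> fermion_labels a e'" for S T e'
    using sub[OF that] by (fastforce simp: sh_def)
  have fp: "\<exists>e'. S \<in> fermion_labels a e' \<and> T \<in> fermion_labels b (e' = e)" if "(S, T) \<in> fermion_pairs a b e" for S T
    using that by (auto simp: fermion_pairs_def)
  have card: "card (S \<union> sh ` T) = card S + card T" if "S \<in> fermion_labels a e'" "finite T" for S T e'
    using that dis[OF that(1), of T] card_image[of sh T] inj
    by (subst card_Un_disjoint) (auto simp: fermion_labels_def inj_on_subset)
  have su: "sh (us x) = x" if "\<not> fst x < a" for x using that by (cases x) (simp add: us_def sh_def)
  have bij: "bij_betw ?f (fermion_pairs a b e) (fermion_labels (a + b) e)"
  proof (rule bij_betw_byWitness[of _ ?g])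
    show "\<forall>p\<in>fermion_pairs a b e. ?g (?f p) = p"
    proof
      fix p assume p: "p \<in> fermion_pairs a b e"
      obtain S T where ST: "p = (S, T)" by (cases p)
      obtain e' where e': "S \<in> fermion_labels a e'" using fp p ST by blast
      have "{x \<in> S \<union> sh ` T. fst x < a} = S" "{x \<in> S \<union> sh ` T. \<not> fst x < a} = sh ` T"
        using sub[OF e'] by (auto simp: sh_def)
      then show "?g (?f p) = p" by (simp add: ST image_image us)
    qed
    show "\<forall>U\<in>fermion_labels (a + b) e. ?f (?g U) = U"
    proof
      fix U
      have "sh ` us ` {x \<in> U. \<not> fst x < a} = {x \<in> U. \<not> fst x < a}" by (force simp: image_image su)
      then show "?f (?g U) = U" by auto
    qed
    show "?f ` fermion_pairs a b e \<subseteq> fermion_labels (a + b) e"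
    proof
      fix U assume "U \<in> ?f ` fermion_pairs a b e"
      then obtain S T where ST: "(S, T) \<in> fermion_pairs a b e" "U = S \<union> sh ` T" by auto
      obtain e' where e': "S \<in> fermion_labels a e'" "T \<in> fermion_labels b (e' = e)" using fp[OF ST(1)] by blast
      have T: "finite T" using e'(2) by (simp add: fermion_labels_def)
      have "fst ` U \<subseteq> {..<a + b}" using e' by (force simp: fermion_labels_def ST(2) sh_def)
      then show "U \<in> fermion_labels (a + b) e"
        using e' card[OF e'(1) T] by (auto simp: fermion_labels_def ST(2))
    qed
    show "?g ` fermion_labels (a + b) e \<subseteq> fermion_pairs a b e"
    proof
      fix p assume "p \<in> ?g ` fermion_labels (a + b) e"
      then obtain U where U: "U \<in> fermion_labels (a + b) e" and p: "p = ?g U" by auto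
      let ?S = "fst (?g U)" and ?T = "snd (?g U)"
      have fU: "finite U" using U by (simp add: fermion_labels_def)
      have S: "?S \<in> fermion_labels a (even (card ?S))" using fU by (auto simp: fermion_labels_def)
      have "fst ` ?T \<subseteq> {..<b}" using U by (force simp: fermion_labels_def us_def)
      then have T: "?T \<in> fermion_labels b (even (card ?T))" using fU by (simp add: fermion_labels_def)
      have "sh ` ?T = {x \<in> U. \<not> fst x < a}" by (force simp: image_image su)
      then have "?S \<union> sh ` ?T = U" by auto
      then have "even (card ?S + card ?T) = e"
        using card[OF S, of ?T] fU U by (simp add: fermion_labels_def)
      then have "even (card ?T) = (even (card ?S) = e)" by auto
      with S T show "p \<in> fermion_pairs a b e" unfolding p fermion_pairs_def
        by (cases "even (card ?S)") auto
    qed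
  qed
  show ?thesis
  proof (rule ch_bij(1)[OF bij, symmetric])
    fix p assume p: "p \<in> fermion_pairs a b e"
    obtain S T where ST: "p = (S, T)" by (cases p)
    obtain e' where e': "S \<in> fermion_labels a e'" "T \<in> fermion_labels b (e' = e)" using fp p ST by blast
    have f: "finite S" "finite T" using e' by (simp_all add: fermion_labels_def)
    have i: "inj_on sh T" using inj by (rule inj_on_subset) simp
    have "(\<Sum>x\<in>S \<union> sh ` T. h (snd x)) = (\<Sum>x\<in>S. h (snd x)) + (\<Sum>x\<in>T. h (snd x))" for h :: "int \<Rightarrow> nat"
    proof -
      have "(\<Sum>x\<in>sh ` T. h (snd x)) = (\<Sum>x\<in>T. h (snd x))"
        unfolding sum.reindex[OF i] by (rule sum.cong) (auto simp: sh_def)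
      then show ?thesis using f dis[OF e'(1), of T] by (simp add: sum.union_disjoint)
    qed
    then show "fermion_deg tw (a + b) (?f p) = (case p of (S, T) \<Rightarrow> fermion_deg tw a S + fermion_deg tw b T)"
      using assms by (auto simp: fermion_deg_def ST split_beta elim!: evenE)
  qed
qed

corollary fch_split:
  "even a \<Longrightarrow> even b \<Longrightarrow> fch tw (a + b) e = fch tw a True * fch tw b e + fch tw a False * fch tw b (\<not> e)"
  using fch_add[of a b e tw] ch_fermion_pairs(1)[of a b e tw] by simp

section \<open>The boson-fermion correspondence for graded dimensions\<close>

definition lattice_labels :: "(real ^ 'n) set \<Rightarrow> 'n lattice_label set" where
  "lattice_labels K = {(P, v). v \<in> K \<and> (\<forall>(i, m)\<in>#P. m \<ge> 1)}"

definition lattice_deg :: "'n::finite lattice_label \<Rightarrow> nat" where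
  "lattice_deg = (\<lambda>(P, v). nat \<lfloor>2 * (v \<bullet> v)\<rfloor> + 4 * (\<Sum>(i, m)\<in>#P. m))"

definition shift :: "bool \<Rightarrow> real" where
  "shift tw = (if tw then 1 / 2 else 0)"

text \<open>The lattices of charge vectors, shifted by $\frac12$ in the twisted sector, with a parity condition on the sum
  of the charges.  In rank 4 these are the four cosets of $D_4$ in its dual.\<close>

definition parity_class :: "bool \<Rightarrow> bool \<Rightarrow> (real ^ 'n::finite) set" where
  "parity_class tw e = {v. \<exists>n :: 'n \<Rightarrow> int. (\<forall>i. v $ i = of_int (n i) - shift tw) \<and> even (\<Sum>i\<in>UNIV. n i) = e}"

text \<open>In the twisted sector the energies \<open>\<bar>2 * j + 2\<bar>\<close> differ from the untwisted ones by the charge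
  of the mode.  This completes the square to $(n-\frac12)^2$.\<close>

lemma mode_energy:
  assumes "finite S"
  shows "int (\<Sum>j\<in>S. 2 * nat \<bar>if tw then 2 * j + 2 else 2 * j + 1\<bar>) = 2 * energy S - (if tw then 2 * charge S else 0)"
proof (cases tw)
  case False
  then show ?thesis by (simp add: energy_def sum_distrib_left)
next
  case True
  have "2 * \<bar>2 * j + 2\<bar> = 2 * \<bar>2 * j + 1\<bar> - 2 * (if j < 0 then 1 else - 1)" for j :: int by auto
  then have "(\<Sum>j\<in>S. 2 * \<bar>2 * j + 2\<bar>) = (\<Sum>j\<in>S. 2 * \<bar>2 * j + 1\<bar>) - (\<Sum>j\<in>S. 2 * (if j < 0 then 1 else - 1))"
    by (simp only: sum_subtractf)
  then show ?thesis using True by (simp only: energy_def charge_def sum_distrib_left of_nat_sum if_True) simp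
qed

lemma image_mset_sum: "image_mset f (\<Sum>k\<in>A. M k) = (\<Sum>k\<in>A. image_mset f (M k))"
  by (induction A rule: infinite_finite_induct) simp_all

lemma filter_mset_sum: "filter_mset p (\<Sum>k\<in>A. M k) = (\<Sum>k\<in>A. filter_mset p (M k))"
  by (induction A rule: infinite_finite_induct) simp_all

text \<open>The rank one bijection in each of the coordinates.  The fermion parity is the parity of the total charge, and
  the vacuum energy of the twisted sector comes from the constant shift by $\frac12$ in each coordinate.\<close>

theorem boson_fermion:
  assumes tw: "tw \<longrightarrow> even CARD('n::finite)"
  shows "\<exists>F. bij_betw F (fermion_labels CARD('n) e) (lattice_labels (parity_class tw e :: (real ^ 'n) set)) \<and>
     (\<forall>S\<in>fermion_labels CARD('n) e. lattice_deg (F S) = fermion_deg tw CARD('n) S)"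
proof -
  let ?m = "CARD('n)" and ?\<delta> = "shift tw"
  obtain B :: "int set \<Rightarrow> int \<times> nat multiset"
    where B: "bij_betw B {S. finite S} (UNIV \<times> {P. \<forall>m\<in>#P. 1 \<le> m})"
      and Bc: "\<And>S. finite S \<Longrightarrow> fst (B S) = charge S"
      and Be: "\<And>S. finite S \<Longrightarrow> energy S = charge S ^ 2 + 2 * int (\<Sum>\<^sub># (snd (B S)))"
    by (rule fermion_boson_bijection) blast
  define B' where "B' = inv_into {S. finite S} B"
  have B'B: "B' (B S) = S" if "finite S" for S
    unfolding B'_def by (rule bij_betw_inv_into_left[OF B]) (simp add: that)
  have BB': "B (B' (n, P)) = (n, P)" and fB': "finite (B' (n, P))" if "\<forall>m\<in>#P. 1 \<le> m" for n P
  proof -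
    have x: "(n, P) \<in> UNIV \<times> {P. \<forall>m\<in>#P. 1 \<le> m}" using that by simp
    show "B (B' (n, P)) = (n, P)" unfolding B'_def by (rule bij_betw_inv_into_right[OF B x])
    show "finite (B' (n, P))" using bij_betw_apply[OF bij_betw_inv_into[OF B] x] by (simp add: B'_def)
  qed
  have Bp: "\<forall>m\<in>#snd (B S). 1 \<le> m" if "finite S" for S
  proof -
    have "B S \<in> UNIV \<times> {P. \<forall>m\<in>#P. 1 \<le> m}" by (rule bij_betw_apply[OF B]) (simp add: that)
    then show ?thesis by (cases "B S") auto
  qed
  obtain \<pi> :: "'n \<Rightarrow> nat" where "bij_betw \<pi> UNIV {0..<?m}"
    using ex_bij_betw_finite_nat[OF finite[of "UNIV :: 'n set"]] by auto
  then have pi: "inj \<pi>" "range \<pi> = {..<?m}" by (auto simp: bij_betw_def atLeast0LessThan)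
  define sl where "sl S k = {j :: int. (\<pi> k, j) \<in> S}" for S k
  have fsl: "finite (sl S k)" if "finite S" for S k
  proof (rule finite_subset)
    show "sl S k \<subseteq> snd ` S" by (force simp: sl_def)
  qed (use that in simp)
  have slice: "(\<Sum>(i, j)\<in>S. h j) = (\<Sum>k\<in>UNIV. \<Sum>j\<in>sl S k. h j)" if S: "finite S" "fst ` S \<subseteq> {..<?m}"
    for S and h :: "int \<Rightarrow> nat"
  proof -
    have "S = (\<lambda>(k, j). (\<pi> k, j)) ` Sigma UNIV (sl S)"
    proof (intro set_eqI iffI)
      fix x assume x: "x \<in> S"
      then have "fst x \<in> range \<pi>" using S(2) pi(2) by auto
      then obtain k j where kj: "x = (\<pi> k, j)" by (cases x) auto
      then show "x \<in> (\<lambda>(k, j). (\<pi> k, j)) ` Sigma UNIV (sl S)"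
        using x by (intro image_eqI[of _ _ "(k, j)"]) (simp_all add: sl_def)
    qed (auto simp: sl_def)
    then have "(\<Sum>(i, j)\<in>S. h j) = (\<Sum>(i, j)\<in>(\<lambda>(k, j). (\<pi> k, j)) ` Sigma UNIV (sl S). h j)" by (rule arg_cong)
    also have "\<dots> = (\<Sum>(k, j)\<in>Sigma UNIV (sl S). h j)"
      by (subst sum.reindex) (use pi(1) in \<open>auto simp: inj_on_def split_beta comp_def\<close>)
    also have "\<dots> = (\<Sum>k\<in>UNIV. \<Sum>j\<in>sl S k. h j)" by (rule sum.Sigma[symmetric]) (use fsl[OF S(1)] in auto)
    finally show ?thesis .
  qed
  define F where "F S = (\<Sum>k\<in>UNIV. image_mset (Pair k) (snd (B (sl S k))), \<chi> k. of_int (charge (sl S k)) - ?\<delta>)" for S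
  define Q where "Q P k = image_mset snd (filter_mset (\<lambda>x. fst x = k) P)" for P :: "('n \<times> nat) multiset" and k
  define G where "G = (\<lambda>(P, v :: real ^ 'n). \<Union>k. {\<pi> k} \<times> B' (\<lfloor>v $ k + ?\<delta>\<rfloor>, Q P k))"
  have QF: "Q (\<Sum>k\<in>UNIV. image_mset (Pair k) (M k)) k = M k" for M k
  proof -
    have "image_mset snd (filter_mset (\<lambda>x. fst x = k) (image_mset (Pair k') (M k'))) = (if k' = k then M k' else {#})" for k'
      by (simp add: filter_mset_image_mset image_mset.compositionality comp_def)
    then show ?thesis unfolding Q_def filter_mset_sum image_mset_sum by (simp add: sum.delta)
  qed
  have FQ: "(\<Sum>k\<in>UNIV. image_mset (Pair k) (Q P k)) = P" for P
  proof (induction P)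
    case empty then show ?case by (simp add: Q_def)
  next
    case (add x P)
    have "image_mset (Pair k) (Q (add_mset x P) k) = (if k = fst x then {#x#} else {#}) + image_mset (Pair k) (Q P k)" for k
      by (auto simp: Q_def)
    then show ?case by (simp add: sum.distrib sum.delta add.IH)
  qed
  have Qp: "\<forall>m\<in>#Q P k. 1 \<le> m" if "\<forall>(i, m)\<in>#P. m \<ge> 1" for P k using that by (auto simp: Q_def)
  have GF: "G (F S) = S" if S: "finite S" "fst ` S \<subseteq> {..<?m}" for S
  proof -
    have "G (F S) = (\<Union>k. {\<pi> k} \<times> B' (charge (sl S k), snd (B (sl S k))))"
      unfolding G_def F_def by (simp add: QF)
    also have "\<dots> = (\<Union>k. {\<pi> k} \<times> sl S k)"
    proof (rule SUP_cong[OF refl])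
      fix k have "(charge (sl S k), snd (B (sl S k))) = B (sl S k)" using Bc[OF fsl[OF S(1)], of k] by (simp add: prod_eq_iff)
      then show "{\<pi> k} \<times> B' (charge (sl S k), snd (B (sl S k))) = {\<pi> k} \<times> sl S k" by (simp add: B'B[OF fsl[OF S(1)]])
    qed
    also have "\<dots> = S"
    proof (intro set_eqI iffI)
      fix x assume x: "x \<in> S"
      then have "fst x \<in> range \<pi>" using S(2) pi(2) by auto
      then show "x \<in> (\<Union>k. {\<pi> k} \<times> sl S k)" using x by (cases x) (auto simp: sl_def)
    qed (auto simp: sl_def)
    finally show ?thesis .
  qed
  have slG: "sl (G (P, v)) k = B' (\<lfloor>v $ k + ?\<delta>\<rfloor>, Q P k)" for P v k
    using pi(1) by (auto simp: sl_def G_def inj_eq)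
  have par: "even (\<Sum>k\<in>UNIV. charge (sl S k)) \<longleftrightarrow> even (card S)" if S: "finite S" "fst ` S \<subseteq> {..<?m}" for S
  proof -
    have "card S = (\<Sum>k\<in>UNIV. card (sl S k))" using slice[OF S, of "\<lambda>_. 1"] by (simp add: split_beta)
    moreover have "even (\<Sum>k\<in>A. charge (sl S k)) \<longleftrightarrow> even (\<Sum>k\<in>A. card (sl S k))" for A
      by (induction A rule: infinite_finite_induct) (auto simp: even_charge[OF fsl[OF S(1)]])
    ultimately show ?thesis by simp
  qed
  have FL: "F S \<in> lattice_labels (parity_class tw e)" if S: "S \<in> fermion_labels ?m e" for S
  proof -
    have S': "finite S" "fst ` S \<subseteq> {..<?m}" "even (card S) = e" using S by (simp_all add: fermion_labels_def)
    have "set_mset (\<Sum>k\<in>UNIV. image_mset (Pair k) (snd (B (sl S k)))) = (\<Union>k. Pair k ` set_mset (snd (B (sl S k))))"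
      by (simp add: set_mset_sum)
    then have "\<forall>(i, m)\<in>#(\<Sum>k\<in>UNIV. image_mset (Pair k) (snd (B (sl S k)))). m \<ge> 1"
      using Bp[OF fsl[OF S'(1)]] by auto
    moreover have "(\<chi> k. of_int (charge (sl S k)) - ?\<delta>) \<in> parity_class tw e"
      unfolding parity_class_def using par[OF S'(1,2)] S'(3) by (intro CollectI exI[of _ "\<lambda>k. charge (sl S k)"]) simp
    ultimately show ?thesis by (simp add: F_def lattice_labels_def)
  qed
  have GL: "G p \<in> fermion_labels ?m e \<and> F (G p) = p" if p: "p \<in> lattice_labels (parity_class tw e)" for p
  proof -
    obtain P v where Pv: "p = (P, v)" by (cases p)
    have P: "\<forall>(i, m)\<in>#P. m \<ge> 1" using p by (simp add: Pv lattice_labels_def)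
    obtain n where n: "\<And>i. v $ i = of_int (n i) - ?\<delta>" "even (\<Sum>i\<in>UNIV. n i) = e"
    proof -
      have "v \<in> parity_class tw e" using p by (simp add: Pv lattice_labels_def)
      then show ?thesis using that unfolding parity_class_def by blast
    qed
    have fl: "\<lfloor>v $ k + ?\<delta>\<rfloor> = n k" for k by (simp add: n)
    have sG: "sl (G p) k = B' (n k, Q P k)" for k unfolding Pv slG fl ..
    have fG: "finite (G p)" unfolding G_def Pv using fB'[OF Qp[OF P]] by simp
    have sub: "fst ` G p \<subseteq> {..<?m}" unfolding pi(2)[symmetric] by (auto simp: G_def Pv)
    have BG: "B (sl (G p) k) = (n k, Q P k)" for k unfolding sG by (rule BB'[OF Qp[OF P]])
    have cG: "charge (sl (G p) k) = n k" for k using Bc[OF fsl[OF fG], of k] by (simp add: BG)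
    have "F (G p) = (\<Sum>k\<in>UNIV. image_mset (Pair k) (Q P k), \<chi> k. of_int (n k) - ?\<delta>)" by (simp add: F_def BG cG)
    also have "\<dots> = p" by (simp add: FQ Pv vec_eq_iff n)
    finally show ?thesis using par[OF fG sub] fG sub n(2) by (simp add: fermion_labels_def cG)
  qed
  have bij: "bij_betw F (fermion_labels ?m e) (lattice_labels (parity_class tw e :: (real ^ 'n) set))"
  proof (rule bij_betw_byWitness[of _ G])
    show "\<forall>S\<in>fermion_labels ?m e. G (F S) = S" using GF by (simp add: fermion_labels_def)
    show "\<forall>p\<in>lattice_labels (parity_class tw e). F (G p) = p" using GL by blast
    show "F ` fermion_labels ?m e \<subseteq> lattice_labels (parity_class tw e)" using FL by blast
    show "G ` lattice_labels (parity_class tw e) \<subseteq> fermion_labels ?m e" using GL by blast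
  qed
  have "lattice_deg (F S) = fermion_deg tw ?m S" if S: "S \<in> fermion_labels ?m e" for S
  proof -
    have S': "finite S" "fst ` S \<subseteq> {..<?m}" using S by (simp_all add: fermion_labels_def)
    let ?c = "\<lambda>k. charge (sl S k)" and ?w = "\<lambda>k. \<Sum>\<^sub># (snd (B (sl S k)))"
    let ?W = "\<Sum>k\<in>UNIV. ?w k" and ?v = "(\<chi> k. of_int (?c k) - ?\<delta>) :: real ^ 'n"
    have W: "(\<Sum>(i, m)\<in>#fst (F S). m) = ?W"
    proof -
      have "(\<Sum>(i, m)\<in>#(\<Sum>k\<in>A. image_mset (Pair k) (M k)). m) = (\<Sum>k\<in>A. \<Sum>\<^sub># (M k))" for A :: "'n set" and M
        by (induction A rule: infinite_finite_induct) (simp_all add: image_mset.compositionality comp_def)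
      then show ?thesis by (simp add: F_def)
    qed
    have one: "real (\<Sum>j\<in>sl S k. 2 * nat \<bar>if tw then 2 * j + 2 else 2 * j + 1\<bar>) =
        2 * (of_int (?c k) - ?\<delta>) ^ 2 - (if tw then 1 / 2 else 0) + 4 * real (?w k)" for k
    proof -
      define w where "w = ?w k"
      have "int (\<Sum>j\<in>sl S k. 2 * nat \<bar>if tw then 2 * j + 2 else 2 * j + 1\<bar>) =
          2 * (?c k ^ 2 + 2 * int w) - (if tw then 2 * ?c k else 0)"
        using mode_energy[OF fsl[OF S'(1)], of tw k] Be[OF fsl[OF S'(1)], of k] by (simp only: w_def)
      from arg_cong[OF this, of real_of_int] show ?thesis unfolding w_def[symmetric]
        by (cases tw) (simp_all add: shift_def power2_eq_square algebra_simps)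
    qed
    have "real (fermion_deg tw ?m S) =
        (\<Sum>k\<in>UNIV. real (\<Sum>j\<in>sl S k. 2 * nat \<bar>if tw then 2 * j + 2 else 2 * j + 1\<bar>)) + (if tw then real ?m / 2 else 0)"
      unfolding fermion_deg_def slice[OF S'] of_nat_add of_nat_sum using tw by (auto elim!: evenE)
    also have "\<dots> = 2 * (\<Sum>k\<in>UNIV. (of_int (?c k) - ?\<delta>) ^ 2) + 4 * real ?W"
      unfolding one by (simp add: sum.distrib sum_subtractf sum_distrib_left)
    also have "(\<Sum>k\<in>UNIV. (of_int (?c k) - ?\<delta>) ^ 2) = ?v \<bullet> ?v" by (simp add: inner_vec_def power2_eq_square)
    finally have d: "2 * (?v \<bullet> ?v) = real_of_int (int (fermion_deg tw ?m S) - 4 * int ?W)" 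
      unfolding of_int_diff of_int_mult of_int_of_nat_eq of_int_numeral by linarith
    then have "\<lfloor>2 * (?v \<bullet> ?v)\<rfloor> = int (fermion_deg tw ?m S) - 4 * int ?W" by (simp only: floor_of_int)
    moreover have "0 \<le> 2 * (?v \<bullet> ?v)" by simp
    then have "int (fermion_deg tw ?m S) - 4 * int ?W \<ge> 0" unfolding d by (simp only: of_int_0_le_iff)
    moreover have "lattice_deg (F S) = nat \<lfloor>2 * (?v \<bullet> ?v)\<rfloor> + 4 * (\<Sum>(i, m)\<in>#fst (F S). m)"
      by (simp add: lattice_deg_def F_def)
    moreover have "nat (int a - 4 * int w) + 4 * w = a" if "int a - 4 * int w \<ge> 0" for a w :: nat using that by linarith
    ultimately show ?thesis by (simp only: W)
  qed
  with bij show ?thesis by blast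
qed

abbreviation lch :: "(real ^ 'n::finite) set \<Rightarrow> int fps" where
  "lch K \<equiv> ch (lattice_labels K) lattice_deg"

lemma fch_lch:
  assumes "tw \<longrightarrow> even CARD('n::finite)"
  shows "lch (parity_class tw e :: (real ^ 'n) set) = fch tw CARD('n) e"
    and "graded_finite (lattice_labels (parity_class tw e :: (real ^ 'n) set)) lattice_deg"
proof -
  obtain F where F: "bij_betw F (fermion_labels CARD('n) e) (lattice_labels (parity_class tw e :: (real ^ 'n) set))"
    "\<And>S. S \<in> fermion_labels CARD('n) e \<Longrightarrow> lattice_deg (F S) = fermion_deg tw CARD('n) S"
    using boson_fermion[OF assms, of e] by blast
  show "lch (parity_class tw e :: (real ^ 'n) set) = fch tw CARD('n) e" by (rule ch_bij(1)[OF F(1), symmetric]) (rule F(2))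
  show "graded_finite (lattice_labels (parity_class tw e :: (real ^ 'n) set)) lattice_deg"
    using ch_bij(2)[OF F(1), where e = lattice_deg and d = "fermion_deg tw CARD('n)"] F(2) graded_finite_fermion by blast
qed

text \<open>The degree of a lattice label only sees the norm of the momentum.\<close>

lemma lch_isometry:
  fixes R :: "real ^ 'n::finite \<Rightarrow> real ^ 'n"
  assumes "\<And>v. R (R v) = v" "\<And>v. R v \<bullet> R v = v \<bullet> v" "\<And>v. v \<in> K \<Longrightarrow> R v \<in> K'" "\<And>v. v \<in> K' \<Longrightarrow> R v \<in> K"
  shows "lch K = lch K'"
  by (rule ch_bij(1)[of "\<lambda>(P, v). (P, R v)"], rule bij_betw_byWitness[of _ "\<lambda>(P, v). (P, R v)"])
    (use assms in \<open>auto simp: lattice_labels_def lattice_deg_def\<close>)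

section \<open>Triality\<close>

text \<open>Half a Hadamard matrix, a symmetric involution.  It fixes $D_4$ and exchanges the vector coset with a spinor
  coset.\<close>

definition triality :: "real ^ 4 \<Rightarrow> real ^ 4" where
  "triality v = (\<chi> i. (if i = 1 then v $ 1 + v $ 2 + v $ 3 + v $ 4 else if i = 2 then v $ 1 + v $ 2 - v $ 3 - v $ 4
     else if i = 3 then v $ 1 - v $ 2 + v $ 3 - v $ 4 else v $ 1 - v $ 2 - v $ 3 + v $ 4) / 2)"

text \<open>It changes the parity of the charge vectors with half-integral coordinates, hence exchanges the two spinor
  cosets.\<close>

definition reflection :: "real ^ 4 \<Rightarrow> real ^ 4" where
  "reflection v = (\<chi> i. if i = 4 then - v $ 4 else v $ i)"

text \<open>The witnesses are the coordinates of the image; parity makes the half sum of the coordinates integral up to the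
  shift.\<close>

lemma lch_triality: "lch (parity_class False False :: (real ^ 4) set) = lch (parity_class True True :: (real ^ 4) set)"
proof (rule lch_isometry[of triality])
  fix v :: "real ^ 4"
  show "triality (triality v) = v" by (simp add: triality_def vec_eq_iff forall_4 field_simps)
  show "triality v \<bullet> triality v = v \<bullet> v" by (simp add: triality_def inner_vec_def sum_4 field_simps)
  show "triality v \<in> parity_class True True" if "v \<in> parity_class False False"
  proof -
    obtain n :: "4 \<Rightarrow> int" where n: "\<And>i. v $ i = of_int (n i) - shift False" "even (\<Sum>i\<in>UNIV. n i) = False"
      using \<open>v \<in> parity_class False False\<close> unfolding parity_class_def by blast
    then have "odd (n 1 + n 2 + n 3 + n 4)" by (simp add: sum_4)
    then obtain k where "n 1 + n 2 + n 3 + n 4 = 2 * k + 1" by (rule oddE)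
    then have k: "n 1 = 2 * k + 1 - n 2 - n 3 - n 4" by simp
    show ?thesis unfolding parity_class_def
      by (intro CollectI exI[of _ "\<lambda>i. if i = 1 then k + 1 else if i = 2 then k + 1 - n 3 - n 4
            else if i = 3 then k + 1 - n 2 - n 4 else k + 1 - n 2 - n 3"])
        (simp add: triality_def shift_def forall_4 sum_4 n(1) k field_simps)
  qed
  show "triality v \<in> parity_class False False" if "v \<in> parity_class True True"
  proof -
    obtain n :: "4 \<Rightarrow> int" where n: "\<And>i. v $ i = of_int (n i) - shift True" "even (\<Sum>i\<in>UNIV. n i) = True"
      using \<open>v \<in> parity_class True True\<close> unfolding parity_class_def by blast
    then have "even (n 1 + n 2 + n 3 + n 4)" by (simp add: sum_4)
    then obtain k where "n 1 + n 2 + n 3 + n 4 = 2 * k" by (rule evenE)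
    then have k: "n 1 = 2 * k - n 2 - n 3 - n 4" by simp
    show ?thesis unfolding parity_class_def
      by (intro CollectI exI[of _ "\<lambda>i. if i = 1 then k - 1 else if i = 2 then k - n 3 - n 4
            else if i = 3 then k - n 2 - n 4 else k - n 2 - n 3"])
        (simp add: triality_def shift_def forall_4 sum_4 n(1) k field_simps)
  qed
qed

lemma lch_reflection: "lch (parity_class True True :: (real ^ 4) set) = lch (parity_class True False :: (real ^ 4) set)"
proof (rule lch_isometry[of reflection])
  fix v :: "real ^ 4"
  show "reflection (reflection v) = v" by (simp add: reflection_def vec_eq_iff)
  show "reflection v \<bullet> reflection v = v \<bullet> v" by (simp add: reflection_def inner_vec_def sum_4)
  have "reflection v \<in> parity_class True (\<not> e)" if v: "v \<in> parity_class True e" for e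
  proof -
    obtain n :: "4 \<Rightarrow> int" where n: "\<And>i. v $ i = of_int (n i) - shift True" "even (\<Sum>i\<in>UNIV. n i) = e"
      using v unfolding parity_class_def by blast
    show ?thesis unfolding parity_class_def
      by (intro CollectI exI[of _ "\<lambda>i. if i = 4 then 1 - n 4 else n i"])
        (use n(2) in \<open>auto simp: reflection_def shift_def forall_4 sum_4 n(1)\<close>)
  qed
  from this[of True] this[of False]
  show "v \<in> parity_class True True \<Longrightarrow> reflection v \<in> parity_class True False"
    "v \<in> parity_class True False \<Longrightarrow> reflection v \<in> parity_class True True" by simp_all
qed

text \<open>All of $U_1$, $U_\omega$, $U_{\bar\omega}$ have the same graded dimension.\<close>

lemma fch_4: "fch tw 4 e = (if \<not> tw \<and> e then fch False 4 True else fch False 4 False)"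
  using lch_triality lch_reflection fch_lch(1)[where 'n = 4] by (cases tw; cases e) simp_all

section \<open>Cosets of the root lattice\<close>

lemma parity_class_nonempty: "parity_class tw e \<noteq> ({} :: (real ^ 4) set)"
proof -
  have "(\<chi> i. of_int (if i = (1 :: 4) then (if e then 0 else 1) else 0) - shift tw) \<in> parity_class tw e"
    unfolding parity_class_def
    by (intro CollectI exI[of _ "\<lambda>i. if i = 1 then (if e then 0 else 1) else 0"]) (simp add: sum_4)
  then show ?thesis by blast
qed

lemma parity_class_disjoint:
  assumes "v \<in> parity_class tw e" "v \<in> parity_class tw' e'"
  shows "tw = tw' \<and> e = e'"
proof -
  obtain n where n: "\<And>i. v $ i = of_int (n i) - shift tw" "even (\<Sum>i\<in>UNIV. n i) = e"
    using assms(1) unfolding parity_class_def by blast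
  obtain n' where n': "\<And>i. v $ i = of_int (n' i) - shift tw'" "even (\<Sum>i\<in>UNIV. n' i) = e'"
    using assms(2) unfolding parity_class_def by blast
  have d: "of_int (n i) - shift tw = of_int (n' i) - shift tw'" for i using n(1)[of i] n'(1)[of i] by simp
  have tw: "tw = tw'"
  proof (rule ccontr)
    assume "tw \<noteq> tw'"
    then have "2 * real_of_int (n i) = 2 * real_of_int (n' i) + 1 \<or> 2 * real_of_int (n i) + 1 = 2 * real_of_int (n' i)" for i
      using d[of i] by (cases tw) (auto simp: shift_def)
    then have "real_of_int (2 * n i) = real_of_int (2 * n' i + 1) \<or> real_of_int (2 * n i + 1) = real_of_int (2 * n' i)" for i
      by simp
    then have "2 * n i = 2 * n' i + 1 \<or> 2 * n i + 1 = 2 * n' i" for i unfolding of_int_eq_iff .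
    from this[of undefined] show False by presburger
  qed
  then have "n i = n' i" for i using d[of i] by simp
  then show ?thesis using tw n(2) n'(2) by simp
qed

lemma coset_parity_class:
  assumes y: "y \<in> (parity_class tw e :: (real ^ 4) set)" shows "coset D4 y = parity_class tw e"
proof -
  obtain n where n: "\<And>i. y $ i = of_int (n i) - shift tw" "even (\<Sum>i\<in>UNIV. n i) = e"
    using y unfolding parity_class_def by blast
  show ?thesis
  proof (intro set_eqI iffI)
    fix z assume "z \<in> coset D4 y"
    then obtain x where x: "x \<in> D4" "z = x + y" by (auto simp: coset_def)
    then obtain l where l: "\<And>i. x $ i = of_int (l i)" "even (\<Sum>i\<in>UNIV. l i)" by (auto simp: D4_def)
    show "z \<in> parity_class tw e" unfolding parity_class_def
      by (intro CollectI exI[of _ "\<lambda>i. l i + n i"]) (use n l x(2) in \<open>simp add: sum.distrib\<close>)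
  next
    fix z :: "real ^ 4" assume z: "z \<in> parity_class tw e"
    obtain l where l: "\<And>i. z $ i = of_int (l i) - shift tw" "even (\<Sum>i\<in>UNIV. l i) = e"
      using z unfolding parity_class_def by blast
    have "z - y \<in> D4" unfolding D4_def
      by (intro CollectI exI[of _ "\<lambda>i. l i - n i"]) (use n l in \<open>simp add: sum_subtractf\<close>)
    then show "z \<in> coset D4 y" unfolding coset_def by (rule image_eqI[rotated]) simp
  qed
qed

text \<open>Pairing with $\pm e_j\pm e_k$ and $2e_1$ shows that the coordinates are all integral or all
  half-integral.\<close>

lemma dual_D4: "dual_lattice D4 = (\<Union>tw e. parity_class tw e)"
proof (intro set_eqI iffI)
  fix y :: "real ^ 4" assume y: "y \<in> dual_lattice D4"
  have a: "(\<chi> i. of_int (if i = j then s else if i = k then t else 0)) \<in> D4" if "j \<noteq> k" "even (s + t)" for j k :: 4 and s t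
    unfolding D4_def
  proof (intro CollectI exI conjI allI)
    show "even (\<Sum>i\<in>UNIV. if i = j then s else if i = k then t else 0)"
      using that exhaust_4[of j] exhaust_4[of k] by (auto simp: sum_4)
  qed simp
  have int: "of_int s * y $ j + of_int t * y $ k \<in> \<int>" if "j \<noteq> k" "even (s + t)" for j k s t
  proof -
    have "(\<chi> i. of_int (if i = j then s else if i = k then t else 0)) \<bullet> y \<in> \<int>"
      using y a[OF that] by (auto simp: dual_lattice_def)
    moreover have "(\<chi> i. of_int (if i = j then s else if i = k then t else 0)) \<bullet> y = of_int s * y $ j + of_int t * y $ k"
      using that(1) exhaust_4[of j] exhaust_4[of k] by (auto simp: inner_vec_def sum_4)
    ultimately show ?thesis by simp
  qed
  have "2 * y $ 1 \<in> \<int>" using int[of 1 2 2 0] by simp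
  then obtain c where c: "2 * y $ 1 = of_int c" by (auto elim: Ints_cases)
  have "\<exists>d. y $ i = y $ 1 + of_int d" for i
  proof (cases "i = 1")
    case False
    then have "y $ i - y $ 1 \<in> \<int>" using int[of i 1 1 "- 1"] by simp
    then show ?thesis by (auto elim!: Ints_cases simp: algebra_simps)
  qed (auto intro: exI[of _ 0])
  then obtain d where d: "\<And>i. y $ i = y $ 1 + of_int (d i)" by metis
  define n where "n i = d i + (c + 1) div 2" for i
  have "y $ 1 = of_int ((c + 1) div 2) - shift (odd c)"
    using c by (cases "even c") (auto simp: shift_def elim!: evenE oddE)
  then have "y $ i = of_int (n i) - shift (odd c)" for i using d[of i] by (simp add: n_def)
  then have "y \<in> parity_class (odd c) (even (\<Sum>i\<in>UNIV. n i))" by (auto simp: parity_class_def)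
  then show "y \<in> (\<Union>tw e. parity_class tw e)" by blast
next
  fix y :: "real ^ 4" assume "y \<in> (\<Union>tw e. parity_class tw e)"
  then obtain tw n where n: "\<And>i. y $ i = of_int (n i) - shift tw" by (auto simp: parity_class_def)
  show "y \<in> dual_lattice D4" unfolding dual_lattice_def
  proof (intro CollectI ballI)
    fix x assume "x \<in> D4"
    then obtain l k where l: "\<And>i. x $ i = of_int (l i)" "(\<Sum>i\<in>UNIV. l i) = 2 * k" by (auto simp: D4_def elim!: evenE)
    have "x \<bullet> y = of_int (\<Sum>i\<in>UNIV. l i * n i) - shift tw * of_int (\<Sum>i\<in>UNIV. l i)"
      by (simp add: inner_vec_def n l(1) sum_subtractf sum_distrib_left algebra_simps)
    then have "x \<bullet> y = of_int ((\<Sum>i\<in>UNIV. l i * n i) - (if tw then k else 0))" by (simp add: l(2) shift_def)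
    then show "x \<bullet> y \<in> \<int>" by (simp only: Ints_of_int)
  qed
qed

lemma UNIV_klein: "UNIV = {K0, K1, Kw, Kwbar}"
  using klein.exhaust by auto

text \<open>The labelling covers all four cosets, so by counting it is injective, and \<open>\<gamma> K0\<close> lies in $D_4$ by additivity.
  The three other cosets are not told apart, since they have equal graded dimensions.\<close>

lemma D4_cosets:
  assumes "D4_labelling \<gamma>"
  obtains c where "\<And>i. coset D4 (\<gamma> i) = parity_class (fst (c i)) (snd (c i))" "\<And>i. c i = (False, True) \<longleftrightarrow> i = K0"
proof -
  have dual: "dual_lattice D4 = (\<Union>i. coset D4 (\<gamma> i))" and add: "\<And>i j. \<gamma> i + \<gamma> j - \<gamma> (kadd i j) \<in> D4"
    using assms by (auto simp: D4_labelling_def)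
  have self: "\<gamma> i \<in> coset D4 (\<gamma> i)" for i
    unfolding coset_def by (rule image_eqI[of _ _ 0]) (auto simp: D4_def intro!: exI[of _ "\<lambda>_. 0"])
  have "\<exists>c. \<gamma> i \<in> parity_class (fst c) (snd c)" for i
  proof -
    have "\<gamma> i \<in> dual_lattice D4" unfolding dual using self by blast
    then show ?thesis unfolding dual_D4 by auto
  qed
  then obtain c where c: "\<And>i. \<gamma> i \<in> parity_class (fst (c i)) (snd (c i))" by metis
  have co: "coset D4 (\<gamma> i) = parity_class (fst (c i)) (snd (c i))" for i by (rule coset_parity_class[OF c])
  have "x \<in> range c" for x
  proof -
    obtain r where r: "r \<in> (parity_class (fst x) (snd x) :: (real ^ 4) set)" using parity_class_nonempty by blast
    then have "r \<in> dual_lattice D4" unfolding dual_D4 by blast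
    then obtain i where "r \<in> coset D4 (\<gamma> i)" unfolding dual by blast
    then have "r \<in> parity_class (fst (c i)) (snd (c i))" unfolding co .
    then have "x = c i" using parity_class_disjoint[OF r] by (simp add: prod_eq_iff)
    then show ?thesis by blast
  qed
  then have "range c = UNIV" by blast
  then have "inj c" by (intro eq_card_imp_inj_on) (simp_all add: UNIV_klein card_UNIV_bool flip: UNIV_Times_UNIV)
  moreover have "c K0 = (False, True)"
  proof -
    have "\<gamma> K0 \<in> D4" using add[of K0 K0] by simp
    moreover have "D4 = (parity_class False True :: (real ^ 4) set)" by (simp add: D4_def parity_class_def shift_def)
    ultimately show ?thesis using parity_class_disjoint[OF c[of K0], of False True] by (simp add: prod_eq_iff)
  qed
  ultimately show thesis by (intro that[of c] co) (auto simp: inj_eq[of c, symmetric])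
qed

section \<open>Coordinates for the constituents\<close>

lemma parity_class_integral:
  assumes "v \<in> (parity_class tw e :: (real ^ 4) set)" shows "2 * (v \<bullet> v) \<in> \<int>"
proof -
  obtain n where n: "\<And>i. v $ i = of_int (n i) - shift tw" using assms unfolding parity_class_def by blast
  have "2 * (v \<bullet> v) = of_int (2 * (\<Sum>i\<in>UNIV. n i * n i) + (if tw then 2 - 2 * (\<Sum>i\<in>UNIV. n i) else 0))"
    by (simp add: inner_vec_def n sum_4 shift_def field_simps)
  then show ?thesis by (simp only: Ints_of_int)
qed

lemma lattice_unitary_model:
  "unitary_model (lattice_module (parity_class tw e :: (real ^ 4) set)) (\<lambda>_. 1) (lattice_labels (parity_class tw e :: (real ^ 4) set)) lattice_deg 4 (\<lambda>_. 1)"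
proof -
  interpret lattice_coset "parity_class tw e :: (real ^ 4) set" by unfold_locales (rule parity_class_integral)
  have "lat = lattice_labels (parity_class tw e)" unfolding lat_def lattice_labels_def ..
  moreover have "ldeg = lattice_deg" unfolding ldeg_def lattice_deg_def ..
  ultimately show ?thesis using lattice_model by simp
qed

definition all_fermion_labels :: "nat \<Rightarrow> nat modes set" where
  "all_fermion_labels m = {S. finite S \<and> fst ` S \<subseteq> {..<m}}"

lemma clifford_unitary_model:
  fixes b :: "'n::{finite,linorder} polarized_space"
  assumes "polarized_space b" "CARD('n) = 2 * m" "even m"
  shows "unitary_model (clifford b tw) parity (all_fermion_labels m) (fermion_deg tw m) (of_nat m) parity"
proof -
  interpret fermions m tw by unfold_locales (rule assms(3))
  have "labels = all_fermion_labels m" unfolding labels_def all_fermion_labels_def ..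
  moreover have "deg = fermion_deg tw m" by (simp add: fun_eq_iff deg_def fermion_deg_def \<kappa>_def)
  ultimately show ?thesis using clifford_model[OF assms, of tw] by simp
qed

lemma parity_part_model:
  fixes b :: "'n::{finite,linorder} polarized_space"
  assumes "polarized_space b" "CARD('n) = 2 * m" "even m" and j: "j = 0 \<or> j = 1"
  shows "unitary_model (parity_part j (clifford b tw)) (\<lambda>_. 1) (fermion_labels m (j = 0)) (fermion_deg tw m) (of_nat m) (\<lambda>_. 1)"
proof -
  define e :: complex where "e = (if j = 0 then 1 else - 1)"
  have e: "e = 1 \<or> e = - 1" by (simp add: e_def)
  have p: "e * parity S = 1 \<longleftrightarrow> card S mod 2 = j" for S :: "'z set"
    using j by (cases "even (card S)") (auto simp: e_def parity_def odd_iff_mod_2_eq_one)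
  have "smul (\<lambda>S. e * parity S) f = f \<longleftrightarrow> (\<forall>S. f S \<noteq> 0 \<longrightarrow> card S mod 2 = j)" for f :: "'n modes fn"
    by (auto simp: smul_def fun_eq_iff p)
  then have "(clifford b tw)\<lparr>carr := {f \<in> carr (clifford b tw). smul (\<lambda>S. e * parity S) f = f}\<rparr> = parity_part j (clifford b tw)"
    by (simp add: parity_part_def)
  moreover have "{S \<in> all_fermion_labels m. e * parity S = 1} = fermion_labels m (j = 0)"
    unfolding p using j by (auto simp: all_fermion_labels_def fermion_labels_def odd_iff_mod_2_eq_one)
  ultimately show ?thesis
    using unitary_model_fixed[OF unitary_model_sign[OF clifford_unitary_model[OF assms(1-3), of tw] e]] by simp
qed

definition klein_even :: "klein \<Rightarrow> bool" where "klein_even i \<longleftrightarrow> i = K0 \<or> i = Kw"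
definition klein_tw :: "klein \<Rightarrow> bool" where "klein_tw i \<longleftrightarrow> i = Kw \<or> i = Kwbar"

lemma theta_klein: "theta i = (if klein_even i then 1 else - 1)"
  by (cases i) (simp_all add: klein_even_def)

lemma U_mod_model:
  fixes e :: "'n::{finite,linorder} polarized_space"
  assumes "polarized_space e" "CARD('n) = 8"
  shows "unitary_model (U_mod e i) (\<lambda>_. 1) (fermion_labels 4 (klein_even i)) (fermion_deg (klein_tw i) 4) 4 (\<lambda>_. 1)"
  using parity_part_model[of e 4 0] parity_part_model[of e 4 1] assms
  by (cases i) (simp_all add: klein_even_def klein_tw_def)

section \<open>The two sides\<close>

abbreviation sum12_labels :: "bool \<Rightarrow> (nat modes + nat modes) set" where
  "sum12_labels e \<equiv> fermion_labels 12 e <+> fermion_labels 12 (\<not> e)"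
abbreviation sum12_deg :: "nat modes + nat modes \<Rightarrow> nat" where
  "sum12_deg \<equiv> case_sum (fermion_deg False 12) (fermion_deg True 12)"

lemma moonshine_model:
  fixes a :: "'a::{finite,linorder} polarized_space"
  assumes "polarized_space a" "CARD('a) = 24"
  shows "\<exists>\<sigma> s. unitary_model (Vsnat a) \<sigma> (sum12_labels True) sum12_deg 12 s"
    and "\<exists>\<sigma> s. unitary_model (Vsnat_tw a) \<sigma> (sum12_labels False) sum12_deg 12 s"
proof -
  have "unitary_model (parity_part j (clifford a tw)) (\<lambda>_. 1) (fermion_labels 12 (j = 0)) (fermion_deg tw 12) 12 (\<lambda>_. 1)"
    if "j = 0 \<or> j = 1" for j tw
    using parity_part_model[of a 12 j tw] assms that by simp
  note p = this[of 0] this[of 1]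
  show "\<exists>\<sigma> s. unitary_model (Vsnat a) \<sigma> (sum12_labels True) sum12_deg 12 s"
    unfolding Vsnat_def using unitary_model_dsum2[OF p(1)[of False] p(2)[of True]] by auto
  show "\<exists>\<sigma> s. unitary_model (Vsnat_tw a) \<sigma> (sum12_labels False) sum12_deg 12 s"
    unfolding Vsnat_tw_def using unitary_model_dsum2[OF p(2)[of False] p(1)[of True]] by auto
qed

definition torus_labels :: "(klein \<Rightarrow> (real ^ 4) set) \<Rightarrow> (klein \<times> (nat modes \<times> 4 lattice_label) \<times> (nat modes \<times> 4 lattice_label)) set" where
  "torus_labels K = {(i, (S, p), (S', p')). S \<in> all_fermion_labels 2 \<and> S' \<in> all_fermion_labels 2 \<and>
     p \<in> lattice_labels (K i) \<and> p' \<in> lattice_labels (K i) \<and> even (card S + card S') = klein_even i}"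

definition torus_deg :: "bool \<Rightarrow> klein \<times> (nat modes \<times> 4 lattice_label) \<times> (nat modes \<times> 4 lattice_label) \<Rightarrow> nat" where
  "torus_deg rr = (\<lambda>(i, (S, p), (S', p')). (fermion_deg rr 2 S + lattice_deg p) + (fermion_deg rr 2 S' + lattice_deg p'))"

text \<open>The total involution on the summand \<open>i\<close> is the fermion parity of both sides times the sign \<open>theta i\<close>.\<close>

lemma torus_model:
  fixes g :: "4 polarized_space"
  assumes g: "polarized_space g" and K: "\<And>i. coset D4 (\<gamma> i) = K i" and Kc: "\<And>i. \<exists>t e. K i = parity_class t e"
  shows "unitary_model (fixed_points kappa_torus (torus g \<gamma> rr)) (\<lambda>_. 1) (torus_labels K) (torus_deg rr) 12 (\<lambda>_. 1)"
proof -
  have L: "unitary_model (lattice_module (K i)) (\<lambda>_. 1) (lattice_labels (K i)) lattice_deg 4 (\<lambda>_. 1)" for i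
    using Kc[of i] lattice_unitary_model by fastforce
  have C: "unitary_model (clifford g rr) parity (all_fermion_labels 2) (fermion_deg rr 2) 2 parity"
    using clifford_unitary_model[OF g, of 2 rr] by simp
  note T = unitary_model_tensor[OF C L]
  have th: "theta i = 1 \<or> theta i = - 1" for i by (simp add: theta_klein)
  note D = unitary_model_fixed[OF unitary_model_dsum[where I = UNIV, OF _ unitary_model_sign[OF unitary_model_tensor[OF T T] th]]]
  let ?\<sigma> = "\<lambda>(i, x). theta i * (case x of (x, y) \<Rightarrow> (case x of (S, p) \<Rightarrow> parity S * 1) * (case y of (S, p) \<Rightarrow> parity S * 1))"
  have k: "kappa_torus = smul ?\<sigma>" by (auto simp: kappa_torus_def smul_def fun_eq_iff parity_def power_add)
  have fin: "finite (UNIV :: klein set)" by (simp add: UNIV_klein)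
  have par: "theta i * (parity S * parity S') = 1 \<longleftrightarrow> even (card S + card S') = klein_even i" for i and S S' :: "nat modes"
    by (cases "even (card S)"; cases "even (card S')"; cases "klein_even i") (auto simp: theta_klein parity_def)
  have l: "{x \<in> Sigma UNIV (\<lambda>i. (all_fermion_labels 2 \<times> lattice_labels (K i)) \<times> (all_fermion_labels 2 \<times> lattice_labels (K i))).
      ?\<sigma> x = 1} = torus_labels K"
    by (auto simp: torus_labels_def par)
  have d: "torus_deg rr = (\<lambda>(i, x). case x of (x, y) \<Rightarrow>
      (case x of (x, y) \<Rightarrow> fermion_deg rr 2 x + lattice_deg y) + (case y of (x, y) \<Rightarrow> fermion_deg rr 2 x + lattice_deg y))"
    by (auto simp: torus_deg_def fun_eq_iff)
  show ?thesis
    unfolding fixed_points_def k torus_def K l[symmetric] d using D[OF fin] by simp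
qed

definition twisted_labels :: "bool \<Rightarrow> (klein \<times> (klein \<times> nat modes) \<times> (nat modes \<times> nat modes)) set" where
  "twisted_labels rr = Sigma UNIV (\<lambda>i. Sigma {j \<in> if rr then {K0, K1} else {Kw, Kwbar}. klein_even j = klein_even i}
     (\<lambda>j. fermion_labels 4 (klein_even j)) \<times> (fermion_labels 4 (klein_even i) \<times> fermion_labels 4 (klein_even (kadd i Kw))))"

definition twisted_deg :: "klein \<times> (klein \<times> nat modes) \<times> (nat modes \<times> nat modes) \<Rightarrow> nat" where
  "twisted_deg = (\<lambda>(i, x). case x of (x, y) \<Rightarrow> (case x of (j, S) \<Rightarrow> fermion_deg (klein_tw j) 4 S) +
     (case y of (x, y) \<Rightarrow> fermion_deg (klein_tw i) 4 x + fermion_deg (klein_tw (kadd i Kw)) 4 y))"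

lemma twisted_model:
  fixes e :: "'n::{finite,linorder} polarized_space"
  assumes e: "polarized_space e" "CARD('n) = 8"
  shows "unitary_model (fixed_points kappa_twisted (twisted_sector e rr)) (\<lambda>_. 1) (twisted_labels rr) twisted_deg 12 (\<lambda>_. 1)"
proof -
  note U = U_mod_model[OF e]
  let ?J = "if rr then {K0, K1} else {Kw, Kwbar}"
  have th: "theta i = 1 \<or> theta i = - 1" for i by (simp add: theta_klein)
  have J: "finite ?J" by simp
  have fin: "finite (UNIV :: klein set)" by (simp add: UNIV_klein)
  note Us = unitary_model_sign[OF U th]
  note D = unitary_model_fixed[OF unitary_model_dsum[where I = UNIV, OF fin
        unitary_model_tensor[OF unitary_model_dsum[where I = ?J, OF J Us] unitary_model_tensor[OF Us U]]]]
  let ?\<sigma> = "\<lambda>(i, x). case x of (x, y) \<Rightarrow> (case x of (j, S) \<Rightarrow> theta j * 1) * (case y of (S, S') \<Rightarrow> theta i * 1 * 1)"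
  have k: "kappa_twisted = smul ?\<sigma>" by (auto simp: kappa_twisted_def smul_def fun_eq_iff)
  have par: "theta j * theta i = 1 \<longleftrightarrow> klein_even j = klein_even i" for i j by (simp add: theta_klein)
  have l: "{x \<in> Sigma UNIV (\<lambda>i. Sigma ?J (\<lambda>j. fermion_labels 4 (klein_even j)) \<times>
      (fermion_labels 4 (klein_even i) \<times> fermion_labels 4 (klein_even (kadd i Kw)))). ?\<sigma> x = 1} = twisted_labels rr"
    by (auto simp: twisted_labels_def par simp del: theta.simps)
  show ?thesis
    unfolding fixed_points_def k twisted_sector_def l[symmetric] twisted_deg_def using D by simp
qed

text \<open>The left and right fermions, two pairs each, are combined into the four pairs of rank 8.\<close>

lemma ch_torus:
  assumes K0: "\<And>i. lch (K i) = (if i = K0 then fch False 4 True else fch False 4 False)"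
    and K: "\<And>i. graded_finite (lattice_labels (K i)) lattice_deg"
  shows "ch (torus_labels K) (torus_deg rr) =
      (\<Sum>i\<in>UNIV. fch rr 4 (klein_even i) * (lch (K i) * lch (K i)))" and "graded_finite (torus_labels K) (torus_deg rr)"
proof -
  let ?X = "\<lambda>i. fermion_pairs 2 2 (klein_even i) \<times> (lattice_labels (K i) \<times> lattice_labels (K i))"
  let ?d = "\<lambda>(x, y). (case x of (S, T) \<Rightarrow> fermion_deg rr 2 S + fermion_deg rr 2 T) + (case y of (p, q) \<Rightarrow> lattice_deg p + lattice_deg q)"
  have pairs: "(S, S') \<in> fermion_pairs 2 2 e \<longleftrightarrow> S \<in> all_fermion_labels 2 \<and> S' \<in> all_fermion_labels 2 \<and> even (card S + card S') = e"
    for S S' e by (auto simp: fermion_pairs_def fermion_labels_def all_fermion_labels_def)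
  have bij: "bij_betw (\<lambda>(i, (S, p), (S', p')). (i, (S, S'), (p, p'))) (torus_labels K) (Sigma UNIV ?X)"
    by (rule bij_betw_byWitness[of _ "\<lambda>(i, (S, S'), (p, p')). (i, (S, p), (S', p'))"])
      (auto simp: torus_labels_def pairs)
  note L = ch_times[OF K K]
  note P = ch_times[OF ch_fermion_pairs(2) L(2)]
  have S: "ch (Sigma UNIV ?X) (\<lambda>(i, x). ?d x) = (\<Sum>i\<in>UNIV. ch (?X i) ?d) \<and> graded_finite (Sigma UNIV ?X) (\<lambda>(i, x). ?d x)"
    by (rule ch_Sigma) (simp add: UNIV_klein, rule P(2))
  have dd: "(\<lambda>(i, x). ?d x) ((\<lambda>(i, (S, p), (S', p')). (i, (S, S'), (p, p'))) x) = torus_deg rr x"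
    for x :: "klein \<times> (nat modes \<times> 4 lattice_label) \<times> (nat modes \<times> 4 lattice_label)"
    by (cases x) (auto simp: torus_deg_def)
  have f4: "ch (fermion_pairs 2 2 e) (\<lambda>(S, T). fermion_deg rr 2 S + fermion_deg rr 2 T) = fch rr 4 e" for e
    using fch_add[of 2 2 e rr] by simp
  have B: "ch (torus_labels K) (torus_deg rr) = ch (Sigma UNIV ?X) (\<lambda>(i, x). ?d x)" by (rule ch_bij(1)[OF bij]) (rule dd)
  show "ch (torus_labels K) (torus_deg rr) = (\<Sum>i\<in>UNIV. fch rr 4 (klein_even i) * (lch (K i) * lch (K i)))"
    unfolding B S[THEN conjunct1] P(1) L(1) f4 ..
  have "graded_finite (torus_labels K) (torus_deg rr) \<longleftrightarrow> graded_finite (Sigma UNIV ?X) (\<lambda>(i, x). ?d x)"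
    by (rule ch_bij(2)[OF bij]) (rule dd)
  then show "graded_finite (torus_labels K) (torus_deg rr)" using S by blast
qed

lemma ch_twisted:
  "ch (twisted_labels rr) twisted_deg =
     (\<Sum>i\<in>UNIV. (\<Sum>j\<in>{j \<in> if rr then {K0, K1} else {Kw, Kwbar}. klein_even j = klein_even i}. fch (klein_tw j) 4 (klein_even j)) *
        (fch (klein_tw i) 4 (klein_even i) * fch (klein_tw (kadd i Kw)) 4 (klein_even (kadd i Kw)))) \<and>
   graded_finite (twisted_labels rr) twisted_deg"
proof -
  let ?J = "\<lambda>i. {j \<in> if rr then {K0, K1} else {Kw, Kwbar}. klein_even j = klein_even i}"
  have J: "finite (?J i)" for i by (rule finite_subset[of _ "{K0, K1, Kw, Kwbar}"]) auto
  note S = ch_Sigma[OF J, where X = "\<lambda>j. fermion_labels 4 (klein_even j)" and d = "\<lambda>j. fermion_deg (klein_tw j) 4", OF graded_finite_fermion]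
  note T = ch_times[OF graded_finite_fermion graded_finite_fermion]
  note P = ch_times[OF S[THEN conjunct2] T(2)]
  let ?X = "\<lambda>i. Sigma (?J i) (\<lambda>j. fermion_labels 4 (klein_even j)) \<times>
    (fermion_labels 4 (klein_even i) \<times> fermion_labels 4 (klein_even (kadd i Kw)))"
  let ?d = "\<lambda>i (x, y). (case x of (j, S) \<Rightarrow> fermion_deg (klein_tw j) 4 S) +
    (case y of (x, y) \<Rightarrow> fermion_deg (klein_tw i) 4 x + fermion_deg (klein_tw (kadd i Kw)) 4 y)"
  have "ch (Sigma UNIV ?X) (\<lambda>(i, x). ?d i x) = (\<Sum>i\<in>UNIV. ch (?X i) (?d i)) \<and> graded_finite (Sigma UNIV ?X) (\<lambda>(i, x). ?d i x)"
    by (rule ch_Sigma) (simp add: UNIV_klein, rule P(2))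
  moreover have "ch (?X i) (?d i) = (\<Sum>j\<in>?J i. fch (klein_tw j) 4 (klein_even j)) *
        (fch (klein_tw i) 4 (klein_even i) * fch (klein_tw (kadd i Kw)) 4 (klein_even (kadd i Kw)))" for i
    by (simp only: P(1) S[THEN conjunct1] T(1))
  ultimately show ?thesis unfolding twisted_labels_def twisted_deg_def by (simp only:)
qed

theorem proposition11p1:
  fixes a :: "'a::{finite,linorder} polarized_space"
    and e :: "'e::{finite,linorder} polarized_space"
    and g :: "4 polarized_space"
    and \<gamma> :: "klein \<Rightarrow> real ^ 4"
  assumes "polarized_space a" and "CARD('a) = 24"
    and "polarized_space e" and "CARD('e) = 8"
    and "polarized_space g" and "\<And>u w. form g u w = (\<Sum>i\<in>UNIV. u $ i * w $ i)"
    and "D4_labelling \<gamma>"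
  shows "virasoro_isomorphic (Vsnat a) (K3_model g \<gamma> e False) \<and>
         virasoro_isomorphic (Vsnat_tw a) (K3_model g \<gamma> e True)"
proof -
  obtain c where c: "\<And>i. coset D4 (\<gamma> i) = parity_class (fst (c i)) (snd (c i))" "\<And>i. c i = (False, True) \<longleftrightarrow> i = K0"
    by (rule D4_cosets[OF assms(7)]) blast
  define K :: "klein \<Rightarrow> (real ^ 4) set" where "K i = parity_class (fst (c i)) (snd (c i))" for i
  have KK: "coset D4 (\<gamma> i) = K i" "\<exists>t e. K i = parity_class t e" for i using c(1) by (auto simp: K_def)
  have Kf: "graded_finite (lattice_labels (K i)) lattice_deg" for i
    unfolding K_def by (rule fch_lch(2)) simp
  have l: "lch (K i) = fch (fst (c i)) 4 (snd (c i))" for i unfolding K_def by (subst fch_lch(1)) simp_all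
  have K0: "lch (K i) = (if i = K0 then fch False 4 True else fch False 4 False)" for i
    unfolding l[of i] fch_4[where tw = "fst (c i)" and e = "snd (c i)"] using c(2)[of i] by (cases "c i") auto
  note V = moonshine_model[OF assms(1,2)]
  note T = ch_torus[OF K0 Kf]
  note W = ch_twisted
  let ?X = "\<lambda>rr. torus_labels K <+> twisted_labels rr" and ?d = "\<lambda>rr. case_sum (torus_deg rr) twisted_deg"
  have M: "unitary_model (K3_model g \<gamma> e rr) (case_sum (\<lambda>_. 1) (\<lambda>_. 1)) (?X rr) (?d rr) 12 (case_sum (\<lambda>_. 1) (\<lambda>_. 1))" for rr
    unfolding K3_model_def by (rule unitary_model_dsum2[OF torus_model[OF assms(5) KK] twisted_model[OF assms(3,4)]])
  note P = ch_Plus[OF T(2) W[THEN conjunct2]]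
  note Q = ch_Plus[OF graded_finite_fermion graded_finite_fermion]
  have f12: "fch tw 12 e = fch tw 4 True * (fch tw 4 True * fch tw 4 e + fch tw 4 False * fch tw 4 (\<not> e)) +
      fch tw 4 False * (fch tw 4 True * fch tw 4 (\<not> e) + fch tw 4 False * fch tw 4 e)" for tw e
    using fch_split[of 4 8 e tw] fch_split[of 4 4 _ tw] by simp
  have sets: "{j \<in> if rr then {K0, K1} else {Kw, Kwbar}. klein_even j = klein_even i} =
      {if rr then (if klein_even i then K0 else K1) else (if klein_even i then Kw else Kwbar)}" for rr i
    by (auto simp: klein_even_def split: if_splits)
  have eq: "ch (sum12_labels (\<not> rr)) sum12_deg = ch (?X rr) (?d rr)" for rr
    unfolding P(1) Q(1) T(1) W[THEN conjunct1] K0 f12 sets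
    by (cases rr) (simp_all add: UNIV_klein klein_even_def klein_tw_def fch_4[where tw = True] algebra_simps)
  have iso: "virasoro_isomorphic N (K3_model g \<gamma> e rr)" if N: "unitary_model N \<sigma> (sum12_labels (\<not> rr)) sum12_deg 12 s"
    for N :: "('a modes + 'a modes) vir" and \<sigma> s rr
    by (rule unitary_models_isomorphic[OF N M])
      (use Q(2) P(2) eq[of rr] in \<open>auto simp: graded_finite_def ch_eq_iff\<close>)
  show ?thesis using V iso[of _ _ False] iso[of _ _ True] by auto
qed

end
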